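(* Let $M_1$ and $M_2$ be two complex analytic sets. Let $V_1\subset M_1$ and $V_2\subset M_2$ be proper analytic subvarieties such that $M_1-V_1$ and $M_2-V_2$ are complex manifolds of the same dimension. Assume that $f:M_1-V_1\to M_2-V_2$ is a finite ($m$-sheeted) holomorphic covering map. Let $\Gamma$ be the deck transformation group for the covering map (with $|\Gamma|=m$), and denote by $K_i(z,\bar w)$ the Bergman kernels of $M_i$ for $i=1,2$. Then the Bergman kernel forms transform according to $$\sum_{\gamma\in\Gamma}(\gamma,\mathrm{id})^*K_1=\sum_{\gamma\in\Gamma}(\mathrm{id},\gamma)^*K_1=(f,f)^*K_2\quad\text{on }(M_1-V_1)\times(M_1-V_1),$$ where $\mathrm{id}:M_1\to M_1$ is the identity map.
   Context: For an $n$-dimensional complex manifold $M$, $A^2_{(n,0)}(M)$ is the Hilbert space of holomorphic $(n,0)$-forms $\varphi$ on $M$ with $i^{n^2}\int_M\varphi\wedge\overline{\varphi}<\infty$, with inner product $(\varphi,\psi)=i^{n^2}\int_M\varphi\wedge\overline{\psi}$. Assuming $A^2_{(n,0)}(M)\neq\{0\}$, the Bergman kernel (form) of $M$ is $K_M(x,\bar y)=i^{n^2}\sum_k\varphi_k(x)\wedge\overline{\varphi_k(y)}$ for any orthonormal basis $\{\varphi_k\}$ of $A^2_{(n,0)}(M)$; it does not depend on the basis. For a reduced complex analytic space $M$ with set of singular points $S$, the Bergman kernel form is defined by $K_M(x,\bar y):=K_{M-S}(x,\bar y)$ for $x,y\in M-S$. Pullback: for holomorphic maps $\gamma:N_1\to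 M$, $\tau:N_2\to M$ from $n$-dimensional complex manifolds $N_1,N_2$, $((\gamma,\tau)^*K_M)(z,\bar w)=i^{n^2}\sum_k\gamma^*\varphi_k(z)\wedge\overline{\tau^*\varphi_k(w)}$ for $z\in N_1$, $w\in N_2$. In local coordinates, if $K_M(x,\bar y)=\widetilde K(x,\bar y)\,dx_1\wedge\cdots\wedge dx_n\wedge d\overline{y_1}\wedge\cdots\wedge d\overline{y_n}$, then $((\gamma,\tau)^*K_M)(z,\bar w)=\widetilde K(\gamma(z),\overline{\tau(w)})\,J_\gamma(z)\,\overline{J_\tau(w)}\,dz_1\wedge\cdots\wedge dz_n\wedge d\overline{w_1}\wedge\cdots\wedge d\overline{w_n}$, where $J_\gamma,J_\tau$ are the Jacobian determinants of $\gamma$ and $\tau$.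
   Formalization: It is also assumed that M_1−V_1 is connected or Γ acts transitively on the fibres of f; for disconnected M_1−V_1, |Γ|=m alone does not suffice and the formula can fail. The common dimension is taken to be at least 1. *)

theory Defs
  imports "HOL-Analysis.Analysis"
begin

section \<open>Holomorphic functions of several variables\<close>

text \<open>\<open>matrix (frechet_derivative F (at z))\<close> is the complex Jacobian matrix when \<open>F\<close> is holomorphic
  at \<open>z\<close>: its entries are the components of the derivative at the vectors \<open>axis j 1\<close>.\<close>

definition holo_on :: "(complex^'n \<Rightarrow> complex) \<Rightarrow> (complex^'n) set \<Rightarrow> bool" where
  "holo_on h D \<longleftrightarrow> (\<forall>z\<in>D. \<exists>L. (h has_derivative L) (at z) \<and> (\<forall>c v. L (c *s v) = c * L v))"

definition jac :: "(complex^'n \<Rightarrow> complex^'n) \<Rightarrow> complex^'n \<Rightarrow> complex" where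
  "jac F z = det (matrix (frechet_derivative F (at z)))"

text \<open>The local models of a complex space live in spaces of unbounded dimension \<open>N\<close>, so these are
  realised inside the product space \<open>nat \<Rightarrow> complex\<close>, where the coordinates from \<open>N\<close> on carry no
  information.  The subspace topology is the Euclidean one.\<close>

definition CN :: "nat \<Rightarrow> (nat \<Rightarrow> complex) set" where
  "CN N = (\<Pi>\<^sub>E i\<in>{..<N}. UNIV)"

definition holo_CN :: "nat \<Rightarrow> ((nat \<Rightarrow> complex) \<Rightarrow> complex) \<Rightarrow> (nat \<Rightarrow> complex) set \<Rightarrow> bool" where
  "holo_CN N h D \<longleftrightarrow>
    (\<forall>z\<in>D. \<exists>a :: nat \<Rightarrow> complex.
      ((\<lambda>w. (h w - h z - (\<Sum>i<N. a i * (w i - z i))) / of_real (\<Sum>i<N. norm (w i - z i)))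
        \<longlongrightarrow> 0) (at z within CN N))"

section \<open>Reduced complex spaces\<close>

text \<open>A reduced complex space is a topological space with a sheaf of complex-valued functions.
  Sections over \<open>W\<close> are total functions of which only the values on \<open>W\<close> matter.\<close>

record 'a complex_space =
  ctop :: "'a topology"
  hol :: "'a set \<Rightarrow> ('a \<Rightarrow> complex) set"

definition function_sheaf :: "'a complex_space \<Rightarrow> bool" where
  "function_sheaf X \<longleftrightarrow>
    (\<forall>W g h. openin (ctop X) W \<and> g \<in> hol X W \<and> (\<forall>x\<in>W. h x = g x) \<longrightarrow> h \<in> hol X W) \<and>
    (\<forall>W W' g. openin (ctop X) W \<and> openin (ctop X) W' \<and> W' \<subseteq> W \<and> g \<in> hol X W \<longrightarrow> g \<in> hol X W') \<and>
    (\<forall>W g. openin (ctop X) W \<and>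
       (\<forall>x\<in>W. \<exists>W'. openin (ctop X) W' \<and> x \<in> W' \<and> W' \<subseteq> W \<and> g \<in> hol X W') \<longrightarrow> g \<in> hol X W)"

text \<open>\<open>\<kappa>\<close> is an isomorphism of the open subspace \<open>U\<close> of \<open>X\<close> onto the set \<open>A\<close> with sheaf \<open>\<O>\<close>.\<close>

definition local_iso ::
  "'a complex_space \<Rightarrow> 'a set \<Rightarrow> ('a \<Rightarrow> 'm::topological_space) \<Rightarrow> 'm set
    \<Rightarrow> ('m set \<Rightarrow> ('m \<Rightarrow> complex) set) \<Rightarrow> bool" where
  "local_iso X U \<kappa> A \<O> \<longleftrightarrow>
    openin (ctop X) U \<and>
    homeomorphic_map (subtopology (ctop X) U) (top_of_set A) \<kappa> \<and>
    (\<forall>W g. openin (ctop X) W \<and> W \<subseteq> U \<longrightarrow>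
       (g \<in> hol X W \<longleftrightarrow> (\<lambda>z. g (inv_into U \<kappa> z)) \<in> \<O> (\<kappa> ` W)))"

text \<open>The structure sheaf of an analytic subset of an open subset of \<open>CN N\<close>: functions that are
  locally restrictions of holomorphic functions of the ambient space.\<close>

definition model_sheaf :: "nat \<Rightarrow> (nat \<Rightarrow> complex) set \<Rightarrow> ((nat \<Rightarrow> complex) \<Rightarrow> complex) set" where
  "model_sheaf N W = {h. \<forall>z\<in>W. \<exists>D' h'. openin (top_of_set (CN N)) D' \<and> z \<in> D' \<and>
     holo_CN N h' D' \<and> (\<forall>w\<in>D' \<inter> W. h w = h' w)}"

definition reduced_complex_space :: "'a complex_space \<Rightarrow> bool" where
  "reduced_complex_space X \<longleftrightarrow>
    Hausdorff_space (ctop X) \<and> second_countable (ctop X) \<and> function_sheaf X \<and>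
    (\<forall>x\<in>topspace (ctop X). \<exists>N D F U \<kappa>.
       openin (top_of_set (CN N)) D \<and> finite F \<and> (\<forall>h\<in>F. holo_CN N h D) \<and> x \<in> U \<and>
       local_iso X U \<kappa> {z\<in>D. \<forall>h\<in>F. h z = 0} (model_sheaf N))"

definition analytic_subvariety :: "'a complex_space \<Rightarrow> 'a set \<Rightarrow> bool" where
  "analytic_subvariety X V \<longleftrightarrow> V \<subseteq> topspace (ctop X) \<and>
    (\<forall>x\<in>topspace (ctop X). \<exists>W F. openin (ctop X) W \<and> x \<in> W \<and> finite F \<and> F \<subseteq> hol X W \<and>
       V \<inter> W = {y\<in>W. \<forall>g\<in>F. g y = 0})"

definition without :: "'a complex_space \<Rightarrow> 'a set \<Rightarrow> 'a complex_space" where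
  "without X V = \<lparr>ctop = subtopology (ctop X) (topspace (ctop X) - V), hol = hol X\<rparr>"

definition holomorphic_map :: "'a complex_space \<Rightarrow> 'b complex_space \<Rightarrow> ('a \<Rightarrow> 'b) \<Rightarrow> bool" where
  "holomorphic_map X Y f \<longleftrightarrow> continuous_map (ctop X) (ctop Y) f \<and>
    (\<forall>W g. openin (ctop Y) W \<and> g \<in> hol Y W \<longrightarrow> g \<circ> f \<in> hol X {x\<in>topspace (ctop X). f x \<in> W})"

definition singular_points :: "'a complex_space \<Rightarrow> 'a set" where
  "singular_points X = {x\<in>topspace (ctop X). \<not> (\<exists>k D U \<kappa>.
     openin (top_of_set (CN k)) D \<and> x \<in> U \<and> local_iso X U \<kappa> D (\<lambda>W. {h. holo_CN k h W}))}"

definition regular_part :: "'a complex_space \<Rightarrow> 'a complex_space" where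
  "regular_part X = without X (singular_points X)"

section \<open>Complex manifolds and holomorphic forms of top degree\<close>

type_synonym ('a, 'n) chart = "'a set \<times> ('a \<Rightarrow> complex^'n)"

definition charts :: "'a complex_space \<Rightarrow> ('a, 'n::finite) chart set" where
  "charts X = {(U, \<kappa>). open (\<kappa> ` U) \<and> local_iso X U \<kappa> (\<kappa> ` U) (\<lambda>W. {h. holo_on h W})}"

definition complex_manifold :: "'n::finite itself \<Rightarrow> 'a complex_space \<Rightarrow> bool" where
  "complex_manifold _ X \<longleftrightarrow>
    Hausdorff_space (ctop X) \<and> second_countable (ctop X) \<and> function_sheaf X \<and>
    (\<forall>x\<in>topspace (ctop X). \<exists>c\<in>charts X :: ('a, 'n) chart set. x \<in> fst c)"

definition chart_inv :: "('a, 'n) chart \<Rightarrow> complex^'n \<Rightarrow> 'a" where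
  "chart_inv c = inv_into (fst c) (snd c)"

definition chart_at :: "'a complex_space \<Rightarrow> 'a \<Rightarrow> ('a, 'n::finite) chart" where
  "chart_at X x = (SOME c. c \<in> charts X \<and> x \<in> fst c)"

text \<open>A form of degree \<open>(n,0)\<close> is given by its coefficients: \<open>\<omega> c x\<close> is the coefficient at \<open>x\<close> with
  respect to \<open>dz\<^sub>1 \<and> \<dots> \<and> dz\<^sub>n\<close> in the chart \<open>c\<close>, where \<open>n = CARD('n)\<close>.  Values that have no meaning
  are normalised to 0.  If \<open>X\<close> has components of other dimensions, these contain no (nonempty)
  chart and are ignored.\<close>

type_synonym ('a, 'n) form = "('a, 'n) chart \<Rightarrow> 'a \<Rightarrow> complex"

definition holomorphic_form :: "'a complex_space \<Rightarrow> ('a, 'n::finite) form \<Rightarrow> bool" where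
  "holomorphic_form X \<omega> \<longleftrightarrow>
    (\<forall>c x. \<not> (c \<in> charts X \<and> x \<in> fst c) \<longrightarrow> \<omega> c x = 0) \<and>
    (\<forall>c\<in>charts X. holo_on (\<lambda>z. \<omega> c (chart_inv c z)) (snd c ` fst c)) \<and>
    (\<forall>c\<in>charts X. \<forall>d\<in>charts X. \<forall>x\<in>fst c \<inter> fst d.
       \<omega> c x = \<omega> d x * jac (\<lambda>z. snd d (chart_inv c z)) (snd c x))"

text \<open>Integration of \<open>(n,n)\<close>-forms: decompose the manifold into countably many disjoint Borel pieces,
  each contained in a chart.  By the change of variables formula, the integral does not depend on
  the decomposition.\<close>

definition chart_partition :: "'a complex_space \<Rightarrow> (nat \<Rightarrow> ('a, 'n::finite) chart \<times> 'a set) \<Rightarrow> bool" where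
  "chart_partition X P \<longleftrightarrow>
    (\<forall>k. case P k of (c, A) \<Rightarrow> c \<in> charts X \<and> A \<subseteq> fst c \<and> snd c ` A \<in> sets borel) \<and>
    disjoint_family (\<lambda>k. snd (P k)) \<and>
    (\<Union>k. snd (P k)) = \<Union>(fst ` (charts X :: ('a, 'n) chart set))"

definition pieces :: "'a complex_space \<Rightarrow> nat \<Rightarrow> ('a, 'n::finite) chart \<times> 'a set" where
  "pieces X = (SOME P. chart_partition X P)"

text \<open>An \<open>(n,n)\<close>-form is given by its coefficients with respect to
  \<open>dz\<^sub>1 \<and> \<dots> \<and> dz\<^sub>n \<and> d\<zeta>\<^sub>1 \<and> \<dots> \<and> d\<zeta>\<^sub>n\<close>, with \<open>\<zeta>\<^sub>j\<close> the conjugate of \<open>z\<^sub>j\<close>.  Multiplied by \<open>\<i> ^ n\<^sup>2\<close>, that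
  form is the product of the \<open>\<i> dz\<^sub>j \<and> d\<zeta>\<^sub>j\<close>, hence \<open>2 ^ n\<close> times Lebesgue measure.\<close>

definition integral_form :: "'a complex_space \<Rightarrow> ('a, 'n::finite) form \<Rightarrow> complex" where
  "integral_form X \<Phi> = (\<Sum>k. case pieces X k of (c, A) \<Rightarrow>
     (LINT z:snd c ` A|lborel. \<Phi> c (chart_inv c z) * 2 ^ CARD('n) / \<i> ^ (CARD('n)\<^sup>2)))"

definition abs_integral_form :: "'a complex_space \<Rightarrow> ('a, 'n::finite) form \<Rightarrow> ennreal" where
  "abs_integral_form X \<Phi> = (\<Sum>k. case pieces X k of (c, A) \<Rightarrow>
     (\<integral>\<^sup>+z\<in>snd c ` A. ennreal (norm (\<Phi> c (chart_inv c z)) * 2 ^ CARD('n)) \<partial>lborel))"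

section \<open>The Bergman kernel\<close>

definition A2 :: "'a complex_space \<Rightarrow> ('a, 'n::finite) form set" where
  "A2 X = {\<omega>. holomorphic_form X \<omega> \<and> abs_integral_form X (\<lambda>c x. \<omega> c x * cnj (\<omega> c x)) < \<infinity>}"

definition A2_inner :: "'a complex_space \<Rightarrow> ('a, 'n::finite) form \<Rightarrow> ('a, 'n) form \<Rightarrow> complex" where
  "A2_inner X \<omega> \<eta> = \<i> ^ (CARD('n)\<^sup>2) * integral_form X (\<lambda>c x. \<omega> c x * cnj (\<eta> c x))"

definition orthonormal_basis :: "'a complex_space \<Rightarrow> ('a, 'n::finite) form set \<Rightarrow> bool" where
  "orthonormal_basis X B \<longleftrightarrow> B \<subseteq> A2 X \<and>
    (\<forall>\<phi>\<in>B. \<forall>\<psi>\<in>B. A2_inner X \<phi> \<psi> = (if \<phi> = \<psi> then 1 else 0)) \<and>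
    (\<forall>\<psi>\<in>A2 X. (\<forall>\<phi>\<in>B. A2_inner X \<psi> \<phi> = 0) \<longrightarrow> \<psi> = (\<lambda>c x. 0))"

text \<open>A kernel form \<open>K\<close> on \<open>X \<times> Y\<close> is given by its coefficients: \<open>K c x d y\<close> is the coefficient at
  \<open>(x, y)\<close> with respect to \<open>dx\<^sub>1 \<and> \<dots> \<and> dx\<^sub>n \<and> d\<upsilon>\<^sub>1 \<and> \<dots> \<and> d\<upsilon>\<^sub>n\<close>, with \<open>\<upsilon>\<^sub>j\<close> the conjugate of \<open>y\<^sub>j\<close>, for
  the coordinates \<open>x\<^sub>j\<close> of the chart \<open>c\<close> and \<open>y\<^sub>j\<close> of the chart \<open>d\<close>.\<close>

type_synonym ('a, 'b, 'n) kernel_form =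
  "('a, 'n) chart \<Rightarrow> 'a \<Rightarrow> ('b, 'n) chart \<Rightarrow> 'b \<Rightarrow> complex"

definition manifold_bergman_kernel :: "'a complex_space \<Rightarrow> ('a, 'a, 'n::finite) kernel_form" where
  "manifold_bergman_kernel X c x d y =
    \<i> ^ (CARD('n)\<^sup>2) * (\<Sum>\<^sub>\<infinity>\<phi>\<in>(SOME B. orthonormal_basis X B). \<phi> c x * cnj (\<phi> d y))"

definition bergman_kernel :: "'a complex_space \<Rightarrow> ('a, 'a, 'n::finite) kernel_form" where
  "bergman_kernel X = manifold_bergman_kernel (regular_part X)"

text \<open>Pullback of a kernel form on \<open>X \<times> X\<close> under maps \<open>\<gamma>, \<tau>\<close> into \<open>X\<close>.  It does not depend on the
  charts of \<open>X\<close> chosen at \<open>\<gamma> z\<close> and \<open>\<tau> w\<close>.\<close>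

definition pullback_kernel ::
  "'x complex_space \<Rightarrow> ('a \<Rightarrow> 'x) \<Rightarrow> ('b \<Rightarrow> 'x) \<Rightarrow> ('x, 'x, 'n::finite) kernel_form
    \<Rightarrow> ('a, 'b, 'n) kernel_form" where
  "pullback_kernel X \<gamma> \<tau> K c z d w =
    (let a = chart_at X (\<gamma> z); b = chart_at X (\<tau> w) in
      K a (\<gamma> z) b (\<tau> w)
        * jac (\<lambda>\<xi>. snd a (\<gamma> (chart_inv c \<xi>))) (snd c z)
        * cnj (jac (\<lambda>\<xi>. snd b (\<tau> (chart_inv d \<xi>))) (snd d w)))"

section \<open>Finite coverings\<close>

definition finite_covering :: "nat \<Rightarrow> 'a topology \<Rightarrow> 'b topology \<Rightarrow> ('a \<Rightarrow> 'b) \<Rightarrow> bool" where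
  "finite_covering m S T f \<longleftrightarrow> 0 < m \<and> continuous_map S T f \<and>
    (\<forall>y\<in>topspace T. \<exists>W \<U>. openin T W \<and> y \<in> W \<and> finite \<U> \<and> card \<U> = m \<and> disjoint \<U> \<and>
       \<Union>\<U> = {x\<in>topspace S. f x \<in> W} \<and>
       (\<forall>U\<in>\<U>. openin S U \<and> homeomorphic_map (subtopology S U) (subtopology T W) f))"

text \<open>Deck transformations are normalised to be \<open>undefined\<close> outside the space, so that they can be
  counted.\<close>

definition deck_group :: "'a topology \<Rightarrow> ('a \<Rightarrow> 'b) \<Rightarrow> ('a \<Rightarrow> 'a) set" where
  "deck_group S f = {\<gamma>. \<gamma> \<in> extensional (topspace S) \<and> homeomorphic_map S S \<gamma> \<and>
     (\<forall>x\<in>topspace S. f (\<gamma> x) = f x)}"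

end

theory Submission
  imports Defs "HOL-Complex_Analysis.Complex_Analysis"
begin

text \<open>
  Square integrable holomorphic forms extend across a thin analytic set (on generic complex lines the
  singularities are isolated and removable).  So the Bergman kernel of \<open>M\<^sub>i\<close> restricts to the one of
  \<open>N\<^sub>i = M\<^sub>i - V\<^sub>i\<close>; where \<open>V\<^sub>i\<close> has interior points, forms split orthogonally into the parts on \<open>N\<^sub>i\<close>
  and on that interior.

  The covering \<open>f: N\<^sub>1 \<rightarrow> N\<^sub>2\<close> is locally biholomorphic: for a local inverse \<open>G\<close> of \<open>f\<close>, the function
  \<open>J\<^sub>f \<circ> G\<close> is continuous and holomorphic where it does not vanish, hence holomorphic by Rado's theorem.
  The pull-back satisfies \<open>(f\<^sup>*\<psi>, f\<^sup>*\<eta>) = m (\<psi>, \<eta>)\<close> and the push-forward satisfies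
  \<open>f\<^sup>*f\<^sub>*\<phi> = \<Sum>\<gamma>\<in>\<Gamma>. \<gamma>\<^sup>*\<phi>\<close>, because \<open>\<Gamma>\<close> acts simply transitively on the fibres.  For the kernel
  \<open>k = K\<^sub>1(\<cdot>, w)\<close> this gives
  \<open>m (\<psi>, f\<^sub>*k) = \<Sum>\<gamma>\<in>\<Gamma>. (f\<^sup>*\<psi>, \<gamma>\<^sup>*k) = \<Sum>\<gamma>\<in>\<Gamma>. (\<gamma>\<^sup>*f\<^sup>*\<psi>, \<gamma>\<^sup>*k) = m (f\<^sup>*\<psi>)(w)\<close>,
  so \<open>f\<^sub>*k\<close> is the reproducing kernel \<open>K\<^sub>2(\<cdot>, f w)\<close> up to the conjugate Jacobian of \<open>f\<close> at \<open>w\<close>; pull back by \<open>f\<close>.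
\<close>

section \<open>Hilbert spaces of functions with bounded point evaluations\<close>

text \<open>The kernel is an infinite sum over an orthonormal basis picked by \<open>SOME\<close>,
  so it can only be reached through its reproducing property; this is why Hilbert space theory,
  reduced to bounded point evaluations, is the entry point. Inner products are never transformed
  directly: norms are, and polarization does the rest.

  The obstacle is that holomorphy is given by sheaves, and deck transformations only as
  homeomorphisms. Everything analytic about the covering comes from one fact: a sheet with the
  coordinates of its image is itself a chart, and in such charts \<open>f\<close> and the deck
  transformations are the identity. This asks for the holomorphy of a merely continuous inverse
  whose Jacobian might vanish somewhere. Once the Jacobian is holomorphic in the target coordinates,
  the volume formula shows that it vanishes on no open set, and the extension across thin sets,
  applied to the bounded inverse, finishes. The volume formula rests on the equality of the real
  determinant of a complex linear map with the squared modulus of the complex one.\<close>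

definition fdiff :: "('i => 'j => complex) => ('i => 'j => complex) => 'i => 'j => complex" where
  "fdiff f g = (\<lambda>i j. f i j - g i j)"

text \<open>A form is a function of a chart and a point, hence functions of two arguments.
  Definiteness comes from \<open>eval_bounded\<close>: a function of norm zero vanishes at every
  argument. \<open>complete\<close> is stated with squared norms.\<close>

locale function_hilbert_space =
  fixes H :: "('i => 'j => complex) set"
    and ip :: "('i => 'j => complex) => ('i => 'j => complex) => complex"
  assumes zero_mem: "(\<lambda>i j. 0) \<in> H"
    and add_mem: "\<And>f g. f \<in> H ==> g \<in> H ==> (\<lambda>i j. f i j + g i j) \<in> H"
    and scale_mem: "\<And>f c. f \<in> H ==> (\<lambda>i j. c * f i j) \<in> H"
    and ip_add: "\<And>f g h. f \<in> H ==> g \<in> H ==> h \<in> H ==>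
      ip (\<lambda>i j. f i j + g i j) h = ip f h + ip g h"
    and ip_scale: "\<And>f g c. f \<in> H ==> g \<in> H ==> ip (\<lambda>i j. c * f i j) g = c * ip f g"
    and ip_cnj: "\<And>f g. f \<in> H ==> g \<in> H ==> ip g f = cnj (ip f g)"
    and ip_nonneg: "\<And>f. f \<in> H ==> 0 \<le> Re (ip f f)"
    and eval_bounded: "\<And>i j. \<exists>C. \<forall>f\<in>H. (cmod (f i j))^2 \<le> C * Re (ip f f)"
    and complete: "\<And>s. (\<And>n::nat. s n \<in> H) ==>
      (\<And>e. e > 0 ==> \<exists>N. \<forall>m\<ge>N. \<forall>n\<ge>N. Re (ip (fdiff (s m) (s n)) (fdiff (s m) (s n))) < e) ==>
      \<exists>l\<in>H. (\<lambda>n. Re (ip (fdiff (s n) l) (fdiff (s n) l))) \<longlonglongrightarrow> 0"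
begin

definition sqn :: "('i => 'j => complex) => real" where
  "sqn f = Re (ip f f)"

definition lincomb ::
  "(('i => 'j => complex) => complex) => ('i => 'j => complex) set => 'i => 'j => complex" where
  "lincomb a F = (\<lambda>i j. \<Sum>p\<in>F. a p * p i j)"

definition orthonormal :: "('i => 'j => complex) set => bool" where
  "orthonormal B \<longleftrightarrow> B \<subseteq> H \<and> (\<forall>p\<in>B. \<forall>q\<in>B. ip p q = (if p = q then 1 else 0))"

definition onb :: "('i => 'j => complex) set => bool" where
  "onb B \<longleftrightarrow> orthonormal B \<and> (\<forall>q\<in>H. (\<forall>p\<in>B. ip q p = 0) \<longrightarrow> q = (\<lambda>i j. 0))"

text \<open>Infinite expansions are tested against these functionals only; inner products and point
  evaluations are the two cases that occur.\<close>

definition bounded_functional :: "(('i => 'j => complex) => complex) => bool" where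
  "bounded_functional L \<longleftrightarrow>
     (\<forall>f\<in>H. \<forall>g\<in>H. L (\<lambda>i j. f i j + g i j) = L f + L g) \<and>
     (\<forall>f\<in>H. \<forall>c. L (\<lambda>i j. c * f i j) = c * L f) \<and>
     (\<exists>C\<ge>0. \<forall>f\<in>H. (cmod (L f))^2 \<le> C * sqn f)"

lemma
  assumes "bounded_functional L"
  shows bounded_functional_add: "f \<in> H ==> g \<in> H ==> L (\<lambda>i j. f i j + g i j) = L f + L g"
    and bounded_functional_scale: "f \<in> H ==> L (\<lambda>i j. c * f i j) = c * L f"
  using assms by (simp_all add: bounded_functional_def)

lemma diff_mem: "f \<in> H ==> g \<in> H ==> fdiff f g \<in> H"
  using add_mem[of f "\<lambda>i j. (-1) * g i j"] scale_mem[of g "-1"] by (simp add: fdiff_def)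

lemma ip_diff: "f \<in> H ==> g \<in> H ==> h \<in> H ==> ip (fdiff f g) h = ip f h - ip g h"
  using ip_add[of f "\<lambda>i j. (-1) * g i j" h] ip_scale[of g h "-1"] scale_mem[of g "-1"]
  by (simp add: fdiff_def)

lemma ip_add_right: "f \<in> H ==> g \<in> H ==> h \<in> H ==> ip h (\<lambda>i j. f i j + g i j) = ip h f + ip h g"
  using ip_cnj[of "\<lambda>i j. f i j + g i j" h] ip_cnj[of f h] ip_cnj[of g h] ip_add[of f g h] add_mem[of f g]
  by simp

lemma ip_scale_right: "f \<in> H ==> g \<in> H ==> ip g (\<lambda>i j. c * f i j) = cnj c * ip g f"
  using ip_cnj[of "\<lambda>i j. c * f i j" g] ip_cnj[of f g] ip_scale[of f g c] scale_mem[of f c]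
  by simp

lemma ip_diff_right: "f \<in> H ==> g \<in> H ==> h \<in> H ==> ip h (fdiff f g) = ip h f - ip h g"
  using ip_cnj[of "fdiff f g" h] ip_cnj[of f h] ip_cnj[of g h] ip_diff[of f g h] diff_mem[of f g]
  by simp

lemma ip_self: "f \<in> H ==> ip f f = of_real (sqn f)"
  using ip_cnj[of f f] by (simp add: sqn_def complex_eq_iff)

lemma sqn_nonneg: "f \<in> H ==> 0 \<le> sqn f"
  using ip_nonneg by (simp add: sqn_def)

lemma sqn_eq_0D: assumes "f \<in> H" "sqn f = 0" shows "f = (\<lambda>i j. 0)"
proof (intro ext)
  fix i j
  obtain C where "\<forall>f\<in>H. (cmod (f i j))^2 \<le> C * Re (ip f f)" using eval_bounded by blast
  then have "(cmod (f i j))^2 \<le> 0" using assms by (force simp: sqn_def)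
  then show "f i j = 0" by simp
qed

lemma fdiff_eq_0D: "fdiff f g = (\<lambda>i j. 0) ==> f = g"
  by (auto simp: fdiff_def fun_eq_iff)

lemma sqn_diff_commute: "f \<in> H ==> g \<in> H ==> sqn (fdiff f g) = sqn (fdiff g f)"
  by (simp add: sqn_def ip_diff ip_diff_right diff_mem)

lemma cauchy_schwarz:
  assumes "f \<in> H" "g \<in> H"
  shows "(cmod (ip f g))^2 \<le> sqn f * sqn g"
proof (cases "sqn g = 0")
  case True
  then have "g = (\<lambda>i j. 0)" using assms sqn_eq_0D by blast
  then have "ip f g = 0" using ip_scale_right[OF zero_mem assms(1), of 0] by simp
  then show ?thesis using True by simp
next
  case False
  then have gp: "sqn g > 0" using sqn_nonneg[OF assms(2)] by linarith
  define t where "t = ip f g / of_real (sqn g)"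
  define h where "h = fdiff f (\<lambda>i j. t * g i j)"
  have tg: "(\<lambda>i j. t * g i j) \<in> H" using scale_mem assms by blast
  have h: "h \<in> H" using diff_mem[OF assms(1) tg] by (simp add: h_def)
  have "ip h h = ip f f - cnj t * ip f g - t * ip g f + t * cnj t * ip g g"
    using assms tg by (simp add: h_def ip_diff ip_diff_right diff_mem ip_scale ip_scale_right algebra_simps)
  also have "... = of_real (sqn f) - of_real ((cmod (ip f g))^2 / sqn g)"
  proof -
    have "cnj t * ip f g = of_real ((cmod (ip f g))^2 / sqn g)"
      "t * ip g f = of_real ((cmod (ip f g))^2 / sqn g)"
      "t * cnj t * ip g g = of_real ((cmod (ip f g))^2 / sqn g)"
      using gp ip_cnj[OF assms] ip_self[OF assms(2)]
      by (simp_all add: t_def complex_norm_square mult.commute del: of_real_power)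
    then show ?thesis using ip_self[OF assms(1)] by simp
  qed
  finally have "Re (ip h h) = sqn f - (cmod (ip f g))^2 / sqn g" by simp
  then have "(cmod (ip f g))^2 / sqn g \<le> sqn f" using ip_nonneg[OF h] by linarith
  then show ?thesis using gp by (simp add: pos_divide_le_eq)
qed

lemma bounded_functional_ip: "g \<in> H ==> bounded_functional (\<lambda>f. ip f g)"
  unfolding bounded_functional_def
  using ip_add ip_scale cauchy_schwarz sqn_nonneg by (auto simp: mult.commute intro!: exI[of _ "sqn g"])

lemma bounded_functional_eval: "bounded_functional (\<lambda>f. f i j)"
proof -
  obtain C where C: "\<forall>f\<in>H. (cmod (f i j))^2 \<le> C * Re (ip f f)" using eval_bounded by blast
  have "\<forall>f\<in>H. (cmod (f i j))^2 \<le> \<bar>C\<bar> * sqn f"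
  proof
    fix f assume f: "f \<in> H"
    have "C * sqn f \<le> \<bar>C\<bar> * sqn f" using sqn_nonneg[OF f] by (intro mult_right_mono) auto
    then show "(cmod (f i j))^2 \<le> \<bar>C\<bar> * sqn f" using C f by (force simp: sqn_def)
  qed
  then show ?thesis unfolding bounded_functional_def by (auto intro!: exI[of _ "\<bar>C\<bar>"])
qed

lemma lincomb_insert:
  "finite F ==> p \<notin> F ==> lincomb a (insert p F) = (\<lambda>i j. a p * p i j + lincomb a F i j)"
  by (simp add: lincomb_def)

lemma lincomb_mem: "finite F ==> F \<subseteq> H ==> lincomb a F \<in> H"
proof (induction rule: finite_induct)
  case empty then show ?case using zero_mem by (simp add: lincomb_def)
next
  case (insert x F)
  then show ?case using add_mem scale_mem by (simp add: lincomb_insert)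
qed

lemma functional_lincomb:
  assumes "bounded_functional L"
  shows "finite F ==> F \<subseteq> H ==> L (lincomb a F) = (\<Sum>p\<in>F. a p * L p)"
proof (induction rule: finite_induct)
  case empty
  show ?case
    using bounded_functional_scale[OF assms zero_mem, of 0] by (simp add: lincomb_def)
next
  case (insert x F)
  have "L (lincomb a (insert x F)) = L (\<lambda>i j. a x * x i j) + L (lincomb a F)"
    using insert lincomb_mem[of F a] scale_mem[of x "a x"] assms
    unfolding bounded_functional_def by (simp add: lincomb_insert)
  also have "L (\<lambda>i j. a x * x i j) = a x * L x"
    using insert assms unfolding bounded_functional_def by blast
  finally show ?case using insert by simp
qed

lemma functional_diff:
  assumes "bounded_functional L" "f \<in> H" "g \<in> H"
  shows "L (fdiff f g) = L f - L g"
proof -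
  have "L (\<lambda>i j. f i j + (-1) * g i j) = L f + L (\<lambda>i j. (-1) * g i j)"
    by (rule bounded_functional_add[OF assms(1,2) scale_mem[OF assms(3)]])
  also have "L (\<lambda>i j. (-1) * g i j) = (-1) * L g"
    by (rule bounded_functional_scale[OF assms(1,3)])
  finally show ?thesis by (simp add: fdiff_def)
qed

lemma sqn_lincomb:
  assumes "orthonormal B" "finite F" "F \<subseteq> B"
  shows "sqn (lincomb a F) = (\<Sum>p\<in>F. (cmod (a p))^2)"
proof -
  have FH: "F \<subseteq> H" using assms by (auto simp: orthonormal_def)
  have l: "lincomb a F \<in> H" using lincomb_mem assms FH by blast
  have *: "ip q (lincomb a F) = cnj (a q)" if "q \<in> F" for q
  proof -
    have psi: "q \<in> H" using that FH by blast
    have "ip (lincomb a F) q = (\<Sum>p\<in>F. a p * ip p q)"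
      using functional_lincomb[OF bounded_functional_ip[OF psi] assms(2) FH] .
    also have "... = (\<Sum>p\<in>F. if p = q then a p else 0)"
      by (rule sum.cong) (use assms that in \<open>auto simp: orthonormal_def subset_iff\<close>)
    also have "... = a q" using that assms by simp
    finally show ?thesis using ip_cnj[OF l psi] by simp
  qed
  have "ip (lincomb a F) (lincomb a F) = (\<Sum>p\<in>F. a p * ip p (lincomb a F))"
    using functional_lincomb[OF bounded_functional_ip[OF l] assms(2) FH] .
  also have "... = (\<Sum>p\<in>F. of_real ((cmod (a p))^2))"
    by (rule sum.cong) (use * in \<open>auto simp: complex_norm_square[symmetric]\<close>)
  finally show ?thesis by (simp add: sqn_def)
qed

lemma lincomb_diff:
  "finite G ==> F \<subseteq> G ==> fdiff (lincomb a G) (lincomb a F) = lincomb a (G - F)"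
  by (auto simp: fdiff_def lincomb_def sum_diff finite_subset intro!: ext)

text \<open>Riesz-Fischer for a basis of any cardinality. A sequence of finite sets
  \<open>F n\<close> whose square sums beyond \<open>F n\<close> stay below
  \<open>1 / (n + 1)\<close> reduces the unordered sum to a Cauchy sequence, and
  \<open>complete\<close> supplies the limit. Since the limit is taken in norm, every bounded
  functional may be summed term by term.\<close>

lemma square_summable_expansion:
  assumes B: "orthonormal B"
    and bd: "\<And>F. finite F ==> F \<subseteq> B ==> (\<Sum>p\<in>F. (cmod (a p))^2) \<le> C"
  obtains l where "l \<in> H"
    and "\<And>L. bounded_functional L ==> ((\<lambda>p. a p * L p) has_sum L l) B"
proof -
  have BH: "B \<subseteq> H" using B by (simp add: orthonormal_def)
  have "(\<lambda>p. (cmod (a p))^2) summable_on B"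
    by (rule nonneg_bdd_above_summable_on) (use bd in \<open>auto intro!: bdd_aboveI2[where M = C]\<close>)
  then obtain S where S: "((\<lambda>p. (cmod (a p))^2) has_sum S) B" by (auto simp: summable_on_def)
  have "\<exists>F. finite F \<and> F \<subseteq> B \<and> (\<forall>G. finite G \<and> F \<subseteq> G \<and> G \<subseteq> B \<longrightarrow>
      dist (\<Sum>p\<in>G. (cmod (a p))^2) S < 1 / (2 * real (Suc n)))" for n
  proof -
    have "\<forall>\<^sub>F G in finite_subsets_at_top B. dist (\<Sum>p\<in>G. (cmod (a p))^2) S < 1 / (2 * real (Suc n))"
      using S unfolding has_sum_def by (rule tendstoD) simp
    then show ?thesis unfolding eventually_finite_subsets_at_top by blast
  qed
  then obtain F0 where F0: "\<And>n. finite (F0 n) \<and> F0 n \<subseteq> B"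
    and F0': "\<And>n G. finite G ==> F0 n \<subseteq> G ==> G \<subseteq> B ==>
      dist (\<Sum>p\<in>G. (cmod (a p))^2) S < 1 / (2 * real (Suc n))"
    by metis
  \<comment> \<open>Unions make the sets increase, so that \<open>s m - s n\<close> is a partial sum
    outside \<open>F n\<close> for \<open>m \<ge> n\<close>.\<close>
  define F where "F n = (\<Union>k\<le>n. F0 k)" for n
  have F: "finite (F n)" "F n \<subseteq> B" "F0 n \<subseteq> F n" "m \<le> n ==> F m \<subseteq> F n" for m n
    using F0 by (fastforce simp: F_def)+
  have tail: "sqn (fdiff (lincomb a G) (lincomb a (F n))) < 1 / real (Suc n)"
    if "finite G" "F n \<subseteq> G" "G \<subseteq> B" for G n
  proof -
    have "sqn (fdiff (lincomb a G) (lincomb a (F n))) = (\<Sum>p\<in>G - F n. (cmod (a p))^2)"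
      unfolding lincomb_diff[OF that(1,2)] by (rule sqn_lincomb[OF B]) (use that in auto)
    also have "... = (\<Sum>p\<in>G. (cmod (a p))^2) - (\<Sum>p\<in>F n. (cmod (a p))^2)"
      using that F by (simp add: sum_diff)
    also have "... < 1 / real (Suc n)"
    proof -
      have 1: "dist (\<Sum>p\<in>G. (cmod (a p))^2) S < 1 / (2 * real (Suc n))"
        "dist (\<Sum>p\<in>F n. (cmod (a p))^2) S < 1 / (2 * real (Suc n))"
        using F0'[of G n] F0'[of "F n" n] F(1,2,3)[of n] that by auto
      have 2: "1 / (2 * real (Suc n)) + 1 / (2 * real (Suc n)) = 1 / real (Suc n)"
        by (simp add: field_simps del: of_nat_Suc)
      have gen: "x - y < D" if "dist x S < d" "dist y S < d" "d + d = D" for x y d D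
        using that unfolding dist_real_def by linarith
      show ?thesis by (rule gen[OF 1 2])
    qed
    finally show ?thesis .
  qed
  define s where "s n = lincomb a (F n)" for n
  have sH: "s n \<in> H" for n using lincomb_mem F BH by (metis s_def order_trans)
  have "\<exists>N. \<forall>m\<ge>N. \<forall>n\<ge>N. Re (ip (fdiff (s m) (s n)) (fdiff (s m) (s n))) < e" if "e > 0" for e
  proof -
    obtain N where N: "1 / real (Suc N) < e" using nat_approx_posE \<open>e > 0\<close> by metis
    have *: "sqn (fdiff (s m) (s n)) < e" if "N \<le> n" "n \<le> m" for m n
    proof -
      have "sqn (fdiff (s m) (s n)) < 1 / real (Suc n)" using tail[of "F m" n] F that by (simp add: s_def)
      also have "... \<le> 1 / real (Suc N)" using that by (simp add: frac_le)
      finally show ?thesis using N by simp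
    qed
    have "sqn (fdiff (s m) (s n)) < e" if "N \<le> n" "N \<le> m" for m n
      using *[of n m] *[of m n] that sqn_diff_commute[OF sH sH, of m n] by (cases "n \<le> m") auto
    then show ?thesis by (auto simp: sqn_def)
  qed
  from complete[of s, OF sH this] obtain l where l: "l \<in> H" "(\<lambda>n. sqn (fdiff (s n) l)) \<longlonglongrightarrow> 0"
    by (auto simp: sqn_def)
  have "((\<lambda>p. a p * L p) has_sum L l) B" if L: "bounded_functional L" for L
    unfolding has_sum_def
  proof (rule tendstoI)
    fix e :: real assume "e > 0"
    obtain K where K: "K \<ge> 0" "\<And>f. f \<in> H ==> (cmod (L f))^2 \<le> K * sqn f"
      using L by (auto simp: bounded_functional_def)
    \<comment> \<open>The denominator is \<open>K + 1\<close> since \<open>K\<close> may be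
      zero.\<close>
    define d where "d = (e/2)^2 / (K + 1)"
    have "d > 0" using \<open>e > 0\<close> K by (simp add: d_def)
    have small: "cmod (L f) < e / 2" if "f \<in> H" "sqn f < d" for f
    proof -
      have "(cmod (L f))^2 \<le> K * sqn f" using K that by blast
      also have "... \<le> K * d" using K that by (intro mult_left_mono) auto
      also have "... < (K + 1) * d" using \<open>d > 0\<close> by (simp add: algebra_simps)
      also have "... = (e/2)^2" using K by (simp add: d_def)
      finally show ?thesis by (rule power2_less_imp_less) (use \<open>e > 0\<close> in simp)
    qed
    have "\<forall>\<^sub>F n in sequentially. 1 / real (Suc n) < d"
      using LIMSEQ_inverse_real_of_nat \<open>d > 0\<close> by (auto simp: inverse_eq_divide intro: order_tendstoD)
    moreover have "\<forall>\<^sub>F n in sequentially. sqn (fdiff (s n) l) < d"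
      using l(2) \<open>d > 0\<close> by (rule order_tendstoD)
    ultimately obtain n where n: "1 / real (Suc n) < d" "sqn (fdiff (s n) l) < d"
      using eventually_happens[OF eventually_conj] sequentially_bot by blast
    have "dist (\<Sum>p\<in>G. a p * L p) (L l) < e" if G: "finite G" "F n \<subseteq> G" "G \<subseteq> B" for G
    proof -
      have GH: "lincomb a G \<in> H" using G BH lincomb_mem by blast
      have "(\<Sum>p\<in>G. a p * L p) = L (lincomb a G)"
        using functional_lincomb[OF L G(1)] G BH by auto
      moreover have "L (fdiff (lincomb a G) (s n)) = L (lincomb a G) - L (s n)"
        by (rule functional_diff[OF L GH sH])
      moreover have "L (fdiff (s n) l) = L (s n) - L l"
        by (rule functional_diff[OF L sH l(1)])
      moreover have "cmod (L (fdiff (lincomb a G) (s n))) < e / 2"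
        by (rule small) (use tail[OF G] n GH sH diff_mem in \<open>auto simp: s_def\<close>)
      moreover have "cmod (L (fdiff (s n) l)) < e / 2"
        by (rule small) (use n sH l diff_mem in auto)
      ultimately show ?thesis
        using norm_triangle_ineq[of "L (lincomb a G) - L (s n)" "L (s n) - L l"] by (simp add: dist_norm)
    qed
    then show "\<forall>\<^sub>F G in finite_subsets_at_top B. dist (\<Sum>p\<in>G. a p * L p) (L l) < e"
      unfolding eventually_finite_subsets_at_top using F[of n] by blast
  qed
  with l(1) show ?thesis using that by blast
qed

text \<open>Cauchy-Schwarz for \<open>f\<close> and its projection \<open>g\<close>: both
  \<open>ip g f\<close> and \<open>sqn g\<close> equal the sum \<open>S\<close> on the left, whence
  \<open>S^2 \<le> S * sqn f\<close>.\<close>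

lemma bessel:
  assumes B: "orthonormal B" and F: "finite F" "F \<subseteq> B" and f: "f \<in> H"
  shows "(\<Sum>p\<in>F. (cmod (ip f p))^2) \<le> sqn f"
proof -
  define a where "a p = ip f p" for p
  define g where "g = lincomb a F"
  have FH: "F \<subseteq> H" using assms by (auto simp: orthonormal_def)
  have g: "g \<in> H" using lincomb_mem F FH by (simp add: g_def)
  define S where "S = (\<Sum>p\<in>F. (cmod (ip f p))^2)"
  have gg: "sqn g = S" using sqn_lincomb[OF B F, of a] by (simp add: g_def a_def S_def)
  have "ip g f = (\<Sum>p\<in>F. a p * ip p f)"
    unfolding g_def by (rule functional_lincomb[OF bounded_functional_ip[OF f] F(1) FH])
  also have "... = (\<Sum>p\<in>F. of_real ((cmod (ip f p))^2))"
    by (rule sum.cong) (use ip_cnj[OF f] FH in \<open>auto simp: a_def complex_norm_square[symmetric] subset_iff\<close>)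
  finally have "ip g f = of_real S" by (simp add: S_def)
  then have "S^2 \<le> S * sqn f" using cauchy_schwarz[OF g f] gg by simp
  moreover have "S \<ge> 0" unfolding S_def by (simp add: sum_nonneg)
  ultimately show ?thesis unfolding S_def[symmetric]
    using sqn_nonneg[OF f] by (cases "S = 0") (auto simp: power2_eq_square)
qed

text \<open>A maximal orthonormal set from Zorn's lemma has trivial orthogonal complement: a nonzero
  vector in it could be normalised and added.\<close>

lemma onb_exists: "\<exists>B. onb B"
proof -
  have "\<exists>M\<in>Collect orthonormal. \<forall>X\<in>Collect orthonormal. M \<subseteq> X \<longrightarrow> X = M"
  proof (rule subset_Zorn')
    fix c assume c: "subset.chain (Collect orthonormal) c"
    have "ip p q = (if p = q then 1 else 0)" if "p \<in> \<Union>c" "q \<in> \<Union>c" for p q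
    proof -
      obtain X Y where "X \<in> c" "Y \<in> c" "p \<in> X" "q \<in> Y" using \<open>p \<in> \<Union>c\<close> \<open>q \<in> \<Union>c\<close> by blast
      moreover from this c have "X \<subseteq> Y \<or> Y \<subseteq> X" by (auto simp: subset.chain_def)
      moreover have "orthonormal X" "orthonormal Y" using c \<open>X \<in> c\<close> \<open>Y \<in> c\<close> by (auto simp: subset.chain_def)
      ultimately show ?thesis by (metis (mono_tags, lifting) orthonormal_def subsetD)
    qed
    moreover have "\<Union>c \<subseteq> H" using c unfolding subset.chain_def orthonormal_def by blast
    ultimately show "\<Union>c \<in> Collect orthonormal" by (simp add: orthonormal_def)
  qed
  then obtain B where B: "orthonormal B" and max: "\<And>X. orthonormal X ==> B \<subseteq> X ==> X = B" by auto
  have "q = (\<lambda>i j. 0)" if psi: "q \<in> H" "\<forall>p\<in>B. ip q p = 0" for q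
  proof (rule ccontr)
    assume "q ~= (\<lambda>i j. 0)"
    then have pos: "sqn q > 0" using sqn_eq_0D[OF psi(1)] sqn_nonneg[OF psi(1)] by fastforce
    define c where "c = complex_of_real (1 / sqrt (sqn q))"
    define r where "r = (\<lambda>i j. c * q i j)"
    have r: "r \<in> H" using scale_mem psi by (simp add: r_def)
    have BH: "B \<subseteq> H" using B by (simp add: orthonormal_def)
    have e0: "ip r p = 0" "ip p r = 0" if "p \<in> B" for p
    proof -
      show "ip r p = 0" using ip_scale[of q p c] psi that BH by (auto simp: r_def)
      then show "ip p r = 0" using ip_cnj[of r p] r that BH by auto
    qed
    have "ip r r = c * cnj c * ip q q"
      using psi r ip_scale[of q r c] ip_scale_right[of q q c] by (simp add: r_def)
    also have "... = 1" using pos ip_self[OF psi(1)] 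
      by (simp add: c_def flip: of_real_mult)
    finally have "ip r r = 1" .
    then have "orthonormal (insert r B)" using e0 r B by (auto simp: orthonormal_def)
    then have "r \<in> B" using max by blast
    then show False using e0 \<open>ip r r = 1\<close> by auto
  qed
  then show ?thesis using B onb_def by blast
qed

text \<open>The coefficients \<open>cnj (p i' j')\<close> are square summable because a partial sum
  \<open>g\<close> with them satisfies \<open>g i' j' = sqn g\<close>, and bounded evaluation then
  bounds \<open>sqn g\<close> by \<open>C\<close>. The reproducing property compares two sums with
  the same terms \<open>ip f p * p i' j'\<close>: the expansion of \<open>f\<close> paired with the
  kernel, and the same expansion evaluated at the point.\<close>

theorem reproducing_kernel:
  assumes B: "onb B"
  defines "K \<equiv> \<lambda>i j i' j'. \<Sum>\<^sub>\<infinity>p\<in>B. p i j * cnj (p i' j')"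
  shows "(\<lambda>i j. K i j i' j') \<in> H"
    and "f \<in> H ==> ip f (\<lambda>i j. K i j i' j') = f i' j'"
proof -
  have B': "orthonormal B" and BH: "B \<subseteq> H" using B by (auto simp: onb_def orthonormal_def)
  obtain C where C: "C \<ge> 0" "\<And>f. f \<in> H ==> (cmod (f i' j'))^2 \<le> C * sqn f"
    using bounded_functional_eval[of i' j'] by (auto simp: bounded_functional_def)
  have "(\<Sum>p\<in>F. (cmod (cnj (p i' j')))^2) \<le> C" if F: "finite F" "F \<subseteq> B" for F
  proof -
    define S where "S = (\<Sum>p\<in>F. (cmod (p i' j'))^2)"
    define g where "g = lincomb (\<lambda>p. cnj (p i' j')) F"
    have g: "g \<in> H" using lincomb_mem F BH by (auto simp: g_def)
    have "sqn g = S" using sqn_lincomb[OF B' F] by (simp add: g_def S_def)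
    moreover have "g i' j' = of_real S"
      by (simp add: g_def lincomb_def S_def mult.commute complex_norm_square[symmetric] flip: of_real_power)
    ultimately have "S^2 \<le> C * S" using C(2)[OF g] by simp
    moreover have "S \<ge> 0" unfolding S_def by (simp add: sum_nonneg)
    ultimately have "S \<le> C" using C(1) by (cases "S = 0") (auto simp: power2_eq_square)
    then show ?thesis by (simp add: S_def)
  qed
  from square_summable_expansion[OF B' this]
  obtain k where k: "k \<in> H"
    "\<And>L. bounded_functional L ==> ((\<lambda>p. cnj (p i' j') * L p) has_sum L k) B" by blast
  have kK: "k = (\<lambda>i j. K i j i' j')"
    using k(2)[OF bounded_functional_eval] by (auto simp: K_def mult.commute intro!: ext infsumI[symmetric])
  show "(\<lambda>i j. K i j i' j') \<in> H" using k kK by simp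
  have coef: "l \<in> H ==> (\<And>L. bounded_functional L ==> ((\<lambda>p. a p * L p) has_sum L l) B) ==>
      q \<in> B ==> ip l q = a q" for a l q
  proof -
    assume l: "l \<in> H" and h: "\<And>L. bounded_functional L ==> ((\<lambda>p. a p * L p) has_sum L l) B"
      and psi: "q \<in> B"
    have "((\<lambda>p. a p * ip p q) has_sum ip l q) B" using h[OF bounded_functional_ip] psi BH by blast
    moreover have "((\<lambda>p. a p * ip p q) has_sum a q) B"
      by (rule has_sum_finite_neutralI[where B = "{q}"])
         (use psi B' in \<open>auto simp: orthonormal_def\<close>)
    ultimately show "ip l q = a q" using has_sum_unique by blast
  qed
  assume f: "f \<in> H"
  have "\<And>F. finite F ==> F \<subseteq> B ==> (\<Sum>p\<in>F. (cmod (ip f p))^2) \<le> sqn f" using bessel[OF B' _ _ f] by blast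
  from square_summable_expansion[OF B' this]
  obtain l where l: "l \<in> H"
    "\<And>L. bounded_functional L ==> ((\<lambda>p. ip f p * L p) has_sum L l) B" by blast
  have "fdiff f l = (\<lambda>i j. 0)"
    using B diff_mem[OF f l(1)] coef[OF l] ip_diff[OF f l(1)] BH by (auto simp: onb_def subset_iff)
  then have fl: "f = l" by (rule fdiff_eq_0D)
  have ev: "ip p k = p i' j'" if "p \<in> B" for p
    using coef[OF k that] ip_cnj[OF k(1), of p] that BH by auto
  have "((\<lambda>p. ip f p * ip p k) has_sum ip f k) B"
    using l(2)[OF bounded_functional_ip[OF k(1)]] fl by simp
  then have e1: "((\<lambda>p. ip f p * p i' j') has_sum ip f k) B"
    by (rule has_sum_cong[THEN iffD1, rotated]) (simp add: ev)
  have e2: "((\<lambda>p. ip f p * p i' j') has_sum f i' j') B"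
    using l(2)[OF bounded_functional_eval, of i' j'] unfolding fl .
  show "ip f (\<lambda>i j. K i j i' j') = f i' j'"
    using has_sum_unique[OF e1 e2] unfolding kK .
qed

lemma kernel_unique:
  assumes "k \<in> H" "k' \<in> H" "\<And>f. f \<in> H ==> ip f k = ip f k'"
  shows "k = k'"
proof -
  have "sqn (fdiff k k') = 0"
    using assms diff_mem by (simp add: sqn_def ip_diff_right)
  then have "fdiff k k' = (\<lambda>i j. 0)" using sqn_eq_0D diff_mem assms by blast
  then show ?thesis by (rule fdiff_eq_0D)
qed

end

section \<open>Rado's theorem\<close>

text \<open>Otherwise \<open>(M / x) ^ k * S\<close> tends to 0 while staying above
  \<open>c\<close>.\<close>

lemma bounded_power_imp_le:
  fixes x M c S :: real
  assumes "\<And>k. x ^ k * c \<le> M ^ k * S" "c > 0" "M \<ge> 0"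
  shows "x \<le> M"
proof (rule ccontr)
  assume "\<not> x \<le> M"
  then have x: "M < x" "x > 0" using assms by auto
  then have "(\<lambda>k. (M / x) ^ k * S) \<longlonglongrightarrow> 0 * S"
    using assms by (intro tendsto_intros LIMSEQ_realpow_zero) auto
  moreover have "c \<le> (M / x) ^ k * S" for k
    using assms(1)[of k] x by (simp add: power_divide field_simps)
  ultimately have "c \<le> 0 * S" by (intro LIMSEQ_le_const) auto
  then show False using assms by simp
qed

text \<open>The boundary of \<open>U\<close> lies on the circle or in the zero set of
  \<open>u\<close>. Multiplying a power of \<open>h\<close> by \<open>u\<close> kills the second
  part of the boundary, and letting the exponent grow removes the factor \<open>u\<close> from the
  estimate.\<close>

lemma rado_maximum_principle:
  fixes u h :: "complex => complex"
  defines "U \<equiv> {z \<in> ball 0 1. u z ~= 0}"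
  assumes cu: "continuous_on (cball 0 1) u" and hu: "u holomorphic_on U"
    and ch: "continuous_on (cball 0 1) h" and hh: "h holomorphic_on U"
    and M: "\<And>z. z \<in> sphere 0 1 ==> cmod (h z) \<le> M" and z: "z \<in> U"
  shows "cmod (h z) \<le> M"
proof -
  have op: "open U"
  proof -
    have "continuous_on (ball 0 1) u" using cu ball_subset_cball continuous_on_subset by blast
    then have "open (ball 0 1 \<inter> u -` (- {0}))" by (intro continuous_open_preimage) auto
    also have "ball 0 1 \<inter> u -` (- {0}) = U" by (auto simp: U_def)
    finally show ?thesis .
  qed
  have cl: "closure U \<subseteq> cball 0 1"
    by (rule closure_minimal) (auto simp: U_def)
  have fr: "w \<in> sphere 0 1 \<or> u w = 0" if "w \<in> frontier U" for w
    using that cl op by (auto simp: frontier_def interior_open U_def subset_iff)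
  have Mnn: "M \<ge> 0" by (rule order_trans[OF norm_ge_zero M[of 1]]) simp
  have "compact (u ` sphere 0 1)"
    by (intro compact_continuous_image continuous_on_subset[OF cu]) auto
  then obtain S where S: "\<And>w. w \<in> sphere 0 1 ==> cmod (u w) \<le> S"
    using compact_imp_bounded bounded_iff by (metis imageI)
  have Snn: "S \<ge> 0" by (rule order_trans[OF norm_ge_zero S[of 1]]) simp
  have "cmod (h z) ^ k * cmod (u z) \<le> M ^ k * S" for k
  proof -
    have "cmod (h z ^ k * u z) \<le> M ^ k * S"
    proof (rule maximum_modulus_frontier[of "\<lambda>w. h w ^ k * u w" U])
      show "(\<lambda>w. h w ^ k * u w) holomorphic_on interior U"
        using op hh hu by (auto simp: interior_open intro!: holomorphic_intros)
      show "continuous_on (closure U) (\<lambda>w. h w ^ k * u w)"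
        by (intro continuous_intros continuous_on_subset[OF ch] continuous_on_subset[OF cu] cl)
      show "bounded U" by (rule bounded_subset[OF bounded_ball[of 0 1]]) (auto simp: U_def)
      show "cmod (h w ^ k * u w) \<le> M ^ k * S" if "w \<in> frontier U" for w
        using fr[OF that]
      proof
        assume "w \<in> sphere 0 1"
        then show ?thesis using M S Mnn by (auto simp: norm_mult norm_power intro!: mult_mono power_mono)
      qed (use Mnn Snn in simp)
    qed fact
    then show ?thesis by (simp add: norm_mult norm_power)
  qed
  from bounded_power_imp_le[OF this] show ?thesis using z Mnn by (auto simp: U_def)
qed

text \<open>The moduli of \<open>exp (h z)\<close> and \<open>exp (- h z)\<close> are the
  exponentials of plus and minus the real part; the previous bound applies to both.\<close>

lemma rado_maximum_principle_Re:
  fixes u h :: "complex => complex"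
  defines "U \<equiv> {z \<in> ball 0 1. u z ~= 0}"
  assumes cu: "continuous_on (cball 0 1) u" and hu: "u holomorphic_on U"
    and ch: "continuous_on (cball 0 1) h" and hh: "h holomorphic_on U"
    and M: "\<And>z. z \<in> sphere 0 1 ==> \<bar>Re (h z)\<bar> \<le> M" and z: "z \<in> U"
  shows "\<bar>Re (h z)\<bar> \<le> M"
proof -
  have "cmod (exp (h z)) \<le> exp M"
    by (rule rado_maximum_principle[OF cu, of "\<lambda>z. exp (h z)"])
       (use hu ch hh M z in \<open>auto simp: U_def abs_le_iff intro!: holomorphic_intros continuous_intros\<close>)
  moreover have "cmod (exp (- h z)) \<le> exp M"
    by (rule rado_maximum_principle[OF cu, of "\<lambda>z. exp (- h z)"])
       (use hu ch hh M z in \<open>force simp: U_def abs_le_iff intro!: holomorphic_intros continuous_intros\<close>)+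
  ultimately show ?thesis by (simp add: abs_le_iff)
qed

section \<open>Harmonic polynomials on the unit circle\<close>

lemma Re_poly_mult_on_circle:
  fixes p q :: "complex poly"
  shows "\<exists>r. \<forall>z\<in>sphere 0 1. Re (poly p z) * Re (poly q z) = Re (poly r z)"
proof -
  define T where "T = {g :: complex => real. \<exists>r. \<forall>z\<in>sphere 0 1. g z = Re (poly r z)}"
  have Tadd: "(\<lambda>z. f z + g z) \<in> T" if fT: "f \<in> T" and gT: "g \<in> T" for f g
  proof -
    obtain r s where "\<forall>z\<in>sphere 0 1. f z = Re (poly r z)" "\<forall>z\<in>sphere 0 1. g z = Re (poly s z)"
      using fT gT unfolding T_def by blast
    then have "\<forall>z\<in>sphere 0 1. f z + g z = Re (poly (r + s) z)" by simp
    then show ?thesis unfolding T_def by blast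
  qed
  have T0: "(\<lambda>z. 0) \<in> T" unfolding T_def by (auto intro!: exI[of _ 0])
  have Tsum: "finite I ==> (\<And>i. i \<in> I ==> f i \<in> T) ==> (\<lambda>z. \<Sum>i\<in>I. f i z) \<in> T"
    for I :: "nat set" and f
    by (induction I rule: finite_induct) (auto intro!: T0 Tadd)
  have mono: "(\<lambda>z. Re (c * z ^ k)) \<in> T" for c k
    unfolding T_def by (auto intro!: exI[of _ "monom c k"] simp: poly_monom)
  have mono2: "(\<lambda>z. Re (c * z ^ i * cnj z ^ j)) \<in> T" for c i j
  proof -
    \<comment> \<open>On the circle \<open>cnj z\<close> is the inverse of \<open>z\<close>, so a
      mixed monomial collapses to a power of \<open>z\<close> or to the conjugate of one.\<close>
    have unit: "z * cnj z = 1" if "z \<in> sphere 0 1" for z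
      using that complex_norm_square[of z] by simp
    show ?thesis
    proof (cases "j \<le> i")
      case True
      have "Re (c * z ^ i * cnj z ^ j) = Re (c * z ^ (i - j))" if "z \<in> sphere 0 1" for z
      proof -
        have "z ^ i = z ^ (i - j) * z ^ j" using True by (simp flip: power_add)
        then have "z ^ i * cnj z ^ j = z ^ (i - j) * (z * cnj z) ^ j" by (simp add: power_mult_distrib)
        then show ?thesis using unit[OF that] by (simp add: mult.assoc)
      qed
      then show ?thesis using mono[of c "i - j"] unfolding T_def by auto
    next
      case False
      have "Re (c * z ^ i * cnj z ^ j) = Re (cnj c * z ^ (j - i))" if "z \<in> sphere 0 1" for z
      proof -
        have "cnj z ^ j = cnj z ^ (j - i) * cnj z ^ i" using False by (simp flip: power_add)
        then have "z ^ i * cnj z ^ j = cnj z ^ (j - i) * (z * cnj z) ^ i" by (simp add: power_mult_distrib)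
        then have "c * z ^ i * cnj z ^ j = cnj (cnj c * z ^ (j - i))" using unit[OF that] by (simp add: mult.assoc)
        then show ?thesis by (simp del: complex_cnj_mult complex_cnj_power)
      qed
      then show ?thesis using mono[of "cnj c" "j - i"] unfolding T_def by auto
    qed
  qed
  \<comment> \<open>The product of two real parts is
    \<open>Re (a * b) / 2 + Re (a * cnj b) / 2\<close>; the double sum applies this to all pairs of
    monomials.\<close>
  have mem: "(\<lambda>z. \<Sum>i\<le>degree p. \<Sum>j\<le>degree q. Re (coeff p i * coeff q j / 2 * z ^ (i + j))
      + Re (coeff p i * cnj (coeff q j) / 2 * z ^ i * cnj z ^ j)) \<in> T"
    by (intro Tsum Tadd mono mono2) auto
  have eq: "(\<lambda>z. \<Sum>i\<le>degree p. \<Sum>j\<le>degree q. Re (coeff p i * coeff q j / 2 * z ^ (i + j))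
      + Re (coeff p i * cnj (coeff q j) / 2 * z ^ i * cnj z ^ j)) = (\<lambda>z. Re (poly p z) * Re (poly q z))"
  proof
    fix z
    have "(\<Sum>i\<le>degree p. \<Sum>j\<le>degree q. Re (coeff p i * coeff q j / 2 * z ^ (i + j))
      + Re (coeff p i * cnj (coeff q j) / 2 * z ^ i * cnj z ^ j))
      = (\<Sum>i\<le>degree p. \<Sum>j\<le>degree q. Re (coeff p i * z ^ i) * Re (coeff q j * z ^ j))"
    proof (intro sum.cong refl)
      fix i j
      have *: "Re (a * b / 2) + Re (a * cnj b / 2) = Re a * Re b" for a b :: complex
        by (simp add: field_simps)
      have "coeff p i * coeff q j / 2 * z ^ (i + j) = (coeff p i * z ^ i) * (coeff q j * z ^ j) / 2"
        "coeff p i * cnj (coeff q j) / 2 * z ^ i * cnj z ^ j = (coeff p i * z ^ i) * cnj (coeff q j * z ^ j) / 2"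
        by (simp_all add: power_add)
      then show "Re (coeff p i * coeff q j / 2 * z ^ (i + j))
          + Re (coeff p i * cnj (coeff q j) / 2 * z ^ i * cnj z ^ j) = Re (coeff p i * z ^ i) * Re (coeff q j * z ^ j)"
        using *[of "coeff p i * z ^ i" "coeff q j * z ^ j"] by metis
    qed
    also have "... = Re (poly p z) * Re (poly q z)"
      unfolding poly_altdef Re_sum sum_product ..
    finally show "(\<Sum>i\<le>degree p. \<Sum>j\<le>degree q. Re (coeff p i * coeff q j / 2 * z ^ (i + j))
      + Re (coeff p i * cnj (coeff q j) / 2 * z ^ i * cnj z ^ j)) = Re (poly p z) * Re (poly q z)" .
  qed
  show ?thesis using mem unfolding eq unfolding T_def by blast
qed

text \<open>By Stone-Weierstrass the real polynomials in two real coordinates are dense; on the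
  circle these are real parts of complex polynomials. This takes the place of solving the Dirichlet
  problem.\<close>

lemma Re_poly_dense_on_circle:
  fixes g :: "complex => real"
  assumes "continuous_on (sphere 0 1) g" "e > 0"
  obtains p where "\<And>z. z \<in> sphere 0 1 ==> \<bar>g z - Re (poly p z)\<bar> < e"
proof -
  have P: "\<exists>p. \<forall>z\<in>sphere 0 1. h z = Re (poly p z)" if "real_polynomial_function h" for h :: "complex => real"
    using that
  proof (induction rule: real_polynomial_function.induct)
    case (linear f)
    then interpret f: bounded_linear f .
    \<comment> \<open>A real linear form \<open>a x + b y\<close> is the real part of
      \<open>(a - b \<i>) z\<close>.\<close>
    have "f z = Re (poly [:0, Complex (f 1) (- f \<i>):] z)" for z
    proof -
      have "f z = f (Re z *\<^sub>R 1 + Im z *\<^sub>R \<i>)"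
        by (rule arg_cong[of _ _ f]) (simp add: complex_eq_iff)
      also have "... = Re z * f 1 + Im z * f \<i>" by (simp only: f.add f.scaleR real_scaleR_def)
      finally show ?thesis by simp
    qed
    then show ?case by blast
  next
    case (const c) then show ?case by (auto intro!: exI[of _ "[:of_real c:]"])
  next
    case (add f g)
    then obtain r s where "\<forall>z\<in>sphere 0 1. f z = Re (poly r z)" "\<forall>z\<in>sphere 0 1. g z = Re (poly s z)" by auto
    then have "\<forall>z\<in>sphere 0 1. f z + g z = Re (poly (r + s) z)" by simp
    then show ?case by blast
  next
    case (mult f g)
    then obtain r s where "\<forall>z\<in>sphere 0 1. f z = Re (poly r z)" "\<forall>z\<in>sphere 0 1. g z = Re (poly s z)" by auto
    then show ?case using Re_poly_mult_on_circle[of r s] by auto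
  qed
  show ?thesis
    using Stone_Weierstrass_real_polynomial_function[OF compact_sphere assms] P that by metis
qed

text \<open>The ratio is an \<open>N\<close>-th root of unity, different from 1 because
  \<open>m\<close> is not a multiple of \<open>N\<close>; so the geometric sum vanishes.\<close>

lemma sum_roots_of_unity_eq_0:
  fixes N :: nat and m :: int
  assumes "m ~= 0" "\<bar>m\<bar> < int N"
  shows "(\<Sum>l<N. cis (2 * pi * real_of_int m / real N) ^ l) = 0"
proof -
  have N: "N > 0" using assms by auto
  define x where "x = cis (2 * pi * real_of_int m / real N)"
  have "x ^ N = 1"
  proof -
    have "x ^ N = cis (2 * pi * real_of_int m)" unfolding x_def Complex.DeMoivre using N by simp
    then show ?thesis using cis_multiple_2pi[of "real_of_int m"] by (simp add: mult_ac)
  qed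
  moreover have "x ~= 1"
  proof
    assume "x = 1"
    then have "cos (2 * pi * real_of_int m / real N) = 1" by (simp add: x_def complex_eq_iff)
    then obtain n :: int where "2 * pi * real_of_int m / real N = of_int n * 2 * pi"
      using cos_one_2pi_int by auto
    then have "real_of_int m = of_int (n * int N)" using N by (simp add: field_simps)
    then have "m = n * int N" using of_int_eq_iff by blast
    then show False using assms by (cases "n = 0") (auto simp: abs_mult)
  qed
  ultimately show ?thesis unfolding x_def[symmetric] by (simp add: geometric_sum)
qed

text \<open>The coefficient is the average of \<open>(A + cnj B) z ^ - k\<close> over roots of unity of high order.\<close>

lemma coeff_bound_of_harmonic_bound:
  fixes A B :: "complex poly"
  assumes bd: "\<And>z. z \<in> sphere 0 1 ==> cmod (poly A z + cnj (poly B z)) \<le> d"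
    and B0: "coeff B 0 = 0"
  shows "cmod (coeff A k) \<le> d"
proof -
  \<comment> \<open>All exponents compared below, \<open>i\<close>, \<open>k\<close> and
    \<open>i + k\<close>, are at most \<open>D < N\<close>; two of them give the same power of the
    roots of unity only if they are equal.\<close>
  define D where "D = degree A + degree B + k"
  define N where "N = Suc D"
  have N: "N > 0" by (simp add: N_def)
  define w where "w l = cis (2 * pi * real l / real N)" for l
  have avg: "(\<Sum>l<N. w l ^ i * cnj (w l) ^ j) = (if i = j then of_nat N else 0)" if "i < N" "j < N" for i j
  proof -
    have "w l ^ i * cnj (w l) ^ j = cis (2 * pi * real_of_int (int i - int j) / real N) ^ l" for l
      unfolding w_def cis_cnj Complex.DeMoivre cis_mult by (simp add: field_simps diff_divide_distrib)
    then have "(\<Sum>l<N. w l ^ i * cnj (w l) ^ j) = (\<Sum>l<N. cis (2 * pi * real_of_int (int i - int j) / real N) ^ l)"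
      by simp
    also have "... = (if i = j then of_nat N else 0)"
      using sum_roots_of_unity_eq_0[of "int i - int j" N] that by auto
    finally show ?thesis .
  qed
  have ext: "poly p z = (\<Sum>i\<le>D. coeff p i * z ^ i)" if "degree p \<le> D" for p :: "complex poly" and z
    unfolding poly_altdef by (rule sum.mono_neutral_left) (use that in \<open>auto simp: coeff_eq_0\<close>)
  have "(\<Sum>l<N. poly A (w l) * cnj (w l) ^ k) = (\<Sum>i\<le>D. coeff A i * (\<Sum>l<N. w l ^ i * cnj (w l) ^ k))"
    by (simp add: ext D_def sum_distrib_right sum_distrib_left mult.assoc) (rule sum.swap)
  also have "... = (\<Sum>i\<le>D. coeff A i * (if i = k then of_nat N else 0))"
    by (intro sum.cong refl) (use avg in \<open>auto simp: N_def D_def\<close>)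
  also have "... = coeff A k * of_nat N" by (auto simp: D_def if_distrib cong: if_cong)
  finally have 1: "(\<Sum>l<N. poly A (w l) * cnj (w l) ^ k) = coeff A k * of_nat N" .
  have "(\<Sum>l<N. cnj (poly B (w l)) * cnj (w l) ^ k)
      = cnj (\<Sum>i\<le>degree B. coeff B i * (\<Sum>l<N. w l ^ (i + k) * cnj (w l) ^ 0))"
    by (simp add: poly_altdef sum_distrib_right sum_distrib_left mult.assoc power_add) (rule sum.swap)
  also have "(\<Sum>i\<le>degree B. coeff B i * (\<Sum>l<N. w l ^ (i + k) * cnj (w l) ^ 0)) = 0"
  proof (rule sum.neutral, intro ballI)
    fix i assume "i \<in> {..degree B}"
    then show "coeff B i * (\<Sum>l<N. w l ^ (i + k) * cnj (w l) ^ 0) = 0"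
      using avg[of "i + k" 0] B0 by (cases "i = 0") (auto simp: N_def D_def)
  qed
  finally have 2: "(\<Sum>l<N. cnj (poly B (w l)) * cnj (w l) ^ k) = 0" by simp
  have "coeff A k * of_nat N = (\<Sum>l<N. (poly A (w l) + cnj (poly B (w l))) * cnj (w l) ^ k)"
    using 1 2 by (simp add: algebra_simps sum.distrib)
  then have "cmod (coeff A k * of_nat N) \<le> (\<Sum>l<N. cmod ((poly A (w l) + cnj (poly B (w l))) * cnj (w l) ^ k))"
    by (simp only: norm_sum)
  also have "... \<le> (\<Sum>l<N. d)"
    by (intro sum_mono) (use bd in \<open>auto simp: norm_mult norm_power w_def\<close>)
  finally have "cmod (coeff A k) * real N \<le> d * real N" by (simp add: norm_mult mult.commute)
  then show ?thesis using N by simp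
qed

lemma norm_poly_le_of_coeff:
  fixes p :: "complex poly"
  assumes "\<And>k. cmod (coeff p k) \<le> c" "cmod z < 1"
  shows "cmod (poly p z) \<le> c / (1 - cmod z)"
proof -
  have c: "c \<ge> 0" using assms(1)[of 0] norm_ge_zero order_trans by blast
  have "cmod (poly p z) \<le> (\<Sum>i\<le>degree p. cmod (coeff p i * z ^ i))"
    unfolding poly_altdef by (rule norm_sum)
  also have "... \<le> (\<Sum>i\<le>degree p. c * cmod z ^ i)"
    by (intro sum_mono) (auto simp: norm_mult norm_power intro!: mult_right_mono assms)
  also have "... = c * (\<Sum>i\<le>degree p. cmod z ^ i)" by (simp add: sum_distrib_left)
  also have "... \<le> c * (1 / (1 - cmod z))"
  proof (rule mult_left_mono[OF _ c])
    have "(1 - cmod z) * (\<Sum>i\<le>degree p. cmod z ^ i) \<le> 1" unfolding sum_gp_basic by simp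
    then show "(\<Sum>i\<le>degree p. cmod z ^ i) \<le> 1 / (1 - cmod z)"
      using assms(2) by (simp add: field_simps)
  qed
  finally show ?thesis by simp
qed

text \<open>A common bound on all coefficients of \<open>A m - A n\<close> gives, through the
  geometric series, a bound on the values that is uniform on smaller discs; so the limit is locally
  uniform.\<close>

lemma coefficientwise_Cauchy_limit:
  fixes A :: "nat => complex poly"
  assumes bd: "\<And>m n k. cmod (coeff (A m - A n) k) \<le> e m + e n" and e: "e \<longlonglongrightarrow> 0"
  obtains g where "g holomorphic_on ball 0 1" "\<And>z. z \<in> ball 0 1 ==> (\<lambda>n. poly (A n) z) \<longlonglongrightarrow> g z"
proof -
  have est: "cmod (poly (A m) z - poly (A n) z) \<le> (e m + e n) / (1 - cmod z)" if "cmod z < 1" for m n z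
    using norm_poly_le_of_coeff[OF bd that, of m n] by simp
  have conv: "convergent (\<lambda>n. poly (A n) z)" if z: "cmod z < 1" for z
  proof (rule Cauchy_convergent, rule CauchyI)
    fix r :: real assume r: "r > 0"
    have "\<forall>\<^sub>F n in sequentially. e n < r * (1 - cmod z) / 2"
      using order_tendstoD(2)[OF e, of "r * (1 - cmod z) / 2"] r z by simp
    then obtain M where M: "\<And>n. n \<ge> M ==> e n < r * (1 - cmod z) / 2"
      by (auto simp: eventually_sequentially)
    have "cmod (poly (A m) z - poly (A n) z) < r" if "m \<ge> M" "n \<ge> M" for m n
    proof -
      have "(e m + e n) / (1 - cmod z) < r"
        using M[OF that(1)] M[OF that(2)] z by (simp add: pos_divide_less_eq)
      then show ?thesis using est[OF z, of m n] by linarith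
    qed
    then show "\<exists>M. \<forall>m\<ge>M. \<forall>n\<ge>M. cmod (poly (A m) z - poly (A n) z) < r" by blast
  qed
  define g where "g z = lim (\<lambda>n. poly (A n) z)" for z
  have g: "(\<lambda>n. poly (A n) z) \<longlonglongrightarrow> g z" if "cmod z < 1" for z
    using conv[OF that] by (simp add: g_def convergent_LIMSEQ_iff)
  have estg: "cmod (poly (A n) z - g z) \<le> e n / (1 - cmod z)" if "cmod z < 1" for n z
  proof (rule LIMSEQ_le[OF _ _ exI[of _ 0]])
    show "(\<lambda>m. cmod (poly (A n) z - poly (A m) z)) \<longlonglongrightarrow> cmod (poly (A n) z - g z)"
      by (intro tendsto_intros g that)
    have "(\<lambda>m. (e n + e m) / (1 - cmod z)) \<longlonglongrightarrow> (e n + 0) / (1 - cmod z)"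
      by (intro tendsto_intros e) (use that in auto)
    then show "(\<lambda>m. (e n + e m) / (1 - cmod z)) \<longlonglongrightarrow> e n / (1 - cmod z)" by simp
  qed (use est[OF that] in auto)
  have "g holomorphic_on ball 0 1"
  proof (rule holomorphic_uniform_sequence)
    fix x :: complex assume "x \<in> ball 0 1"
    then have x: "cmod x < 1" by simp
    define d where "d = (1 - cmod x) / 2"
    have dp: "d > 0" using x by (simp add: d_def)
    have in': "cmod y \<le> 1 - d" if "y \<in> cball x d" for y
      using that norm_triangle_ineq2[of y x] by (simp add: d_def dist_norm norm_minus_commute field_simps)
    have "uniform_limit (cball x d) (\<lambda>n. poly (A n)) g sequentially"
    proof (rule uniform_limitI)
      fix r :: real assume r: "r > 0"
      have "\<forall>\<^sub>F n in sequentially. e n < r * d"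
        using order_tendstoD(2)[OF e, of "r * d"] r dp by simp
      then show "\<forall>\<^sub>F n in sequentially. \<forall>y\<in>cball x d. dist (poly (A n) y) (g y) < r"
      proof eventually_elim
        case (elim n)
        show ?case
        proof
          fix y assume "y \<in> cball x d"
          then have y: "cmod y \<le> 1 - d" by (rule in')
          have "e n \<ge> 0" using bd[of n n 0] by simp
          have "dist (poly (A n) y) (g y) \<le> e n / (1 - cmod y)" using estg[of y n] y dp by (simp add: dist_norm)
          also have "... \<le> e n / d" using y dp \<open>e n \<ge> 0\<close> by (intro divide_left_mono) auto
          also have "... < r" using elim dp by (simp add: pos_divide_less_eq)
          finally show "dist (poly (A n) y) (g y) < r" .
        qed
      qed
    qed
    moreover have "cball x d \<subseteq> ball 0 1" using in' dp by force
    ultimately show "\<exists>d>0. cball x d \<subseteq> ball 0 1 \<and> uniform_limit (cball x d) (\<lambda>n. poly (A n)) g sequentially"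
      using dp by blast
  qed (auto intro!: holomorphic_intros)
  then show ?thesis using g that by auto
qed

text \<open>Comparing the derivatives of \<open>cnj \<circ> f\<close> in the directions
  \<open>1\<close> and \<open>\<i>\<close> gives \<open>cnj D = E\<close> and
  \<open>- cnj D = E\<close>.\<close>

lemma holomorphic_and_cnj_imp_deriv_0:
  assumes "(f has_field_derivative D) (at z)" "((\<lambda>w. cnj (f w)) has_field_derivative E) (at z)"
  shows "D = 0"
proof -
  have "((\<lambda>w. cnj (f w)) has_derivative (\<lambda>h. cnj (D * h))) (at z)"
    using has_derivative_compose[OF assms(1)[unfolded has_field_derivative_def], of cnj cnj]
      bounded_linear_cnj bounded_linear_imp_has_derivative by blast
  with assms(2)[unfolded has_field_derivative_def]
  have "(\<lambda>h. cnj (D * h)) = (*) E" by (rule has_derivative_unique[symmetric])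
  then have "cnj D = E" "cnj (D * \<i>) = E * \<i>" by (metis mult.right_neutral, metis)
  then show ?thesis by (auto simp: complex_eq_iff)
qed

lemma fsigma_unit_disc: "fsigma (ball (0::complex) 1)"
proof -
  have "ball (0::complex) 1 = (\<Union>n. cball 0 (1 - 1 / real (Suc n)))"
  proof (intro equalityI subsetI)
    fix z :: complex assume "z \<in> ball 0 1"
    then obtain n where "1 / real (Suc n) < 1 - cmod z"
      using nat_approx_posE[of "1 - cmod z"] by auto
    then have "z \<in> cball 0 (1 - 1 / real (Suc n))" by simp
    then show "z \<in> (\<Union>n. cball 0 (1 - 1 / real (Suc n)))" by blast
  next
    fix z :: complex assume "z \<in> (\<Union>n. cball 0 (1 - 1 / real (Suc n)))"
    then obtain n where "cmod z \<le> 1 - 1 / real (Suc n)" by auto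
    also have "1 - 1 / real (Suc n) < 1" by simp
    finally show "z \<in> ball 0 1" by simp
  qed
  then show ?thesis using fsigma.intros[of "\<lambda>n. cball (0::complex) (1 - 1 / real (Suc n))"] by simp
qed

text \<open>On the circle \<open>u\<close> is approximated by harmonic polynomials
  \<open>A n + cnj (B n)\<close>; the maximum principle carries the approximation into the set
  \<open>U\<close> where \<open>u\<close> does not vanish. In the limit \<open>u = F + cnj G\<close>
  on \<open>U\<close>, with \<open>F\<close> and \<open>G\<close> holomorphic on the whole disc. On
  \<open>U\<close> the function \<open>cnj G = u - F\<close> is holomorphic, so \<open>G\<close> is
  constant. Finally \<open>u = F\<close> spreads from \<open>U\<close> to the disc, because
  \<open>U\<close> is closed and open in the connected set where \<open>F\<close> does not
  vanish.\<close>

lemma rado_unit_disc: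
  fixes u :: "complex => complex"
  assumes cu: "continuous_on (cball 0 1) u" and hu: "u holomorphic_on {z \<in> ball 0 1. u z ~= 0}"
  shows "u holomorphic_on ball 0 1"
proof (cases "\<forall>z\<in>ball 0 1. u z = 0")
  case True
  then show ?thesis using holomorphic_cong[of "ball 0 1" _ u "\<lambda>_. 0"] by auto
next
  case False
  define U where "U = {z \<in> ball 0 1. u z ~= 0}"
  have cub: "continuous_on (ball 0 1) u" using cu ball_subset_cball continuous_on_subset by blast
  have op: "open U"
  proof -
    have "open (ball 0 1 \<inter> u -` (- {0}))" by (intro continuous_open_preimage cub) auto
    also have "ball 0 1 \<inter> u -` (- {0}) = U" by (auto simp: U_def)
    finally show ?thesis .
  qed
  have hu': "u holomorphic_on U" using hu by (simp add: U_def)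
  have cus: "continuous_on (sphere 0 1) u" using cu continuous_on_subset sphere_cball by blast
  define e where "e n = 1 / real (Suc n)" for n
  have e0: "e n > 0" for n by (simp add: e_def)
  have "\<exists>p. \<forall>z\<in>sphere 0 1. \<bar>Re (u z) - Re (poly p z)\<bar> < e n" for n
    using Re_poly_dense_on_circle[of "\<lambda>z. Re (u z)" "e n"] cus e0 by (metis continuous_on_Re)
  then obtain p where p: "\<And>n z. z \<in> sphere 0 1 ==> \<bar>Re (u z) - Re (poly (p n) z)\<bar> < e n" by metis
  have "\<exists>p. \<forall>z\<in>sphere 0 1. \<bar>Im (u z) - Re (poly p z)\<bar> < e n" for n
    using Re_poly_dense_on_circle[of "\<lambda>z. Im (u z)" "e n"] cus e0 by (metis continuous_on_Im)
  then obtain q where q: "\<And>n z. z \<in> sphere 0 1 ==> \<bar>Im (u z) - Re (poly (q n) z)\<bar> < e n" by metis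
  have p': "\<bar>Re (u z) - Re (poly (p n) z)\<bar> \<le> e n" if "z \<in> U" for z n
  proof -
    have "\<bar>Re (u z - poly (p n) z)\<bar> \<le> e n"
      by (rule rado_maximum_principle_Re[OF cu hu])
         (use that hu' cu less_imp_le[OF p] in \<open>simp_all add: U_def continuous_intros holomorphic_intros\<close>)
    then show ?thesis by simp
  qed
  have q': "\<bar>Im (u z) - Re (poly (q n) z)\<bar> \<le> e n" if "z \<in> U" for z n
  proof -
    \<comment> \<open>The factor \<open>- \<i>\<close> turns the imaginary part of \<open>u\<close>
      into a real part.\<close>
    have "\<bar>Re (- \<i> * u z - poly (q n) z)\<bar> \<le> e n"
      by (rule rado_maximum_principle_Re[OF cu hu])
         (use that hu' cu less_imp_le[OF q] in \<open>simp_all add: U_def continuous_intros holomorphic_intros\<close>)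
    then show ?thesis by simp
  qed
  \<comment> \<open>Splitting \<open>Re p + \<i> * Re q\<close> into a holomorphic and an
    antiholomorphic part gives \<open>(p + \<i> q) / 2\<close> and the conjugate of
    \<open>B0 = (p - \<i> q) / 2\<close>. The constant term of \<open>B0\<close> moves to
    \<open>A\<close>, since the coefficient bound asks for \<open>coeff B 0 = 0\<close>.\<close>
  define B0 where "B0 n = smult (1/2) (p n - smult \<i> (q n))" for n
  define B where "B n = B0 n - [:coeff (B0 n) 0:]" for n
  define A where "A n = smult (1/2) (p n + smult \<i> (q n)) + [:cnj (coeff (B0 n) 0):]" for n
  have AB: "poly (A n) z + cnj (poly (B n) z) = Complex (Re (poly (p n) z)) (Re (poly (q n) z))" for n z
    by (simp add: A_def B_def B0_def complex_eq_iff add_divide_distrib diff_divide_distrib)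
  have close: "cmod (u z - (poly (A n) z + cnj (poly (B n) z))) \<le> 2 * e n"
    if "z \<in> sphere 0 1 \<or> z \<in> U" for z n
  proof -
    have "cmod (u z - (poly (A n) z + cnj (poly (B n) z)))
       \<le> \<bar>Re (u z - (poly (A n) z + cnj (poly (B n) z)))\<bar> + \<bar>Im (u z - (poly (A n) z + cnj (poly (B n) z)))\<bar>"
      by (rule cmod_le)
    also have "... \<le> 2 * e n"
      using p[of z n] p'[of z n] q[of z n] q'[of z n] that unfolding AB by auto
    finally show ?thesis .
  qed
  have e2: "(\<lambda>n. 2 * e n) \<longlonglongrightarrow> 0"
    unfolding e_def using tendsto_mult_left_zero[OF LIMSEQ_inverse_real_of_nat, of 2]
    by (simp add: inverse_eq_divide mult.commute)
  have B00: "coeff (B n) 0 = 0" for n by (simp add: B_def)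
  have diff: "cmod (poly (A m - A n) z + cnj (poly (B m - B n) z)) \<le> 2 * e m + 2 * e n"
    if "z \<in> sphere 0 1" for m n z
  proof -
    have "poly (A m - A n) z + cnj (poly (B m - B n) z)
      = (u z - (poly (A n) z + cnj (poly (B n) z))) - (u z - (poly (A m) z + cnj (poly (B m) z)))" by simp
    also have "cmod ... \<le> 2 * e n + 2 * e m"
      by (rule order_trans[OF norm_triangle_ineq4 add_mono[OF close close]]) (use that in auto)
    finally show ?thesis by simp
  qed
  have cA: "cmod (coeff (A m - A n) k) \<le> 2 * e m + 2 * e n" for m n k
    by (rule coeff_bound_of_harmonic_bound[of _ "B m - B n"]) (use diff B00 in auto)
  have cB: "cmod (coeff (B m - B n) k) \<le> 2 * e m + 2 * e n" for m n k
  proof (cases "k = 0")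
    case True then show ?thesis using B00 e0[of m] e0[of n] by simp
  next
    case False
    \<comment> \<open>Conjugation exchanges the roles of \<open>A\<close> and \<open>B\<close>; the
      constant \<open>c\<close> moves the constant term again, now from the \<open>A\<close> part to
      the \<open>B\<close> part.\<close>
    define c where "c = cnj (coeff (A m - A n) 0)"
    have "cmod (coeff (B m - B n + [:c:]) k) \<le> 2 * e m + 2 * e n"
    proof (rule coeff_bound_of_harmonic_bound[of _ "A m - A n - [:cnj c:]"])
      fix z :: complex assume z: "z \<in> sphere 0 1"
      have "poly (B m - B n + [:c:]) z + cnj (poly (A m - A n - [:cnj c:]) z)
        = cnj (poly (A m - A n) z + cnj (poly (B m - B n) z))" by simp
      then show "cmod (poly (B m - B n + [:c:]) z + cnj (poly (A m - A n - [:cnj c:]) z)) \<le> 2 * e m + 2 * e n"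
        using diff[OF z, of m n] by (metis complex_mod_cnj)
    qed (simp add: c_def)
    then show ?thesis using False by (cases k) auto
  qed
  obtain F where F: "F holomorphic_on ball 0 1" "\<And>z. z \<in> ball 0 1 ==> (\<lambda>n. poly (A n) z) \<longlonglongrightarrow> F z"
    using coefficientwise_Cauchy_limit[OF cA e2] by blast
  obtain G where G: "G holomorphic_on ball 0 1" "\<And>z. z \<in> ball 0 1 ==> (\<lambda>n. poly (B n) z) \<longlonglongrightarrow> G z"
    using coefficientwise_Cauchy_limit[OF cB e2] by blast
  have uFG: "u z = F z + cnj (G z)" if z: "z \<in> U" for z
  proof -
    have zb: "z \<in> ball 0 1" using z by (simp add: U_def)
    have "(\<lambda>n. u z - (poly (A n) z + cnj (poly (B n) z))) \<longlonglongrightarrow> u z - (F z + cnj (G z))"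
      by (intro tendsto_intros F G zb)
    moreover have "(\<lambda>n. u z - (poly (A n) z + cnj (poly (B n) z))) \<longlonglongrightarrow> 0"
      by (rule Lim_null_comparison[OF _ e2]) (use close z in auto)
    ultimately have "u z - (F z + cnj (G z)) = 0" using LIMSEQ_unique by blast
    then show ?thesis by simp
  qed
  have Ub: "U \<subseteq> ball 0 1" by (auto simp: U_def)
  have dG: "deriv G z = 0" if z: "z \<in> U" for z
  proof -
    have "(G has_field_derivative deriv G z) (at z)"
      using G(1) z Ub holomorphic_derivI[of G "ball 0 1"] by auto
    moreover have "(\<lambda>z. u z - F z) holomorphic_on U"
      by (intro holomorphic_intros hu' holomorphic_on_subset[OF F(1)] Ub)
    then have "(\<lambda>z. cnj (G z)) holomorphic_on U"
      using uFG by (subst holomorphic_cong[of U U _ "\<lambda>z. u z - F z"]) auto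
    then have "((\<lambda>w. cnj (G w)) has_field_derivative deriv (\<lambda>w. cnj (G w)) z) (at z)"
      using op z holomorphic_derivI by blast
    ultimately show ?thesis by (rule holomorphic_and_cnj_imp_deriv_0)
  qed
  have Une: "U ~= {}" using False by (auto simp: U_def)
  have dG0: "deriv G z = 0" if "z \<in> ball 0 1" for z
    using analytic_continuation_open[of U "ball 0 1" "deriv G" "\<lambda>_. 0" z] op Une Ub dG G(1) that
    by (auto intro!: holomorphic_deriv)
  have "G 0 = 0"
  proof -
    have "poly (B n) 0 = 0" for n using B00 by (simp add: poly_0_coeff_0)
    then show ?thesis using G(2)[of 0] by (simp add: LIMSEQ_const_iff)
  qed
  have "(G has_field_derivative 0) (at z within ball 0 1)" if "z \<in> ball 0 1" for z
    using dG0[OF that] holomorphic_derivI[OF G(1) open_ball that] has_field_derivative_at_within by fastforce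
  then have "G z = G 0" if "z \<in> ball 0 1" for z
    using has_field_derivative_zero_constant[of "ball 0 1" G] that by (metis centre_in_ball convex_ball zero_less_one)
  then have uF: "u z = F z" if "z \<in> U" for z
    using uFG[OF that] \<open>G 0 = 0\<close> that Ub by auto
  define Z where "Z = {z \<in> ball 0 1. F z = 0}"
  have cF: "continuous_on (ball 0 1) F" using F(1) by (rule holomorphic_on_imp_continuous_on)
  have opZ: "open (ball 0 1 - Z)"
  proof -
    have "open (ball 0 1 \<inter> F -` (- {0}))" by (intro continuous_open_preimage cF) auto
    also have "ball 0 1 \<inter> F -` (- {0}) = ball 0 1 - Z" by (auto simp: Z_def)
    finally show ?thesis .
  qed
  have conn: "connected (ball 0 1 - Z)"
  proof (cases "F constant_on ball 0 1")
    case True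
    have "Z = {}"
    proof -
      obtain c where c: "\<And>z. z \<in> ball 0 1 ==> F z = c" using True by (auto simp: constant_on_def)
      obtain z where "z \<in> U" using Une by blast
      then have "c ~= 0" using c[of z] uF[of z] by (auto simp: U_def)
      then show ?thesis using c by (auto simp: Z_def)
    qed
    then show ?thesis by simp
  next
    case False
    \<comment> \<open>Zeros of a nonconstant function on the disc are countable, and removing a
      countable set leaves a plane domain connected.\<close>
    have "countable Z" unfolding Z_def
      by (rule holomorphic_countable_zeros[OF F(1)]) (use False fsigma_unit_disc in auto)
    then show ?thesis by (intro connected_open_diff_countable) auto
  qed
  \<comment> \<open>Off \<open>Z\<close> the complement of \<open>U\<close> is the open set where
    \<open>u\<close> and \<open>F\<close> differ: on \<open>U\<close> they agree, elsewhere
    \<open>u\<close> is zero and \<open>F\<close> is not.\<close>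
  have op2: "open ((ball 0 1 - Z) - U)"
  proof -
    have "(ball 0 1 - Z) - U = (ball 0 1 - Z) \<inter> (\<lambda>z. u z - F z) -` (- {0})"
      using uF by (auto simp: U_def Z_def)
    moreover have "open ((ball 0 1 - Z) \<inter> (\<lambda>z. u z - F z) -` (- {0}))"
      by (intro continuous_open_preimage opZ continuous_intros continuous_on_subset[OF cub]
          continuous_on_subset[OF cF]) auto
    ultimately show ?thesis by simp
  qed
  have "U \<subseteq> ball 0 1 - Z" using uF by (auto simp: Z_def U_def)
  then have "(ball 0 1 - Z) - U = {}"
    using connectedD[OF conn op op2] Une by blast
  then have "u z = F z" if "z \<in> ball 0 1" for z
    using uF[of z] that by (cases "z \<in> Z") (auto simp: Z_def U_def)
  then show ?thesis using F(1) by (subst holomorphic_cong[of _ "ball 0 1" _ F]) auto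
qed

theorem rado:
  assumes "open S" "continuous_on S u" "u holomorphic_on {z \<in> S. u z ~= 0}"
  shows "u holomorphic_on S"
proof -
  have "u field_differentiable at a" if a: "a \<in> S" for a
  proof -
    obtain r where r: "r > 0" "cball a r \<subseteq> S" using open_contains_cball_eq[OF assms(1)] a by blast
    define v where "v w = u (a + of_real r * w)" for w
    have sub: "a + of_real r * w \<in> S" if "w \<in> cball 0 1" for w
    proof -
      have "r * cmod w \<le> r" using that r by (simp add: mult_left_le)
      then have "a + of_real r * w \<in> cball a r" using r by (simp add: dist_norm norm_mult)
      then show ?thesis using r by blast
    qed
    have "v holomorphic_on ball 0 1"
    proof (rule rado_unit_disc)
      show "continuous_on (cball 0 1) v" unfolding v_def
        by (rule continuous_on_compose2[OF assms(2)]) (auto intro!: continuous_intros sub)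
      have "(u \<circ> (\<lambda>w. a + of_real r * w)) holomorphic_on {w \<in> ball 0 1. v w ~= 0}"
        by (rule holomorphic_on_compose_gen[OF _ assms(3)])
           (use sub in \<open>auto simp: v_def intro!: holomorphic_intros\<close>)
      moreover have "v = u \<circ> (\<lambda>w. a + of_real r * w)" by (simp add: v_def fun_eq_iff)
      ultimately show "v holomorphic_on {w \<in> ball 0 1. v w ~= 0}" by metis
    qed
    then have "v field_differentiable at ((a - a) / of_real r)"
      by (auto intro: holomorphic_on_imp_differentiable_at)
    then have "(v \<circ> (\<lambda>z. (z - a) / of_real r)) field_differentiable at a"
      using r by (intro field_differentiable_compose) (auto intro!: derivative_intros)
    moreover have "v \<circ> (\<lambda>z. (z - a) / of_real r) = u" using r by (auto simp: v_def)
    ultimately show ?thesis by simp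
  qed
  then show ?thesis by (simp add: field_differentiable_at_within holomorphic_on_def)
qed

no_notation fps_nth (infixl "$" 75)

section \<open>Holomorphic functions of several variables\<close>

definition chol :: "(complex^'n => complex^'m) => (complex^'n => complex^'m) => complex^'n => bool" where
  "chol F L z \<longleftrightarrow> (F has_derivative L) (at z) \<and> (\<forall>c v. L (c *s v) = c *s L v)"

definition holo_map :: "(complex^'n => complex^'m) => (complex^'n) set => bool" where
  "holo_map F D \<longleftrightarrow> (\<forall>i. holo_on (\<lambda>z. F z $ i) D)"

definition pd :: "'n => (complex^'n => complex) => complex^'n => complex" where
  "pd i h z = deriv (\<lambda>u. h (z + u *s axis i 1)) 0"

lemma norm_smult_vec: "norm (c *s (v::complex^'n)) = cmod c * norm v"
  by (simp add: norm_vec_def L2_set_def norm_mult power_mult_distrib sum_distrib_left[symmetric]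
      real_sqrt_mult)

lemma dist_line: "dist w (w + c *s (e::complex^'n)) = cmod c * norm e"
  by (simp add: dist_norm norm_smult_vec)

lemma bounded_linear_smult_left: "bounded_linear (\<lambda>u. u *s (e::complex^'n))"
  by (rule bounded_linear_intro[of _ "norm e"])
     (simp_all add: vector_sadd_rdistrib norm_smult_vec vec_eq_iff scaleR_conv_of_real[symmetric])

lemma bounded_linear_smult_right: "bounded_linear (\<lambda>v::complex^'n. c *s v)"
  by (rule bounded_linear_intro[of _ "cmod c"])
     (simp_all add: vector_add_ldistrib norm_smult_vec vec_eq_iff mult.commute)

lemma continuous_smult [continuous_intros]:
  "continuous_on S f ==> continuous_on S g ==> continuous_on S (\<lambda>x. f x *s (g x :: complex^'n))"
  unfolding vector_scalar_mult_def by (intro continuous_intros)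

lemma holo_onI:
  "(\<And>z. z \<in> D ==> \<exists>L. (h has_derivative L) (at z) \<and> (\<forall>c v. L (c *s v) = c * L v)) ==> holo_on h D"
  by (simp add: holo_on_def)

lemma holo_onE:
  assumes "holo_on h D" "z \<in> D"
  obtains L where "(h has_derivative L) (at z)" "\<forall>c v. L (c *s v) = c * L v"
  using assms unfolding holo_on_def by blast

lemma holo_on_subset: "holo_on h D ==> E \<subseteq> D ==> holo_on h E"
  by (auto simp: holo_on_def)

lemma holo_on_continuous: "holo_on h D ==> continuous_on D h"
  unfolding holo_on_def
  by (meson continuous_at_imp_continuous_on has_derivative_continuous)

lemma holo_on_cong:
  assumes "open D" "\<And>z. z \<in> D ==> f z = g z" "holo_on f D"
  shows "holo_on g D"
proof (rule holo_onI)
  fix z assume z: "z \<in> D"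
  from holo_onE[OF assms(3) this]
  obtain L where L: "(f has_derivative L) (at z)" "\<forall>c v. L (c *s v) = c * L v" .
  have "(g has_derivative L) (at z)"
    by (rule has_derivative_transform_within_open[OF L(1) assms(1) z]) (use assms in auto)
  then show "\<exists>L. (g has_derivative L) (at z) \<and> (\<forall>c v. L (c *s v) = c * L v)" using L by blast
qed

lemma holo_on_local:
  assumes "\<And>z. z \<in> D ==> \<exists>E. z \<in> E \<and> holo_on h E"
  shows "holo_on h D"
  using assms by (fastforce simp: holo_on_def)

lemma holo_on_const: "holo_on (\<lambda>z. c) D"
  by (rule holo_onI) (auto intro!: exI[of _ "\<lambda>_. 0"])

lemma holo_on_coord: "holo_on (\<lambda>z. z $ i) D"
  by (rule holo_onI) (auto intro!: exI[of _ "\<lambda>v. v $ i"] bounded_linear_imp_has_derivative bounded_linear_vec_nth)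

lemma holo_on_add: assumes "holo_on f D" "holo_on g D" shows "holo_on (\<lambda>z. f z + g z) D"
proof (rule holo_onI)
  fix z assume "z \<in> D"
  then obtain L M where "(f has_derivative L) (at z)" "\<forall>c v. L (c *s v) = c * L v"
    "(g has_derivative M) (at z)" "\<forall>c v. M (c *s v) = c * M v"
    using assms unfolding holo_on_def by meson
  then show "\<exists>L. ((\<lambda>z. f z + g z) has_derivative L) (at z) \<and> (\<forall>c v. L (c *s v) = c * L v)"
    by (intro exI[of _ "\<lambda>v. L v + M v"]) (auto intro!: derivative_eq_intros simp: algebra_simps)
qed

lemma holo_on_mult: assumes "holo_on f D" "holo_on g D" shows "holo_on (\<lambda>z. f z * g z) D"
proof (rule holo_onI)
  fix z assume "z \<in> D"
  then obtain L M where "(f has_derivative L) (at z)" "\<forall>c v. L (c *s v) = c * L v"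
    "(g has_derivative M) (at z)" "\<forall>c v. M (c *s v) = c * M v"
    using assms unfolding holo_on_def by meson
  then show "\<exists>L. ((\<lambda>z. f z * g z) has_derivative L) (at z) \<and> (\<forall>c v. L (c *s v) = c * L v)"
    by (intro exI[of _ "\<lambda>v. f z * M v + L v * g z"]) (auto intro!: derivative_eq_intros simp: algebra_simps)
qed

lemma holo_on_sum: "(\<And>i. i \<in> I ==> holo_on (f i) D) ==> holo_on (\<lambda>z. \<Sum>i\<in>I. f i z) D"
  by (induction I rule: infinite_finite_induct) (auto intro: holo_on_const holo_on_add)

lemma holo_on_prod: "(\<And>i. i \<in> I ==> holo_on (f i) D) ==> holo_on (\<lambda>z. \<Prod>i\<in>I. f i z) D"
  by (induction I rule: infinite_finite_induct) (auto intro: holo_on_const holo_on_mult)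

lemma chol_components:
  fixes F :: "complex^'n => complex^'m"
  assumes "\<And>i. \<exists>L. ((\<lambda>z. F z $ i) has_derivative L) (at z) \<and> (\<forall>c v. L (c *s v) = c * L v)"
  shows "\<exists>L. chol F L z"
proof -
  obtain L where L: "\<And>i. ((\<lambda>z. F z $ i) has_derivative L i) (at z)" "\<And>i c v. L i (c *s v) = c * L i v"
    using assms by metis
  have "((\<lambda>z. \<chi> i. F z $ i) has_derivative (\<lambda>v. \<chi> i. L i v)) (at z)"
    unfolding has_derivative_componentwise_within[of "\<lambda>z. \<chi> i. F z $ i"]
  proof
    fix b :: "complex^'m" assume "b \<in> Basis"
    then obtain i c where b: "b = axis i c" "c \<in> Basis" by (auto simp: Basis_vec_def)
    have "((\<lambda>x. F x $ i \<bullet> c) has_derivative (\<lambda>x. L i x \<bullet> c)) (at z)"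
      by (intro derivative_intros L)
    then show "((\<lambda>x. (\<chi> i. F x $ i) \<bullet> b) has_derivative (\<lambda>x. (\<chi> i. L i x) \<bullet> b)) (at z)"
      unfolding b by (simp add: inner_axis)
  qed
  then show ?thesis using L(2) by (auto simp: chol_def vec_eq_iff intro!: exI[of _ "\<lambda>v. \<chi> i. L i v"])
qed

lemma chol_nth: assumes "chol F L z"
  shows "((\<lambda>z. F z $ i) has_derivative (\<lambda>v. L v $ i)) (at z) \<and> (\<forall>c v. L (c *s v) $ i = c * L v $ i)"
  using assms bounded_linear.has_derivative[OF bounded_linear_vec_nth, of F L "at z" i]
  by (simp add: chol_def)

lemma holo_map_iff: "holo_map F D \<longleftrightarrow> (\<forall>z\<in>D. \<exists>L. chol F L z)"
proof
  assume "holo_map F D" then show "\<forall>z\<in>D. \<exists>L. chol F L z"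
    unfolding holo_map_def holo_on_def using chol_components by blast
next
  assume *: "\<forall>z\<in>D. \<exists>L. chol F L z"
  show "holo_map F D" unfolding holo_map_def
  proof (intro allI holo_onI)
    fix i z assume "z \<in> D"
    with * obtain L where "chol F L z" by blast
    from chol_nth[OF this, of i]
    show "\<exists>L. ((\<lambda>z. F z $ i) has_derivative L) (at z) \<and> (\<forall>c v. L (c *s v) = c * L v)"
      by (intro exI[of _ "\<lambda>v. L v $ i"]) simp
  qed
qed

lemma chol_compose: "chol G M z ==> chol F L (G z) ==> chol (\<lambda>z. F (G z)) (\<lambda>v. L (M v)) z"
  unfolding chol_def by (auto intro: has_derivative_compose)

lemma holo_on_compose:
  assumes "holo_map G D" "holo_on h E" "G ` D \<subseteq> E" shows "holo_on (\<lambda>z. h (G z)) D"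
proof (rule holo_onI)
  fix z assume z: "z \<in> D"
  then obtain M where M: "chol G M z" using assms(1) by (auto simp: holo_map_iff)
  have "G z \<in> E" using assms z by blast
  from holo_onE[OF assms(2) this]
  obtain L where L: "(h has_derivative L) (at (G z))" "\<forall>c v. L (c *s v) = c * L v" .
  have "((\<lambda>z. h (G z)) has_derivative (\<lambda>v. L (M v))) (at z)"
    using M L(1) unfolding chol_def by (auto intro: has_derivative_compose)
  then show "\<exists>L. ((\<lambda>z. h (G z)) has_derivative L) (at z) \<and> (\<forall>c v. L (c *s v) = c * L v)"
    using M L by (auto simp: chol_def intro!: exI[of _ "\<lambda>v. L (M v)"])
qed

lemma holo_map_subset: "holo_map F D ==> E \<subseteq> D ==> holo_map F E"
  by (auto simp: holo_map_def intro: holo_on_subset)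

lemma holo_map_continuous: "holo_map F D ==> continuous_on D F"
  unfolding holo_map_iff chol_def
  by (meson continuous_at_imp_continuous_on has_derivative_continuous)

lemma holo_map_translate: "holo_map (\<lambda>z. z + a) D"
  unfolding holo_map_def by (auto intro: holo_on_add holo_on_coord holo_on_const)

section \<open>Complex lines, partial derivatives and the Jacobian\<close>

lemma has_derivative_line: "((\<lambda>u. z + u *s (e::complex^'n)) has_derivative (\<lambda>u. u *s e)) (at u0)"
proof -
  have "((\<lambda>u. u *s e) has_derivative (\<lambda>u. u *s e)) (at u0)"
    by (rule bounded_linear_imp_has_derivative[OF bounded_linear_smult_left])
  from has_derivative_add[OF has_derivative_const[of z] this] show ?thesis by simp
qed

lemma holo_on_line_deriv:
  fixes h :: "complex^'n => complex"
  assumes "(h has_derivative L) (at (z + u *s e))" "\<forall>c v. L (c *s v) = c * L v"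
  shows "((\<lambda>u. h (z + u *s e)) has_field_derivative L e) (at u)"
  unfolding has_field_derivative_def
  using has_derivative_compose[OF has_derivative_line[of z e u] assms(1)] assms(2)
  by (simp add: mult_commute_abs)

lemma holo_on_line:
  fixes h :: "complex^'n => complex"
  assumes "holo_on h D" "\<And>u. u \<in> S ==> z + u *s e \<in> D"
  shows "(\<lambda>u. h (z + u *s e)) holomorphic_on S"
  unfolding holomorphic_on_def
proof
  fix u :: complex assume "u \<in> S"
  from holo_onE[OF assms(1) assms(2)[OF this]]
  obtain L where "(h has_derivative L) (at (z + u *s e))" "\<forall>c v. L (c *s v) = c * L v" .
  from holo_on_line_deriv[OF this] show "(\<lambda>u. h (z + u *s e)) field_differentiable at u within S"
    using field_differentiable_at_within field_differentiable_def by blast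
qed

lemma pd_eq: "(h has_derivative L) (at z) ==> \<forall>c v. L (c *s v) = c * L v ==> pd i h z = L (axis i 1)"
  unfolding pd_def using holo_on_line_deriv[of h L z 0 "axis i 1"] by (auto intro: DERIV_imp_deriv)

lemma chol_matrix:
  assumes "chol F L z" shows "matrix L = (\<chi> i j. pd j (\<lambda>z. F z $ i) z)"
proof -
  have "pd j (\<lambda>z. F z $ i) z = L (axis j 1) $ i" for i j
    using pd_eq[of "\<lambda>z. F z $ i" "\<lambda>v. L v $ i" z j] chol_nth[OF assms, of i] by blast
  then show ?thesis by (simp add: matrix_def)
qed

lemma jac_eq: assumes "chol F L z" shows "jac F z = det (matrix L)"
proof -
  have "frechet_derivative F (at z) = L"
    by (rule frechet_derivative_at[symmetric, OF assms[unfolded chol_def, THEN conjunct1]])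
  then show ?thesis by (simp add: jac_def)
qed

lemma jac_eq_pd: "\<exists>L. chol F L z ==> jac F z = det (\<chi> i j. pd j (\<lambda>z. F z $ i) z)"
  using jac_eq chol_matrix by metis

lemma chol_linear: assumes "chol F L z" shows "Vector_Spaces.linear vector_scalar_mult vector_scalar_mult L"
proof -
  have lin: "linear L" and hom: "L (c *s v) = c *s L v" for c v
    using assms has_derivative_linear by (auto simp: chol_def)
  show ?thesis
  proof unfold_locales
    show "L (x + y) = L x + L y" for x y by (rule linear_add[OF lin])
    show "L (c *s x) = c *s L x" for c x by (rule hom)
  qed
qed

lemma jac_compose:
  assumes "\<exists>M. chol G M z" "\<exists>L. chol F L (G z)"
  shows "jac (\<lambda>z. F (G z)) z = jac F (G z) * jac G z"
proof -
  obtain M L where LM: "chol G M z" "chol F L (G z)" using assms by blast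
  have "jac (\<lambda>z. F (G z)) z = det (matrix (L \<circ> M))"
    using jac_eq[OF chol_compose[OF LM]] by (simp add: o_def)
  also have "... = det (matrix L ** matrix M)"
    using matrix_compose_gen[OF chol_linear[OF LM(1)] chol_linear[OF LM(2)]] by simp
  finally show ?thesis using jac_eq[OF LM(1)] jac_eq[OF LM(2)] by (simp add: det_mul)
qed

lemma jac_cong:
  assumes "open D" "z \<in> D" "\<And>w. w \<in> D ==> F w = G w"
  shows "jac F z = jac G z"
proof -
  have "(F has_derivative L) (at z) \<longleftrightarrow> (G has_derivative L) (at z)" for L
    by (intro iffI; erule has_derivative_transform_within_open[OF _ assms(1,2)]) (simp_all add: assms(3))
  then show ?thesis unfolding jac_def frechet_derivative_def by simp
qed

lemma chol_id: "chol (\<lambda>z. z) (\<lambda>v. v) z"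
  by (simp add: chol_def)

lemma jac_id: fixes z :: "complex^'n" shows "jac (\<lambda>z. z) z = 1"
proof -
  have "matrix (\<lambda>v::complex^'n. v) = mat 1" by (simp add: matrix_def mat_def axis_def vec_eq_iff)
  then show ?thesis using jac_eq[OF chol_id, of z] by simp
qed

section \<open>Osgood's lemma, uniform limits and Cauchy integrals with a parameter\<close>

lemma deriv_continuous_param:
  fixes g :: "'p::metric_space => complex => complex"
  assumes c: "continuous_on (S \<times> cball 0 r) (\<lambda>(p, u). g p u)" and r: "r > 0"
    and hol: "\<And>p. p \<in> S ==> g p holomorphic_on ball 0 r"
  shows "continuous_on S (\<lambda>p. deriv (g p) 0)"
  unfolding continuous_on_iff
proof (intro ballI allI impI)
  fix p0 e assume p0: "p0 \<in> S" and e: "(e::real) > 0"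
  \<comment> \<open>Compactness of the closed disc makes \<open>g p\<close> uniformly close to
    \<open>g p0\<close> for \<open>p\<close> near \<open>p0\<close>; Cauchy's inequality divides
    this bound \<open>e'\<close> by \<open>r\<close>.\<close>
  define e' where "e' = e * r / 2"
  have e': "e' > 0" using e r by (simp add: e'_def)
  obtain X where X: "p0 \<in> X" "open X"
    "\<forall>p\<in>X \<inter> S. \<forall>u\<in>cball 0 r. dist ((\<lambda>(p, u). g p u) (p, u)) ((\<lambda>(p, u). g p u) (p0, u)) \<le> e'"
    by (rule continuous_on_prod_compactE[OF c compact_cball p0 e'])
  obtain d where d: "d > 0" "ball p0 d \<subseteq> X" by (rule openE[OF X(2,1)])
  have cont: "continuous_on (cball 0 r) (g p)" if "p \<in> S" for p
  proof -
    have "continuous_on (cball 0 r) (\<lambda>u. (\<lambda>(p, u). g p u) (p, u))"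
      by (rule continuous_on_compose2[OF c]) (use that in \<open>auto intro!: continuous_intros\<close>)
    then show ?thesis by simp
  qed
  have "dist (deriv (g p) 0) (deriv (g p0) 0) < e" if p: "p \<in> S" "dist p p0 < d" for p
  proof -
    have pX: "p \<in> X" using d p by (auto simp: dist_commute)
    have "cmod ((deriv ^^ 1) (\<lambda>u. g p u - g p0 u) 0) \<le> fact 1 * e' / r ^ 1"
    proof (rule Cauchy_inequality)
      show "(\<lambda>u. g p u - g p0 u) holomorphic_on ball 0 r" using hol p p0 by (intro holomorphic_intros) auto
      show "continuous_on (cball 0 r) (\<lambda>u. g p u - g p0 u)" using cont p p0 by (intro continuous_intros) auto
      show "cmod (g p x - g p0 x) \<le> e'" if "cmod (0 - x) = r" for x
        using X(3) pX p that by (auto simp: dist_norm)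
    qed (use r in auto)
    moreover have "deriv (\<lambda>u. g p u - g p0 u) 0 = deriv (g p) 0 - deriv (g p0) 0"
      using hol[of p] hol[of p0] p p0 r
      by (intro deriv_diff) (auto intro: holomorphic_on_imp_differentiable_at)
    ultimately have "dist (deriv (g p) 0) (deriv (g p0) 0) \<le> e' / r" by (simp add: dist_norm)
    also have "... = e / 2" using r by (simp add: e'_def)
    finally show ?thesis using e by simp
  qed
  then show "\<exists>d>0. \<forall>p\<in>S. dist p p0 < d \<longrightarrow> dist (deriv (g p) 0) (deriv (g p0) 0) < e" using d by blast
qed

text \<open>Differentiability at the parameter 0 for every base point is enough: the point with
  parameter \<open>u\<close> serves as a new base point.\<close>

lemma line_holomorphic_of_diff_at_0:
  fixes h :: "complex^'n => complex"
  assumes "\<And>w. w \<in> D ==> (\<lambda>u. h (w + u *s e)) field_differentiable at 0"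
    and "\<And>u. u \<in> S ==> z + u *s e \<in> D"
  shows "(\<lambda>u. h (z + u *s e)) holomorphic_on S"
    and "u \<in> S ==> ((\<lambda>u. h (z + u *s e)) has_field_derivative deriv (\<lambda>\<eta>. h (z + u *s e + \<eta> *s e)) 0) (at u)"
proof -
  show *: "((\<lambda>u. h (z + u *s e)) has_field_derivative deriv (\<lambda>\<eta>. h (z + u *s e + \<eta> *s e)) 0) (at u)"
    if "u \<in> S" for u :: complex
  proof -
    have "((\<lambda>\<eta>. h (z + u *s e + \<eta> *s e)) has_field_derivative deriv (\<lambda>\<eta>. h (z + u *s e + \<eta> *s e)) 0) (at 0)"
      using assms(1)[OF assms(2)[OF that]] field_differentiable_derivI by blast
    then have "((\<lambda>\<eta>. h (z + (\<eta> + u) *s e)) has_field_derivative deriv (\<lambda>\<eta>. h (z + u *s e + \<eta> *s e)) 0) (at 0)"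
      by (simp add: vector_sadd_rdistrib add.assoc add.commute[of "_ *s _" "u *s e"])
    then show ?thesis using DERIV_shift[of "\<lambda>\<eta>. h (z + \<eta> *s e)" _ 0 u] by simp
  qed
  then show "(\<lambda>u. h (z + u *s e)) holomorphic_on S"
    unfolding holomorphic_on_def using field_differentiable_at_within field_differentiable_def by blast
qed

lemma pd_continuous_sep:
  fixes h :: "complex^'n => complex"
  assumes "open D" "continuous_on D h"
    and "\<And>w. w \<in> D ==> (\<lambda>u. h (w + u *s axis i 1)) field_differentiable at 0"
  shows "continuous_on D (pd i h)"
proof -
  have "continuous (at z) (pd i h)" if z: "z \<in> D" for z
  proof -
    obtain r0 where r0: "r0 > 0" "cball z r0 \<subseteq> D" using open_contains_cball_eq[OF assms(1)] z by blast
    define r where "r = r0 / 2"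
    have r: "r > 0" "cball z (2 * r) \<subseteq> D" using r0 by (auto simp: r_def)
    have sub: "w + u *s axis i 1 \<in> D" if "w \<in> ball z r" "u \<in> cball 0 r" for w and u :: complex
    proof -
      have "dist z (w + u *s axis i 1) \<le> dist z w + cmod u"
        using norm_triangle_ineq4[of "z - w" "u *s axis i 1"] by (simp add: dist_norm norm_smult_vec algebra_simps)
      then show ?thesis using that r by auto
    qed
    have "continuous_on (ball z r) (\<lambda>p. deriv (\<lambda>u. h (p + u *s axis i 1)) 0)"
    proof (rule deriv_continuous_param[OF _ r(1)])
      show "continuous_on (ball z r \<times> cball 0 r) (\<lambda>(p, u). h (p + u *s axis i 1))"
        unfolding split_beta by (rule continuous_on_compose2[OF assms(2)]) (use sub in \<open>auto intro!: continuous_intros\<close>)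
      show "(\<lambda>u. h (p + u *s axis i 1)) holomorphic_on ball 0 r" if "p \<in> ball z r" for p
        by (rule line_holomorphic_of_diff_at_0(1)[OF assms(3)]) (use sub that in auto)
    qed
    then show ?thesis unfolding pd_def[abs_def] using r by (simp add: continuous_on_eq_continuous_at)
  qed
  then show ?thesis by (simp add: continuous_at_imp_continuous_on)
qed

text \<open>Cauchy's inequality makes the partial derivatives continuous, and then total
  differentiability follows by changing one coordinate at a time, each change controlled by the mean
  value inequality in one complex variable.\<close>

lemma osgood:
  fixes h :: "complex^'n => complex"
  assumes "open D" "continuous_on D h"
    and sep: "\<And>w i. w \<in> D ==> (\<lambda>u. h (w + u *s axis i 1)) field_differentiable at 0"
  shows "holo_on h D"
proof (rule holo_onI)
  fix z assume z: "z \<in> D"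
  \<comment> \<open>\<open>R S v\<close> is the displacement \<open>v\<close> cut down to the
    coordinates in \<open>S\<close>; the induction adds them one by one.\<close>
  define R where "R S v = (\<chi> i. if i \<in> S then v $ i else 0)" for S :: "'n set" and v :: "complex^'n"
  have R_norm: "norm (R S v) \<le> norm v" for S v
    unfolding norm_vec_def by (intro L2_set_mono) (auto simp: R_def)
  have R_ins: "R (insert j S) v = R S v + v $ j *s axis j 1" if "j \<notin> S" for j S v
    using that by (auto simp: R_def vec_eq_iff axis_def)
  have step: "\<forall>e>0. \<exists>d>0. \<forall>v. norm v < d \<longrightarrow> norm (h (z + R S v) - h z - (\<Sum>i\<in>S. pd i h z * v $ i)) \<le> e * norm v"
    for S :: "'n set"
    using finite[of S]
  proof (induction S rule: finite_induct)
    case empty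
    have "R {} v = 0" for v by (simp add: R_def vec_eq_iff)
    then show ?case by (auto intro: exI[of _ 1])
  next
    case (insert j S)
    show ?case
    proof (intro allI impI)
      fix e :: real assume e: "e > 0"
      then obtain d1 where d1: "d1 > 0" "\<And>v. norm v < d1 ==>
          norm (h (z + R S v) - h z - (\<Sum>i\<in>S. pd i h z * v $ i)) \<le> e/2 * norm v"
        using insert(3) half_gt_zero by blast
      have "continuous_on D (pd j h)" by (rule pd_continuous_sep[OF assms])
      then have "isCont (pd j h) z" using \<open>open D\<close> z by (simp add: continuous_on_eq_continuous_at)
      then obtain d2 where d2: "d2 > 0" "\<And>w. dist w z < d2 ==> dist (pd j h w) (pd j h z) < e/2"
        using e unfolding continuous_at_eps_delta by (meson half_gt_zero)
      obtain d3 where d3: "d3 > 0" "ball z d3 \<subseteq> D" using openE[OF assms(1) z] by blast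
      \<comment> \<open>The displacement of \<open>p + u *s axis j 1\<close> from \<open>z\<close>
        may reach twice \<open>norm v\<close>, hence the halves.\<close>
      define d where "d = min d1 (min (d2/2) (d3/2))"
      have "norm (h (z + R (insert j S) v) - h z - (\<Sum>i\<in>insert j S. pd i h z * v $ i)) \<le> e * norm v"
        if v: "norm v < d" for v
      proof -
        define p where "p = z + R S v"
        \<comment> \<open>With the linear term at \<open>z\<close> subtracted, the derivative of
          \<open>\<phi>\<close> is a difference of values of \<open>pd j h\<close>, at most
          \<open>e/2\<close> by continuity.\<close>
        define \<phi> where "\<phi> u = h (p + u *s axis j 1) - pd j h z * u" for u :: complex
        have vj: "cmod (v $ j) \<le> norm v" by (rule Finite_Cartesian_Product.norm_nth_le)
        have near: "dist (p + u *s axis j 1) z < min d2 d3" if "u \<in> cball 0 (norm v)" for u :: complex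
        proof -
          have "dist (p + u *s axis j 1) z \<le> norm (R S v) + norm (u *s (axis j 1 :: complex^'n))"
            using norm_triangle_ineq[of "R S v" "u *s axis j 1"] by (simp add: dist_norm p_def algebra_simps)
          also have "... \<le> norm v + norm v" using R_norm[of S v] that by (simp add: norm_smult_vec)
          finally show ?thesis using v by (auto simp: d_def)
        qed
        have "norm (\<phi> (v $ j) - \<phi> 0) \<le> e/2 * norm (v $ j - 0)"
        proof (rule field_differentiable_bound[of "cball 0 (norm v)"])
          fix u :: complex assume u: "u \<in> cball 0 (norm v)"
          have inD: "p + \<eta> *s axis j 1 \<in> D" if "\<eta> \<in> cball 0 (norm v)" for \<eta> :: complex
            using near[OF that] d3 by (auto simp: dist_commute)
          have "((\<lambda>u. h (p + u *s axis j 1)) has_field_derivative pd j h (p + u *s axis j 1)) (at u)"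
            unfolding pd_def using line_holomorphic_of_diff_at_0(2)[OF sep inD u] .
          then have "(\<phi> has_field_derivative pd j h (p + u *s axis j 1) - pd j h z) (at u)"
            unfolding \<phi>_def by (auto intro!: derivative_eq_intros)
          then show "(\<phi> has_field_derivative pd j h (p + u *s axis j 1) - pd j h z) (at u within cball 0 (norm v))"
            by (rule has_field_derivative_at_within)
          show "norm (pd j h (p + u *s axis j 1) - pd j h z) \<le> e/2"
            using d2(2)[of "p + u *s axis j 1"] near[OF u] by (simp add: dist_norm)
        qed (use vj in auto)
        also have "... \<le> e/2 * norm v" using vj e by simp
        finally have 1: "norm (h (p + v $ j *s axis j 1) - h p - pd j h z * v $ j) \<le> e/2 * norm v"
          by (simp add: \<phi>_def algebra_simps)
        have 2: "norm (h p - h z - (\<Sum>i\<in>S. pd i h z * v $ i)) \<le> e/2 * norm v"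
          using d1(2)[of v] v by (simp add: p_def d_def)
        have "h (z + R (insert j S) v) - h z - (\<Sum>i\<in>insert j S. pd i h z * v $ i)
          = (h (p + v $ j *s axis j 1) - h p - pd j h z * v $ j) + (h p - h z - (\<Sum>i\<in>S. pd i h z * v $ i))"
          using insert(1,2) by (simp add: R_ins p_def add.assoc)
        moreover have "norm ((h (p + v $ j *s axis j 1) - h p - pd j h z * v $ j)
            + (h p - h z - (\<Sum>i\<in>S. pd i h z * v $ i))) \<le> e * norm v"
          using norm_triangle_mono[OF 1 2] by simp
        ultimately show ?thesis by metis
      qed
      moreover have "d > 0" using d1 d2 d3 by (simp add: d_def)
      ultimately show "\<exists>d>0. \<forall>v. norm v < d \<longrightarrow>
          norm (h (z + R (insert j S) v) - h z - (\<Sum>i\<in>insert j S. pd i h z * v $ i)) \<le> e * norm v" by blast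
    qed
  qed
  define L where "L v = (\<Sum>i\<in>UNIV. pd i h z * v $ i)" for v
  have "bounded_linear L" unfolding L_def
    by (intro bounded_linear_sum bounded_linear_const_mult bounded_linear_vec_nth)
  moreover have "\<exists>d>0. \<forall>y. norm (y - z) < d \<longrightarrow> norm (h y - h z - L (y - z)) \<le> e * norm (y - z)"
    if "e > 0" for e
  proof -
    have RU: "R UNIV v = v" for v by (simp add: R_def vec_eq_iff)
    obtain d where d: "d > 0" "\<And>v. norm v < d ==> norm (h (z + v) - h z - L v) \<le> e * norm v"
      using step[of UNIV] \<open>e > 0\<close> unfolding RU L_def by blast
    have "norm (h y - h z - L (y - z)) \<le> e * norm (y - z)" if "norm (y - z) < d" for y
      using d(2)[OF that] by simp
    then show ?thesis using d(1) by blast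
  qed
  ultimately have "(h has_derivative L) (at z)"
    unfolding has_derivative_at_alt by blast
  moreover have "\<forall>c v. L (c *s v) = c * L v" by (simp add: L_def sum_distrib_left mult_ac)
  ultimately show "\<exists>L. (h has_derivative L) (at z) \<and> (\<forall>c v. L (c *s v) = c * L v)" by blast
qed

lemma holo_on_sep:
  fixes h :: "complex^'n => complex"
  assumes "holo_on h D" "w \<in> D"
  shows "(\<lambda>u. h (w + u *s e)) field_differentiable at 0"
proof -
  obtain L where "(h has_derivative L) (at w)" "\<forall>c v. L (c *s v) = c * L v"
    using holo_onE[OF assms] .
  then show ?thesis using holo_on_line_deriv[of h L w 0 e] unfolding field_differentiable_def by auto
qed

text \<open>Osgood's lemma reduces this to the one-variable theorem on locally uniform limits, along
  coordinate lines.\<close>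

lemma holo_on_uniform_limit:
  fixes f :: "nat => complex^'n => complex"
  assumes D: "open D" and hol: "\<And>n. holo_on (f n) D"
    and lim: "\<And>x. x \<in> D ==> \<exists>d>0. cball x d \<subseteq> D \<and> uniform_limit (cball x d) f g sequentially"
  shows "holo_on g D"
proof (rule osgood[OF D])
  have "continuous (at x) g" if x: "x \<in> D" for x
  proof -
    obtain d where d: "d > 0" "cball x d \<subseteq> D" "uniform_limit (cball x d) f g sequentially" using lim[OF x] by blast
    have "continuous_on (cball x d) g"
      by (rule uniform_limit_theorem[OF _ d(3)])
         (auto intro!: always_eventually continuous_on_subset[OF holo_on_continuous[OF hol] d(2)])
    then show ?thesis using d(1) continuous_on_interior[of "cball x d" g x] by simp
  qed
  then show "continuous_on D g" by (simp add: continuous_at_imp_continuous_on)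
  fix w i assume w: "w \<in> D"
  obtain d where d: "d > 0" "cball w d \<subseteq> D" "uniform_limit (cball w d) f g sequentially" using lim[OF w] by blast
  have inb: "w + u *s axis i 1 \<in> cball w d" if "cmod u \<le> d" for u :: complex
    using that by (simp add: dist_norm norm_smult_vec)
  have "(\<lambda>u. g (w + u *s axis i 1)) holomorphic_on ball 0 d"
  proof (rule holomorphic_uniform_sequence)
    show "(\<lambda>u. f n (w + u *s axis i 1)) holomorphic_on ball 0 d" for n
      by (rule holo_on_line[OF hol]) (use inb d(2) in auto)
    fix x :: complex assume "x \<in> ball 0 d"
    then have "\<exists>r>0. cball x r \<subseteq> ball 0 d" using open_contains_cball[of "ball 0 d"] open_ball by blast
    then obtain r where r: "r > 0" "cball x r \<subseteq> ball 0 d" by blast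
    have "uniform_limit (cball x r) (\<lambda>n u. f n (w + u *s axis i 1)) (\<lambda>u. g (w + u *s axis i 1)) sequentially"
    proof (rule uniform_limitI)
      fix e :: real assume "e > 0"
      with d(3) have "\<forall>\<^sub>F n in sequentially. \<forall>x\<in>cball w d. dist (f n x) (g x) < e" by (rule uniform_limitD)
      then show "\<forall>\<^sub>F n in sequentially. \<forall>u\<in>cball x r. dist (f n (w + u *s axis i 1)) (g (w + u *s axis i 1)) < e"
      proof eventually_elim
        case (elim n)
        show ?case
        proof
          fix u :: complex assume "u \<in> cball x r"
          then have "u \<in> ball 0 d" using r by blast
          then show "dist (f n (w + u *s axis i 1)) (g (w + u *s axis i 1)) < e" using elim inb by auto
        qed
      qed
    qed
    then show "\<exists>r>0. cball x r \<subseteq> ball 0 d \<and>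
      uniform_limit (cball x r) (\<lambda>n u. f n (w + u *s axis i 1)) (\<lambda>u. g (w + u *s axis i 1)) sequentially"
      using r by blast
  qed auto
  then show "(\<lambda>u. g (w + u *s axis i 1)) field_differentiable at 0"
    using d(1) by (auto intro: holomorphic_on_imp_differentiable_at)
qed

lemma holo_on_integral:
  fixes G :: "complex^'n => real => complex"
  assumes D: "open D" and c: "continuous_on (D \<times> {0..1}) (\<lambda>(z, t). G z t)"
    and hol: "\<And>t. t \<in> {0..1} ==> holo_on (\<lambda>z. G z t) D"
  shows "holo_on (\<lambda>z. integral {0..1} (G z)) D"
proof (rule osgood[OF D])
  show "continuous_on D (\<lambda>z. integral {0..1} (G z))"
    using integral_continuous_on_param[of D 0 1 G] c by simp
  fix w i assume w: "w \<in> D"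
  obtain r0 where r0: "r0 > 0" "cball w r0 \<subseteq> D" using open_contains_cball_eq[OF D] w by blast
  define r where "r = r0 / 2"
  have r: "r > 0" using r0 by (simp add: r_def)
  have sub: "w + (x + \<eta>) *s axis i 1 \<in> D" if "x \<in> ball 0 r" "\<eta> \<in> cball 0 r" for x \<eta>
  proof -
    have "cmod (x + \<eta>) \<le> r0" using that norm_triangle_ineq[of x \<eta>] by (simp add: r_def)
    then have "w + (x + \<eta>) *s axis i 1 \<in> cball w r0" unfolding mem_cball dist_line by simp
    then show ?thesis using r0 by blast
  qed
  have sub0: "w + x *s axis i 1 \<in> D" if "x \<in> ball 0 r" for x using sub[OF that, of 0] r by simp
  \<comment> \<open>The derivative with respect to \<open>x\<close> is written as a derivative at 0
    of a family with parameter \<open>(x, t)\<close>, so that \<open>deriv_continuous_param\<close>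
    gives the joint continuity that the Leibniz rule asks for.\<close>
  define g where "g p \<eta> = G (w + (fst p + \<eta>) *s axis i 1) (snd p)" for p :: "complex \<times> real" and \<eta> :: complex
  have "continuous_on (ball 0 r \<times> {0..1}) (\<lambda>p. deriv (g p) 0)"
  proof (rule deriv_continuous_param[OF _ r])
    have "continuous_on ((ball 0 r \<times> {0..1}) \<times> cball 0 r) (\<lambda>q. (\<lambda>(z,t). G z t) (w + (fst (fst q) + snd q) *s axis i 1, snd (fst q)))"
      by (rule continuous_on_compose2[OF c]) (use sub in \<open>auto intro!: continuous_intros\<close>)
    then show "continuous_on ((ball 0 r \<times> {0..1}) \<times> cball 0 r) (\<lambda>(p, u). g p u)"
      by (simp add: g_def split_beta)
    fix p :: "complex \<times> real" assume p: "p \<in> ball 0 r \<times> {0..1}"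
    have "(\<lambda>\<eta>. G ((w + fst p *s axis i 1) + \<eta> *s axis i 1) (snd p)) holomorphic_on ball 0 r"
      by (rule holo_on_line[OF hol]) (use p sub in \<open>auto simp: vector_sadd_rdistrib add.assoc\<close>)
    then show "g p holomorphic_on ball 0 r" by (simp add: g_def[abs_def] vector_sadd_rdistrib add.assoc)
  qed
  then have c': "continuous_on (ball 0 r \<times> cbox 0 1) (\<lambda>(x, t). deriv (g (x, t)) 0)" by (simp add: split_beta)
  have "(\<lambda>x. integral (cbox 0 1) (G (w + x *s axis i 1))) holomorphic_on ball 0 r"
  proof (rule leibniz_rule_holomorphic[OF _ _ c'])
    fix x :: complex and t :: real assume x: "x \<in> ball 0 r" and t: "t \<in> cbox 0 1"
    have "((\<lambda>x. G (w + x *s axis i 1) t) has_field_derivative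
        deriv (\<lambda>\<eta>. G (w + x *s axis i 1 + \<eta> *s axis i 1) t) 0) (at x)"
      by (rule line_holomorphic_of_diff_at_0(2)[where D = D and S = "ball 0 r"])
         (use holo_on_sep[OF hol] t x sub0 in auto)
    then show "((\<lambda>x. G (w + x *s axis i 1) t) has_field_derivative deriv (g (x, t)) 0) (at x within ball 0 r)"
      by (simp add: g_def[abs_def] vector_sadd_rdistrib add.assoc has_field_derivative_at_within)
  next
    fix x :: complex assume x: "x \<in> ball 0 r"
    have "continuous_on {0..1} (\<lambda>t. (\<lambda>(z,t). G z t) (w + x *s axis i 1, t))"
      by (rule continuous_on_compose2[OF c]) (use sub0[OF x] in \<open>auto intro!: continuous_intros\<close>)
    then show "G (w + x *s axis i 1) integrable_on cbox 0 1" by (auto intro: integrable_continuous_real)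
  qed auto
  then show "(\<lambda>u. integral {0..1} (G (w + u *s axis i 1))) field_differentiable at 0"
    using r by (auto intro: holomorphic_on_imp_differentiable_at)
qed

text \<open>Cauchy integrals over a circle in the direction \<open>e\<close>: \<open>k = 2\<close>
  yields partial derivatives, \<open>k = 1\<close> the values in the extension theorem.\<close>

lemma holo_on_circle_integral:
  fixes h :: "complex^'n => complex"
  assumes D': "open D'" and hol: "holo_on h D" and r: "r > 0"
    and sub: "\<And>z u. z \<in> D' ==> cmod u = r ==> z + u *s e \<in> D"
  shows "holo_on (\<lambda>z. contour_integral (circlepath 0 r) (\<lambda>u. h (z + u *s e) / u ^ k)) D'"
proof -
  let ?c = "\<lambda>t. circlepath 0 r t"
  have nc: "cmod (?c t) = r" for t using r by (simp add: circlepath_def part_circlepath_def norm_mult)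
  have cc: "continuous_on S ?c" for S unfolding circlepath_def part_circlepath_def by (intro continuous_intros)
  have vd: "vector_derivative (circlepath 0 r) (at t) = 2 * pi * \<i> * r * exp (2 * of_real pi * \<i> * t)" for t
    by (simp add: vector_derivative_circlepath)
  have "holo_on (\<lambda>z. integral {0..1} (\<lambda>t. h (z + ?c t *s e) * (2 * pi * \<i> * r * exp (2 * of_real pi * \<i> * t) / ?c t ^ k))) D'"
  proof (rule holo_on_integral[OF D'])
    have "continuous_on (D' \<times> {0..1}) (\<lambda>p. h (fst p + ?c (snd p) *s e))"
      by (rule continuous_on_compose2[OF holo_on_continuous[OF hol]])
         (use sub nc in \<open>auto intro!: continuous_intros continuous_on_compose2[OF cc]\<close>)
    moreover have "?c t ~= 0" for t using nc[of t] r by auto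
    ultimately show "continuous_on (D' \<times> {0..1})
        (\<lambda>(z, t). h (z + ?c t *s e) * (2 * pi * \<i> * r * exp (2 * of_real pi * \<i> * t) / ?c t ^ k))"
      unfolding split_beta by (intro continuous_intros continuous_on_compose2[OF cc]) auto
    fix t :: real
    have "holo_on (\<lambda>z. h (z + ?c t *s e)) D'"
      by (rule holo_on_compose[OF holo_map_translate hol]) (use sub nc in auto)
    then show "holo_on (\<lambda>z. h (z + ?c t *s e) * (2 * pi * \<i> * r * exp (2 * of_real pi * \<i> * t) / ?c t ^ k)) D'"
      by (intro holo_on_mult holo_on_const)
  qed
  then show ?thesis by (simp add: contour_integral_integral vd)
qed

lemma holo_on_pd:
  fixes h :: "complex^'n => complex"
  assumes D: "open D" and hol: "holo_on h D"
  shows "holo_on (pd i h) D"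
proof (rule holo_on_local)
  fix z assume "z \<in> D"
  then obtain r0 where r0: "r0 > 0" "cball z r0 \<subseteq> D" using open_contains_cball_eq[OF D] by blast
  define r where "r = r0 / 2"
  have r: "r > 0" using r0 by (simp add: r_def)
  have sub: "w + u *s axis i 1 \<in> D" if "w \<in> ball z r" "cmod u \<le> r" for w and u :: complex
  proof -
    have "dist z (w + u *s axis i 1) \<le> dist z w + cmod u"
      using norm_triangle_ineq4[of "z - w" "u *s axis i 1"] by (simp add: dist_norm norm_smult_vec algebra_simps)
    then show ?thesis using that r0 by (auto simp: r_def)
  qed
  have "holo_on (\<lambda>w. 1 / (2 * pi * \<i>) * contour_integral (circlepath 0 r) (\<lambda>u. h (w + u *s axis i 1) / u ^ 2)) (ball z r)"
    by (intro holo_on_mult holo_on_const holo_on_circle_integral[OF open_ball hol r]) (use sub in auto)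
  moreover have "1 / (2 * pi * \<i>) * contour_integral (circlepath 0 r) (\<lambda>u. h (w + u *s axis i 1) / u ^ 2) = pd i h w"
    if w: "w \<in> ball z r" for w
  proof -
    have hl: "(\<lambda>u. h (w + u *s axis i 1)) holomorphic_on cball 0 r"
      by (rule holo_on_line[OF hol]) (use sub w in auto)
    have "contour_integral (circlepath 0 r) (\<lambda>u. h (w + u *s axis i 1) / (u - 0) ^ 2)
        = 2 * pi * \<i> * deriv (\<lambda>u. h (w + u *s axis i 1)) 0"
      by (rule Cauchy_contour_integral_circlepath_2)
         (use hl r in \<open>auto intro: holomorphic_on_imp_continuous_on holomorphic_on_subset\<close>)
    then show ?thesis by (simp add: pd_def)
  qed
  ultimately have "holo_on (pd i h) (ball z r)"
    using holo_on_cong[OF open_ball, of z r "\<lambda>w. 1 / (2 * pi * \<i>) * contour_integral (circlepath 0 r) (\<lambda>u. h (w + u *s axis i 1) / u ^ 2)" "pd i h"]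
    by simp
  then show "\<exists>E. z \<in> E \<and> holo_on (pd i h) E" using r by (auto intro!: exI[of _ "ball z r"])
qed

lemma holo_on_jac:
  fixes F :: "complex^'n => complex^'n"
  assumes D: "open D" and "holo_map F D"
  shows "holo_on (jac F) D"
proof -
  have "holo_on (\<lambda>z. det (\<chi> i j. pd j (\<lambda>z. F z $ i) z)) D"
    unfolding det_def using assms
    by (intro holo_on_sum holo_on_mult holo_on_const holo_on_prod)
       (simp add: holo_map_def holo_on_pd)
  moreover have "jac F z = det (\<chi> i j. pd j (\<lambda>z. F z $ i) z)" if "z \<in> D" for z
    using assms(2) that by (intro jac_eq_pd) (auto simp: holo_map_iff)
  ultimately show ?thesis using holo_on_cong[OF D, of "\<lambda>z. det (\<chi> i j. pd j (\<lambda>z. F z $ i) z)" "jac F"] by simp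
qed

section \<open>The change of variables formula for holomorphic maps\<close>

text \<open>\<open>T\<close> is a linear isometry between a space of real vectors, where the
  Lebesgue change of variables is applied, and an arbitrary Euclidean space; \<open>rdet\<close> is
  then the modulus of the real determinant of an endomorphism of that space.\<close>

locale coord_iso =
  fixes \<sigma> :: "'m::{finite,wellorder} => 'a::euclidean_space"
  assumes bij: "bij_betw \<sigma> UNIV Basis"
begin

definition T :: "(real, 'm) vec => 'a" where "T x = (\<Sum>k\<in>UNIV. x $ k *\<^sub>R \<sigma> k)"
definition T' :: "'a => (real, 'm) vec" where "T' y = (\<chi> k. y \<bullet> \<sigma> k)"
definition rdet :: "('a => 'a) => real" where "rdet l = \<bar>det (matrix (\<lambda>x. T' (l (T x))))\<bar>"

lemma sigma_inner: "\<sigma> j \<bullet> \<sigma> k = (if j = k then 1 else 0)"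
proof -
  have "\<sigma> j \<in> Basis" "\<sigma> k \<in> Basis" using bij by (auto simp: bij_betw_def)
  moreover have "\<sigma> j = \<sigma> k \<longleftrightarrow> j = k" using bij by (auto simp: bij_betw_def inj_on_def)
  ultimately show ?thesis by (simp add: inner_Basis)
qed

lemma T'_T [simp]: "T' (T x) = x"
proof -
  have "T x \<bullet> \<sigma> k = x $ k" for k
    unfolding T_def inner_sum_left by (simp add: sigma_inner if_distrib cong: if_cong)
  then show ?thesis by (simp add: T'_def vec_eq_iff)
qed

lemma T_T' [simp]: "T (T' y) = y"
proof -
  have "T (T' y) = (\<Sum>k\<in>UNIV. (y \<bullet> \<sigma> k) *\<^sub>R \<sigma> k)" by (simp add: T_def T'_def)
  also have "... = (\<Sum>b\<in>Basis. (y \<bullet> b) *\<^sub>R b)"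
    using sum.reindex_bij_betw[OF bij, of "\<lambda>b. (y \<bullet> b) *\<^sub>R b"] .
  finally show ?thesis by (simp add: euclidean_representation)
qed

lemma linear_T: "linear T"
  by (rule linearI) (simp_all add: T_def scaleR_add_left sum.distrib scaleR_sum_right)

lemma linear_T': "linear T'"
  by (rule linearI) (simp_all add: T'_def vec_eq_iff inner_add_left)

lemma bounded_linear_T: "bounded_linear T" using linear_T by (rule linear_conv_bounded_linear[THEN iffD1])
lemma bounded_linear_T': "bounded_linear T'" using linear_T' by (rule linear_conv_bounded_linear[THEN iffD1])

lemma T_inner: "T x \<bullet> y = x \<bullet> T' y"
  unfolding T_def T'_def inner_sum_left inner_vec_def by (simp add: inner_commute)

lemma norm_T [simp]: "norm (T x) = norm x"
  by (simp add: norm_eq_sqrt_inner T_inner)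

lemma norm_T' [simp]: "norm (T' x) = norm x"
  using norm_T[of "T' x"] by simp

lemma T_measurable [measurable]: "T \<in> borel_measurable borel"
  by (intro borel_measurable_continuous_onI linear_continuous_on bounded_linear_T)

lemma distr_T: "distr lborel borel T = lborel"
proof (rule lborel_eqI[symmetric])
  fix l u :: 'a assume le: "\<And>b. b \<in> Basis ==> l \<bullet> b \<le> u \<bullet> b"
  have sB: "\<sigma> k \<in> Basis" for k using bij by (auto simp: bij_betw_def)
  have "T -` box l u = box (T' l) (T' u)"
  proof (intro set_eqI)
    fix x
    have "T x \<in> box l u \<longleftrightarrow> (\<forall>k. l \<bullet> \<sigma> k < T x \<bullet> \<sigma> k \<and> T x \<bullet> \<sigma> k < u \<bullet> \<sigma> k)"
      using bij unfolding mem_box bij_betw_def by (metis UNIV_I imageE sB)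
    also have "... \<longleftrightarrow> x \<in> box (T' l) (T' u)"
    proof -
      have "T x \<bullet> \<sigma> k = x $ k" for k using arg_cong[OF T'_T[of x], of "\<lambda>v. v $ k"] by (simp add: T'_def)
      then show ?thesis by (simp add: mem_box_cart T'_def)
    qed
    finally show "x \<in> T -` box l u \<longleftrightarrow> x \<in> box (T' l) (T' u)" by simp
  qed
  then have "emeasure (distr lborel borel T) (box l u) = emeasure lborel (box (T' l) (T' u))"
    by (simp add: emeasure_distr)
  also have "... = (\<Prod>b\<in>Basis. (T' u - T' l) \<bullet> b)"
    by (rule emeasure_lborel_box) (use le sB in \<open>auto simp: T'_def Basis_vec_def inner_axis\<close>)
  also have "(\<Prod>b\<in>Basis. (T' u - T' l) \<bullet> b) = (\<Prod>k\<in>UNIV. (T' u - T' l) \<bullet> axis k 1)"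
  proof (rule prod.reindex_bij_betw[symmetric])
    show "bij_betw (\<lambda>k::'m. axis k (1::real)) UNIV Basis"
      by (auto simp: bij_betw_def inj_on_def axis_eq_axis Basis_vec_def)
  qed
  also have "... = (\<Prod>k\<in>UNIV. (u - l) \<bullet> \<sigma> k)" by (simp add: T'_def inner_axis inner_diff_left)
  also have "... = (\<Prod>b\<in>Basis. (u - l) \<bullet> b)"
    by (rule prod.reindex_bij_betw[OF bij])
  finally show "emeasure (distr lborel borel T) (box l u) = (\<Prod>b\<in>Basis. (u - l) \<bullet> b)" .
qed simp

text \<open>In the coordinates of \<open>T\<close>, the image has finite measure \<open>m\<close>
  exactly if the Jacobian has integral \<open>m\<close>. The two cases below transfer this to
  \<open>ennreal\<close>: either side is finite as soon as the other is.\<close>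

lemma emeasure_differentiable_image:
  assumes S: "S \<in> sets borel" and fS: "f ` S \<in> sets borel"
    and der: "\<And>x. x \<in> S ==> (f has_derivative f' x) (at x within S)"
    and inj: "inj_on f S"
    and meas: "(\<lambda>x. ennreal (rdet (f' x)) * indicator S x) \<in> borel_measurable borel"
  shows "emeasure lborel (f ` S) = (\<integral>\<^sup>+x. ennreal (rdet (f' x)) * indicator S x \<partial>lborel)"
proof -
  define g where "g x = T' (f (T x))" for x
  define S' where "S' = T -` S"
  define D where "D x = rdet (f' (T x))" for x
  have S': "S' \<in> sets borel" unfolding S'_def using measurable_sets[OF T_measurable S] by simp
  have gS': "g ` S' = T -` (f ` S)"
  proof (intro set_eqI iffI)
    fix y assume "y \<in> g ` S'" then show "y \<in> T -` (f ` S)" by (auto simp: g_def S'_def)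
  next
    fix y assume "y \<in> T -` (f ` S)"
    then obtain s where s: "s \<in> S" "T y = f s" by auto
    then have "y = T' (f s)" using T'_T[of y] by metis
    then have "y = g (T' s)" by (simp add: g_def)
    then show "y \<in> g ` S'" using s by (auto simp: S'_def)
  qed
  have gS'b: "g ` S' \<in> sets borel" unfolding gS' using measurable_sets[OF T_measurable fS] by simp
  have "(g has_derivative (\<lambda>v. T' (f' (T x) (T v)))) (at x within S')" if x: "x \<in> S'" for x
  proof -
    have 1: "(T has_derivative T) (at x within S')"
      by (rule bounded_linear_imp_has_derivative[OF bounded_linear_T])
    have "(f has_derivative f' (T x)) (at (T x) within T ` S')"
      by (rule has_derivative_subset[OF der]) (use x in \<open>auto simp: S'_def\<close>)
    from has_derivative_in_compose[OF 1 this]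
    have "((\<lambda>x. f (T x)) has_derivative (\<lambda>v. f' (T x) (T v))) (at x within S')" .
    from bounded_linear.has_derivative[OF bounded_linear_T' this]
    show ?thesis by (simp add: g_def[abs_def])
  qed
  moreover have "inj_on g S'"
  proof (rule inj_onI)
    fix x y assume *: "x \<in> S'" "y \<in> S'" "g x = g y"
    then have "f (T x) = f (T y)" using *(3) by (metis g_def T_T')
    then have "T x = T y" using inj * by (auto simp: S'_def inj_on_def)
    then show "x = y" using T'_T by metis
  qed
  ultimately have key: "g ` S' \<in> lmeasurable \<and> measure lebesgue (g ` S') = m \<longleftrightarrow> (D has_integral m) S'" for m
    using has_measure_differentiable_image[of S' g "\<lambda>x v. T' (f' (T x) (T v))" m] S'
    unfolding D_def rdet_def by auto
  have e1: "emeasure lborel (f ` S) = emeasure lborel (g ` S')"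
    using fS by (subst distr_T[symmetric]) (simp add: emeasure_distr gS')
  have "(\<integral>\<^sup>+x. ennreal (rdet (f' x)) * indicator S x \<partial>lborel)
      = (\<integral>\<^sup>+x. ennreal (rdet (f' x)) * indicator S x \<partial>distr lborel borel T)"
    by (simp add: distr_T)
  also have "... = (\<integral>\<^sup>+x. ennreal (rdet (f' (T x))) * indicator S (T x) \<partial>lborel)"
    by (rule nn_integral_distr) (use meas in simp_all)
  also have "... = (\<integral>\<^sup>+x. ennreal (D x) * indicator S' x \<partial>lborel)"
    by (intro nn_integral_cong) (simp add: D_def S'_def indicator_def)
  finally have e2: "(\<integral>\<^sup>+x. ennreal (rdet (f' x)) * indicator S x \<partial>lborel) = (\<integral>\<^sup>+x. ennreal (D x) * indicator S' x \<partial>lborel)" .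
  have Dnn: "D x \<ge> 0" for x by (simp add: D_def rdet_def)
  have "emeasure lborel (g ` S') = (\<integral>\<^sup>+x. ennreal (D x) * indicator S' x \<partial>lborel)"
  proof (cases "emeasure lborel (g ` S') < \<infinity>")
    case True
    then have lm: "g ` S' \<in> lmeasurable" using gS'b by (auto simp: fmeasurable_def)
    then have "(D has_integral measure lebesgue (g ` S')) S'" using key by blast
    from nn_integral_has_integral_lebesgue'[OF Dnn this]
    have "(\<integral>\<^sup>+x. ennreal (D x) * indicator S' x \<partial>lborel) = ennreal (measure lebesgue (g ` S'))" .
    moreover have "emeasure lebesgue (g ` S') = ennreal (measure lebesgue (g ` S'))"
      using lm by (simp add: emeasure_eq_measure2)
    moreover have "emeasure lebesgue (g ` S') = emeasure lborel (g ` S')"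
      using gS'b by simp
    ultimately show ?thesis by simp
  next
    case False
    have "\<not> (\<integral>\<^sup>+x. ennreal (D x) * indicator S' x \<partial>lborel) < \<infinity>"
    proof
      assume fin: "(\<integral>\<^sup>+x. ennreal (D x) * indicator S' x \<partial>lborel) < \<infinity>"
      define r where "r = enn2real (\<integral>\<^sup>+x. ennreal (D x) * indicator S' x \<partial>lborel)"
      have eq: "(\<lambda>x. ennreal (D x * indicator S' x)) = (\<lambda>x. ennreal (D x) * indicator S' x)"
        by (auto simp: indicator_def)
      have bm: "(\<lambda>x. ennreal (D x * indicator S' x)) \<in> borel_measurable borel"
      proof -
        have "(\<lambda>x. ennreal (rdet (f' (T x))) * indicator S (T x)) \<in> borel_measurable borel"
          using measurable_compose[OF T_measurable meas] .
        moreover have "(\<lambda>x. ennreal (rdet (f' (T x))) * indicator S (T x)) = (\<lambda>x. ennreal (D x * indicator S' x))"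
          by (auto simp: D_def S'_def indicator_def)
        ultimately show ?thesis by simp
      qed
      have "(\<lambda>x. D x * indicator S' x) \<in> borel_measurable borel"
      proof -
        have "(\<lambda>x. enn2real (ennreal (D x * indicator S' x))) \<in> borel_measurable borel"
          by (rule measurable_compose[OF bm]) simp
        moreover have "enn2real (ennreal (D x * indicator S' x)) = D x * indicator S' x" for x
          using Dnn by (simp add: indicator_def)
        ultimately show ?thesis by simp
      qed
      moreover have "(\<integral>\<^sup>+x. ennreal (D x * indicator S' x) \<partial>lborel) = ennreal r"
        using fin by (simp add: r_def eq)
      ultimately have "((\<lambda>x. D x * indicator S' x) has_integral r) UNIV"
        using Dnn by (intro nn_integral_has_integral) (auto simp: r_def)
      moreover have "(\<lambda>x. D x * indicator S' x) = (\<lambda>x. if x \<in> S' then D x else 0)" by (auto simp: indicator_def)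
      ultimately have "(D has_integral r) S'" by (simp add: has_integral_restrict_UNIV)
      then have "g ` S' \<in> lmeasurable" using key by blast
      then have "emeasure lebesgue (g ` S') ~= \<infinity>" using fmeasurableD2 by fastforce
      moreover have "emeasure lebesgue (g ` S') = emeasure lborel (g ` S')" using gS'b by simp
      ultimately show False using False by (simp add: less_top)
    qed
    then show ?thesis using False by (metis infinity_ennreal_def top.not_eq_extremum)
  qed
  then show ?thesis using e1 e2 by simp
qed

lemma rdet_isometry:
  assumes "linear l" "\<And>x. norm (l x) = norm x"
  shows "rdet l = 1"
proof -
  have "linear (\<lambda>x. T' (l (T x)))"
    using linear_compose[OF linear_compose[OF linear_T assms(1)] linear_T'] by (simp add: o_def)
  then have "orthogonal_transformation (\<lambda>x. T' (l (T x)))"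
    unfolding orthogonal_transformation by (simp add: assms)
  then show ?thesis unfolding rdet_def by (rule orthogonal_transformation_det)
qed

lemma distr_isometry:
  fixes l :: "'a => 'a"
  assumes "linear l" "\<And>x. norm (l x) = norm x"
  shows "distr lborel borel l = lborel"
proof (rule measure_eqI)
  have inj: "inj l" using assms
    by (metis (no_types, opaque_lifting) linear_injective_0 norm_eq_zero)
  then have surj: "surj l" using assms(1) linear_injective_imp_surjective by blast
  have bl: "bounded_linear l" using assms(1) by (rule linear_conv_bounded_linear[THEN iffD1])
  have m: "l \<in> borel_measurable borel"
    by (intro borel_measurable_continuous_onI linear_continuous_on bl)
  fix E assume "E \<in> sets (distr lborel borel l)"
  then have E: "E \<in> sets borel" by simp
  have lE: "l -` E \<in> sets borel" using measurable_sets[OF m E] by simp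
  have im: "l ` (l -` E) = E" using surj by auto
  have "emeasure lborel (l ` (l -` E)) = (\<integral>\<^sup>+x. ennreal (rdet l) * indicator (l -` E) x \<partial>lborel)"
    by (rule emeasure_differentiable_image)
       (use lE E im inj bl in \<open>auto intro: bounded_linear_imp_has_derivative inj_on_subset\<close>)
  also have "... = emeasure lborel (l -` E)" using lE by (simp add: rdet_isometry[OF assms])
  finally show "emeasure (distr lborel borel l) E = emeasure lborel E"
    using E m unfolding im by (simp add: emeasure_distr)
qed simp

lemma rdet_compose:
  assumes "linear l" "linear k"
  shows "rdet (\<lambda>x. l (k x)) = rdet l * rdet k"
proof -
  have 1: "linear (\<lambda>x. T' (l (T x)))" "linear (\<lambda>x. T' (k (T x)))"
    using linear_compose[OF linear_compose[OF linear_T assms(1)] linear_T']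
      linear_compose[OF linear_compose[OF linear_T assms(2)] linear_T'] by (simp_all add: o_def)
  have "(\<lambda>x. T' (l (k (T x)))) = (\<lambda>x. T' (l (T x))) \<circ> (\<lambda>x. T' (k (T x)))" by (simp add: o_def)
  then show ?thesis unfolding rdet_def using matrix_compose[OF 1(2) 1(1)] by (simp add: det_mul abs_mult)
qed

lemma rdet_eq_0_iff:
  assumes "linear l" shows "rdet l = 0 \<longleftrightarrow> \<not> inj l"
proof -
  have 1: "linear (\<lambda>x. T' (l (T x)))"
    using linear_compose[OF linear_compose[OF linear_T assms(1)] linear_T'] by (simp add: o_def)
  have "inj (\<lambda>x. T' (l (T x))) \<longleftrightarrow> inj l" unfolding inj_def by (metis T'_T T_T')
  then show ?thesis using det_nz_iff_inj[OF 1] by (auto simp: rdet_def)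
qed

end

section \<open>The real determinant of a complex linear map\<close>

definition shear :: "'n => ('n => complex) => complex^'n^'n" where
  "shear i r = (\<chi> a b. (if a = b then 1 else 0) + (if a = i then r b else 0))"

definition dilation :: "'n => complex => complex^'n^'n" where
  "dilation i c = (\<chi> a b. if a = b then (if a = i then c else 1) else 0)"

lemma shear_mult: "(shear i r ** A) $ a $ b = A $ a $ b + (if a = i then (\<Sum>k\<in>UNIV. r k * A $ k $ b) else 0)"
  by (simp add: shear_def matrix_matrix_mult_def distrib_right sum.distrib if_distrib[of "\<lambda>x. x * _"] cong: if_cong)

lemma mult_shear: "(A ** shear i r) $ a $ b = A $ a $ b + A $ a $ i * r b"
  by (simp add: shear_def matrix_matrix_mult_def distrib_left sum.distrib if_distrib[of "\<lambda>x. _ * x"] cong: if_cong)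

lemma dilation_mult: "(dilation i c ** A) $ a $ b = (if a = i then c else 1) * A $ a $ b"
  by (simp add: dilation_def matrix_matrix_mult_def if_distrib[of "\<lambda>x. x * _"] cong: if_cong)

lemma mult_dilation: "(A ** dilation i c) $ a $ b = A $ a $ b * (if b = i then c else 1)"
  by (simp add: dilation_def matrix_matrix_mult_def if_distrib[of "\<lambda>x. _ * x"] cong: if_cong)

text \<open>Rows other than \<open>i\<close> are untouched, and \<open>r i = 0\<close> keeps row
  \<open>i\<close> from being fed back into itself; so composition adds the coefficient
  functions.\<close>

lemma shear_add: assumes "r i = 0" shows "shear i r ** shear i s = shear i (\<lambda>b. r b + s b)"
  using assms by (simp add: vec_eq_iff mult_shear) (simp add: shear_def)

lemma shear_0: "shear i (\<lambda>b. 0) = mat 1"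
  by (simp add: shear_def mat_def vec_eq_iff)

lemma shear_inverse: "r i = 0 ==> shear i (\<lambda>b. - r b) ** shear i r = mat 1"
  "r i = 0 ==> shear i r ** shear i (\<lambda>b. - r b) = mat 1"
  using shear_add[of "\<lambda>b. - r b" i r] shear_add[of r i "\<lambda>b. - r b"] by (simp_all add: shear_0)

lemma dilation_dilation: "dilation i c ** dilation i d = dilation i (c * d)"
  by (simp add: vec_eq_iff dilation_mult) (simp add: dilation_def)

lemma dilation_1: "dilation i 1 = mat 1"
  by (simp add: dilation_def mat_def vec_eq_iff)

text \<open>A shear is conjugate to its own square, by a dilation.\<close>

lemma multiplicative_shear:
  fixes \<mu> :: "complex^'n^'n => 'b::field"
  assumes mult: "\<And>A B. \<mu> (A ** B) = \<mu> A * \<mu> B" and one: "\<mu> (mat 1) = 1" and r: "r i = 0"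
  shows "\<mu> (shear i r) = 1"
proof -
  have "dilation i 2 ** shear i r ** dilation i (1/2) = shear i r ** shear i r"
    unfolding shear_add[of r i r, OF r] vec_eq_iff mult_dilation dilation_mult
    using r by (auto simp: shear_def)
  then have "\<mu> (dilation i 2) * \<mu> (shear i r) * \<mu> (dilation i (1/2)) = \<mu> (shear i r) * \<mu> (shear i r)"
    by (metis mult)
  moreover have "\<mu> (dilation i 2) * \<mu> (dilation i (1/2)) = 1"
    unfolding mult[symmetric] dilation_dilation by (simp add: dilation_1 one)
  ultimately have "\<mu> (shear i r) * 1 = \<mu> (shear i r) * \<mu> (shear i r)"
    by (metis mult.commute mult.left_commute)
  moreover have "\<mu> (shear i r) ~= 0"
    using mult[of "shear i (\<lambda>b. - r b)" "shear i r"] shear_inverse(1)[of r i, OF r] one by auto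
  ultimately show ?thesis by (metis mult_left_cancel)
qed

lemma det_shear: "r i = 0 ==> det (shear i r) = 1"
  by (rule multiplicative_shear[of det]) (simp_all add: det_mul)

lemma det_dilation: "det (dilation i c) = c"
proof -
  have "det (dilation i c) = (\<Prod>a\<in>UNIV. dilation i c $ a $ a)"
    by (rule det_diagonal) (simp add: dilation_def)
  also have "... = c" by (simp add: dilation_def)
  finally show ?thesis .
qed

text \<open>Gauss elimination, with \<open>S\<close> the set of rows that already agree with the
  identity. A nonzero pivot is scaled to 1 and the rest of its row is cleared from the right; a zero
  pivot is first repaired by adding a row \<open>k\<close> with a nonzero entry in column
  \<open>i\<close>.\<close>

lemma complex_matrix_elementary_induct:
  fixes P :: "complex^'n^'n => bool"
  assumes one: "P (mat 1)" and mult: "\<And>A B. P A ==> P B ==> P (A ** B)"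
    and sh: "\<And>i r. r i = 0 ==> P (shear i r)" and dil: "\<And>i c. c ~= 0 ==> P (dilation i c)"
    and A: "det A ~= 0"
  shows "P A"
proof -
  have main: "det A ~= 0 ==> (\<And>s b. s \<in> S ==> A $ s $ b = (if s = b then 1 else 0)) ==> card (- S) = n ==> P A"
    for n S and A :: "complex^'n^'n"
  proof (induction n arbitrary: S A)
    case 0
    then have "S = UNIV" by (simp add: card_eq_0_iff Compl_eq_Diff_UNIV) blast
    then have "A = mat 1" using 0 by (simp add: vec_eq_iff mat_def)
    then show ?case using one by simp
  next
    case (Suc n)
    then obtain i where i: "i \<notin> S" by (metis Compl_iff card.empty ex_in_conv nat.distinct(1))
    have pivot: "P A" if A: "det A ~= 0" "\<And>s b. s \<in> S ==> A $ s $ b = (if s = b then 1 else 0)"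
      and nz: "A $ i $ i ~= 0" for A :: "complex^'n^'n"
    proof -
      define B where "B = dilation i (1 / A $ i $ i) ** A"
      define r where "r b = (if b = i then 0 else - B $ i $ b)" for b
      define C where "C = B ** shear i r"
      have ri: "r i = 0" by (simp add: r_def)
      have Bii: "B $ i $ i = 1" using nz by (simp add: B_def dilation_mult)
      have Bs: "B $ s $ b = (if s = b then 1 else 0)" if "s \<in> S" for s b
        using that i A(2) by (auto simp: B_def dilation_mult)
      have "P C"
      proof (rule Suc.IH[of _ "insert i S"])
        show "det C ~= 0" using A(1) nz by (simp add: C_def B_def det_mul det_shear[of r i, OF ri] det_dilation)
        show "C $ s $ b = (if s = b then 1 else 0)" if "s \<in> insert i S" for s b
        proof (cases "s = i")
          case True then show ?thesis using Bii by (auto simp: C_def mult_shear r_def)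
        next
          case False then show ?thesis using that i Bs by (auto simp: C_def mult_shear)
        qed
        have "- insert i S = - S - {i}" by auto
        then show "card (- insert i S) = n" using Suc.prems(3) i by simp
      qed
      moreover have "C ** shear i (\<lambda>b. - r b) = B"
        unfolding C_def matrix_mul_assoc[symmetric] shear_inverse(2)[of r i, OF ri] by simp
      ultimately have "P B" using mult sh[of "\<lambda>b. - r b" i] ri by (metis neg_equal_0_iff_equal)
      moreover have "dilation i (A $ i $ i) ** B = A"
        unfolding B_def matrix_mul_assoc dilation_dilation using nz by (simp add: dilation_1)
      ultimately show "P A" using mult dil[OF nz, of i] by metis
    qed
    show ?case
    proof (cases "A $ i $ i = 0")
      case False then show ?thesis using pivot[of A] Suc.prems by blast
    next
      case True
      obtain k where k: "A $ k $ i ~= 0"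
      proof (rule ccontr)
        assume "\<not> thesis"
        then have "\<And>k. A $ k $ i = 0" using that by blast
        then have "column i A = 0" by (simp add: column_def vec_eq_iff)
        then have "row i (transpose A) = 0" by (simp add: row_transpose)
        then have "det (transpose A) = 0" by (rule det_zero_row(2))
        then show False using Suc.prems(1) by (simp add: det_transpose)
      qed
      have "k ~= i" using k True by auto
      define r where "r b = (if b = k then 1 else (0::complex))" for b
      have ri: "r i = 0" using \<open>k ~= i\<close> by (simp add: r_def)
      have "P (shear i r ** A)"
      proof (rule pivot)
        show "det (shear i r ** A) ~= 0" using Suc.prems(1) by (simp add: det_mul det_shear[of r i, OF ri])
        show "(shear i r ** A) $ s $ b = (if s = b then 1 else 0)" if "s \<in> S" for s b
          using that i Suc.prems(2)[of s b] by (auto simp: shear_mult)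
        show "(shear i r ** A) $ i $ i ~= 0"
          using True k by (simp add: shear_mult r_def if_distrib[of "\<lambda>x. x * _"] cong: if_cong)
      qed
      then have "P (shear i (\<lambda>b. - r b) ** (shear i r ** A))" using mult sh[of "\<lambda>b. - r b" i] ri by simp
      then show ?thesis unfolding matrix_mul_assoc shear_inverse(1)[of r i, OF ri] by simp
    qed
  qed
  show ?thesis by (rule main[of A "{}"]) (use A in auto)
qed

lemma linear_complex_matrix_vector: "linear (\<lambda>x. (A::complex^'n^'n) *v x)"
proof (rule linearI)
  fix c :: real and x :: "complex^'n"
  have "A *v (of_real c *s x) = of_real c *s (A *v x)" by (rule vector_scalar_commute)
  moreover have "of_real c *s y = c *\<^sub>R y" for y :: "complex^'n" by (auto simp: vec_eq_iff complex_eq_iff)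
  ultimately show "A *v (c *\<^sub>R x) = c *\<^sub>R (A *v x)" by simp
qed (simp add: matrix_vector_right_distrib)

lemma coord_iso_complex_vec: "\<exists>\<sigma> :: ('n::finite) bit0 => complex^'n. coord_iso \<sigma>"
proof -
  have "card (UNIV :: 'n bit0 set) = card (Basis :: (complex^'n) set)" by simp
  then show ?thesis unfolding coord_iso_def by (intro finite_same_card_bij) auto
qed

lemma coord_iso_complex: "\<exists>\<sigma> :: 2 => complex. coord_iso \<sigma>"
proof -
  have "card (UNIV :: 2 set) = card (Basis :: complex set)" by simp
  then show ?thesis unfolding coord_iso_def by (intro finite_same_card_bij) auto
qed

text \<open>Both sides are multiplicative in \<open>A\<close>, so shears and dilations decide.
  Shears count 1 on both sides; a dilation factors into one by a unit scalar, which is an isometry,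
  and a positive one, which scales two real directions. For singular \<open>A\<close> both sides are
  0.\<close>

lemma rdet_complex_linear:
  fixes \<sigma> :: "('m::{finite,wellorder}) => complex^'n"
  assumes "coord_iso \<sigma>"
  shows "coord_iso.rdet \<sigma> (\<lambda>x. A *v x) = (cmod (det A))^2"
proof -
  interpret coord_iso \<sigma> by fact
  define \<delta> where "\<delta> A = rdet (\<lambda>x. A *v x)" for A :: "complex^'n^'n"
  have mult: "\<delta> (A ** B) = \<delta> A * \<delta> B" for A B
    unfolding \<delta>_def using rdet_compose[OF linear_complex_matrix_vector linear_complex_matrix_vector, of A B]
    by (simp add: matrix_vector_mul_assoc)
  have iso: "\<delta> A = 1" if "\<And>x. norm (A *v x) = norm x" for A
    unfolding \<delta>_def by (rule rdet_isometry[OF linear_complex_matrix_vector that])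
  have one: "\<delta> (mat 1) = 1" by (rule iso) simp
  have dv: "dilation i c *v x = (\<chi> a. (if a = i then c else 1) * x $ a)" for i c x
    by (simp add: dilation_def matrix_vector_mult_def if_distrib[of "\<lambda>x. x * _"] vec_eq_iff cong: if_cong)
  have unit: "\<delta> (dilation i c) = 1" if "cmod c = 1" for i c
  proof (rule iso)
    fix x :: "complex^'n"
    show "norm (dilation i c *v x) = norm x"
      unfolding dv norm_vec_def by (rule L2_set_cong) (use that in \<open>auto simp: norm_mult\<close>)
  qed
  have pos: "\<delta> (dilation i (of_real c)) = c^2" if "c > 0" for i c
  proof -
    \<comment> \<open>A positive dilation stretches exactly the real basis vectors
      \<open>axis i 1\<close> and \<open>axis i \<i>\<close>, which gives the square of
      \<open>c\<close>.\<close>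
    define d where "d b = (if b \<in> {axis i 1, axis i \<i>} then c else 1)" for b :: "complex^'n"
    have dil: "dilation i (of_real c) *v b = d b *\<^sub>R b" if b: "b \<in> Basis" for b
    proof -
      obtain j e where je: "b = axis j e" "e \<in> {1, \<i>}" using b by (auto simp: Basis_vec_def Basis_complex_def)
      show ?thesis
      proof (cases "j = i")
        case True
        then have "d b = c" using je by (auto simp: d_def)
        then show ?thesis using True je(1) unfolding \<open>d b = c\<close> by (auto simp: dv vec_eq_iff axis_def complex_eq_iff)
      next
        case False
        then have "d b = 1" using je by (auto simp: d_def axis_eq_axis)
        then show ?thesis using False je(1) unfolding \<open>d b = 1\<close> by (auto simp: dv vec_eq_iff axis_def)
      qed
    qed
    have sB: "\<sigma> k \<in> Basis" for k using bij by (auto simp: bij_betw_def)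
    have Tax: "T (axis k 1) = \<sigma> k" for k by (simp add: T_def axis_def if_distrib[of "\<lambda>x. x *\<^sub>R _"] cong: if_cong)
    have entry: "matrix (\<lambda>x. T' (dilation i (of_real c) *v T x)) $ a $ k = (if a = k then d (\<sigma> k) else 0)" for a k
      by (simp add: matrix_def Tax dil[OF sB] T'_def sigma_inner)
    have "det (matrix (\<lambda>x. T' (dilation i (of_real c) *v T x))) = (\<Prod>k\<in>UNIV. d (\<sigma> k))"
      using det_diagonal[of "matrix (\<lambda>x. T' (dilation i (of_real c) *v T x))"] by (simp add: entry)
    also have "... = (\<Prod>b\<in>Basis. d b)" by (rule prod.reindex_bij_betw[OF bij])
    also have "... = (\<Prod>b\<in>{axis i 1, axis i \<i>}. d b)"
      by (rule prod.mono_neutral_right) (auto simp: d_def Basis_vec_def Basis_complex_def)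
    also have "... = c^2" by (simp add: d_def axis_eq_axis power2_eq_square)
    finally show ?thesis by (simp add: \<delta>_def rdet_def)
  qed
  have dil: "\<delta> (dilation i c) = (cmod c)^2" if c: "c ~= 0" for i c
  proof -
    have "c = of_real (cmod c) * sgn c" using c by (simp add: sgn_div_norm scaleR_conv_of_real)
    then have "dilation i c = dilation i (of_real (cmod c)) ** dilation i (sgn c)"
      using dilation_dilation by metis
    then show ?thesis using mult pos[of "cmod c" i] unit[of "sgn c" i] c by (simp add: norm_sgn)
  qed
  show ?thesis
  proof (cases "det A = 0")
    case False
    have "\<delta> A = (cmod (det A))^2"
    proof (rule complex_matrix_elementary_induct[where P = "\<lambda>A. \<delta> A = (cmod (det A))^2", OF _ _ _ _ False])
      show "\<delta> (mat 1) = (cmod (det (mat 1 :: complex^'n^'n)))^2" using one by simp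
      show "\<delta> (shear i r) = (cmod (det (shear i r)))^2" if "r i = 0" for i and r :: "'n => complex"
        using multiplicative_shear[of \<delta> r i, OF mult one that] det_shear[of r i, OF that] by simp
    qed (simp_all add: mult det_mul norm_mult power_mult_distrib dil det_dilation)
    then show ?thesis by (simp add: \<delta>_def)
  next
    case True
    then have "\<not> invertible A" by (simp add: invertible_det_nz)
    then have "\<not> inj (\<lambda>x. A *v x)"
      using matrix_left_invertible_injective[of A] invertible_left_inverse[of A] by auto
    then have "rdet (\<lambda>x. A *v x) = 0" using rdet_eq_0_iff[OF linear_complex_matrix_vector] by blast
    then show ?thesis using True by simp
  qed
qed

section \<open>Volume and substitution under holomorphic maps\<close>

lemma chol_matrix_works: assumes "chol F L z" shows "L = (\<lambda>v. matrix L *v v)"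
  by (rule ext) (rule matrix_works[OF chol_linear[OF assms], symmetric])

theorem emeasure_holomorphic_image:
  fixes F :: "complex^'n => complex^'n"
  assumes A: "open A" and F: "holo_map F A" and inj: "inj_on F A"
    and S: "S \<subseteq> A" "S \<in> sets borel" "F ` S \<in> sets borel"
  shows "emeasure lborel (F ` S) = (\<integral>\<^sup>+z\<in>S. ennreal ((cmod (jac F z))^2) \<partial>lborel)"
proof -
  obtain \<sigma> :: "'n bit0 => complex^'n" where \<sigma>: "coord_iso \<sigma>" using coord_iso_complex_vec by blast
  interpret coord_iso \<sigma> by fact
  obtain L where L: "\<And>z. z \<in> A ==> chol F (L z) z" using F by (metis holo_map_iff)
  have eq: "ennreal (rdet (L z)) * indicator S z = ennreal ((cmod (jac F z))^2) * indicator S z" for z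
  proof (cases "z \<in> S")
    case True
    then have c: "chol F (L z) z" using L S by blast
    have "rdet (L z) = (cmod (jac F z))^2"
      using rdet_complex_linear[OF \<sigma>, of "matrix (L z)"] chol_matrix_works[OF c] jac_eq[OF c] by simp
    then show ?thesis by simp
  qed simp
  have cj: "continuous_on A (jac F)" using holo_on_continuous[OF holo_on_jac[OF A F]] .
  have "(\<lambda>z. ennreal ((cmod (jac F z))^2) * indicator S z) \<in> borel_measurable borel"
  proof -
    have "(\<lambda>z. indicator S z *\<^sub>R (cmod (jac F z))^2) \<in> borel_measurable borel"
      by (rule borel_measurable_continuous_on_indicator[OF S(2)])
         (intro continuous_intros continuous_on_subset[OF cj S(1)])
    then have "(\<lambda>z. ennreal (indicator S z *\<^sub>R (cmod (jac F z))^2)) \<in> borel_measurable borel" by measurable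
    moreover have "(\<lambda>z. ennreal (indicator S z *\<^sub>R (cmod (jac F z))^2)) = (\<lambda>z. ennreal ((cmod (jac F z))^2) * indicator S z)"
      by (auto simp: indicator_def)
    ultimately show ?thesis by (rule back_subst[where P = "\<lambda>f. f \<in> borel_measurable borel"])
  qed
  then have "emeasure lborel (F ` S) = (\<integral>\<^sup>+z. ennreal (rdet (L z)) * indicator S z \<partial>lborel)"
    by (intro emeasure_differentiable_image S inj_on_subset[OF inj])
       (use L S in \<open>auto simp: eq chol_def intro: has_derivative_at_withinI\<close>)
  then show ?thesis by (simp add: eq)
qed

text \<open>The volume formula for all Borel subsets of \<open>S\<close> says that two measures on
  the target coincide; integrating \<open>g\<close> against both gives the claim. The continuous
  inverse \<open>G\<close> ensures that images of Borel sets are Borel.\<close>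

theorem nn_integral_holomorphic_substitution:
  fixes F G :: "complex^'n => complex^'n"
  assumes A: "open A" and F: "holo_map F A" and B: "open B" and FA: "F ` A = B"
    and G: "\<And>z. z \<in> A ==> G (F z) = z" "continuous_on B G"
    and S: "S \<subseteq> A" "S \<in> sets borel" and g: "g \<in> borel_measurable borel"
  shows "(\<integral>\<^sup>+w\<in>F ` S. g w \<partial>lborel) = (\<integral>\<^sup>+z\<in>S. g (F z) * ennreal ((cmod (jac F z))^2) \<partial>lborel)"
proof -
  have inj: "inj_on F A" using G(1) by (metis inj_on_inverseI)
  have cF: "continuous_on A F" by (rule holo_map_continuous[OF F])
  have image_borel: "F ` E \<in> sets borel" if E: "E \<subseteq> A" "E \<in> sets borel" for E
  proof -
    have "F ` E = B \<inter> G -` E" using FA G(1) E by force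
    moreover have "B \<inter> G -` E \<in> sets borel"
    proof -
      have "(\<lambda>w. indicator B w *\<^sub>R G w) \<in> borel_measurable borel"
        by (rule borel_measurable_continuous_on_indicator) (use B G in auto)
      from measurable_sets[OF this E(2)] have "(\<lambda>w. indicator B w *\<^sub>R G w) -` E \<in> sets borel" by simp
      moreover have "B \<inter> G -` E = B \<inter> (\<lambda>w. indicator B w *\<^sub>R G w) -` E" by auto
      ultimately show ?thesis using B by auto
    qed
    ultimately show ?thesis by simp
  qed
  define J where "J z = ennreal ((cmod (jac F z))^2) * indicator S z" for z
  have cj: "continuous_on A (jac F)" using holo_on_continuous[OF holo_on_jac[OF A F]] .
  have Jm: "J \<in> borel_measurable borel"
  proof -
    have "(\<lambda>z. indicator S z *\<^sub>R (cmod (jac F z))^2) \<in> borel_measurable borel"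
      by (rule borel_measurable_continuous_on_indicator[OF S(2)])
         (intro continuous_intros continuous_on_subset[OF cj S(1)])
    then have "(\<lambda>z. ennreal (indicator S z *\<^sub>R (cmod (jac F z))^2)) \<in> borel_measurable borel" by measurable
    moreover have "(\<lambda>z. ennreal (indicator S z *\<^sub>R (cmod (jac F z))^2)) = J"
      by (auto simp: J_def indicator_def)
    ultimately show ?thesis by (rule back_subst[where P = "\<lambda>f. f \<in> borel_measurable borel"])
  qed
  \<comment> \<open>Extended by 0 outside \<open>S\<close> to be measurable on the whole space; the
    density \<open>J\<close> vanishes there.\<close>
  define F' where "F' z = indicator S z *\<^sub>R F z" for z
  have F'm: "F' \<in> borel_measurable borel" unfolding F'_def
    by (rule borel_measurable_continuous_on_indicator[OF S(2) continuous_on_subset[OF cF S(1)]])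
  have FS: "F ` S \<in> sets borel" by (rule image_borel[OF S])
  have meq: "distr (density lborel J) borel F' = density lborel (indicator (F ` S))"
  proof (rule measure_eqI)
    fix E assume "E \<in> sets (distr (density lborel J) borel F')"
    then have E: "E \<in> sets borel" by simp
    define R where "R = S \<inter> F' -` E"
    have Rb: "R \<in> sets borel" unfolding R_def using S(2) measurable_sets[OF F'm E] by auto
    have FR: "F ` R = F ` S \<inter> E" by (auto simp: R_def F'_def)
    have "emeasure (distr (density lborel J) borel F') E = emeasure (density lborel J) (F' -` E)"
      using E F'm by (subst emeasure_distr) auto
    also have "... = (\<integral>\<^sup>+z. J z * indicator (F' -` E) z \<partial>lborel)"
      using Jm measurable_sets[OF F'm E] by (subst emeasure_density) auto
    also have "... = (\<integral>\<^sup>+z\<in>R. ennreal ((cmod (jac F z))^2) \<partial>lborel)"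
      by (intro nn_integral_cong) (auto simp: J_def R_def indicator_def)
    also have "... = emeasure lborel (F ` R)"
    proof (rule emeasure_holomorphic_image[OF A F inj, symmetric])
      show "R \<subseteq> A" using S(1) by (auto simp: R_def)
      then show "F ` R \<in> sets borel" using image_borel Rb by blast
    qed (rule Rb)
    also have "... = emeasure (density lborel (indicator (F ` S))) E"
      using FS E unfolding FR by (subst emeasure_density) (auto simp: indicator_inter_arith[symmetric])
    finally show "emeasure (distr (density lborel J) borel F') E = emeasure (density lborel (indicator (F ` S))) E" .
  qed simp
  have "(\<integral>\<^sup>+w\<in>F ` S. g w \<partial>lborel) = (\<integral>\<^sup>+w. g w \<partial>density lborel (indicator (F ` S)))"
    using FS g by (subst nn_integral_density) (auto simp: mult.commute)
  also have "... = (\<integral>\<^sup>+w. g w \<partial>distr (density lborel J) borel F')" by (simp add: meq)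
  also have "... = (\<integral>\<^sup>+z. g (F' z) \<partial>density lborel J)"
    using F'm g by (subst nn_integral_distr) auto
  also have "... = (\<integral>\<^sup>+z. J z * g (F' z) \<partial>lborel)"
    using F'm g Jm by (subst nn_integral_density) auto
  also have "... = (\<integral>\<^sup>+z\<in>S. g (F z) * ennreal ((cmod (jac F z))^2) \<partial>lborel)"
    by (intro nn_integral_cong) (auto simp: J_def F'_def indicator_def mult.commute)
  finally show ?thesis .
qed

section \<open>Square integrable holomorphic functions\<close>

lemma nn_integral_lborel_translate:
  fixes g :: "'a::euclidean_space => ennreal"
  assumes "g \<in> borel_measurable borel"
  shows "(\<integral>\<^sup>+v. g (z + v) \<partial>lborel) = (\<integral>\<^sup>+v. g v \<partial>lborel)"
proof -
  have "(\<integral>\<^sup>+v. g v \<partial>lborel) = (\<integral>\<^sup>+v. g v \<partial>distr lborel borel ((+) z))" by (simp add: lborel_distr_plus)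
  also have "... = (\<integral>\<^sup>+v. g (z + v) \<partial>lborel)" by (rule nn_integral_distr) (use assms in auto)
  finally show ?thesis by simp
qed

lemma borel_measurable_indicator_ennreal:
  fixes f :: "'a::euclidean_space => complex"
  assumes "S \<in> sets borel" "continuous_on S f"
  shows "(\<lambda>z. ennreal ((cmod (f z))^2) * indicator S z) \<in> borel_measurable borel"
proof -
  have "(\<lambda>z. indicator S z *\<^sub>R (cmod (f z))^2) \<in> borel_measurable borel"
    by (rule borel_measurable_continuous_on_indicator[OF assms(1)]) (intro continuous_intros assms(2))
  then have "(\<lambda>z. ennreal (indicator S z *\<^sub>R (cmod (f z))^2)) \<in> borel_measurable borel" by measurable
  moreover have "(\<lambda>z. ennreal (indicator S z *\<^sub>R (cmod (f z))^2)) = (\<lambda>z. ennreal ((cmod (f z))^2) * indicator S z)"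
    by (auto simp: indicator_def)
  ultimately show ?thesis by (rule back_subst[where P = "\<lambda>f. f \<in> borel_measurable borel"])
qed

lemma open_null_empty:
  fixes S :: "'a::euclidean_space set"
  assumes "open S" "emeasure lborel S = 0" shows "S = {}"
proof (rule ccontr)
  assume "S ~= {}"
  then have "\<not> negligible S" using assms(1) open_not_negligible by blast
  moreover have "S \<in> null_sets lborel" using assms by (auto simp: null_sets_def)
  then have "S \<in> null_sets lebesgue" by (rule null_sets_completionI)
  then have "negligible S" by (simp add: negligible_iff_null_sets)
  ultimately show False by blast
qed

text \<open>Cauchy's formula for the holomorphic function \<open>\<phi>^2\<close> on the unit
  circle, followed by the triangle inequality for integrals.\<close>

lemma circle_square_mean:
  assumes "\<phi> holomorphic_on ball 0 R" "R > 1"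
  shows "ennreal ((cmod (\<phi> 0))^2) \<le> (\<integral>\<^sup>+t\<in>{0..1::real}. ennreal ((cmod (\<phi> (exp (2 * of_real pi * \<i> * of_real t))))^2) \<partial>lborel)"
proof -
  define c where "c t = exp (2 * of_real pi * \<i> * of_real t)" for t :: real
  have nc: "cmod (c t) = 1" for t unfolding c_def by (simp add: norm_exp_eq_Re)
  have cont: "continuous_on S c" for S unfolding c_def by (intro continuous_intros)
  have cphi: "continuous_on {0..1} (\<lambda>t. \<phi> (c t))"
    by (rule continuous_on_compose2[OF holomorphic_on_imp_continuous_on[OF assms(1)] cont]) (use nc assms(2) in auto)
  have hol: "(\<lambda>y. (\<phi> y)^2) holomorphic_on cball 0 1"
    by (intro holomorphic_intros holomorphic_on_subset[OF assms(1)]) (use assms(2) in auto)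
  have "((\<lambda>u. (\<phi> u)^2 / (u - 0)) has_contour_integral 2 * of_real pi * \<i> * (\<phi> 0)^2) (circlepath 0 1)"
    by (rule Cauchy_integral_circlepath)
       (use hol in \<open>auto intro: holomorphic_on_imp_continuous_on holomorphic_on_subset\<close>)
  then have "contour_integral (circlepath 0 1) (\<lambda>u. (\<phi> u)^2 / (u - 0)) = 2 * of_real pi * \<i> * (\<phi> 0)^2"
    by (rule contour_integral_unique)
  moreover have "circlepath 0 1 t = c t" for t
    by (simp add: circlepath c_def)
  ultimately have "integral {0..1} (\<lambda>t. 2 * pi * \<i> * (\<phi> (c t))^2) = 2 * pi * \<i> * (\<phi> 0)^2"
    unfolding contour_integral_integral vector_derivative_circlepath by (simp add: c_def mult_ac)
  then have I: "integral {0..1} (\<lambda>t. (\<phi> (c t))^2) = (\<phi> 0)^2" by simp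
  have ci: "(\<lambda>t. (cmod (\<phi> (c t)))^2) integrable_on {0..1}"
    by (intro integrable_continuous_real continuous_intros cphi)
  have "cmod (integral {0..1} (\<lambda>t. (\<phi> (c t))^2)) \<le> integral {0..1} (\<lambda>t. (cmod (\<phi> (c t)))^2)"
    by (rule integral_norm_bound_integral)
       (auto intro!: ci integrable_continuous_real continuous_intros cphi simp: norm_power)
  then have le: "(cmod (\<phi> 0))^2 \<le> integral {0..1} (\<lambda>t. (cmod (\<phi> (c t)))^2)" unfolding I by (simp add: norm_power)
  have "(\<integral>\<^sup>+t. ennreal ((cmod (\<phi> (c t)))^2) * indicator {0..1} t \<partial>lborel) = ennreal (integral {0..1} (\<lambda>t. (cmod (\<phi> (c t)))^2))"
    by (rule nn_integral_has_integral_lebesgue') (use ci in auto)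
  then show ?thesis using le by (simp add: c_def ennreal_leI)
qed

text \<open>Rotations preserve volume and the ball, so the integral over the ball equals its average
  over all rotations; Tonelli moves the average inside, where \<open>mean\<close> applies orbit by
  orbit.\<close>

lemma point_bound_by_rotation:
  fixes h :: "'a::euclidean_space => complex" and rot :: "real => 'a => 'a"
  assumes lin: "\<And>t. distr lborel borel (rot t) = lborel" and nrm: "\<And>t v. norm (rot t v) = norm v"
    and cont: "continuous_on UNIV (\<lambda>p. rot (fst p) (snd p))"
    and ch: "continuous_on (ball 0 r) h"
    and mean: "\<And>v. v \<in> ball 0 r ==> ennreal ((cmod (h 0))^2) \<le> (\<integral>\<^sup>+t\<in>{0..1}. ennreal ((cmod (h (rot t v)))^2) \<partial>lborel)"
  shows "ennreal ((cmod (h 0))^2) * emeasure lborel (ball (0::'a) r) \<le> (\<integral>\<^sup>+v\<in>ball 0 r. ennreal ((cmod (h v))^2) \<partial>lborel)"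
proof -
  define g where "g v = ennreal ((cmod (h v))^2) * indicator (ball 0 r) v" for v
  have g: "g \<in> borel_measurable borel"
    unfolding g_def by (rule borel_measurable_indicator_ennreal[OF _ ch]) auto
  have rm: "(\<lambda>p. rot (fst p) (snd p)) \<in> borel_measurable (borel \<Otimes>\<^sub>M borel)"
    unfolding borel_prod by (rule borel_measurable_continuous_onI[OF cont])
  have rt: "rot t \<in> borel_measurable borel" for t
  proof (rule borel_measurable_continuous_onI)
    have "continuous_on UNIV (\<lambda>v. rot (fst (t, v)) (snd (t, v)))"
      by (rule continuous_on_compose2[OF cont]) (auto intro!: continuous_intros)
    then show "continuous_on UNIV (rot t)" by simp
  qed
  have "(\<lambda>p. indicator {0..1} (fst p) * g (rot (fst p) (snd p))) \<in> borel_measurable (borel \<Otimes>\<^sub>M borel)"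
    using measurable_compose[OF rm g] by measurable
  then have m: "(\<lambda>p. indicator {0..1} (fst p) * g (rot (fst p) (snd p))) \<in> borel_measurable (lborel \<Otimes>\<^sub>M lborel)"
    by (simp cong: measurable_cong_sets)
  have "(\<integral>\<^sup>+v. g v \<partial>lborel) = (\<integral>\<^sup>+t. indicator {0..1::real} t * (\<integral>\<^sup>+v. g v \<partial>lborel) \<partial>lborel)"
    by (simp add: nn_integral_multc)
  also have "... = (\<integral>\<^sup>+t. indicator {0..1::real} t * (\<integral>\<^sup>+v. g (rot t v) \<partial>lborel) \<partial>lborel)"
  proof (intro nn_integral_cong)
    fix t :: real
    have "(\<integral>\<^sup>+v. g v \<partial>lborel) = (\<integral>\<^sup>+v. g v \<partial>distr lborel borel (rot t))" by (simp add: lin)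
    also have "... = (\<integral>\<^sup>+v. g (rot t v) \<partial>lborel)" by (rule nn_integral_distr) (use g rt in auto)
    finally show "indicator {0..1::real} t * (\<integral>\<^sup>+v. g v \<partial>lborel) = indicator {0..1} t * (\<integral>\<^sup>+v. g (rot t v) \<partial>lborel)"
      by simp
  qed
  also have "... = (\<integral>\<^sup>+t. (\<integral>\<^sup>+v. indicator {0..1::real} t * g (rot t v) \<partial>lborel) \<partial>lborel)"
    by (intro nn_integral_cong nn_integral_cmult[symmetric]) (use measurable_compose[OF rt g] in auto)
  also have "... = (\<integral>\<^sup>+v. (\<integral>\<^sup>+t. indicator {0..1::real} t * g (rot t v) \<partial>lborel) \<partial>lborel)"
    using pair_sigma_finite.Fubini'[OF pair_sigma_finite.intro[OF sigma_finite_lborel sigma_finite_lborel],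
        of "\<lambda>t v. indicator {0..1::real} t * g (rot t v)"] m by (simp add: split_beta)
  finally have eq: "(\<integral>\<^sup>+v. g v \<partial>lborel) = (\<integral>\<^sup>+v. (\<integral>\<^sup>+t. indicator {0..1::real} t * g (rot t v) \<partial>lborel) \<partial>lborel)" .
  have "(\<integral>\<^sup>+v. ennreal ((cmod (h 0))^2) * indicator (ball (0::'a) r) v \<partial>lborel) \<le> (\<integral>\<^sup>+v. g v \<partial>lborel)"
    unfolding eq
  proof (rule nn_integral_mono)
    fix v :: 'a
    show "ennreal ((cmod (h 0))^2) * indicator (ball 0 r) v \<le> (\<integral>\<^sup>+t. indicator {0..1::real} t * g (rot t v) \<partial>lborel)"
    proof (cases "v \<in> ball 0 r")
      case True
      then have "g (rot t v) = ennreal ((cmod (h (rot t v)))^2)" for t by (simp add: g_def nrm)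
      then show ?thesis using mean[OF True] True by (simp add: mult.commute)
    qed simp
  qed
  then show ?thesis unfolding g_def by (simp add: nn_integral_cmult_indicator)
qed

lemma distr_rotation_complex:
  assumes "cmod c = 1" shows "distr lborel borel (\<lambda>v::complex. c * v) = lborel"
proof -
  obtain \<sigma> :: "2 => complex" where \<sigma>: "coord_iso \<sigma>" using coord_iso_complex by blast
  interpret coord_iso \<sigma> by fact
  show ?thesis by (rule distr_isometry) (use assms in \<open>auto intro!: linearI simp: norm_mult algebra_simps\<close>)
qed

lemma distr_rotation_complex_vec:
  assumes "cmod c = 1" shows "distr lborel borel (\<lambda>v::complex^'n. c *s v) = lborel"
proof -
  obtain \<sigma> :: "'n bit0 => complex^'n" where \<sigma>: "coord_iso \<sigma>" using coord_iso_complex_vec by blast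
  interpret coord_iso \<sigma> by fact
  show ?thesis
    by (rule distr_isometry) (use assms in \<open>auto simp: norm_smult_vec intro: bounded_linear.linear[OF bounded_linear_smult_right]\<close>)
qed

lemma L2_point_bound_1:
  fixes f :: "complex => complex"
  assumes hol: "f holomorphic_on ball z r" and r: "r > 0"
  shows "ennreal ((cmod (f z))^2) * emeasure lborel (ball (0::complex) r) \<le> (\<integral>\<^sup>+v\<in>ball z r. ennreal ((cmod (f v))^2) \<partial>lborel)"
proof -
  define h where "h v = f (z + v)" for v
  have hh: "h holomorphic_on ball 0 r"
  proof -
    have "(f \<circ> (\<lambda>v. z + v)) holomorphic_on ball 0 r"
      by (rule holomorphic_on_compose_gen[OF _ hol]) (auto intro!: holomorphic_intros simp: dist_norm)
    then show ?thesis by (simp add: h_def[abs_def] o_def)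
  qed
  have nc: "cmod (exp (2 * of_real pi * \<i> * of_real t)) = 1" for t :: real by (simp add: norm_exp_eq_Re)
  have "ennreal ((cmod (h 0))^2) * emeasure lborel (ball (0::complex) r) \<le> (\<integral>\<^sup>+v\<in>ball 0 r. ennreal ((cmod (h v))^2) \<partial>lborel)"
  proof (rule point_bound_by_rotation[where rot = "\<lambda>t v. exp (2 * of_real pi * \<i> * of_real t) * v"])
    fix v :: complex assume v: "v \<in> ball 0 r"
    \<comment> \<open>The slice through \<open>v\<close> extends beyond the unit circle, up to
      \<open>r / cmod v > 1\<close>; for \<open>v = 0\<close> it is constant and any radius above 1
      will do.\<close>
    define R where "R = (if v = 0 then 2 else r / cmod v)"
    have "(h \<circ> (\<lambda>y. y * v)) holomorphic_on ball 0 R"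
      by (rule holomorphic_on_compose_gen[OF _ hh])
         (use r v in \<open>auto intro!: holomorphic_intros simp: R_def norm_mult field_simps split: if_splits\<close>)
    moreover have "R > 1" using v r by (auto simp: R_def)
    ultimately show "ennreal ((cmod (h 0))^2) \<le> (\<integral>\<^sup>+t\<in>{0..1}. ennreal ((cmod (h (exp (2 * of_real pi * \<i> * of_real t) * v)))^2) \<partial>lborel)"
      using circle_square_mean[of "h \<circ> (\<lambda>y. y * v)" R] by simp
  qed (use distr_rotation_complex nc hh in \<open>auto simp: norm_mult intro!: continuous_intros holomorphic_on_imp_continuous_on\<close>)
  also have "... = (\<integral>\<^sup>+v. (\<lambda>w. ennreal ((cmod (f w))^2) * indicator (ball z r) w) (z + v) \<partial>lborel)"
    by (intro nn_integral_cong) (auto simp: h_def indicator_def dist_norm)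
  also have "... = (\<integral>\<^sup>+w. ennreal ((cmod (f w))^2) * indicator (ball z r) w \<partial>lborel)"
    by (intro nn_integral_lborel_translate borel_measurable_indicator_ennreal holomorphic_on_imp_continuous_on[OF hol]) auto
  finally show ?thesis by (simp add: h_def)
qed

lemma L2_point_bound:
  fixes f :: "complex^'n => complex"
  assumes hol: "holo_on f (ball z r)" and r: "r > 0"
  shows "ennreal ((cmod (f z))^2) * emeasure lborel (ball (0::complex^'n) r) \<le> (\<integral>\<^sup>+v\<in>ball z r. ennreal ((cmod (f v))^2) \<partial>lborel)"
proof -
  define h where "h v = f (v + z)" for v
  have hh: "holo_on h (ball 0 r)" unfolding h_def[abs_def]
    by (rule holo_on_compose[OF holo_map_translate hol]) (auto simp: dist_norm)
  have nc: "cmod (exp (2 * of_real pi * \<i> * of_real t)) = 1" for t :: real by (simp add: norm_exp_eq_Re)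
  have "ennreal ((cmod (h 0))^2) * emeasure lborel (ball (0::complex^'n) r) \<le> (\<integral>\<^sup>+v\<in>ball 0 r. ennreal ((cmod (h v))^2) \<partial>lborel)"
  proof (rule point_bound_by_rotation[where rot = "\<lambda>t v. exp (2 * of_real pi * \<i> * of_real t) *s v"])
    fix v :: "complex^'n" assume v: "v \<in> ball 0 r"
    define R where "R = (if v = 0 then 2 else r / norm v)"
    have "(\<lambda>y. h (0 + y *s v)) holomorphic_on ball 0 R"
      by (rule holo_on_line[OF hh])
         (use r v in \<open>auto simp: R_def norm_smult_vec field_simps split: if_splits\<close>)
    moreover have "R > 1" using v r by (auto simp: R_def)
    ultimately show "ennreal ((cmod (h 0))^2) \<le> (\<integral>\<^sup>+t\<in>{0..1}. ennreal ((cmod (h (exp (2 * of_real pi * \<i> * of_real t) *s v)))^2) \<partial>lborel)"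
      using circle_square_mean[of "\<lambda>y. h (0 + y *s v)" R] by simp
  qed (use distr_rotation_complex_vec[OF nc] hh in \<open>auto simp: norm_smult_vec intro!: continuous_intros holo_on_continuous\<close>)
  also have "... = (\<integral>\<^sup>+v. (\<lambda>w. ennreal ((cmod (f w))^2) * indicator (ball z r) w) (z + v) \<partial>lborel)"
    by (intro nn_integral_cong) (auto simp: h_def indicator_def dist_norm add.commute)
  also have "... = (\<integral>\<^sup>+w. ennreal ((cmod (f w))^2) * indicator (ball z r) w \<partial>lborel)"
    by (intro nn_integral_lborel_translate borel_measurable_indicator_ennreal holo_on_continuous[OF hol]) auto
  finally show ?thesis by (simp add: h_def)
qed

text \<open>The ball about \<open>z\<close> of radius \<open>s = dist z a\<close> misses
  \<open>a\<close>, so the mean value bound on it gives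
  \<open>(cmod (\<phi> z))^2 * c * s^2 \<le> N\<close>, where \<open>N\<close> is the mass near
  \<open>a\<close>. This mass tends to 0, hence \<open>(z - a) * \<phi> z\<close> does, and the
  singularity is removable.\<close>

lemma L2_removable_singularity:
  fixes \<phi> :: "complex => complex"
  assumes S: "open S" "a \<in> S" and hol: "\<phi> holomorphic_on S - {a}"
    and fin: "(\<integral>\<^sup>+y\<in>S - {a}. ennreal ((cmod (\<phi> y))^2) \<partial>lborel) < \<infinity>"
  obtains g where "g holomorphic_on S" "\<And>z. z \<in> S - {a} ==> g z = \<phi> z"
proof -
  obtain R where R: "R > 0" "ball a R \<subseteq> S" using openE[OF S] by blast
  define w where "w y = ennreal ((cmod (\<phi> y))^2) * indicator (S - {a}) y" for y
  have wm: "w \<in> borel_measurable borel" unfolding w_def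
    by (rule borel_measurable_indicator_ennreal[OF _ holomorphic_on_imp_continuous_on[OF hol]]) (use S in auto)
  define N where "N \<rho> = emeasure (density lborel w) (ball a \<rho>)" for \<rho>
  have N: "N \<rho> = (\<integral>\<^sup>+y. w y * indicator (ball a \<rho>) y \<partial>lborel)" for \<rho>
    unfolding N_def using wm by (subst emeasure_density) auto
  have "(\<lambda>n. emeasure (density lborel w) (ball a (1 / real (Suc n)))) \<longlonglongrightarrow> emeasure (density lborel w) (\<Inter>n. ball a (1 / real (Suc n)))"
  proof (rule Lim_emeasure_decseq)
    show "decseq (\<lambda>n. ball a (1 / real (Suc n)))"
      by (rule decseq_SucI) (intro subset_ball, simp add: frac_le)
    show "emeasure (density lborel w) (ball a (1 / real (Suc n))) ~= \<infinity>" for n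
    proof -
      have "N (1 / real (Suc n)) \<le> (\<integral>\<^sup>+y. w y \<partial>lborel)" unfolding N
        by (intro nn_integral_mono) (auto simp: indicator_def)
      also have "... < \<infinity>" using fin by (simp add: w_def)
      finally show ?thesis by (simp add: N_def)
    qed
  qed auto
  moreover have "(\<Inter>n. ball a (1 / real (Suc n))) = {a}"
  proof (intro equalityI subsetI)
    fix x assume x: "x \<in> (\<Inter>n. ball a (1 / real (Suc n)))"
    show "x \<in> {a}"
    proof (rule ccontr)
      assume "x \<notin> {a}"
      then obtain n where "1 / real (Suc n) < dist a x" using nat_approx_posE[of "dist a x"] by auto
      then show False using x by (auto simp: not_less dest!: spec[of _ n])
    qed
  qed auto
  moreover have "emeasure (density lborel w) {a} = 0"
  proof -
    have "w x * indicator {a} x = 0" for x by (simp add: w_def indicator_def)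
    then show ?thesis using wm by (subst emeasure_density) auto
  qed
  ultimately have N0: "(\<lambda>n. N (1 / real (Suc n))) \<longlonglongrightarrow> 0" by (simp add: N_def)
  define c where "c = unit_ball_vol (real DIM(complex))"
  have c: "c > 0" by (simp add: c_def unit_ball_vol_pos)
  have "((\<lambda>z. (z - a) * \<phi> z) \<longlongrightarrow> 0) (at a)"
  proof (rule tendstoI)
    fix e :: real assume e: "e > 0"
    have "\<forall>\<^sub>F n in sequentially. N (1 / real (Suc n)) < ennreal (c * e^2)"
      by (rule order_tendstoD(2)[OF N0]) (use c e in simp)
    then obtain n where n: "N (1 / real (Suc n)) < ennreal (c * e^2)"
      using eventually_happens sequentially_bot by blast
    \<comment> \<open>The ball about \<open>z\<close> of radius \<open>dist z a\<close> reaches up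
      to twice that distance from \<open>a\<close>, hence half of both radii.\<close>
    define \<rho> where "\<rho> = min R (1 / real (Suc n)) / 2"
    have \<rho>: "\<rho> > 0" using R by (simp add: \<rho>_def)
    have "dist ((z - a) * \<phi> z) 0 < e" if z: "z ~= a" "dist z a < \<rho>" for z
    proof -
      define s where "s = dist z a"
      have s: "s > 0" using z by (simp add: s_def)
      have bsub: "ball z s \<subseteq> S - {a}"
      proof
        fix x assume x: "x \<in> ball z s"
        have "dist a x \<le> dist a z + dist z x" by (rule dist_triangle)
        also have "... < 2 * s" using x by (simp add: s_def dist_commute)
        also have "... \<le> R" using z by (simp add: s_def \<rho>_def)
        finally have "x \<in> S" using R by auto
        moreover have "x ~= a" using x by (auto simp: s_def)
        ultimately show "x \<in> S - {a}" by blast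
      qed
      have "ennreal ((cmod (\<phi> z))^2) * emeasure lborel (ball (0::complex) s) \<le> (\<integral>\<^sup>+v\<in>ball z s. ennreal ((cmod (\<phi> v))^2) \<partial>lborel)"
        by (rule L2_point_bound_1[OF holomorphic_on_subset[OF hol bsub] s])
      also have "... \<le> N (1 / real (Suc n))" unfolding N
      proof (intro nn_integral_mono)
        fix x
        have "x \<in> ball a (1 / real (Suc n))" if x: "x \<in> ball z s"
        proof -
          have "dist a x \<le> dist a z + dist z x" by (rule dist_triangle)
          also have "... < 2 * s" using x by (simp add: s_def dist_commute)
          also have "... \<le> 1 / real (Suc n)" using z by (simp add: s_def \<rho>_def)
          finally show ?thesis by simp
        qed
        then show "ennreal ((cmod (\<phi> x))^2) * indicator (ball z s) x \<le> w x * indicator (ball a (1 / real (Suc n))) x"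
          using bsub by (auto simp: indicator_def w_def)
      qed
      finally have "ennreal ((cmod (\<phi> z))^2) * emeasure lborel (ball (0::complex) s) < ennreal (c * e^2)"
        using n by (rule le_less_trans)
      moreover have "emeasure lborel (ball (0::complex) s) = ennreal (c * s ^ 2)"
        using s by (subst emeasure_ball) (auto simp: c_def)
      ultimately have "ennreal ((cmod (\<phi> z))^2 * (c * s ^ 2)) < ennreal (c * e^2)"
        using c by (simp add: ennreal_mult')
      then have "(cmod (\<phi> z))^2 * (c * s ^ 2) < c * e^2"
        using c by (subst (asm) ennreal_less_iff) auto
      then have "c * (cmod (\<phi> z) * s)^2 < c * e^2" by (simp add: power_mult_distrib mult_ac)
      then have "(cmod (\<phi> z) * s)^2 < e^2" using c by simp
      then have "cmod (\<phi> z) * s < e" by (rule power2_less_imp_less) (use e in simp)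
      then show ?thesis by (simp add: norm_mult s_def dist_norm mult.commute)
    qed
    then show "\<forall>\<^sub>F z in at a. dist ((z - a) * \<phi> z) 0 < e" using \<rho> by (auto simp: eventually_at)
  qed
  then have "\<exists>g. g holomorphic_on S \<and> (\<forall>z\<in>S - {a}. g z = \<phi> z)"
    using holomorphic_on_extend_lim[OF hol] S by (simp add: interior_open)
  then show ?thesis using that by blast
qed

lemma L2_removable_finite:
  fixes \<phi> :: "complex => complex"
  assumes "finite K" "open S" "\<phi> holomorphic_on S - K"
    and "(\<integral>\<^sup>+y\<in>S - K. ennreal ((cmod (\<phi> y))^2) \<partial>lborel) < \<infinity>"
  shows "\<exists>g. g holomorphic_on S \<and> (\<forall>z\<in>S - K. g z = \<phi> z)"
  using assms
proof (induction K arbitrary: \<phi> rule: finite_induct)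
  case empty then show ?case by auto
next
  case (insert a K)
  show ?case
  proof (cases "a \<in> S")
    case False
    then have "S - insert a K = S - K" by auto
    then show ?thesis using insert by metis
  next
    case True
    have eq: "S - insert a K = S - K - {a}" by auto
    have op: "open (S - K)" using insert by (intro open_Diff finite_imp_closed) auto
    have aS: "a \<in> S - K" using True insert by auto
    obtain g where g: "g holomorphic_on S - K" "\<And>z. z \<in> S - K - {a} ==> g z = \<phi> z"
      using L2_removable_singularity[OF op aS, of \<phi>] insert.prems unfolding eq by blast
    have "(\<integral>\<^sup>+y\<in>S - K. ennreal ((cmod (g y))^2) \<partial>lborel) = (\<integral>\<^sup>+y\<in>S - insert a K. ennreal ((cmod (\<phi> y))^2) \<partial>lborel)"
    proof (rule nn_integral_cong_AE)
      have "AE y in lborel. y ~= a" by (rule AE_lborel_singleton)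
      then show "AE y in lborel. ennreal ((cmod (g y))^2) * indicator (S - K) y = ennreal ((cmod (\<phi> y))^2) * indicator (S - insert a K) y"
        by eventually_elim (use g(2) in \<open>auto simp: indicator_def\<close>)
    qed
    then have "(\<integral>\<^sup>+y\<in>S - K. ennreal ((cmod (g y))^2) \<partial>lborel) < \<infinity>" using insert.prems by simp
    from insert.IH[OF insert.prems(1) g(1) this]
    obtain k where k: "k holomorphic_on S" "\<forall>z\<in>S - K. k z = g z" by blast
    then show ?thesis using g(2) by (intro exI[of _ k]) auto
  qed
qed

section \<open>Thin analytic sets and extension across them\<close>

lemma thin_set_direction:
  fixes g :: "complex^'n => complex"
  assumes g: "holo_on g (ball p R)" and R: "R > 0" and nz: "q \<in> ball p R" "g q ~= 0"
  obtains e r \<delta> where "norm e = 1" "0 < r" "r < R / 2" "0 < \<delta>" "\<delta> < R / 4"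
    "\<And>z y. z \<in> ball p \<delta> ==> cmod y = r ==> g (z + y *s e) ~= 0"
proof -
  \<comment> \<open>The direction from \<open>p\<close> to \<open>q\<close>: on this line
    \<open>g\<close> does not vanish identically. For \<open>q = p\<close> any unit vector
    qualifies.\<close>
  define e where "e = (if q = p then axis undefined 1 else of_real (1 / norm (q - p)) *s (q - p))"
  have e: "norm e = 1"
  proof (cases "q = p")
    case False
    then have "norm e = cmod (of_real (1 / norm (q - p))) * norm (q - p)"
      unfolding e_def by (simp only: norm_smult_vec if_False)
    then show ?thesis using False by (simp add: norm_divide)
  qed (simp add: e_def)
  define f where "f y = g (p + y *s e)" for y
  have inb: "p + y *s e \<in> ball p R" if "cmod y < R" for y
    unfolding mem_ball dist_line using that e by simp
  have f: "f holomorphic_on ball 0 R" unfolding f_def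
    by (rule holo_on_line[OF g]) (use inb in auto)
  have fq: "f (of_real (norm (q - p))) ~= 0"
  proof -
    have "p + of_real (norm (q - p)) *s e = q"
    proof (cases "q = p")
      case False
      then have "of_real (norm (q - p)) * of_real (1 / norm (q - p)) = (1::complex)" by simp
      then have "of_real (norm (q - p)) *s e = q - p"
        unfolding e_def using False by (simp only: if_False vector_smult_assoc vector_smult_lid)
      then show ?thesis by simp
    qed simp
    then show ?thesis using nz by (simp add: f_def)
  qed
  have qb: "of_real (norm (q - p)) \<in> ball (0::complex) R"
    using nz(1) by (simp add: dist_norm norm_minus_commute)
  have fin: "finite {y \<in> cball 0 (R/2). f y = 0}"
  proof (cases "f constant_on ball 0 R")
    case True
    then obtain c where c: "\<And>y. y \<in> ball 0 R ==> f y = c" by (auto simp: constant_on_def)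
    have "c ~= 0" using c[OF qb] fq by simp
    moreover have "cball 0 (R/2) \<subseteq> ball (0::complex) R" using R by auto
    ultimately have "{y \<in> cball 0 (R/2). f y = 0} = {}" using c by blast
    then show ?thesis by (simp only: finite.emptyI)
  next
    case False
    show ?thesis
      by (rule holomorphic_compact_finite_zeros[OF f]) (use R False in auto)
  qed
  \<comment> \<open>Only finitely many moduli are excluded, so some circle about \<open>p\<close> in
    this line avoids the zeros.\<close>
  have "infinite ({0<..<R/2} - cmod ` {y \<in> cball 0 (R/2). f y = 0})"
    using R fin by (intro Diff_infinite_finite finite_imageI) (auto simp: infinite_Ioo)
  then have "{0<..<R/2} - cmod ` {y \<in> cball 0 (R/2). f y = 0} ~= {}" by (rule infinite_imp_nonempty)
  then obtain r where r: "r \<in> {0<..<R/2} - cmod ` {y \<in> cball 0 (R/2). f y = 0}" by blast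
  have fr: "f y ~= 0" if "cmod y = r" for y
    using r that by force
  define U where "U = ball p (R/4)"
  have sub: "z + y *s e \<in> ball p R" if "z \<in> U" "cmod y = r" for z y
  proof -
    have "dist p (z + y *s e) \<le> dist p z + dist z (z + y *s e)" by (rule dist_triangle)
    also have "... < R" unfolding dist_line using that e r by (auto simp: U_def)
    finally show ?thesis by simp
  qed
  have cont: "continuous_on (U \<times> sphere 0 r) (\<lambda>x. g (fst x + snd x *s e))"
    by (rule continuous_on_compose2[OF holo_on_continuous[OF g]]) (use sub in \<open>auto intro!: continuous_intros\<close>)
  have cs: "continuous_on (sphere 0 r) (\<lambda>y. cmod (f y))"
    by (intro continuous_intros continuous_on_subset[OF holomorphic_on_imp_continuous_on[OF f]]) (use r in auto)
  have ne: "sphere (0::complex) r ~= {}" using r by auto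
  obtain y0 where y0: "y0 \<in> sphere 0 r" "\<forall>y\<in>sphere 0 r. cmod (f y0) \<le> cmod (f y)"
    using continuous_attains_inf[OF compact_sphere ne cs] by blast
  \<comment> \<open>Half the minimum of the modulus on the circle is the margin under which
    \<open>g\<close> stays nonzero on all nearby parallel circles.\<close>
  define \<epsilon> where "\<epsilon> = cmod (f y0) / 2"
  have \<epsilon>: "\<epsilon> > 0" using fr y0(1) by (simp add: \<epsilon>_def)
  have pU: "p \<in> U" using R by (simp add: U_def)
  obtain X where X: "p \<in> X" "open X" "\<forall>x\<in>X \<inter> U. \<forall>t\<in>sphere 0 r. dist (g (fst (x, t) + snd (x, t) *s e)) (g (fst (p, t) + snd (p, t) *s e)) \<le> \<epsilon>"
    by (rule continuous_on_prod_compactE[OF cont compact_sphere pU \<epsilon>])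
  obtain d where d: "d > 0" "ball p d \<subseteq> X" using openE[OF X(2,1)] by blast
  define \<delta> where "\<delta> = min d (R / 8)"
  have "g (z + y *s e) ~= 0" if z: "z \<in> ball p \<delta>" and y: "cmod y = r" for z y
  proof
    assume "g (z + y *s e) = 0"
    moreover have "z \<in> X \<inter> U" using z d R by (auto simp: \<delta>_def U_def)
    moreover have "y \<in> sphere 0 r" using y by simp
    ultimately have "cmod (f y) \<le> \<epsilon>" using X(3) by (force simp: f_def dist_norm)
    moreover have "cmod (f y0) \<le> cmod (f y)" using y0(2) \<open>y \<in> sphere 0 r\<close> by blast
    ultimately show False using \<epsilon> unfolding \<epsilon>_def by linarith
  qed
  then show ?thesis using that[of e r \<delta>] e r d R by (auto simp: \<delta>_def)
qed

text \<open>The circle of radius \<open>r\<close> carries nonzero values, so the slice function is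
  not identically zero. Its domain has radius \<open>3 * R / 4\<close> because base points move by
  less than \<open>R / 4\<close>; \<open>5 * R / 8\<close> is a compact radius between
  \<open>R / 2\<close> and that.\<close>

lemma slice_zeros_finite:
  fixes g :: "complex^'n => complex"
  assumes g: "holo_on g (ball p R)" and e: "norm e = 1" "0 < r" "r < R / 2" "\<delta> < R / 4"
    and nz: "\<And>z y. z \<in> ball p \<delta> ==> cmod y = r ==> g (z + y *s e) ~= 0"
    and z: "z \<in> ball p \<delta>"
  shows "finite {y \<in> cball 0 (5 * R / 8). g (z + y *s e) = 0}"
proof -
  define f where "f y = g (z + y *s e)" for y
  have f: "f holomorphic_on ball 0 (3 * R / 4)" unfolding f_def
  proof (rule holo_on_line[OF g])
    fix y :: complex assume y: "y \<in> ball 0 (3 * R / 4)"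
    have "dist p (z + y *s e) \<le> dist p z + dist z (z + y *s e)" by (rule dist_triangle)
    also have "... < R" unfolding dist_line using z y e by auto
    finally show "z + y *s e \<in> ball p R" by simp
  qed
  have fr: "f (of_real r) ~= 0" using nz[OF z, of "of_real r"] e by (simp add: f_def)
  show ?thesis
  proof (cases "f constant_on ball 0 (3 * R / 4)")
    case True
    then obtain c where c: "\<And>y. y \<in> ball 0 (3 * R / 4) ==> f y = c" by (auto simp: constant_on_def)
    have "c ~= 0" using c[of "of_real r"] fr e by simp
    moreover have "cball 0 (5 * R / 8) \<subseteq> ball (0::complex) (3 * R / 4)" using e by auto
    ultimately have "{y \<in> cball 0 (5 * R / 8). f y = 0} = {}" using c by blast
    then have "finite {y \<in> cball 0 (5 * R / 8). f y = 0}" by (simp only: finite.emptyI)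
    then show ?thesis by (simp only: f_def)
  next
    case False
    have "finite {y \<in> cball 0 (5 * R / 8). f y = 0}"
      by (rule holomorphic_compact_finite_zeros[OF f]) (use e False in auto)
    then show ?thesis by (simp add: f_def)
  qed
qed

lemma measurable_line: "(\<lambda>q. fst q + snd q *s (e::complex^'n)) \<in> borel_measurable (lborel \<Otimes>\<^sub>M lborel)"
proof -
  have "(\<lambda>q. fst q + snd q *s e) \<in> borel_measurable (borel :: ((complex^'n) \<times> complex) measure)"
    by (rule borel_measurable_continuous_onI) (intro continuous_intros)
  then have "(\<lambda>q. fst q + snd q *s e) \<in> borel_measurable (borel \<Otimes>\<^sub>M borel)" by (simp add: borel_prod)
  then show ?thesis by (simp cong: measurable_cong_sets)
qed

text \<open>Base points \<open>z\<close> run through a full-dimensional set instead of a transversal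
  to \<open>e\<close>. This counts each slice many times but asks for no coordinates adapted to
  \<open>e\<close>.\<close>

lemma slice_Fubini:
  fixes H :: "complex^'n => ennreal"
  assumes H: "H \<in> borel_measurable borel" and A: "A \<in> sets borel" and B: "B \<in> sets borel"
  shows "(\<integral>\<^sup>+z\<in>A. (\<integral>\<^sup>+y\<in>B. H (z + y *s e) \<partial>lborel) \<partial>lborel) = (\<integral>\<^sup>+y\<in>B. (\<integral>\<^sup>+z\<in>A. H (z + y *s e) \<partial>lborel) \<partial>lborel)"
    and "(\<lambda>z. (\<integral>\<^sup>+y\<in>B. H (z + y *s e) \<partial>lborel)) \<in> borel_measurable borel"
    and "(\<lambda>y. (\<integral>\<^sup>+z\<in>A. H (z + y *s e) \<partial>lborel)) \<in> borel_measurable borel"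
proof -
  have mH: "(\<lambda>q. H (fst q + snd q *s e)) \<in> borel_measurable (lborel \<Otimes>\<^sub>M lborel)"
    using measurable_compose[OF measurable_line H] .
  have mA: "(\<lambda>q. indicator A (fst q :: complex^'n) :: ennreal) \<in> borel_measurable (lborel \<Otimes>\<^sub>M (lborel :: complex measure))"
    by (rule measurable_compose[OF measurable_fst]) (use A in auto)
  have mB: "(\<lambda>q. indicator B (snd q :: complex) :: ennreal) \<in> borel_measurable ((lborel :: (complex^'n) measure) \<Otimes>\<^sub>M lborel)"
    by (rule measurable_compose[OF measurable_snd]) (use B in auto)
  have m: "(\<lambda>q. H (fst q + snd q *s e) * indicator A (fst q) * indicator B (snd q)) \<in> borel_measurable (lborel \<Otimes>\<^sub>M lborel)"
    using mH mA mB by measurable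
  have mB': "(\<lambda>q. H (fst q + snd q *s e) * indicator B (snd q)) \<in> borel_measurable (lborel \<Otimes>\<^sub>M lborel)"
    using mH mB by measurable
  have mA': "(\<lambda>q. H (fst q + snd q *s e) * indicator A (fst q)) \<in> borel_measurable (lborel \<Otimes>\<^sub>M lborel)"
    using mH mA by measurable
  have line1: "(\<lambda>y. H (z + y *s e)) \<in> borel_measurable borel" for z
    by (rule measurable_compose[OF _ H], rule borel_measurable_continuous_onI) (intro continuous_intros)
  have line2: "(\<lambda>z. H (z + y *s e)) \<in> borel_measurable borel" for y
    by (rule measurable_compose[OF _ H], rule borel_measurable_continuous_onI) (intro continuous_intros)
  have "(\<integral>\<^sup>+z\<in>A. (\<integral>\<^sup>+y\<in>B. H (z + y *s e) \<partial>lborel) \<partial>lborel)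
      = (\<integral>\<^sup>+z. (\<integral>\<^sup>+y. H (z + y *s e) * indicator A z * indicator B y \<partial>lborel) \<partial>lborel)"
    by (intro nn_integral_cong) (auto simp: indicator_def)
  also have "... = (\<integral>\<^sup>+y. (\<integral>\<^sup>+z. H (z + y *s e) * indicator A z * indicator B y \<partial>lborel) \<partial>lborel)"
    using pair_sigma_finite.Fubini'[OF pair_sigma_finite.intro[OF sigma_finite_lborel sigma_finite_lborel],
        of "\<lambda>z y. H (z + y *s e) * indicator A z * indicator B y"] m by (simp add: split_beta)
  also have "... = (\<integral>\<^sup>+y\<in>B. (\<integral>\<^sup>+z\<in>A. H (z + y *s e) \<partial>lborel) \<partial>lborel)"
    by (intro nn_integral_cong) (auto simp: indicator_def)
  finally show "(\<integral>\<^sup>+z\<in>A. (\<integral>\<^sup>+y\<in>B. H (z + y *s e) \<partial>lborel) \<partial>lborel) = (\<integral>\<^sup>+y\<in>B. (\<integral>\<^sup>+z\<in>A. H (z + y *s e) \<partial>lborel) \<partial>lborel)" .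
  have "(\<lambda>z. (\<integral>\<^sup>+y\<in>B. H (z + y *s e) \<partial>lborel)) \<in> borel_measurable lborel"
    using sigma_finite_measure.borel_measurable_nn_integral[OF sigma_finite_lborel,
        of "\<lambda>z y. H (z + y *s e) * indicator B y" lborel] mB' by (simp add: split_beta)
  then show "(\<lambda>z. (\<integral>\<^sup>+y\<in>B. H (z + y *s e) \<partial>lborel)) \<in> borel_measurable borel" by simp
  have "(\<lambda>q. H (snd q + fst q *s e) * indicator A (snd q)) \<in> borel_measurable (lborel \<Otimes>\<^sub>M lborel)"
    using measurable_compose[OF measurable_pair_swap' mA'] by (simp add: split_beta)
  then have "(\<lambda>y. (\<integral>\<^sup>+z\<in>A. H (z + y *s e) \<partial>lborel)) \<in> borel_measurable lborel"
    using sigma_finite_measure.borel_measurable_nn_integral[OF sigma_finite_lborel,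
        of "\<lambda>y z. H (z + y *s e) * indicator A z" lborel] by (simp add: split_beta)
  then show "(\<lambda>y. (\<integral>\<^sup>+z\<in>A. H (z + y *s e) \<partial>lborel)) \<in> borel_measurable borel" by simp
qed

lemma holo_zero_set_borel:
  assumes "holo_on g (ball p R)" shows "{z \<in> ball p R. g z = 0} \<in> sets borel" "{z \<in> ball p R. g z ~= 0} \<in> sets borel"
    "open {z \<in> ball p R. g z ~= 0}"
proof -
  have "open (ball p R \<inter> g -` (- {0}))"
    by (intro continuous_open_preimage holo_on_continuous[OF assms]) auto
  moreover have "ball p R \<inter> g -` (- {0}) = {z \<in> ball p R. g z ~= 0}" by auto
  ultimately show op: "open {z \<in> ball p R. g z ~= 0}" by simp
  then show "{z \<in> ball p R. g z ~= 0} \<in> sets borel" by simp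
  then have "ball p R - {z \<in> ball p R. g z ~= 0} \<in> sets borel" by simp
  moreover have "ball p R - {z \<in> ball p R. g z ~= 0} = {z \<in> ball p R. g z = 0}" by auto
  ultimately show "{z \<in> ball p R. g z = 0} \<in> sets borel" by simp
qed

text \<open>Every slice of the zero set is finite, so the double integral vanishes, and for almost
  all \<open>y\<close> the translate of the zero set by \<open>- y *s e\<close> is null near
  \<open>p\<close>. One such \<open>y\<close>, taken small, suffices since volume is translation
  invariant.\<close>

lemma thin_set_null:
  fixes g :: "complex^'n => complex"
  assumes g: "holo_on g (ball p R)" and R: "R > 0" and nz: "q \<in> ball p R" "g q ~= 0"
  obtains \<delta> where "\<delta> > 0" "\<delta> \<le> R" "emeasure lborel {z \<in> ball p \<delta>. g z = 0} = 0"
proof -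
  obtain e r \<delta> where e: "norm e = 1" "0 < r" "r < R / 2" "0 < \<delta>" "\<delta> < R / 4"
    "\<And>z y. z \<in> ball p \<delta> ==> cmod y = r ==> g (z + y *s e) ~= 0"
    using thin_set_direction[OF g R nz] by metis
  define Z where "Z = {z \<in> ball p R. g z = 0}"
  have Zb: "Z \<in> sets borel" unfolding Z_def by (rule holo_zero_set_borel[OF g])
  have Hm: "(indicator Z :: complex^'n => ennreal) \<in> borel_measurable borel" using Zb by simp
  have "(\<integral>\<^sup>+z\<in>ball p \<delta>. (\<integral>\<^sup>+y\<in>ball 0 r. indicator Z (z + y *s e) \<partial>lborel) \<partial>lborel) = (\<integral>\<^sup>+z. 0 \<partial>(lborel :: (complex^'n) measure))"
  proof (intro nn_integral_cong)
    fix z :: "complex^'n"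
    have "(\<integral>\<^sup>+y\<in>ball 0 r. indicator Z (z + y *s e) \<partial>lborel) = 0" if z: "z \<in> ball p \<delta>"
    proof -
      define K where "K = {y \<in> cball 0 (5 * R / 8). g (z + y *s e) = 0}"
      have fK: "finite K" unfolding K_def using slice_zeros_finite[OF g e(1,2,3,5,6) z] by blast
      have "AE y in lborel. y \<notin> K"
        by (rule AE_not_in) (use fK in \<open>auto intro: finite_imp_null_set_lborel\<close>)
      then have "AE y in lborel. indicator Z (z + y *s e) * indicator (ball 0 r) y = (0::ennreal)"
        by eventually_elim (use e R in \<open>auto simp: K_def Z_def indicator_def\<close>)
      then show ?thesis by (subst nn_integral_cong_AE[where v = "\<lambda>_. 0"]) auto
    qed
    then show "(\<integral>\<^sup>+y\<in>ball 0 r. indicator Z (z + y *s e) \<partial>lborel) * indicator (ball p \<delta>) z = 0"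
      by (auto simp: indicator_def)
  qed
  then have "(\<integral>\<^sup>+y\<in>ball 0 r. (\<integral>\<^sup>+z\<in>ball p \<delta>. indicator Z (z + y *s e) \<partial>lborel) \<partial>lborel) = 0"
    using slice_Fubini(1)[OF Hm, of "ball p \<delta>" "ball 0 r" e] by simp
  then have ae: "AE y in lborel. (\<integral>\<^sup>+z\<in>ball p \<delta>. indicator Z (z + y *s e) \<partial>lborel) * indicator (ball 0 r) y = 0"
  proof (subst (asm) nn_integral_0_iff_AE)
    show "(\<lambda>y. (\<integral>\<^sup>+z\<in>ball p \<delta>. indicator Z (z + y *s e) \<partial>lborel) * indicator (ball 0 r) y) \<in> borel_measurable lborel"
      using slice_Fubini(3)[OF Hm, of "ball p \<delta>" "{}" e]
      by (intro borel_measurable_times_ennreal borel_measurable_indicator) auto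
  qed
  \<comment> \<open>The bound \<open>\<delta> / 2\<close> lets the ball of radius
    \<open>\<delta> / 2\<close>, moved by \<open>- y *s e\<close>, stay inside
    \<open>ball p \<delta>\<close>.\<close>
  define s where "s = min r (\<delta> / 2)"
  have s: "s > 0" using e by (simp add: s_def)
  have "\<exists>y\<in>ball 0 s. (\<integral>\<^sup>+z\<in>ball p \<delta>. indicator Z (z + y *s e) \<partial>lborel) = 0"
  proof (rule ccontr)
    assume "\<not> ?thesis"
    then have ne: "(\<integral>\<^sup>+z\<in>ball p \<delta>. indicator Z (z + y *s e) \<partial>lborel) ~= 0" if "y \<in> ball 0 s" for y using that by blast
    have "AE y in lborel. y \<notin> ball (0::complex) s"
      using ae by eventually_elim (use ne in \<open>auto simp: s_def\<close>)
    then have "emeasure lborel (ball (0::complex) s) = 0"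
      by (subst (asm) AE_iff_measurable[of "ball 0 s"]) auto
    then show False using open_null_empty[of "ball (0::complex) s"] s by auto
  qed
  then obtain y where y: "y \<in> ball 0 s" "(\<integral>\<^sup>+z\<in>ball p \<delta>. indicator Z (z + y *s e) \<partial>lborel) = 0" by blast
  define Z' where "Z' = {z \<in> ball p (\<delta>/2). g z = 0}"
  have Z': "Z' \<in> sets borel" unfolding Z'_def
    by (rule holo_zero_set_borel[OF holo_on_subset[OF g]]) (use e R in auto)
  have "emeasure lborel Z' = (\<integral>\<^sup>+z. indicator Z' z \<partial>lborel)" using Z' by simp
  also have "... = (\<integral>\<^sup>+z. indicator Z' (y *s e + z) \<partial>lborel)"
    by (rule nn_integral_lborel_translate[symmetric]) (use Z' in simp)
  also have "... \<le> (\<integral>\<^sup>+z\<in>ball p \<delta>. indicator Z (z + y *s e) \<partial>lborel)"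
  proof (intro nn_integral_mono)
    fix z
    have "z \<in> ball p \<delta> \<and> z + y *s e \<in> Z" if "y *s e + z \<in> Z'"
    proof -
      have 1: "dist p (z + y *s e) < \<delta> / 2" "g (z + y *s e) = 0" using that by (auto simp: Z'_def add.commute)
      have "dist p z \<le> dist p (z + y *s e) + dist (z + y *s e) z" by (rule dist_triangle)
      also have "dist (z + y *s e) z = cmod y" using dist_line[of z y e] e by (simp add: dist_commute)
      finally have "dist p z < \<delta>" using 1 y(1) by (simp add: s_def)
      then show ?thesis using 1 e R by (auto simp: Z_def)
    qed
    then show "indicator Z' (y *s e + z) \<le> (indicator Z (z + y *s e) * indicator (ball p \<delta>) z :: ennreal)"
      by (auto simp: indicator_def)
  qed
  finally have "emeasure lborel Z' = 0" using y(2) by simp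
  then show ?thesis using that[of "\<delta>/2"] e R by (auto simp: Z'_def)
qed

text \<open>The Cauchy integral \<open>F\<close> over the circle in direction \<open>e\<close> is
  holomorphic near \<open>p\<close> since the circle avoids the zeros of \<open>g\<close>. By Fubini
  almost every slice of \<open>h\<close> is square integrable, its finitely many singularities are
  removable, and Cauchy's formula gives \<open>F = h\<close> at its centre; continuity extends this
  to all points off the zero set.\<close>

theorem L2_extension:
  fixes g h :: "complex^'n => complex"
  assumes g: "holo_on g (ball p R)" and R: "R > 0" and nz: "q \<in> ball p R" "g q ~= 0"
    and h: "holo_on h {z \<in> ball p R. g z ~= 0}"
    and fin: "(\<integral>\<^sup>+z\<in>{z \<in> ball p R. g z ~= 0}. ennreal ((cmod (h z))^2) \<partial>lborel) < \<infinity>"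
  obtains \<delta> F where "\<delta> > 0" "\<delta> \<le> R" "holo_on F (ball p \<delta>)" "\<And>z. z \<in> ball p \<delta> ==> g z ~= 0 ==> F z = h z"
proof -
  obtain e r \<delta> where e: "norm e = 1" "0 < r" "r < R / 2" "0 < \<delta>" "\<delta> < R / 4"
    "\<And>z y. z \<in> ball p \<delta> ==> cmod y = r ==> g (z + y *s e) ~= 0"
    using thin_set_direction[OF g R nz] by metis
  define D where "D = {z \<in> ball p R. g z ~= 0}"
  define r' where "r' = 5 * R / 8"
  have Db: "D \<in> sets borel" and Do: "open D" unfolding D_def using holo_zero_set_borel[OF g] by auto
  have inR: "z + y *s e \<in> ball p R" if "z \<in> ball p \<delta>" "cmod y < 3 * R / 4" for z y
  proof -
    have "dist p (z + y *s e) \<le> dist p z + dist z (z + y *s e)" by (rule dist_triangle)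
    also have "... < R" unfolding dist_line using that e by auto
    finally show ?thesis by simp
  qed
  define F where "F z = 1 / (2 * pi * \<i>) * contour_integral (circlepath 0 r) (\<lambda>y. h (z + y *s e) / y ^ 1)" for z
  have F: "holo_on F (ball p \<delta>)" unfolding F_def
    by (intro holo_on_mult holo_on_const holo_on_circle_integral[OF open_ball h e(2)]) (use e inR R in auto)
  define H where "H z = ennreal ((cmod (h z))^2) * indicator D z" for z
  have Hm: "H \<in> borel_measurable borel"
    unfolding H_def using borel_measurable_indicator_ennreal[OF Db] holo_on_continuous[OF h] by (simp add: D_def)
  have fin': "(\<integral>\<^sup>+z. H z \<partial>lborel) < \<infinity>" using fin by (simp add: H_def D_def)
  have "(\<integral>\<^sup>+z\<in>ball p \<delta>. (\<integral>\<^sup>+y\<in>ball 0 r'. H (z + y *s e) \<partial>lborel) \<partial>lborel)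
      = (\<integral>\<^sup>+y\<in>ball 0 r'. (\<integral>\<^sup>+z\<in>ball p \<delta>. H (z + y *s e) \<partial>lborel) \<partial>lborel)"
    by (rule slice_Fubini(1)[OF Hm]) auto
  also have "... \<le> (\<integral>\<^sup>+y\<in>ball (0::complex) r'. (\<integral>\<^sup>+z. H z \<partial>lborel) \<partial>lborel)"
  proof (rule nn_integral_mono, rule mult_right_mono)
    fix y :: complex
    have "(\<integral>\<^sup>+z\<in>ball p \<delta>. H (z + y *s e) \<partial>lborel) \<le> (\<integral>\<^sup>+z. H (y *s e + z) \<partial>lborel)"
      by (intro nn_integral_mono) (auto simp: indicator_def add.commute)
    also have "... = (\<integral>\<^sup>+z. H z \<partial>lborel)" by (rule nn_integral_lborel_translate[OF Hm])
    finally show "(\<integral>\<^sup>+z\<in>ball p \<delta>. H (z + y *s e) \<partial>lborel) \<le> (\<integral>\<^sup>+z. H z \<partial>lborel)" .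
  qed auto
  also have "... = (\<integral>\<^sup>+z. H z \<partial>lborel) * emeasure lborel (ball (0::complex) r')"
    by (simp add: nn_integral_cmult_indicator)
  also have "... < \<infinity>" using fin' emeasure_lborel_ball_finite[of "0::complex" r'] by (simp add: ennreal_mult_less_top)
  finally have "(\<integral>\<^sup>+z\<in>ball p \<delta>. (\<integral>\<^sup>+y\<in>ball 0 r'. H (z + y *s e) \<partial>lborel) \<partial>lborel) ~= \<infinity>" by simp
  then have ae: "AE z in lborel. (\<integral>\<^sup>+y\<in>ball 0 r'. H (z + y *s e) \<partial>lborel) * indicator (ball p \<delta>) z ~= \<infinity>"
  proof (rule nn_integral_PInf_AE[rotated])
    show "(\<lambda>z. (\<integral>\<^sup>+y\<in>ball 0 r'. H (z + y *s e) \<partial>lborel) * indicator (ball p \<delta>) z) \<in> borel_measurable lborel"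
      using slice_Fubini(2)[OF Hm, of "{}" "ball 0 r'" e]
      by (intro borel_measurable_times_ennreal borel_measurable_indicator) auto
  qed
  have eq: "F z = h z" if z: "z \<in> ball p \<delta>" "g z ~= 0" and fz: "(\<integral>\<^sup>+y\<in>ball 0 r'. H (z + y *s e) \<partial>lborel) ~= \<infinity>" for z
  proof -
    define K where "K = {y \<in> cball 0 r'. g (z + y *s e) = 0}"
    have fK: "finite K" unfolding K_def r'_def using slice_zeros_finite[OF g e(1,2,3,5,6) z(1)] by blast
    have inD: "z + y *s e \<in> D" if "y \<in> ball 0 r' - K" for y
      using that inR[OF z(1), of y] R by (auto simp: K_def D_def r'_def)
    have "(\<lambda>y. h (z + y *s e)) holomorphic_on ball 0 r' - K"
      by (rule holo_on_line[OF h]) (use inD in \<open>auto simp: D_def\<close>)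
    moreover have "(\<integral>\<^sup>+y\<in>ball 0 r' - K. ennreal ((cmod (h (z + y *s e)))^2) \<partial>lborel) < \<infinity>"
    proof -
      have "(\<integral>\<^sup>+y\<in>ball 0 r' - K. ennreal ((cmod (h (z + y *s e)))^2) \<partial>lborel) \<le> (\<integral>\<^sup>+y\<in>ball 0 r'. H (z + y *s e) \<partial>lborel)"
        by (intro nn_integral_mono) (use inD in \<open>auto simp: H_def indicator_def\<close>)
      also have "... < \<infinity>" using fz by (simp add: less_top)
      finally show ?thesis .
    qed
    ultimately obtain k where k: "k holomorphic_on ball 0 r'" "\<forall>y\<in>ball 0 r' - K. k y = h (z + y *s e)"
      using L2_removable_finite[OF fK, of "ball 0 r'"] by auto
    have rr': "r < r'" using e R by (simp add: r'_def)
    have "((\<lambda>u. k u / (u - 0)) has_contour_integral 2 * of_real pi * \<i> * k 0) (circlepath 0 r)"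
      by (rule Cauchy_integral_circlepath)
         (use k(1) rr' e in \<open>auto intro!: holomorphic_on_imp_continuous_on intro: holomorphic_on_subset\<close>)
    then have "contour_integral (circlepath 0 r) (\<lambda>u. k u / u) = 2 * pi * \<i> * k 0"
      using contour_integral_unique by fastforce
    moreover have "contour_integral (circlepath 0 r) (\<lambda>u. k u / u) = contour_integral (circlepath 0 r) (\<lambda>y. h (z + y *s e) / y ^ 1)"
    proof (rule contour_integral_eq)
      fix y assume "y \<in> path_image (circlepath 0 r)"
      then have "cmod y = r" using e by (auto simp: path_image_circlepath)
      then have "y \<in> ball 0 r' - K" using e(6)[OF z(1)] rr' by (auto simp: K_def)
      then show "k y / y = h (z + y *s e) / y ^ 1" using k(2) by simp
    qed
    moreover have "k 0 = h z"
    proof -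
      have "0 \<in> ball 0 r' - K" using z(2) R by (auto simp: K_def r'_def)
      then show ?thesis using k(2) by fastforce
    qed
    ultimately show ?thesis by (simp add: F_def)
  qed
  define U where "U = {z \<in> ball p \<delta> \<inter> D. F z - h z ~= 0}"
  have "open U"
  proof -
    have "open ((ball p \<delta> \<inter> D) \<inter> (\<lambda>z. F z - h z) -` (- {0}))"
      by (intro continuous_open_preimage continuous_intros continuous_on_subset[OF holo_on_continuous[OF F]]
          continuous_on_subset[OF holo_on_continuous[OF h]]) (use Do in \<open>auto simp: D_def\<close>)
    moreover have "(ball p \<delta> \<inter> D) \<inter> (\<lambda>z. F z - h z) -` (- {0}) = U" by (auto simp: U_def)
    ultimately show ?thesis by simp
  qed
  moreover have "AE z in lborel. z \<notin> U"
    using ae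
  proof eventually_elim
    case (elim z)
    show ?case
    proof
      assume "z \<in> U"
      then have "z \<in> ball p \<delta>" "g z ~= 0" "F z ~= h z" by (auto simp: U_def D_def)
      then show False using eq[of z] elim by auto
    qed
  qed
  then have "emeasure lborel U = 0"
    using \<open>open U\<close> by (subst (asm) AE_iff_measurable[of U]) auto
  ultimately have "U = {}" by (rule open_null_empty)
  have "F z = h z" if "z \<in> ball p \<delta>" "g z ~= 0" for z
  proof -
    have "ball p \<delta> \<subseteq> ball p R" using e by (intro subset_ball) simp
    then have "z \<in> ball p \<delta> \<inter> D" using that by (auto simp: D_def)
    then show ?thesis using \<open>U = {}\<close> unfolding U_def by auto
  qed
  then show ?thesis using that[of \<delta> F] F e R by auto
qed

text \<open>Where \<open>u\<close>, the Jacobian of \<open>F\<close> in target coordinates, is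
  nonzero, differentiability of a continuous inverse is standard. Once \<open>u\<close> is
  holomorphic, its zero set is thin: otherwise the volume formula would give a ball volume zero. The
  components of \<open>G\<close> are bounded near a point, so they extend across the zero set, and
  the extension agrees with \<open>G\<close> by continuity.\<close>

theorem holo_inverse:
  fixes F G :: "complex^'n => complex^'n"
  assumes A: "open A" and B: "open B" and F: "holo_map F A" and FA: "F ` A = B"
    and GF: "\<And>z. z \<in> A ==> G (F z) = z" and cG: "continuous_on B G"
  shows "holo_map G B"
proof -
  have GB: "G w \<in> A" "F (G w) = w" if "w \<in> B" for w using that FA GF by auto
  define J where "J = jac F"
  have J: "holo_on J A" unfolding J_def by (rule holo_on_jac[OF A F])
  define u where "u w = J (G w)" for w
  have cu: "continuous_on B u" unfolding u_def
    by (rule continuous_on_compose2[OF holo_on_continuous[OF J] cG]) (use GB in auto)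
  have cholG: "\<exists>M. chol G M w" if w: "w \<in> B" "u w ~= 0" for w
  proof -
    obtain L where L: "chol F L (G w)" using F GB[OF w(1)] by (auto simp: holo_map_iff)
    have dL: "det (matrix L) ~= 0" using jac_eq[OF L] w by (simp add: u_def J_def)
    then obtain N where inv: "N ** matrix L = mat 1"
      using invertible_det_nz invertible_left_inverse by blast
    define M where "M v = N *v v" for v
    have blM: "bounded_linear M" unfolding M_def
      by (rule linear_conv_bounded_linear[THEN iffD1]) (rule linear_complex_matrix_vector)
    have "M (L v) = v" for v
    proof -
      have "M (L v) = N *v (matrix L *v v)"
        using fun_cong[OF chol_matrix_works[OF L], of v] by (simp add: M_def)
      also have "... = v" by (simp add: matrix_vector_mul_assoc inv)
      finally show ?thesis .
    qed
    then have MoL: "M \<circ> L = id" by (simp add: fun_eq_iff)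
    have "(G has_derivative M) (at w)"
      by (rule has_derivative_inverse_basic[OF _ blM MoL _ B w(1)])
         (use L cG B w GB in \<open>auto simp: chol_def continuous_on_eq_continuous_at\<close>)
    then have "chol G M w" by (simp add: chol_def M_def vector_scalar_commute)
    then show ?thesis by blast
  qed
  have opU: "open {w \<in> B. u w ~= 0}"
  proof -
    have "open (B \<inter> u -` (- {0}))" by (intro continuous_open_preimage cu B) auto
    moreover have "B \<inter> u -` (- {0}) = {w \<in> B. u w ~= 0}" by auto
    ultimately show ?thesis by simp
  qed
  have Gnz: "holo_map G {w \<in> B. u w ~= 0}" unfolding holo_map_iff using cholG by auto
  have unz: "holo_on u {w \<in> B. u w ~= 0}" unfolding u_def
    by (rule holo_on_compose[OF _ J]) (use Gnz GB in \<open>auto simp: u_def\<close>)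
  have u: "holo_on u B"
  proof (rule osgood[OF B cu])
    fix w and i :: 'n assume w: "w \<in> B"
    define S where "S = (\<lambda>y. w + y *s axis i 1) -` B"
    have S: "open S" unfolding S_def
      by (rule open_vimage[OF B]) (intro continuous_intros)
    \<comment> \<open>Rado's theorem is a statement in one variable; it is applied on coordinate
      slices, and Osgood's lemma assembles them.\<close>
    have "(\<lambda>y. u (w + y *s axis i 1)) holomorphic_on S"
    proof (rule rado[OF S])
      show "continuous_on S (\<lambda>y. u (w + y *s axis i 1))"
        by (rule continuous_on_compose2[OF cu]) (auto intro!: continuous_intros simp: S_def)
      show "(\<lambda>y. u (w + y *s axis i 1)) holomorphic_on {y \<in> S. u (w + y *s axis i 1) ~= 0}"
        by (rule holo_on_line[OF unz]) (auto simp: S_def)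
    qed
    moreover have "0 \<in> S" using w by (simp add: S_def)
    ultimately show "(\<lambda>y. u (w + y *s axis i 1)) field_differentiable at 0"
      using S holomorphic_on_imp_differentiable_at by blast
  qed
  show ?thesis unfolding holo_map_def
  proof (intro allI holo_on_local)
    fix i q assume q: "q \<in> B"
    obtain R where R: "R > 0" "cball q R \<subseteq> B" using open_contains_cball_eq[OF B] q by blast
    have bB: "ball q R \<subseteq> B" using R by auto
    have "\<exists>w\<in>ball q R. u w ~= 0"
    proof (rule ccontr)
      assume "\<not> ?thesis"
      then have z: "\<And>w. w \<in> ball q R ==> u w = 0" by blast
      define S where "S = A \<inter> F -` ball q R"
      have oS: "open S" unfolding S_def by (intro continuous_open_preimage holo_map_continuous[OF F] A) auto
      have FS: "F ` S = ball q R" using bB FA by (auto simp: S_def)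
      have "emeasure lborel (F ` S) = (\<integral>\<^sup>+z\<in>S. ennreal ((cmod (jac F z))^2) \<partial>lborel)"
        by (rule emeasure_holomorphic_image[OF A F])
           (use oS FS inj_on_inverseI[of A G F, OF GF] in \<open>auto simp: S_def\<close>)
      also have "... = (\<integral>\<^sup>+z. 0 \<partial>(lborel :: (complex^'n) measure))"
      proof (intro nn_integral_cong)
        fix x
        have "jac F x = 0" if "x \<in> S" using z[of "F x"] that GF by (auto simp: S_def u_def J_def)
        then show "ennreal ((cmod (jac F x))^2) * indicator S x = 0" by (auto simp: indicator_def)
      qed
      finally show False unfolding FS using open_null_empty[of "ball q R"] R by auto
    qed
    then obtain q' where q': "q' \<in> ball q R" "u q' ~= 0" by blast
    have uR: "holo_on u (ball q R)" by (rule holo_on_subset[OF u bB])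
    have hR: "holo_on (\<lambda>w. G w $ i) {w \<in> ball q R. u w ~= 0}"
    proof -
      have "holo_on (\<lambda>w. G w $ i) {w \<in> B. u w ~= 0}" using Gnz by (simp add: holo_map_def)
      then show ?thesis by (rule holo_on_subset) (use bB in auto)
    qed
    have "compact ((\<lambda>w. G w $ i) ` cball q R)"
      by (intro compact_continuous_image continuous_intros continuous_on_subset[OF cG]) (use R in auto)
    then obtain C where C: "\<And>w. w \<in> cball q R ==> cmod (G w $ i) \<le> C"
      using compact_imp_bounded bounded_iff by (metis imageI)
    have "(\<integral>\<^sup>+w\<in>{w \<in> ball q R. u w ~= 0}. ennreal ((cmod (G w $ i))^2) \<partial>lborel) \<le> (\<integral>\<^sup>+w. ennreal (C^2) * indicator (ball q R) w \<partial>lborel)"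
      by (intro nn_integral_mono) (use C in \<open>auto simp: indicator_def intro!: ennreal_leI power_mono\<close>)
    also have "... = ennreal (C^2) * emeasure lborel (ball q R)"
      by (simp add: nn_integral_cmult_indicator)
    also have "... < \<infinity>" using emeasure_lborel_ball_finite[of q R] by (simp add: ennreal_mult_less_top)
    finally have "(\<integral>\<^sup>+w\<in>{w \<in> ball q R. u w ~= 0}. ennreal ((cmod (G w $ i))^2) \<partial>lborel) < \<infinity>" .
    from L2_extension[OF uR R(1) q' hR this] obtain \<delta> E where E: "\<delta> > 0" "\<delta> \<le> R" "holo_on E (ball q \<delta>)"
      "\<And>z. z \<in> ball q \<delta> ==> u z ~= 0 ==> E z = G z $ i" by metis
    from thin_set_null[OF uR R(1) q'] obtain \<delta>' where d': "\<delta>' > 0" "\<delta>' \<le> R" "emeasure lborel {z \<in> ball q \<delta>'. u z = 0} = 0" by metis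
    define \<rho> where "\<rho> = min \<delta> \<delta>'"
    define W where "W = {w \<in> ball q \<rho>. E w - G w $ i ~= 0}"
    have "open W"
    proof -
      have "open (ball q \<rho> \<inter> (\<lambda>w. E w - G w $ i) -` (- {0}))"
        by (intro continuous_open_preimage continuous_intros continuous_on_subset[OF holo_on_continuous[OF E(3)]]
            continuous_on_subset[OF cG]) (use bB E d' in \<open>auto simp: \<rho>_def subset_iff\<close>)
      moreover have "ball q \<rho> \<inter> (\<lambda>w. E w - G w $ i) -` (- {0}) = W" by (auto simp: W_def)
      ultimately show ?thesis by simp
    qed
    moreover have "emeasure lborel W = 0"
    proof -
      have "emeasure lborel W \<le> emeasure lborel {z \<in> ball q \<delta>'. u z = 0}"
        by (rule emeasure_mono) (use E holo_zero_set_borel(1)[OF holo_on_subset[OF uR subset_ball[OF d'(2)]]] in \<open>auto simp: W_def \<rho>_def\<close>)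
      then show ?thesis using d' by simp
    qed
    ultimately have "W = {}" by (rule open_null_empty)
    then have eq: "\<And>w. w \<in> ball q \<rho> ==> E w = G w $ i" by (auto simp: W_def)
    have "holo_on (\<lambda>w. G w $ i) (ball q \<rho>)"
      by (rule holo_on_cong[OF open_ball eq holo_on_subset[OF E(3)]]) (auto simp: \<rho>_def)
    then show "\<exists>E. q \<in> E \<and> holo_on (\<lambda>w. G w $ i) E"
      using E d' by (intro exI[of _ "ball q \<rho>"]) (auto simp: \<rho>_def)
  qed
qed

section \<open>Charts\<close>

text \<open>Domain and image are open, so the subspace topologies disappear and what remains is an
  injection that is continuous and open for the ambient topologies.\<close>

lemma homeomorphic_chart_iff:
  fixes \<kappa> :: "'a => complex^'n"
  assumes U: "openin T U" and o: "open (\<kappa> ` U)"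
  shows "homeomorphic_map (subtopology T U) (top_of_set (\<kappa> ` U)) \<kappa> \<longleftrightarrow>
    inj_on \<kappa> U \<and> (\<forall>Q. open Q \<longrightarrow> openin T (U \<inter> \<kappa> -` Q)) \<and> (\<forall>W. openin T W \<and> W \<subseteq> U \<longrightarrow> open (\<kappa> ` W))"
    (is "?L \<longleftrightarrow> ?R")
proof
  have ts: "topspace (subtopology T U) = U" using openin_subset[OF U] by auto
  show ?R if L: ?L
  proof (intro conjI allI impI)
    show "inj_on \<kappa> U" using homeomorphic_imp_injective_map[OF L] ts by simp
    fix Q :: "(complex^'n) set" assume Q: "open Q"
    have "openin (top_of_set (\<kappa> ` U)) (\<kappa> ` U \<inter> Q)" using Q by (simp add: openin_open_Int)
    then have "openin (subtopology T U) {x \<in> topspace (subtopology T U). \<kappa> x \<in> \<kappa> ` U \<inter> Q}"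
      using homeomorphic_imp_continuous_map[OF L] openin_continuous_map_preimage by blast
    moreover have "{x \<in> topspace (subtopology T U). \<kappa> x \<in> \<kappa> ` U \<inter> Q} = U \<inter> \<kappa> -` Q" using ts by auto
    ultimately show "openin T (U \<inter> \<kappa> -` Q)" using openin_open_subtopology[OF U] by simp
  next
    fix W assume "openin T W \<and> W \<subseteq> U"
    then have "openin (subtopology T U) W" using openin_open_subtopology[OF U] by simp
    then have "openin (top_of_set (\<kappa> ` U)) (\<kappa> ` W)"
      using homeomorphic_imp_open_map[OF L] by (simp add: open_map_def)
    then show "open (\<kappa> ` W)" using openin_open_eq[OF o] by blast
  qed
  show ?L if R: ?R
  proof (rule bijective_open_imp_homeomorphic_map)
    show "continuous_map (subtopology T U) (top_of_set (\<kappa> ` U)) \<kappa>"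
      unfolding continuous_map_def
    proof (intro conjI allI impI)
      show "\<kappa> \<in> topspace (subtopology T U) \<rightarrow> topspace (top_of_set (\<kappa> ` U))" using ts by auto
      fix V assume "openin (top_of_set (\<kappa> ` U)) V"
      then have "open V" using openin_open_eq[OF o] by blast
      then have "openin T (U \<inter> \<kappa> -` V)" using R by blast
      moreover have "{x \<in> topspace (subtopology T U). \<kappa> x \<in> V} = U \<inter> \<kappa> -` V" using ts by auto
      ultimately show "openin (subtopology T U) {x \<in> topspace (subtopology T U). \<kappa> x \<in> V}"
        using openin_open_subtopology[OF U] by simp
    qed
    show "open_map (subtopology T U) (top_of_set (\<kappa> ` U)) \<kappa>"
      unfolding open_map_def using R openin_open_subtopology[OF U] openin_open_eq[OF o]
      by (simp add: image_mono)
  qed (use R ts in auto)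
qed

lemma mem_charts_iff:
  fixes c :: "('a, 'n::finite) chart"
  shows "c \<in> charts X \<longleftrightarrow> openin (ctop X) (fst c) \<and> open (snd c ` fst c) \<and> inj_on (snd c) (fst c) \<and>
    (\<forall>Q. open Q \<longrightarrow> openin (ctop X) (fst c \<inter> snd c -` Q)) \<and>
    (\<forall>W. openin (ctop X) W \<and> W \<subseteq> fst c \<longrightarrow> open (snd c ` W)) \<and>
    (\<forall>W g. openin (ctop X) W \<and> W \<subseteq> fst c \<longrightarrow>
      (g \<in> hol X W \<longleftrightarrow> holo_on (\<lambda>z. g (chart_inv c z)) (snd c ` W)))"
proof -
  obtain U \<kappa> where c: "c = (U, \<kappa>)" by (cases c)
  show ?thesis
    unfolding c charts_def local_iso_def chart_inv_def
    using homeomorphic_chart_iff[of "ctop X" U \<kappa>] by auto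
qed

context
  fixes X :: "'a complex_space" and c :: "('a, 'n::finite) chart"
  assumes c: "c \<in> charts X"
begin

lemma chart_openin: "openin (ctop X) (fst c)"
  using c by (simp add: mem_charts_iff)

lemma chart_open_image: "openin (ctop X) W ==> W \<subseteq> fst c ==> open (snd c ` W)"
  using c by (simp add: mem_charts_iff)

lemma chart_open_range: "open (snd c ` fst c)"
  using c by (simp add: mem_charts_iff)

lemma chart_inj: "inj_on (snd c) (fst c)"
  using c by (simp add: mem_charts_iff)

lemma chart_vimage: "open Q ==> openin (ctop X) (fst c \<inter> snd c -` Q)"
  using c by (simp add: mem_charts_iff)

lemma chart_hol:
  "openin (ctop X) W ==> W \<subseteq> fst c ==> g \<in> hol X W \<longleftrightarrow> holo_on (\<lambda>z. g (chart_inv c z)) (snd c ` W)"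
  using c by (simp add: mem_charts_iff)

lemma chart_inv_left: "x \<in> fst c ==> chart_inv c (snd c x) = x"
  unfolding chart_inv_def by (rule inv_into_f_f[OF chart_inj])

lemma chart_inv_right: "z \<in> snd c ` fst c ==> snd c (chart_inv c z) = z"
  unfolding chart_inv_def by (rule f_inv_into_f)

lemma chart_inv_mem: "z \<in> snd c ` fst c ==> chart_inv c z \<in> fst c"
  unfolding chart_inv_def by (rule inv_into_into)

lemma chart_image_Int: "A \<subseteq> fst c ==> B \<subseteq> fst c ==> snd c ` (A \<inter> B) = snd c ` A \<inter> snd c ` B"
  by (rule inj_on_image_Int[OF chart_inj])

lemma chart_image_Diff: "A \<subseteq> fst c ==> B \<subseteq> fst c ==> snd c ` (A - B) = snd c ` A - snd c ` B"
  by (rule inj_on_image_set_diff[OF chart_inj]) auto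

lemma chart_subset_topspace: "fst c \<subseteq> topspace (ctop X)"
  by (rule openin_subset[OF chart_openin])

end

lemma chart_restrict:
  fixes c :: "('a, 'n::finite) chart"
  assumes c: "c \<in> charts X" and W: "openin (ctop X) W" "W \<subseteq> fst c"
  shows "(W, snd c) \<in> charts X" and "z \<in> snd c ` W ==> chart_inv (W, snd c) z = chart_inv c z"
proof -
  have inj: "inj_on (snd c) W" by (rule inj_on_subset[OF chart_inj[OF c] W(2)])
  have eq: "chart_inv (W, snd c) z = chart_inv c z" if z: "z \<in> snd c ` W" for z
  proof -
    obtain x where x: "x \<in> W" "z = snd c x" using z by blast
    have "chart_inv (W, snd c) z = x" unfolding chart_inv_def x(2) using x(1) inj by simp
    moreover have "chart_inv c z = x" unfolding x(2) using x(1) W by (intro chart_inv_left[OF c]) auto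
    ultimately show ?thesis by simp
  qed
  show "z \<in> snd c ` W ==> chart_inv (W, snd c) z = chart_inv c z" by (rule eq)
  show "(W, snd c) \<in> charts X"
    unfolding mem_charts_iff fst_conv snd_conv
  proof (intro conjI allI impI)
    show "open (snd c ` W)" by (rule chart_open_image[OF c W])
    fix Q :: "(complex^'n) set" assume "open Q"
    have "W \<inter> snd c -` Q = W \<inter> (fst c \<inter> snd c -` Q)" using W by auto
    then show "openin (ctop X) (W \<inter> snd c -` Q)" using W chart_vimage[OF c \<open>open Q\<close>] by auto
  next
    fix W' assume W': "openin (ctop X) W' \<and> W' \<subseteq> W"
    then show "open (snd c ` W')" using chart_open_image[OF c, of W'] W by blast
    fix g
    have oW': "open (snd c ` W')" using chart_open_image[OF c, of W'] W W' by blast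
    have "holo_on (\<lambda>z. g (chart_inv c z)) (snd c ` W') \<longleftrightarrow> holo_on (\<lambda>z. g (chart_inv (W, snd c) z)) (snd c ` W')"
    proof -
      have e: "g (chart_inv c z) = g (chart_inv (W, snd c) z)" if "z \<in> snd c ` W'" for z
      proof -
        have "z \<in> snd c ` W" using that W' by blast
        then show ?thesis by (simp add: eq)
      qed
      show ?thesis
      proof
        assume "holo_on (\<lambda>z. g (chart_inv c z)) (snd c ` W')"
        from holo_on_cong[OF oW' e this] show "holo_on (\<lambda>z. g (chart_inv (W, snd c) z)) (snd c ` W')" .
      next
        assume "holo_on (\<lambda>z. g (chart_inv (W, snd c) z)) (snd c ` W')"
        from holo_on_cong[OF oW' e[symmetric] this] show "holo_on (\<lambda>z. g (chart_inv c z)) (snd c ` W')" .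
      qed
    qed
    then show "g \<in> hol X W' \<longleftrightarrow> holo_on (\<lambda>z. g (chart_inv (W, snd c) z)) (snd c ` W')"
      using chart_hol[OF c, of W' g] W W' by blast
  qed (use W inj in auto)
qed

lemma sheaf_cong:
  assumes "function_sheaf X" "openin (ctop X) W" "g \<in> hol X W" "\<And>x. x \<in> W ==> h x = g x"
  shows "h \<in> hol X W"
proof -
  have "\<forall>W g h. openin (ctop X) W \<and> g \<in> hol X W \<and> (\<forall>x\<in>W. h x = g x) \<longrightarrow> h \<in> hol X W"
    using assms(1) unfolding function_sheaf_def by (elim conjE)
  from this[rule_format, of W g h] show ?thesis using assms(2-4) by simp
qed

lemma sheaf_restrict:
  assumes "function_sheaf X" "openin (ctop X) W" "openin (ctop X) W'" "W' \<subseteq> W" "g \<in> hol X W"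
  shows "g \<in> hol X W'"
proof -
  have "\<forall>W W' g. openin (ctop X) W \<and> openin (ctop X) W' \<and> W' \<subseteq> W \<and> g \<in> hol X W \<longrightarrow> g \<in> hol X W'"
    using assms(1) unfolding function_sheaf_def by (elim conjE)
  from this[rule_format, of W W' g] show ?thesis using assms(2-5) by simp
qed

lemma sheaf_glue:
  assumes "function_sheaf X" "openin (ctop X) W"
    and "\<And>x. x \<in> W ==> \<exists>W'. openin (ctop X) W' \<and> x \<in> W' \<and> W' \<subseteq> W \<and> g \<in> hol X W'"
  shows "g \<in> hol X W"
proof -
  have "\<forall>W g. openin (ctop X) W \<and>
       (\<forall>x\<in>W. \<exists>W'. openin (ctop X) W' \<and> x \<in> W' \<and> W' \<subseteq> W \<and> g \<in> hol X W') \<longrightarrow> g \<in> hol X W"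
    using assms(1) unfolding function_sheaf_def by (elim conjE)
  from this[rule_format, of W g] show ?thesis using assms(2,3) by simp
qed

text \<open>The gluing axiom puts every function into \<open>hol X {}\<close>. The empty chart pads
  sequences of charts.\<close>

lemma empty_chart: assumes "function_sheaf X" shows "({}, \<kappa>) \<in> charts X"
proof -
  have g: "g \<in> hol X {}" for g by (rule sheaf_glue[OF assms]) auto
  show ?thesis unfolding mem_charts_iff fst_conv snd_conv by (simp add: g holo_on_def)
qed

text \<open>Coordinate functions of \<open>d\<close> are sections of the sheaf, hence holomorphic in
  the chart \<open>c\<close>.\<close>

lemma chart_transition:
  fixes c d :: "('a, 'n::finite) chart"
  assumes c: "c \<in> charts X" and d: "d \<in> charts X"
  shows "holo_map (\<lambda>z. snd d (chart_inv c z)) (snd c ` (fst c \<inter> fst d))"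
  unfolding holo_map_def
proof
  fix i
  define W where "W = fst c \<inter> fst d"
  have W: "openin (ctop X) W" unfolding W_def using chart_openin[OF c] chart_openin[OF d] by auto
  have "holo_on (\<lambda>z. snd d (chart_inv d z) $ i) (snd d ` W)"
    by (rule holo_on_cong[OF chart_open_image[OF d W] _ holo_on_coord[of i]])
       (use chart_inv_left[OF d] in \<open>auto simp: W_def\<close>)
  then have "(\<lambda>x. snd d x $ i) \<in> hol X W" using chart_hol[OF d W] by (simp add: W_def)
  then show "holo_on (\<lambda>z. snd d (chart_inv c z) $ i) (snd c ` (fst c \<inter> fst d))"
    using chart_hol[OF c W] by (simp add: W_def)
qed

section \<open>Forms and their norms\<close>

context
  fixes X :: "'a complex_space" and u :: "('a, 'n::finite) form"
  assumes u: "holomorphic_form X u"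
begin

lemma form_zero: "\<not> (c \<in> charts X \<and> x \<in> fst c) ==> u c x = 0"
  using u unfolding holomorphic_form_def by blast

lemma form_holo: "c \<in> charts X ==> holo_on (\<lambda>z. u c (chart_inv c z)) (snd c ` fst c)"
  using u unfolding holomorphic_form_def by blast

lemma form_transform: "c \<in> charts X ==> d \<in> charts X ==> x \<in> fst c ==> x \<in> fst d ==>
    u c x = u d x * jac (\<lambda>z. snd d (chart_inv c z)) (snd c x)"
  using u unfolding holomorphic_form_def by blast

end

lemma jac_eq_1_of_id:
  assumes "open D" "z \<in> D" "\<And>w. w \<in> D ==> F w = w" shows "jac F z = 1"
  using jac_cong[OF assms(1,2), of F "\<lambda>w. w"] assms(3) jac_id by metis

text \<open>On the overlap the transition map is the identity, so its Jacobian is 1. This applies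
  above all to charts that differ only in their domains.\<close>

lemma form_restrict:
  assumes u: "holomorphic_form X u" and c: "c \<in> charts X" and d: "d \<in> charts X"
    and x: "x \<in> fst c" "x \<in> fst d" and eq: "\<And>y. y \<in> fst c ==> y \<in> fst d ==> snd c y = snd d y"
  shows "u c x = u d x"
proof -
  define W where "W = fst c \<inter> fst d"
  have W: "openin (ctop X) W" unfolding W_def using chart_openin[OF c] chart_openin[OF d] by auto
  have "jac (\<lambda>z. snd d (chart_inv c z)) (snd c x) = 1"
  proof (rule jac_eq_1_of_id)
    show "open (snd c ` W)" using chart_open_image[OF c W] by (simp add: W_def)
    show "snd c x \<in> snd c ` W" using x by (simp add: W_def)
    fix w assume "w \<in> snd c ` W"
    then obtain y where "y \<in> W" "w = snd c y" by blast
    then show "snd d (chart_inv c w) = w" using chart_inv_left[OF c, of y] eq[of y] by (simp add: W_def)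
  qed
  then show ?thesis using form_transform[OF u c d x] by simp
qed

section \<open>Norms over Borel pieces of charts\<close>

definition pint :: "('a, 'n::finite) chart => 'a set => ('a, 'n) form => ennreal" where
  "pint c A u = (\<integral>\<^sup>+z\<in>snd c ` A. ennreal ((cmod (u c (chart_inv c z)))^2) \<partial>lborel)"

lemma pint_measurable:
  assumes u: "holomorphic_form X u" and c: "c \<in> charts X" and A: "A \<subseteq> fst c" "snd c ` A \<in> sets borel"
  shows "(\<lambda>z. ennreal ((cmod (u c (chart_inv c z)))^2) * indicator (snd c ` A) z) \<in> borel_measurable borel"
  by (rule borel_measurable_indicator_ennreal[OF A(2)])
     (use A(1) in \<open>auto intro!: continuous_on_subset[OF holo_on_continuous[OF form_holo[OF u c]]]\<close>)

text \<open>The Borel subsets of the union of all charts.\<close>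

definition cborel :: "'a complex_space => 'n::finite itself => 'a set => bool" where
  "cborel X _ S \<longleftrightarrow> (\<forall>c\<in>charts X :: ('a, 'n) chart set. snd c ` (fst c \<inter> S) \<in> sets borel)"

lemma transition_image:
  assumes c: "c \<in> charts X" and S: "S \<subseteq> fst c"
  shows "(\<lambda>z. snd d (chart_inv c z)) ` (snd c ` S) = snd d ` S"
  using chart_inv_left[OF c] S by (force simp: image_image subset_iff)

lemma transition_borel:
  fixes c d :: "('a, 'n::finite) chart"
  assumes c: "c \<in> charts X" and d: "d \<in> charts X" and S: "S \<subseteq> fst c \<inter> fst d" "snd c ` S \<in> sets borel"
  shows "snd d ` S \<in> sets borel"
proof -
  define W where "W = fst c \<inter> fst d"
  have W: "openin (ctop X) W" unfolding W_def using chart_openin[OF c] chart_openin[OF d] by auto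
  have oW: "open (snd d ` W)" using chart_open_image[OF d W] by (simp add: W_def)
  define G where "G w = indicator (snd d ` W) w *\<^sub>R snd c (chart_inv d w)" for w
  have "continuous_on (snd d ` W) (\<lambda>w. snd c (chart_inv d w))"
    using holo_map_continuous[OF chart_transition[OF d c]] by (simp add: W_def Int_commute)
  then have Gm: "G \<in> borel_measurable borel" unfolding G_def
    using oW by (intro borel_measurable_continuous_on_indicator) auto
  have "snd d ` S = snd d ` W \<inter> G -` (snd c ` S)"
  proof (intro set_eqI iffI)
    fix w assume "w \<in> snd d ` S"
    then obtain x where "x \<in> S" "w = snd d x" by blast
    moreover from this have "w \<in> snd d ` W" using S(1) by (auto simp: W_def)
    ultimately show "w \<in> snd d ` W \<inter> G -` (snd c ` S)"
      using S(1) chart_inv_left[OF d, of x] by (auto simp: G_def)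
  next
    fix w assume w: "w \<in> snd d ` W \<inter> G -` (snd c ` S)"
    then obtain x where x: "x \<in> W" "w = snd d x" by blast
    then have "snd c x \<in> snd c ` S" using w chart_inv_left[OF d, of x] by (auto simp: W_def G_def)
    then have "x \<in> S" using x S(1) chart_inj[OF c] by (auto simp: W_def inj_on_def)
    then show "w \<in> snd d ` S" using x by blast
  qed
  moreover have "snd d ` W \<inter> G -` (snd c ` S) \<in> sets borel"
    using oW measurable_sets[OF Gm S(2)] by auto
  ultimately show ?thesis by simp
qed

lemma cborelI:
  fixes c :: "('a, 'n::finite) chart"
  assumes c: "c \<in> charts X" and A: "A \<subseteq> fst c" "snd c ` A \<in> sets borel"
  shows "cborel X TYPE('n) A"
  unfolding cborel_def
proof
  fix d :: "('a, 'n) chart" assume d: "d \<in> charts X"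
  have W: "openin (ctop X) (fst c \<inter> fst d)" using chart_openin[OF c] chart_openin[OF d] by auto
  have "snd c ` (fst d \<inter> A) = snd c ` A \<inter> snd c ` (fst c \<inter> fst d)"
  proof -
    have "fst d \<inter> A = A \<inter> (fst c \<inter> fst d)" using A by auto
    then show ?thesis using chart_image_Int[OF c A(1), of "fst c \<inter> fst d"] by simp
  qed
  then have "snd c ` (fst d \<inter> A) \<in> sets borel" using A chart_open_image[OF c W] by auto
  then show "snd d ` (fst d \<inter> A) \<in> sets borel" by (rule transition_borel[OF c d, rotated]) (use A in auto)
qed

lemma cborelD:
  fixes c :: "('a, 'n::finite) chart"
  assumes "cborel X TYPE('n) S" "c \<in> charts X" "S \<subseteq> fst c" shows "snd c ` S \<in> sets borel"
proof -
  have "fst c \<inter> S = S" using assms by auto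
  then show ?thesis using assms unfolding cborel_def by metis
qed

lemma cborel_Int:
  assumes "cborel X TYPE('n::finite) S" "cborel X TYPE('n) T" shows "cborel X TYPE('n) (S \<inter> T)"
  unfolding cborel_def
proof
  fix c :: "('a, 'n) chart" assume c: "c \<in> charts X"
  have "snd c ` (fst c \<inter> (S \<inter> T)) = snd c ` (fst c \<inter> S) \<inter> snd c ` (fst c \<inter> T)"
    using chart_image_Int[OF c, of "fst c \<inter> S" "fst c \<inter> T"] by (simp add: Int_left_commute Int_assoc)
  then show "snd c ` (fst c \<inter> (S \<inter> T)) \<in> sets borel" using assms c unfolding cborel_def by auto
qed

lemma cborel_Diff:
  assumes "cborel X TYPE('n::finite) S" "cborel X TYPE('n) T" shows "cborel X TYPE('n) (S - T)"
  unfolding cborel_def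
proof
  fix c :: "('a, 'n) chart" assume c: "c \<in> charts X"
  have e: "fst c \<inter> (S - T) = (fst c \<inter> S) - (fst c \<inter> T)" by auto
  have "snd c ` (fst c \<inter> (S - T)) = snd c ` (fst c \<inter> S) - snd c ` (fst c \<inter> T)"
    unfolding e by (rule chart_image_Diff[OF c]) auto
  then show "snd c ` (fst c \<inter> (S - T)) \<in> sets borel" using assms c unfolding cborel_def by auto
qed

lemma cborel_open:
  assumes "openin (ctop X) W" shows "cborel X TYPE('n::finite) W"
  unfolding cborel_def
proof
  fix c :: "('a, 'n) chart" assume c: "c \<in> charts X"
  have "openin (ctop X) (fst c \<inter> W)" using chart_openin[OF c] assms by auto
  then show "snd c ` (fst c \<inter> W) \<in> sets borel" using chart_open_image[OF c] by auto
qed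

text \<open>The squared modulus of the Jacobian in the transformation of coefficients is the factor
  in the substitution formula.\<close>

lemma pint_transition:
  fixes c d :: "('a, 'n::finite) chart"
  assumes u: "holomorphic_form X u" and c: "c \<in> charts X" and d: "d \<in> charts X"
    and S: "S \<subseteq> fst c \<inter> fst d" "snd c ` S \<in> sets borel"
  shows "pint c S u = pint d S u"
proof -
  define W where "W = fst c \<inter> fst d"
  have W: "openin (ctop X) W" unfolding W_def using chart_openin[OF c] chart_openin[OF d] by auto
  have Wc: "W \<subseteq> fst c" "W \<subseteq> fst d" by (auto simp: W_def)
  define F where "F z = snd d (chart_inv c z)" for z
  define G where "G w = snd c (chart_inv d w)" for w
  define g where "g w = ennreal ((cmod (u d (chart_inv d w)))^2) * indicator (snd d ` W) w" for w
  have oc: "open (snd c ` W)" "open (snd d ` W)" using chart_open_image[OF c W] chart_open_image[OF d W] Wc by auto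
  have g: "g \<in> borel_measurable borel" unfolding g_def
    by (rule pint_measurable[OF u d Wc(2)]) (use oc in auto)
  have F: "holo_map F (snd c ` W)" unfolding F_def W_def by (rule chart_transition[OF c d])
  have G: "continuous_on (snd d ` W) G" unfolding G_def
    using holo_map_continuous[OF chart_transition[OF d c]] by (simp add: W_def Int_commute)
  have FW: "F ` (snd c ` W) = snd d ` W" unfolding F_def by (rule transition_image[OF c Wc(1)])
  have FS: "F ` (snd c ` S) = snd d ` S" unfolding F_def by (rule transition_image[OF c]) (use S in auto)
  have GF: "G (F z) = z" if "z \<in> snd c ` W" for z
    using that Wc chart_inv_left[OF c] chart_inv_left[OF d] by (auto simp: F_def G_def subset_iff)
  have "pint d S u = (\<integral>\<^sup>+w\<in>F ` (snd c ` S). g w \<partial>lborel)"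
    unfolding pint_def FS by (intro nn_integral_cong) (use S in \<open>auto simp: g_def indicator_def W_def\<close>)
  also have "... = (\<integral>\<^sup>+z\<in>snd c ` S. g (F z) * ennreal ((cmod (jac F z))^2) \<partial>lborel)"
    by (rule nn_integral_holomorphic_substitution[OF oc(1) F oc(2) FW GF G _ S(2) g]) (use S in \<open>auto simp: W_def\<close>)
  also have "... = pint c S u" unfolding pint_def
  proof (intro nn_integral_cong)
    fix z
    have "g (F z) * ennreal ((cmod (jac F z))^2) = ennreal ((cmod (u c (chart_inv c z)))^2)" if z: "z \<in> snd c ` S"
    proof -
      obtain x where x: "x \<in> S" "z = snd c x" using z by blast
      have xW: "x \<in> W" using x S by (auto simp: W_def)
      have Fz: "F z = snd d x" "chart_inv c z = x" "chart_inv d (snd d x) = x"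
        using xW Wc chart_inv_left[OF c] chart_inv_left[OF d] x(2) by (auto simp: F_def subset_iff)
      have "u c x = u d x * jac F z"
        using form_transform[OF u c d, of x] xW x(2) by (simp add: W_def F_def[abs_def])
      then show ?thesis using xW by (simp add: g_def Fz norm_mult power_mult_distrib ennreal_mult')
    qed
    then show "g (F z) * ennreal ((cmod (jac F z))^2) * indicator (snd c ` S) z
        = ennreal ((cmod (u c (chart_inv c z)))^2) * indicator (snd c ` S) z"
      by (auto simp: indicator_def)
  qed
  finally show ?thesis by simp
qed

lemma pint_mono: "A \<subseteq> B ==> pint c A u \<le> pint c B u"
  unfolding pint_def by (intro nn_integral_mono) (auto simp: indicator_def)

lemma pint_empty [simp]: "pint c {} u = 0"
  by (simp add: pint_def)

lemma pint_suminf: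
  fixes c :: "('a, 'n::finite) chart"
  assumes u: "holomorphic_form X u" and c: "c \<in> charts X"
    and A: "\<And>l::nat. A l \<subseteq> fst c" "\<And>l. snd c ` A l \<in> sets borel" and disj: "disjoint_family A"
  shows "pint c (\<Union>l. A l) u = (\<Sum>l. pint c (A l) u)"
proof -
  have U: "(\<Union>l. A l) \<subseteq> fst c" "snd c ` (\<Union>l. A l) \<in> sets borel"
    using A by (auto simp: image_UN)
  define w where "w z = ennreal ((cmod (u c (chart_inv c z)))^2) * indicator (snd c ` (\<Union>l. A l)) z" for z
  have wm: "w \<in> borel_measurable borel" unfolding w_def by (rule pint_measurable[OF u c U])
  have e: "pint c B u = emeasure (density lborel w) (snd c ` B)" if "B \<subseteq> (\<Union>l. A l)" "snd c ` B \<in> sets borel" for B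
  proof -
    have "snd c ` B \<subseteq> snd c ` (\<Union>l. A l)" using that(1) by (rule image_mono)
    then have "w z * indicator (snd c ` B) z = ennreal ((cmod (u c (chart_inv c z)))^2) * indicator (snd c ` B) z" for z
    proof (cases "z \<in> snd c ` B")
      case True
      then have "z \<in> snd c ` (\<Union>l. A l)" using \<open>snd c ` B \<subseteq> snd c ` (\<Union>l. A l)\<close> by blast
      then show ?thesis by (simp add: w_def)
    qed simp
    then show ?thesis unfolding pint_def using wm that(2) by (subst emeasure_density) auto
  qed
  have "disjoint_family (\<lambda>l. snd c ` A l)"
    using disj A(1) chart_inj[OF c] unfolding disjoint_family_on_def inj_on_def by blast
  then have "(\<Sum>l. emeasure (density lborel w) (snd c ` A l)) = emeasure (density lborel w) (\<Union>l. snd c ` A l)"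
    using A(2) by (intro suminf_emeasure) auto
  moreover have "(\<Sum>l. pint c (A l) u) = (\<Sum>l. emeasure (density lborel w) (snd c ` A l))"
    by (intro suminf_cong e) (use A in auto)
  ultimately show ?thesis using e[OF order_refl U(2)] by (simp add: image_UN)
qed

lemma suminf_swap_ennreal:
  fixes f :: "nat => nat => ennreal"
  shows "(\<Sum>k. \<Sum>l. f k l) = (\<Sum>l. \<Sum>k. f k l)"
  using nn_integral_suminf[of "\<lambda>l k. f k l" "count_space UNIV"]
  by (simp add: nn_integral_count_space_nat)

text \<open>A \<open>chart_partition\<close> without the covering condition, so that it can be cut
  down to a subset and compared with other families on the same union.\<close>

definition chart_family :: "'a complex_space => (nat => ('a, 'n::finite) chart \<times> 'a set) => bool" where
  "chart_family X P \<longleftrightarrow>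
    (\<forall>k. fst (P k) \<in> charts X \<and> snd (P k) \<subseteq> fst (fst (P k)) \<and> snd (fst (P k)) ` snd (P k) \<in> sets borel) \<and>
    disjoint_family (\<lambda>k. snd (P k))"

definition fint :: "(nat => ('a, 'n::finite) chart \<times> 'a set) => ('a, 'n) form => ennreal" where
  "fint P u = (\<Sum>k. pint (fst (P k)) (snd (P k)) u)"

lemma chart_partition_iff:
  fixes P :: "nat => ('a, 'n::finite) chart \<times> 'a set"
  shows "chart_partition X P \<longleftrightarrow> chart_family X P \<and> (\<Union>k. snd (P k)) = \<Union>(fst ` (charts X :: ('a, 'n) chart set))"
  unfolding chart_partition_def chart_family_def by (auto simp: split_beta)

lemma chart_familyD:
  assumes "chart_family X P"
  shows "fst (P k) \<in> charts X" "snd (P k) \<subseteq> fst (fst (P k))" "snd (fst (P k)) ` snd (P k) \<in> sets borel"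
    "disjoint_family (\<lambda>k. snd (P k))"
  using assms by (auto simp: chart_family_def)

text \<open>Both sums are refined to the pairwise intersections of the pieces; on an intersection
  the two charts give the same value, and the order of summation is exchanged.\<close>

lemma fint_family_independent:
  fixes P Q :: "nat => ('a, 'n::finite) chart \<times> 'a set"
  assumes u: "holomorphic_form X u" and P: "chart_family X P" and Q: "chart_family X Q"
    and U: "(\<Union>k. snd (P k)) = (\<Union>k. snd (Q k))"
  shows "fint P u = fint Q u"
proof -
  note Pd = chart_familyD[OF P] and Qd = chart_familyD[OF Q]
  have cb: "cborel X TYPE('n) (snd (P k) \<inter> snd (Q l))" for k l
    by (intro cborel_Int cborelI[OF Pd(1,2,3)] cborelI[OF Qd(1,2,3)])
  have b1: "snd (fst (P k)) ` (snd (P k) \<inter> snd (Q l)) \<in> sets borel" for k l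
    by (rule cborelD[OF cb Pd(1)]) (use Pd(2)[of k] in blast)
  have b2: "snd (fst (Q l)) ` (snd (P k) \<inter> snd (Q l)) \<in> sets borel" for k l
    by (rule cborelD[OF cb Qd(1)]) (use Qd(2)[of l] in blast)
  have 1: "pint (fst (P k)) (snd (P k)) u = (\<Sum>l. pint (fst (P k)) (snd (P k) \<inter> snd (Q l)) u)" for k
  proof -
    have "snd (P k) = (\<Union>l. snd (P k) \<inter> snd (Q l))" using U by blast
    then have "pint (fst (P k)) (snd (P k)) u = pint (fst (P k)) (\<Union>l. snd (P k) \<inter> snd (Q l)) u" by simp
    also have "... = (\<Sum>l. pint (fst (P k)) (snd (P k) \<inter> snd (Q l)) u)"
      by (rule pint_suminf[OF u Pd(1)])
         (use Pd(2)[of k] b1 in \<open>auto intro: disjoint_family_subset[OF Qd(4)]\<close>)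
    finally show ?thesis .
  qed
  have 2: "pint (fst (Q l)) (snd (Q l)) u = (\<Sum>k. pint (fst (Q l)) (snd (P k) \<inter> snd (Q l)) u)" for l
  proof -
    have "snd (Q l) = (\<Union>k. snd (P k) \<inter> snd (Q l))" using U by blast
    then have "pint (fst (Q l)) (snd (Q l)) u = pint (fst (Q l)) (\<Union>k. snd (P k) \<inter> snd (Q l)) u" by simp
    also have "... = (\<Sum>k. pint (fst (Q l)) (snd (P k) \<inter> snd (Q l)) u)"
      by (rule pint_suminf[OF u Qd(1)])
         (use Qd(2)[of l] b2 in \<open>auto intro: disjoint_family_subset[OF Pd(4)]\<close>)
    finally show ?thesis .
  qed
  have 3: "pint (fst (P k)) (snd (P k) \<inter> snd (Q l)) u = pint (fst (Q l)) (snd (P k) \<inter> snd (Q l)) u" for k l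
    by (rule pint_transition[OF u Pd(1) Qd(1)]) (use Pd(2)[of k] Qd(2)[of l] b1 in auto)
  show ?thesis unfolding fint_def 1 2 3 by (rule suminf_swap_ennreal)
qed

lemma chart_family_Int:
  fixes P :: "nat => ('a, 'n::finite) chart \<times> 'a set"
  assumes P: "chart_family X P" and S: "cborel X TYPE('n) S"
  shows "chart_family X (\<lambda>k. (fst (P k), snd (P k) \<inter> S))"
proof -
  note Pd = chart_familyD[OF P]
  have "snd (fst (P k)) ` (snd (P k) \<inter> S) \<in> sets borel" for k
    by (rule cborelD[OF cborel_Int[OF cborelI[OF Pd(1,2,3)] S] Pd(1)]) (use Pd(2)[of k] in blast)
  moreover have "disjoint_family (\<lambda>k. snd (P k) \<inter> S)" by (rule disjoint_family_subset[OF Pd(4)]) auto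
  ultimately show ?thesis using Pd(1,2) unfolding chart_family_def by auto
qed

lemma pint_le_fint:
  fixes P :: "nat => ('a, 'n::finite) chart \<times> 'a set"
  assumes u: "holomorphic_form X u" and P: "chart_family X P"
    and c: "c \<in> charts X" and A: "A \<subseteq> fst c" "snd c ` A \<in> sets borel" "A \<subseteq> (\<Union>k. snd (P k))"
  shows "pint c A u \<le> fint P u"
proof -
  define Q where "Q k = (c, if k = 0 then A else {})" for k :: nat
  have Q: "chart_family X Q" using c A by (auto simp: chart_family_def Q_def disjoint_family_on_def)
  have "pint c A u = fint Q u"
  proof -
    have "fint Q u = (\<Sum>k\<in>{0}. pint (fst (Q k)) (snd (Q k)) u)"
      unfolding fint_def by (rule suminf_finite) (auto simp: Q_def)
    then show ?thesis by (simp add: Q_def)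
  qed
  also have "... = fint (\<lambda>k. (fst (P k), snd (P k) \<inter> A)) u"
    by (rule fint_family_independent[OF u Q chart_family_Int[OF P cborelI[OF c A(1,2)]]])
       (use A(3) in \<open>auto simp: Q_def split: if_splits\<close>)
  also have "... \<le> fint P u"
    unfolding fint_def by (intro suminf_le) (auto intro: pint_mono)
  finally show ?thesis .
qed

text \<open>Second countability leaves countably many basic open sets that fit into a member of
  \<open>\<C>\<close>; one member for each of them still covers, and subtracting the earlier domains
  makes the pieces disjoint.\<close>

lemma chart_partition_subordinate:
  fixes \<C> :: "('a, 'n::finite) chart set"
  assumes sc: "second_countable (ctop X)" and sh: "function_sheaf X" and C: "\<C> \<subseteq> charts X"
    and cov: "\<Union>(fst ` \<C>) = \<Union>(fst ` (charts X :: ('a, 'n) chart set))"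
  obtains P where "chart_partition X P" "\<And>k. fst (P k) \<in> \<C> \<or> snd (P k) = {}"
proof -
  from sc[unfolded second_countable_def]
  obtain \<B> where B1: "countable \<B>" and B2: "\<forall>U x. openin (ctop X) U \<and> x \<in> U \<longrightarrow> (\<exists>V\<in>\<B>. x \<in> V \<and> V \<subseteq> U)"
    by (elim exE conjE)
  have B3: "\<exists>V\<in>\<B>. x \<in> V \<and> V \<subseteq> U" if "openin (ctop X) U" "x \<in> U" for U x
    using B2 that by blast
  \<comment> \<open>Keeps the enumerated set nonempty when there are no charts; its piece is empty,
    which is the second alternative in the claim.\<close>
  define e0 where "e0 = (({}, undefined) :: ('a, 'n) chart)"
  define pick where "pick V = (SOME c. c \<in> \<C> \<and> V \<subseteq> fst c)" for V
  define E where "E = insert e0 (pick ` {V \<in> \<B>. \<exists>c\<in>\<C>. V \<subseteq> fst c})"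
  have pick: "pick V \<in> \<C> \<and> V \<subseteq> fst (pick V)" if "\<exists>c\<in>\<C>. V \<subseteq> fst c" for V
    unfolding pick_def by (rule someI_ex) (use that in blast)
  have cE: "countable E" "E ~= {}" unfolding E_def using B1 by auto
  define f where "f = from_nat_into E"
  have fE: "range f = E" unfolding f_def using cE by (simp add: range_from_nat_into)
  have Ec: "E \<subseteq> insert e0 \<C>" using pick unfolding E_def by blast
  have e0: "e0 \<in> charts X" unfolding e0_def by (rule empty_chart[OF sh])
  have fk: "f k = e0 \<or> f k \<in> \<C>" for k
  proof -
    have "f k \<in> E" unfolding fE[symmetric] by (rule rangeI)
    then show ?thesis using Ec by blast
  qed
  have fc: "f k \<in> charts X" for k using fk[of k] C e0 by auto
  have Ecov: "\<Union>(fst ` E) = \<Union>(fst ` (charts X :: ('a, 'n) chart set))"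
  proof
    show "\<Union>(fst ` E) \<subseteq> \<Union>(fst ` (charts X :: ('a, 'n) chart set))"
      unfolding fE[symmetric] using fc by auto
    show "\<Union>(fst ` (charts X :: ('a, 'n) chart set)) \<subseteq> \<Union>(fst ` E)"
    proof
      fix x assume "x \<in> \<Union>(fst ` (charts X :: ('a, 'n) chart set))"
      then obtain c where c: "c \<in> \<C>" "x \<in> fst c" using cov by blast
      moreover from this have "openin (ctop X) (fst c)" using C by (intro chart_openin) auto
      ultimately obtain V where V: "V \<in> \<B>" "x \<in> V" "V \<subseteq> fst c" using B3 by blast
      have ex: "\<exists>c\<in>\<C>. V \<subseteq> fst c" using V c by blast
      have "pick V \<in> E" unfolding E_def by (rule insertI2, rule imageI) (use V(1) ex in simp)
      moreover have "V \<subseteq> fst (pick V)" using pick[OF ex] by simp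
      ultimately show "x \<in> \<Union>(fst ` E)" using V(2) by blast
    qed
  qed
  define A where "A k = fst (f k) - (\<Union>j<k. fst (f j))" for k
  define P where "P k = (f k, A k)" for k
  have fam: "chart_family X P"
    unfolding chart_family_def
  proof (intro conjI allI)
    fix k
    have "cborel X TYPE('n) (fst (f k) - (\<Union>j<k. fst (f j)))"
      by (intro cborel_Diff cborel_open openin_Union) (use chart_openin[OF fc] in auto)
    then show "snd (fst (P k)) ` snd (P k) \<in> sets borel"
      using cborelD[OF _ fc[of k]] by (simp add: P_def A_def)
  next
    have "A i \<inter> A j = {}" if "i < j" for i j using that by (auto simp: A_def)
    then show "disjoint_family (\<lambda>k. snd (P k))"
      unfolding disjoint_family_on_def P_def snd_conv by (metis Int_commute linorder_neqE_nat)
  qed (auto simp: P_def A_def fc)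
  have "(\<Union>k. A k) = (\<Union>k. fst (f k))"
  proof
    show "(\<Union>k. fst (f k)) \<subseteq> (\<Union>k. A k)"
    proof
      fix x assume "x \<in> (\<Union>k. fst (f k))"
      then have ex: "\<exists>k. x \<in> fst (f k)" by blast
      define k where "k = (LEAST k. x \<in> fst (f k))"
      have "x \<in> fst (f k)" unfolding k_def using ex by (rule LeastI_ex)
      moreover have "x \<notin> fst (f j)" if "j < k" for j using that not_less_Least unfolding k_def by blast
      ultimately show "x \<in> (\<Union>k. A k)" by (auto simp: A_def)
    qed
  qed (auto simp: A_def)
  also have "... = \<Union>(fst ` E)" using fE by auto
  finally have "chart_partition X P"
    unfolding chart_partition_iff using fam Ecov by (simp add: P_def)
  moreover have "fst (P k) \<in> \<C> \<or> snd (P k) = {}" for k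
  proof -
    show ?thesis using fk[of k] by (auto simp: P_def A_def e0_def)
  qed
  ultimately show ?thesis using that by blast
qed

section \<open>The Hilbert space of square integrable forms\<close>

context function_hilbert_space
begin

lemma Re_ip: "f \<in> H ==> g \<in> H ==>
    Re (ip f g) = (sqn (\<lambda>i j. f i j + g i j) - sqn f - sqn g) / 2"
  using add_mem[of f g] ip_cnj[of f g] by (simp add: sqn_def ip_add ip_add_right)

lemma Im_ip: "f \<in> H ==> g \<in> H ==> Im (ip f g) = Re (ip f (\<lambda>i j. \<i> * g i j))"
  by (simp add: ip_scale_right)

end

text \<open>Polarization recovers inner products from norms, so for extensions
  (\<open>\<kappa> = 1\<close>) and pull-backs (\<open>\<kappa> = m\<close>) only nonnegative
  integrals have to be transformed.\<close>

lemma polarization_transfer: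
  assumes H: "function_hilbert_space H ip" and H': "function_hilbert_space H' ip'"
    and T: "\<And>f. f \<in> H ==> T f \<in> H'"
      "\<And>f g. f \<in> H ==> g \<in> H ==> T (\<lambda>i j. f i j + g i j) = (\<lambda>i j. T f i j + T g i j)"
      "\<And>f c. f \<in> H ==> T (\<lambda>i j. c * f i j) = (\<lambda>i j. c * T f i j)"
    and N: "\<And>f. f \<in> H ==> Re (ip' (T f) (T f)) = \<kappa> * Re (ip f f)"
    and f: "f \<in> H" and g: "g \<in> H"
  shows "ip' (T f) (T g) = of_real \<kappa> * ip f g"
proof -
  interpret H: function_hilbert_space H ip by fact
  interpret H': function_hilbert_space H' ip' by fact
  have N': "H'.sqn (T f) = \<kappa> * H.sqn f" if "f \<in> H" for f
    using N[OF that] by (simp add: H.sqn_def H'.sqn_def)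
  have R: "Re (ip' (T f) (T g)) = \<kappa> * Re (ip f g)" if f: "f \<in> H" and g: "g \<in> H" for f g
  proof -
    have "H'.sqn (\<lambda>i j. T f i j + T g i j) = \<kappa> * H.sqn (\<lambda>i j. f i j + g i j)"
      using N'[OF H.add_mem[OF f g]] T(2)[OF f g] by simp
    then show ?thesis
      unfolding H.Re_ip[OF f g] H'.Re_ip[OF T(1)[OF f] T(1)[OF g]] N'[OF f] N'[OF g] by (simp add: algebra_simps)
  qed
  have "Im (ip' (T f) (T g)) = \<kappa> * Im (ip f g)"
    using H.Im_ip[OF f g] H'.Im_ip[OF T(1)[OF f] T(1)[OF g]] R[OF f H.scale_mem[OF g, of \<i>]] T(3)[OF g, of \<i>] by simp
  then show ?thesis using R[OF f g] by (simp add: complex_eq_iff)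
qed

lemma holomorphic_form_add:
  fixes p q :: "('a, 'n::finite) form"
  assumes "holomorphic_form X p" "holomorphic_form X q"
  shows "holomorphic_form X (\<lambda>c x. p c x + q c x)"
  unfolding holomorphic_form_def
proof (intro conjI ballI allI impI)
  fix c :: "('a, 'n) chart" and x assume "\<not> (c \<in> charts X \<and> x \<in> fst c)"
  then show "p c x + q c x = 0" using form_zero[OF assms(1), of c x] form_zero[OF assms(2), of c x] by simp
next
  fix c :: "('a, 'n) chart" assume c: "c \<in> charts X"
  show "holo_on (\<lambda>z. p c (chart_inv c z) + q c (chart_inv c z)) (snd c ` fst c)"
    by (rule holo_on_add[OF form_holo[OF assms(1) c] form_holo[OF assms(2) c]])
  fix d :: "('a, 'n) chart" and x assume "d \<in> charts X" "x \<in> fst c \<inter> fst d"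
  then show "p c x + q c x = (p d x + q d x) * jac (\<lambda>z. snd d (chart_inv c z)) (snd c x)"
    using form_transform[OF assms(1) c, of d x] form_transform[OF assms(2) c, of d x] by (simp add: distrib_right)
qed

lemma holomorphic_form_scale:
  fixes p :: "('a, 'n::finite) form"
  assumes "holomorphic_form X p"
  shows "holomorphic_form X (\<lambda>c x. k * p c x)"
  unfolding holomorphic_form_def
proof (intro conjI ballI allI impI)
  fix c :: "('a, 'n) chart" and x assume "\<not> (c \<in> charts X \<and> x \<in> fst c)"
  then show "k * p c x = 0" using form_zero[OF assms, of c x] by simp
next
  fix c :: "('a, 'n) chart" assume c: "c \<in> charts X"
  show "holo_on (\<lambda>z. k * p c (chart_inv c z)) (snd c ` fst c)"
    by (rule holo_on_mult[OF holo_on_const form_holo[OF assms c]])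
  fix d :: "('a, 'n) chart" and x assume "d \<in> charts X" "x \<in> fst c \<inter> fst d"
  then show "k * p c x = k * p d x * jac (\<lambda>z. snd d (chart_inv c z)) (snd c x)"
    using form_transform[OF assms c, of d x] by simp
qed

lemma holomorphic_form_diff:
  assumes "holomorphic_form X p" "holomorphic_form X q" shows "holomorphic_form X (fdiff p q)"
  using holomorphic_form_add[OF assms(1) holomorphic_form_scale[OF assms(2), of "-1"]] by (simp add: fdiff_def)

lemma holomorphic_form_0: "holomorphic_form X (\<lambda>c x. 0)"
  by (simp add: holomorphic_form_def holo_on_const)

lemma cmod_add_squared_le: "(cmod (a + b))^2 \<le> 2 * (cmod a)^2 + 2 * (cmod b)^2"
proof -
  have "(cmod (a + b))^2 \<le> (cmod a + cmod b)^2" by (intro power_mono norm_triangle_ineq) auto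
  also have "... \<le> 2 * (cmod a)^2 + 2 * (cmod b)^2"
    using sum_squares_bound[of "cmod a" "cmod b"] by (simp add: power2_sum)
  finally show ?thesis .
qed

lemma fint_add_le:
  assumes P: "chart_family X P" and p: "holomorphic_form X p" and q: "holomorphic_form X q"
  shows "fint P (\<lambda>c x. p c x + q c x) \<le> 2 * fint P p + 2 * fint P q"
proof -
  note Pd = chart_familyD[OF P]
  have "pint (fst (P k)) (snd (P k)) (\<lambda>c x. p c x + q c x)
      \<le> 2 * pint (fst (P k)) (snd (P k)) p + 2 * pint (fst (P k)) (snd (P k)) q" for k
  proof -
    let ?c = "fst (P k)" and ?A = "snd (fst (P k)) ` snd (P k)"
    let ?f = "\<lambda>p z. ennreal ((cmod (p ?c (chart_inv ?c z)))^2) * indicator ?A z"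
    have m: "?f p \<in> borel_measurable lborel" "?f q \<in> borel_measurable lborel"
      using pint_measurable[OF p Pd(1,2,3)] pint_measurable[OF q Pd(1,2,3)] by auto
    have "pint ?c (snd (P k)) (\<lambda>c x. p c x + q c x) \<le> (\<integral>\<^sup>+z. 2 * ?f p z + 2 * ?f q z \<partial>lborel)"
      unfolding pint_def
    proof (intro nn_integral_mono)
      fix z
      let ?a = "p ?c (chart_inv ?c z)" and ?b = "q ?c (chart_inv ?c z)"
      have "ennreal ((cmod (?a + ?b))^2) \<le> ennreal (2 * (cmod ?a)^2 + 2 * (cmod ?b)^2)"
        by (rule ennreal_leI[OF cmod_add_squared_le])
      also have "... = 2 * ennreal ((cmod ?a)^2) + 2 * ennreal ((cmod ?b)^2)"
        by (simp add: ennreal_mult)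
      finally show "ennreal ((cmod (?a + ?b))^2) * indicator ?A z \<le> 2 * ?f p z + 2 * ?f q z"
        by (auto simp: indicator_def)
    qed
    also have "... = 2 * (\<integral>\<^sup>+z. ?f p z \<partial>lborel) + 2 * (\<integral>\<^sup>+z. ?f q z \<partial>lborel)"
      using m by (subst nn_integral_add) (auto simp: nn_integral_cmult)
    finally show ?thesis by (simp add: pint_def)
  qed
  then have "fint P (\<lambda>c x. p c x + q c x) \<le> (\<Sum>k. 2 * pint (fst (P k)) (snd (P k)) p + 2 * pint (fst (P k)) (snd (P k)) q)"
    unfolding fint_def by (intro suminf_le) auto
  also have "... = (\<Sum>k. 2 * pint (fst (P k)) (snd (P k)) p) + (\<Sum>k. 2 * pint (fst (P k)) (snd (P k)) q)"
    by (rule suminf_add[symmetric]) auto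
  also have "... = 2 * fint P p + 2 * fint P q" unfolding fint_def by simp
  finally show ?thesis .
qed

lemma fint_scale:
  assumes P: "chart_family X P" and p: "holomorphic_form X p"
  shows "fint P (\<lambda>c x. k * p c x) = ennreal ((cmod k)^2) * fint P p"
proof -
  note Pd = chart_familyD[OF P]
  have "pint (fst (P i)) (snd (P i)) (\<lambda>c x. k * p c x) = ennreal ((cmod k)^2) * pint (fst (P i)) (snd (P i)) p" for i
    unfolding pint_def using pint_measurable[OF p Pd(1,2,3)]
    by (subst nn_integral_cmult[symmetric]) (auto simp: norm_mult power_mult_distrib ennreal_mult' mult.assoc)
  then show ?thesis unfolding fint_def by simp
qed

locale form_space =
  fixes X :: "'a complex_space" and dim :: "'n::finite itself"
  assumes second_countable: "second_countable (ctop X)" and sheaf: "function_sheaf X"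
begin

definition P :: "nat => ('a, 'n) chart \<times> 'a set" where "P = pieces X"

lemma P_partition: "chart_partition X P"
proof -
  obtain Q :: "nat => ('a, 'n) chart \<times> 'a set" where "chart_partition X Q"
    using chart_partition_subordinate[OF second_countable sheaf order_refl refl] by metis
  then show ?thesis unfolding P_def pieces_def by (rule someI[of "chart_partition X"])
qed

lemma P_family: "chart_family X P" and P_Union: "(\<Union>k. snd (P k)) = \<Union>(fst ` (charts X :: ('a, 'n) chart set))"
  using P_partition by (auto simp: chart_partition_iff)

lemmas Pd = chart_familyD[OF P_family]

text \<open>The factor \<open>2 ^ CARD('n)\<close> of the volume form is left out here and restored
  in \<open>Re_A2_inner_self\<close>.\<close>

definition sqnorm :: "('a, 'n) form => ennreal" where "sqnorm p = fint P p"

text \<open>Extension by 0 off the piece turns integrals over pieces into integrals over the whole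
  coordinate space.\<close>

definition loc :: "('a, 'n) form => nat => complex^'n => complex" where
  "loc p k z = indicator (snd (fst (P k)) ` snd (P k)) z *\<^sub>R p (fst (P k)) (chart_inv (fst (P k)) z)"

lemma loc_measurable:
  assumes "holomorphic_form X p" shows "loc p k \<in> borel_measurable borel"
  unfolding loc_def
  by (rule borel_measurable_continuous_on_indicator[OF Pd(3)])
     (use Pd(2)[of k] in \<open>auto intro!: continuous_on_subset[OF holo_on_continuous[OF form_holo[OF assms Pd(1)]]]\<close>)

lemma pint_loc: "pint (fst (P k)) (snd (P k)) p = (\<integral>\<^sup>+z. ennreal ((cmod (loc p k z))^2) \<partial>lborel)"
  unfolding pint_def by (intro nn_integral_cong) (auto simp: loc_def indicator_def)

lemma sqnorm_loc: "sqnorm p = (\<Sum>k. \<integral>\<^sup>+z. ennreal ((cmod (loc p k z))^2) \<partial>lborel)"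
  unfolding sqnorm_def fint_def pint_loc ..

lemma abs_integral_form_sqnorm:
  assumes p: "holomorphic_form X p"
  shows "abs_integral_form X (\<lambda>c x. p c x * cnj (p c x)) = sqnorm p * 2 ^ CARD('n)"
proof -
  have e: "ennreal (2 ^ CARD('n)) = 2 ^ CARD('n)" by (simp flip: ennreal_power)
  have "(\<integral>\<^sup>+z\<in>snd c ` A. ennreal (norm (p c (chart_inv c z) * cnj (p c (chart_inv c z))) * 2 ^ CARD('n)) \<partial>lborel)
      = pint c A p * 2 ^ CARD('n)" if cA: "P k = (c, A)" for k c A
  proof -
    have m: "(\<lambda>z. ennreal ((cmod (p c (chart_inv c z)))^2) * indicator (snd c ` A) z) \<in> borel_measurable lborel"
      using pint_measurable[OF p Pd(1,2,3), of k] cA by simp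
    have "(\<integral>\<^sup>+z\<in>snd c ` A. ennreal (norm (p c (chart_inv c z) * cnj (p c (chart_inv c z))) * 2 ^ CARD('n)) \<partial>lborel)
      = (\<integral>\<^sup>+z. ennreal ((cmod (p c (chart_inv c z)))^2) * indicator (snd c ` A) z * ennreal (2 ^ CARD('n)) \<partial>lborel)"
      by (intro nn_integral_cong) (auto simp: norm_mult power2_eq_square indicator_def ennreal_mult)
    also have "... = pint c A p * ennreal (2 ^ CARD('n))"
      unfolding pint_def by (rule nn_integral_multc[OF m])
    finally show ?thesis by (simp only: e)
  qed
  then have "abs_integral_form X (\<lambda>c x. p c x * cnj (p c x)) = (\<Sum>k. pint (fst (P k)) (snd (P k)) p * 2 ^ CARD('n))"
    unfolding abs_integral_form_def P_def[symmetric] by (intro suminf_cong) (auto split: prod.split)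
  then show ?thesis unfolding sqnorm_def fint_def by simp
qed

lemma A2_iff: "p \<in> A2 X \<longleftrightarrow> holomorphic_form X p \<and> sqnorm p < \<infinity>" for p :: "('a, 'n) form"
proof -
  have "(2::ennreal) ^ CARD('n) ~= top" by (simp add: power_eq_top_ennreal)
  then have "sqnorm p * 2 ^ CARD('n) < \<infinity> \<longleftrightarrow> sqnorm p < \<infinity>"
    by (auto simp: ennreal_mult_less_top less_top[symmetric] ennreal_mult_eq_top_iff)
  then show ?thesis unfolding A2_def using abs_integral_form_sqnorm[of p] by auto
qed

lemma A2_form: "p \<in> A2 X ==> holomorphic_form X p" for p :: "('a, 'n) form"
  by (simp add: A2_iff)

definition sq :: "('a, 'n) form => nat => real" where "sq p k = (\<integral>z. (cmod (loc p k z))^2 \<partial>lborel)"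
definition pr :: "('a, 'n) form => ('a, 'n) form => nat => complex" where
  "pr p q k = (\<integral>z. loc p k z * cnj (loc q k z) \<partial>lborel)"

lemma sq_facts:
  assumes "p \<in> A2 X"
  shows "integrable lborel (\<lambda>z. (cmod (loc p k z))^2)" and "sq p k \<ge> 0"
    and "(\<integral>\<^sup>+z. ennreal ((cmod (loc p k z))^2) \<partial>lborel) = ennreal (sq p k)"
    and "summable (sq p)" and "sqnorm p = ennreal (\<Sum>k. sq p k)"
proof -
  have m: "loc p k \<in> borel_measurable borel" for k by (rule loc_measurable[OF A2_form[OF assms]])
  have fin: "sqnorm p < \<infinity>" using assms by (simp add: A2_iff)
  have f: "(\<integral>\<^sup>+z. ennreal ((cmod (loc p k z))^2) \<partial>lborel) < \<infinity>" for k
  proof -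
    have "(\<integral>\<^sup>+z. ennreal ((cmod (loc p k z))^2) \<partial>lborel) \<le> sqnorm p"
      unfolding sqnorm_loc using sum_le_suminf[of "\<lambda>k. \<integral>\<^sup>+z. ennreal ((cmod (loc p k z))^2) \<partial>lborel" "{k}"] by simp
    then show ?thesis using fin by (rule le_less_trans)
  qed
  have int: "integrable lborel (\<lambda>z. (cmod (loc p k z))^2)" for k
    by (rule integrableI_bounded) (use f[of k] m[of k] in auto)
  then show "integrable lborel (\<lambda>z. (cmod (loc p k z))^2)" .
  have nn: "sq p k \<ge> 0" for k unfolding sq_def by simp
  then show "sq p k \<ge> 0" .
  have e: "(\<integral>\<^sup>+z. ennreal ((cmod (loc p k z))^2) \<partial>lborel) = ennreal (sq p k)" for k
    unfolding sq_def by (rule nn_integral_eq_integral[OF int]) auto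
  then show "(\<integral>\<^sup>+z. ennreal ((cmod (loc p k z))^2) \<partial>lborel) = ennreal (sq p k)" .
  have "(\<Sum>k. ennreal (sq p k)) ~= \<infinity>" using fin unfolding sqnorm_loc e by simp
  then show sm: "summable (sq p)" using nn by (intro summable_suminf_not_top) auto
  show "sqnorm p = ennreal (\<Sum>k. sq p k)" unfolding sqnorm_loc e using nn sm by (rule suminf_ennreal2)
qed

lemma pr_facts:
  assumes "p \<in> A2 X" "q \<in> A2 X"
  shows "integrable lborel (\<lambda>z. loc p k z * cnj (loc q k z))" and "cmod (pr p q k) \<le> sq p k + sq q k"
    and "summable (pr p q)"
proof -
  have m: "loc p k \<in> borel_measurable borel" "loc q k \<in> borel_measurable borel" for k
    using loc_measurable A2_form assms by blast+
  have le: "cmod (a * cnj b) \<le> (cmod a)^2 + (cmod b)^2" for a b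
  proof -
    have "cmod a * cmod b \<le> 2 * (cmod a * cmod b)" by simp
    also have "... \<le> (cmod a)^2 + (cmod b)^2" using sum_squares_bound[of "cmod a" "cmod b"] by simp
    finally show ?thesis by (simp add: norm_mult)
  qed
  have i2: "integrable lborel (\<lambda>z. (cmod (loc p k z))^2 + (cmod (loc q k z))^2)" for k
    using sq_facts(1) assms by (intro Bochner_Integration.integrable_add) auto
  have int: "integrable lborel (\<lambda>z. loc p k z * cnj (loc q k z))" for k
  proof (rule Bochner_Integration.integrable_bound[OF i2[of k]])
    show "(\<lambda>z. loc p k z * cnj (loc q k z)) \<in> borel_measurable lborel"
      using m borel_measurable_continuous_onI[OF continuous_on_cnj[OF continuous_on_id]]
      by (auto intro!: borel_measurable_times measurable_compose[OF m(2)[of k]])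
    show "AE z in lborel. cmod (loc p k z * cnj (loc q k z)) \<le> norm ((cmod (loc p k z))^2 + (cmod (loc q k z))^2)"
      using le by (intro AE_I2) (simp add: order_trans[OF _ abs_ge_self])
  qed
  then show "integrable lborel (\<lambda>z. loc p k z * cnj (loc q k z))" .
  have b: "cmod (pr p q k) \<le> sq p k + sq q k" for k
  proof -
    have "cmod (pr p q k) \<le> (\<integral>z. cmod (loc p k z * cnj (loc q k z)) \<partial>lborel)"
      unfolding pr_def by (rule integral_norm_bound)
    also have "... \<le> (\<integral>z. (cmod (loc p k z))^2 + (cmod (loc q k z))^2 \<partial>lborel)"
      by (rule integral_mono[OF integrable_norm[OF int] i2 le])
    also have "... = sq p k + sq q k" unfolding sq_def
      using sq_facts(1) assms by (intro Bochner_Integration.integral_add) auto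
    finally show ?thesis .
  qed
  then show "cmod (pr p q k) \<le> sq p k + sq q k" .
  show "summable (pr p q)"
    by (rule summable_comparison_test'[of "\<lambda>k. sq p k + sq q k" 0])
       (use b sq_facts(4) assms in \<open>auto intro: summable_add\<close>)
qed

text \<open>The power of \<open>\<i>\<close> in the inner product cancels the one in
  \<open>integral_form\<close>; only the factor \<open>2 ^ CARD('n)\<close> is left.\<close>

lemma A2_inner_pr:
  fixes p q :: "('a, 'n) form"
  assumes "p \<in> A2 X" "q \<in> A2 X"
  shows "A2_inner X p q = 2 ^ CARD('n) * (\<Sum>k. pr p q k)"
proof -
  define C where "C = (2 ^ CARD('n) / \<i> ^ (CARD('n)^2) :: complex)"
  have "(case P k of (c, A) => (LINT z:snd c ` A|lborel. p c (chart_inv c z) * cnj (q c (chart_inv c z)) * 2 ^ CARD('n) / \<i> ^ (CARD('n)^2)))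
      = pr p q k * C" for k
  proof -
    obtain c A where cA: "P k = (c, A)" by (cases "P k")
    have "(LINT z:snd c ` A|lborel. p c (chart_inv c z) * cnj (q c (chart_inv c z)) * 2 ^ CARD('n) / \<i> ^ (CARD('n)^2))
        = (\<integral>z. loc p k z * cnj (loc q k z) * C \<partial>lborel)"
      unfolding set_lebesgue_integral_def
      by (intro Bochner_Integration.integral_cong refl) (auto simp: loc_def cA C_def indicator_def)
    also have "... = pr p q k * C"
      unfolding pr_def by (rule Bochner_Integration.integral_mult_left[OF pr_facts(1)[OF assms]])
    finally show ?thesis using cA by simp
  qed
  then have "integral_form X (\<lambda>c x. p c x * cnj (q c x)) = (\<Sum>k. pr p q k * C)"
    unfolding integral_form_def P_def[symmetric] by simp
  also have "... = (\<Sum>k. pr p q k) * C" by (rule suminf_mult2[symmetric, OF pr_facts(3)[OF assms]])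
  finally show ?thesis unfolding A2_inner_def C_def by simp
qed

lemma Re_A2_inner_self:
  fixes p :: "('a, 'n) form"
  assumes "p \<in> A2 X"
  shows "Re (A2_inner X p p) = 2 ^ CARD('n) * enn2real (sqnorm p)"
proof -
  have "pr p p k = of_real (sq p k)" for k
  proof -
    have "pr p p k = (\<integral>z. complex_of_real ((cmod (loc p k z))^2) \<partial>lborel)"
      unfolding pr_def by (simp only: complex_norm_square)
    then show ?thesis unfolding sq_def by (simp only: integral_complex_of_real)
  qed
  then have "A2_inner X p p = 2 ^ CARD('n) * (\<Sum>k. complex_of_real (sq p k))"
    using A2_inner_pr[OF assms assms] by simp
  also have "(\<Sum>k. complex_of_real (sq p k)) = of_real (\<Sum>k. sq p k)"
    by (rule suminf_of_real[OF sq_facts(4)[OF assms], symmetric])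
  finally have "A2_inner X p p = of_real (2 ^ CARD('n) * (\<Sum>k. sq p k))" by simp
  then have "Re (A2_inner X p p) = 2 ^ CARD('n) * (\<Sum>k. sq p k)" by (metis Re_complex_of_real)
  moreover have "(\<Sum>k. sq p k) \<ge> 0" by (rule suminf_nonneg[OF sq_facts(4)[OF assms]]) (rule sq_facts(2)[OF assms])
  ultimately show ?thesis using sq_facts(5)[OF assms] by simp
qed

lemma A2_add: "p \<in> A2 X ==> q \<in> A2 X ==> (\<lambda>c x. p c x + q c x) \<in> A2 X" for p q :: "('a, 'n) form"
  unfolding A2_iff sqnorm_def
  using holomorphic_form_add[of X p q] fint_add_le[OF P_family, of p q]
  by (auto intro!: le_less_trans[OF fint_add_le[OF P_family]] simp: ennreal_mult_less_top)

lemma A2_scale: "p \<in> A2 X ==> (\<lambda>c x. k * p c x) \<in> A2 X" for p :: "('a, 'n) form"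
  unfolding A2_iff sqnorm_def
  using holomorphic_form_scale[of X p k] fint_scale[OF P_family, of p k] by (auto simp: ennreal_mult_less_top)

lemma A2_fdiff: "p \<in> A2 X ==> q \<in> A2 X ==> fdiff p q \<in> A2 X" for p q :: "('a, 'n) form"
  using A2_add[of p "\<lambda>c x. (-1) * q c x"] A2_scale[of q "-1"] by (simp add: fdiff_def)

lemma A2_0: "(\<lambda>c x. 0 :: complex) \<in> (A2 X :: ('a, 'n) form set)"
  unfolding A2_iff sqnorm_loc using holomorphic_form_0 by (simp add: loc_def)

lemma local_bound:
  fixes p :: "('a, 'n) form"
  assumes p: "holomorphic_form X p" and c: "c \<in> charts X" and r: "r > 0" and b: "ball z r \<subseteq> snd c ` fst c"
  shows "ennreal ((cmod (p c (chart_inv c z)))^2) * emeasure lborel (ball (0::complex^'n) r) \<le> sqnorm p"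
proof -
  define A where "A = fst c \<inter> snd c -` ball z r"
  have A: "snd c ` A = ball z r" "A \<subseteq> fst c" using b by (auto simp: A_def)
  have "ennreal ((cmod (p c (chart_inv c z)))^2) * emeasure lborel (ball (0::complex^'n) r) \<le> pint c A p"
    unfolding pint_def A(1) by (rule L2_point_bound[OF holo_on_subset[OF form_holo[OF p c] b] r])
  also have "... \<le> sqnorm p" unfolding sqnorm_def
    by (rule pint_le_fint[OF p P_family c A(2)]) (use A c P_Union in auto)
  finally show ?thesis .
qed

lemma ball_measure_pos: "r > 0 ==> 0 < measure lborel (ball (0::complex^'n) r)"
  by (rule content_ball_pos)

lemma local_bound_real:
  fixes p :: "('a, 'n) form"
  assumes p: "p \<in> A2 X" and c: "c \<in> charts X" and r: "r > 0" and b: "ball z r \<subseteq> snd c ` fst c"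
  shows "(cmod (p c (chart_inv c z)))^2 * measure lborel (ball (0::complex^'n) r) \<le> enn2real (sqnorm p)"
proof -
  have "emeasure lborel (ball (0::complex^'n) r) = ennreal (measure lborel (ball (0::complex^'n) r))"
    using emeasure_lborel_ball_finite[of "0::complex^'n" r] by (simp add: emeasure_eq_ennreal_measure less_top)
  then have "ennreal ((cmod (p c (chart_inv c z)))^2 * measure lborel (ball (0::complex^'n) r)) \<le> sqnorm p"
    using local_bound[OF A2_form[OF p] c r b] by (simp add: ennreal_mult')
  then have "enn2real (ennreal ((cmod (p c (chart_inv c z)))^2 * measure lborel (ball (0::complex^'n) r))) \<le> enn2real (sqnorm p)"
    by (rule enn2real_mono) (use p in \<open>auto simp: A2_iff\<close>)
  then show ?thesis by simp
qed

lemma A2_eval_bounded: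
  fixes c :: "('a, 'n) chart"
  shows "\<exists>C. \<forall>p\<in>A2 X. (cmod (p c x))^2 \<le> C * Re (A2_inner X p p)"
proof (cases "c \<in> charts X \<and> x \<in> fst c")
  case False
  then have "p c x = 0" if "p \<in> A2 X" for p :: "('a, 'n) form" using form_zero[OF A2_form[OF that]] by blast
  then show ?thesis by (auto intro!: exI[of _ 0])
next
  case True
  then have c: "c \<in> charts X" and x: "x \<in> fst c" by auto
  have "snd c x \<in> snd c ` fst c" using x by blast
  then obtain r where r: "r > 0" "ball (snd c x) r \<subseteq> snd c ` fst c" using openE[OF chart_open_range[OF c]] by blast
  define v where "v = measure lborel (ball (0::complex^'n) r)"
  have v: "v > 0" unfolding v_def by (rule ball_measure_pos[OF r(1)])
  have "(cmod (p c x))^2 \<le> (1 / (v * 2 ^ CARD('n))) * Re (A2_inner X p p)" if p: "p \<in> A2 X" for p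
    using local_bound_real[OF p c r] v x unfolding Re_A2_inner_self[OF p] v_def[symmetric] chart_inv_left[OF c x]
    by (simp add: field_simps)
  then show ?thesis by blast
qed

text \<open>Bounded evaluations, with a bound uniform on small balls, turn a Cauchy sequence in norm
  into a locally uniformly convergent one, so the limit is a holomorphic form. Fatou's lemma, on
  each piece and then for the sum over pieces, gives convergence in norm.\<close>

lemma A2_complete:
  fixes s :: "nat => ('a, 'n) form"
  assumes s: "\<And>n. s n \<in> A2 X"
    and cauchy: "\<And>e. e > 0 ==> \<exists>N. \<forall>m\<ge>N. \<forall>n\<ge>N. Re (A2_inner X (fdiff (s m) (s n)) (fdiff (s m) (s n))) < e"
  shows "\<exists>l\<in>A2 X. (\<lambda>n. Re (A2_inner X (fdiff (s n) l) (fdiff (s n) l))) \<longlonglongrightarrow> 0"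
proof -
  define D where "D m n = enn2real (sqnorm (fdiff (s m) (s n)))" for m n
  have DA: "fdiff (s m) (s n) \<in> A2 X" for m n using A2_fdiff s by blast
  have Dc: "\<exists>N. \<forall>m\<ge>N. \<forall>n\<ge>N. D m n < e" if e: "e > 0" for e
  proof -
    obtain N where N: "\<forall>m\<ge>N. \<forall>n\<ge>N. Re (A2_inner X (fdiff (s m) (s n)) (fdiff (s m) (s n))) < 2 ^ CARD('n) * e"
      using cauchy[of "2 ^ CARD('n) * e"] e by auto
    then show ?thesis unfolding Re_A2_inner_self[OF DA] D_def by (intro exI[of _ N]) simp
  qed
  define l where "l c x = lim (\<lambda>n. s n c x)" for c x
  have loc_unif: "\<exists>r>0. cball z r \<subseteq> snd c ` fst c \<and>
      uniform_limit (cball z r) (\<lambda>n z. s n c (chart_inv c z)) (\<lambda>z. l c (chart_inv c z)) sequentially"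
    if c: "c \<in> charts X" and z: "z \<in> snd c ` fst c" for c z
  proof -
    obtain r0 where r0: "r0 > 0" "cball z r0 \<subseteq> snd c ` fst c"
      using open_contains_cball_eq[OF chart_open_range[OF c]] z by blast
    \<comment> \<open>Half the radius leaves room for a ball of radius \<open>r\<close> around every
      point of \<open>cball z r\<close>.\<close>
    define r where "r = r0 / 2"
    have r: "r > 0" "cball z r \<subseteq> snd c ` fst c" using r0 by (auto simp: r_def)
    define v where "v = measure lborel (ball (0::complex^'n) r)"
    have v: "v > 0" unfolding v_def by (rule ball_measure_pos[OF r(1)])
    have bd: "(cmod (s m c (chart_inv c w) - s n c (chart_inv c w)))^2 * v \<le> D m n" if w: "w \<in> cball z r" for w m n
    proof -
      have "ball w r \<subseteq> snd c ` fst c"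
      proof
        fix y assume "y \<in> ball w r"
        then have "dist z y \<le> r0" using w dist_triangle[of z y w] by (simp add: r_def)
        then show "y \<in> snd c ` fst c" using r0 by auto
      qed
      from local_bound_real[OF DA c r(1) this] show ?thesis by (simp add: fdiff_def D_def v_def)
    qed
    have "uniformly_Cauchy_on (cball z r) (\<lambda>n z. s n c (chart_inv c z))"
      unfolding uniformly_Cauchy_on_def
    proof (intro allI impI)
      fix e :: real assume e: "e > 0"
      obtain N where N: "\<forall>m\<ge>N. \<forall>n\<ge>N. D m n < e^2 * v" using Dc[of "e^2 * v"] e v by auto
      have "dist (s m c (chart_inv c w)) (s n c (chart_inv c w)) < e" if "w \<in> cball z r" "m \<ge> N" "n \<ge> N" for w m n
      proof -
        have "(cmod (s m c (chart_inv c w) - s n c (chart_inv c w)))^2 * v < e^2 * v"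
          using bd[OF that(1), of m n] N that by fastforce
        then have "(cmod (s m c (chart_inv c w) - s n c (chart_inv c w)))^2 < e^2" using v by simp
        then show ?thesis unfolding dist_norm by (rule power2_less_imp_less) (use e in simp)
      qed
      then show "\<exists>M. \<forall>x\<in>cball z r. \<forall>m\<ge>M. \<forall>n\<ge>M. dist (s m c (chart_inv c x)) (s n c (chart_inv c x)) < e" by blast
    qed
    then have "uniformly_convergent_on (cball z r) (\<lambda>n z. s n c (chart_inv c z))"
      by (rule Cauchy_uniformly_convergent)
    then have "uniform_limit (cball z r) (\<lambda>n z. s n c (chart_inv c z)) (\<lambda>z. l c (chart_inv c z)) sequentially"
      unfolding uniformly_convergent_uniform_limit_iff l_def .
    then show ?thesis using r by blast
  qed
  have conv: "(\<lambda>n. s n c x) \<longlonglongrightarrow> l c x" for c x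
  proof (cases "c \<in> charts X \<and> x \<in> fst c")
    case False
    then have "s n c x = 0" for n using form_zero[OF A2_form[OF s]] by blast
    then show ?thesis by (simp add: l_def)
  next
    case True
    then have c: "c \<in> charts X" and x: "x \<in> fst c" by auto
    obtain r where "r > 0" "uniform_limit (cball (snd c x) r) (\<lambda>n z. s n c (chart_inv c z)) (\<lambda>z. l c (chart_inv c z)) sequentially"
      using loc_unif[OF c imageI[OF x]] by blast
    then have "(\<lambda>n. s n c (chart_inv c (snd c x))) \<longlonglongrightarrow> l c (chart_inv c (snd c x))"
      by (intro tendsto_uniform_limitI) auto
    then show ?thesis by (simp add: chart_inv_left[OF c x])
  qed
  have lform: "holomorphic_form X l"
    unfolding holomorphic_form_def
  proof (intro conjI ballI allI impI)
    fix c :: "('a, 'n) chart" and x assume "\<not> (c \<in> charts X \<and> x \<in> fst c)"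
    then have "s n c x = 0" for n using form_zero[OF A2_form[OF s]] by blast
    then show "l c x = 0" using conv[of c x] by (simp add: LIMSEQ_const_iff)
  next
    fix c :: "('a, 'n) chart" assume c: "c \<in> charts X"
    have h: "holo_on (\<lambda>z. s n c (chart_inv c z)) (snd c ` fst c)" for n by (rule form_holo[OF A2_form[OF s] c])
    show "holo_on (\<lambda>z. l c (chart_inv c z)) (snd c ` fst c)"
      by (rule holo_on_uniform_limit[OF chart_open_range[OF c] h loc_unif[OF c]])
    fix d :: "('a, 'n) chart" and x assume d: "d \<in> charts X" and x: "x \<in> fst c \<inter> fst d"
    have "s n c x = s n d x * jac (\<lambda>z. snd d (chart_inv c z)) (snd c x)" for n
      using form_transform[OF A2_form[OF s] c d] x by blast
    then have "(\<lambda>n. s n d x * jac (\<lambda>z. snd d (chart_inv c z)) (snd c x)) \<longlonglongrightarrow> l c x"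
      using conv[of c x] by simp
    moreover have "(\<lambda>n. s n d x * jac (\<lambda>z. snd d (chart_inv c z)) (snd c x)) \<longlonglongrightarrow> l d x * jac (\<lambda>z. snd d (chart_inv c z)) (snd c x)"
      by (intro tendsto_mult conv tendsto_const)
    ultimately show "l c x = l d x * jac (\<lambda>z. snd d (chart_inv c z)) (snd c x)" by (rule LIMSEQ_unique)
  qed
  have fatou: "sqnorm (fdiff (s n) l) \<le> liminf (\<lambda>m. sqnorm (fdiff (s n) (s m)))" for n
  proof -
    let ?u = "\<lambda>m k. \<integral>\<^sup>+z. ennreal ((cmod (loc (fdiff (s n) (s m)) k z))^2) \<partial>lborel"
    have "(\<integral>\<^sup>+z. ennreal ((cmod (loc (fdiff (s n) l) k z))^2) \<partial>lborel) \<le> liminf (\<lambda>m. ?u m k)" for k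
    proof -
      have "ennreal ((cmod (loc (fdiff (s n) l) k z))^2) = liminf (\<lambda>m. ennreal ((cmod (loc (fdiff (s n) (s m)) k z))^2))" for z
      proof -
        have "(\<lambda>m. ennreal ((cmod (loc (fdiff (s n) (s m)) k z))^2)) \<longlonglongrightarrow> ennreal ((cmod (loc (fdiff (s n) l) k z))^2)"
          unfolding loc_def fdiff_def by (intro tendsto_intros tendsto_ennrealI conv)
        from lim_imp_Liminf[OF _ this] show ?thesis by simp
      qed
      then have "(\<integral>\<^sup>+z. ennreal ((cmod (loc (fdiff (s n) l) k z))^2) \<partial>lborel)
          = (\<integral>\<^sup>+z. liminf (\<lambda>m. ennreal ((cmod (loc (fdiff (s n) (s m)) k z))^2)) \<partial>lborel)" by simp
      also have "... \<le> liminf (\<lambda>m. ?u m k)"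
        by (rule nn_integral_liminf) (use loc_measurable[OF A2_form[OF DA]] in measurable)
      finally show ?thesis .
    qed
    then have "sqnorm (fdiff (s n) l) \<le> (\<Sum>k. liminf (\<lambda>m. ?u m k))"
      unfolding sqnorm_loc by (intro suminf_le) auto
    \<comment> \<open>The sum over pieces is an integral for counting measure, so that Fatou's lemma
      applies a second time.\<close>
    also have "... = (\<integral>\<^sup>+k. liminf (\<lambda>m. ?u m k) \<partial>count_space UNIV)" by (simp add: nn_integral_count_space_nat)
    also have "... \<le> liminf (\<lambda>m. \<integral>\<^sup>+k. ?u m k \<partial>count_space UNIV)" by (rule nn_integral_liminf) auto
    also have "... = liminf (\<lambda>m. sqnorm (fdiff (s n) (s m)))" unfolding sqnorm_loc by (simp add: nn_integral_count_space_nat)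
    finally show ?thesis .
  qed
  have small: "\<exists>N. \<forall>n\<ge>N. sqnorm (fdiff (s n) l) \<le> ennreal e" if e: "e > 0" for e
  proof -
    obtain N where N: "\<forall>m\<ge>N. \<forall>n\<ge>N. D m n < e" using Dc[OF e] by blast
    have "sqnorm (fdiff (s n) l) \<le> ennreal e" if n: "n \<ge> N" for n
    proof -
      have "sqnorm (fdiff (s n) l) \<le> liminf (\<lambda>m. sqnorm (fdiff (s n) (s m)))" by (rule fatou)
      also have "... \<le> liminf (\<lambda>m. ennreal e)"
      proof (rule Liminf_mono)
        show "\<forall>\<^sub>F m in sequentially. sqnorm (fdiff (s n) (s m)) \<le> ennreal e"
          unfolding eventually_sequentially
        proof (intro exI[of _ N] allI impI)
          fix m assume "m \<ge> N"
          then have "D n m < e" using N n by blast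
          moreover have "sqnorm (fdiff (s n) (s m)) = ennreal (D n m)"
            using DA[of n m] unfolding D_def A2_iff by (simp add: less_top)
          ultimately show "sqnorm (fdiff (s n) (s m)) \<le> ennreal e" by (simp add: ennreal_leI)
        qed
      qed
      finally show ?thesis by (simp add: Liminf_const)
    qed
    then show ?thesis by blast
  qed
  have dform: "holomorphic_form X (fdiff (s n) l)" for n by (rule holomorphic_form_diff[OF A2_form[OF s] lform])
  obtain N1 where N1: "\<forall>n\<ge>N1. sqnorm (fdiff (s n) l) \<le> ennreal 1" using small[of 1] by auto
  have "fdiff (s N1) l \<in> A2 X"
    unfolding A2_iff using dform[of N1] N1 by (metis ennreal_less_top infinity_ennreal_def le_less_trans order_refl)
  then have "fdiff (s N1) (fdiff (s N1) l) \<in> A2 X" using A2_fdiff s by blast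
  then have lA: "l \<in> A2 X" by (simp add: fdiff_def)
  have dA: "fdiff (s n) l \<in> A2 X" for n using A2_fdiff s lA by blast
  have "(\<lambda>n. Re (A2_inner X (fdiff (s n) l) (fdiff (s n) l))) \<longlonglongrightarrow> 0"
  proof (rule LIMSEQ_I)
    fix e :: real assume e: "e > 0"
    obtain N where N: "\<forall>n\<ge>N. sqnorm (fdiff (s n) l) \<le> ennreal (e / 2 ^ CARD('n) / 2)"
      using small[of "e / 2 ^ CARD('n) / 2"] e by auto
    have "norm (Re (A2_inner X (fdiff (s n) l) (fdiff (s n) l)) - 0) < e" if "n \<ge> N" for n
    proof -
      have "enn2real (sqnorm (fdiff (s n) l)) \<le> e / 2 ^ CARD('n) / 2"
        using N that e by (intro enn2real_leI) auto
      also have "... < e / 2 ^ CARD('n)"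
      proof -
        have half: "t / 2 < t" if "t > 0" for t :: real using that by simp
        show ?thesis by (rule half) (use e in simp)
      qed
      finally show ?thesis unfolding Re_A2_inner_self[OF dA] by (simp add: field_simps)
    qed
    then show "\<exists>no. \<forall>n\<ge>no. norm (Re (A2_inner X (fdiff (s n) l) (fdiff (s n) l)) - 0) < e" by blast
  qed
  then show ?thesis using lA by blast
qed

lemma loc_add: "loc (\<lambda>c x. p c x + q c x) k z = loc p k z + loc q k z"
  by (simp add: loc_def scaleR_add_right)

lemma loc_scale: "loc (\<lambda>c x. a * p c x) k z = a * loc p k z"
  by (simp add: loc_def)

theorem A2_function_hilbert_space: "function_hilbert_space (A2 X :: ('a, 'n) form set) (A2_inner X)"
proof
  fix f g h :: "('a, 'n) form" and c :: complex
  show "(\<lambda>c x. 0 :: complex) \<in> (A2 X :: ('a, 'n) form set)" by (rule A2_0)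
  show "f \<in> A2 X ==> g \<in> A2 X ==> (\<lambda>c x. f c x + g c x) \<in> A2 X" by (rule A2_add)
  show "f \<in> A2 X ==> (\<lambda>i j. c * f i j) \<in> A2 X" by (rule A2_scale)
  show "A2_inner X (\<lambda>i j. f i j + g i j) h = A2_inner X f h + A2_inner X g h"
    if f: "f \<in> A2 X" and g: "g \<in> A2 X" and h: "h \<in> A2 X"
  proof -
    have "pr (\<lambda>i j. f i j + g i j) h k = pr f h k + pr g h k" for k
      unfolding pr_def loc_add distrib_right by (rule Bochner_Integration.integral_add[OF pr_facts(1)[OF f h] pr_facts(1)[OF g h]])
    then have "pr (\<lambda>i j. f i j + g i j) h = (\<lambda>k. pr f h k + pr g h k)" by blast
    then show ?thesis
      unfolding A2_inner_pr[OF A2_add[OF f g] h] A2_inner_pr[OF f h] A2_inner_pr[OF g h]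
      using suminf_add[OF pr_facts(3)[OF f h] pr_facts(3)[OF g h], symmetric] by (simp add: distrib_left)
  qed
  show "A2_inner X (\<lambda>i j. c * f i j) g = c * A2_inner X f g" if f: "f \<in> A2 X" and g: "g \<in> A2 X"
  proof -
    have "pr (\<lambda>i j. c * f i j) g k = c * pr f g k" for k
      unfolding pr_def loc_scale mult.assoc by (rule Bochner_Integration.integral_mult_right[OF pr_facts(1)[OF f g]])
    then have "pr (\<lambda>i j. c * f i j) g = (\<lambda>k. c * pr f g k)" by blast
    then show ?thesis
      unfolding A2_inner_pr[OF A2_scale[OF f] g] A2_inner_pr[OF f g]
      using suminf_mult[OF pr_facts(3)[OF f g], of c] by simp
  qed
  show "A2_inner X g f = cnj (A2_inner X f g)" if f: "f \<in> A2 X" and g: "g \<in> A2 X"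
  proof -
    have "pr g f k = cnj (pr f g k)" for k
    proof -
      have "cnj (pr f g k) = (\<integral>z. cnj (loc f k z * cnj (loc g k z)) \<partial>lborel)"
        unfolding pr_def by (rule Bochner_Integration.integral_cnj[symmetric])
      then show ?thesis by (simp add: pr_def mult.commute)
    qed
    then have "pr g f = (\<lambda>k. cnj (pr f g k))" by blast
    then show ?thesis
      unfolding A2_inner_pr[OF f g] A2_inner_pr[OF g f]
      using bounded_linear.suminf[OF bounded_linear_cnj pr_facts(3)[OF f g]] by simp
  qed
  show "0 \<le> Re (A2_inner X f f)" if "f \<in> A2 X" unfolding Re_A2_inner_self[OF that] by simp
  show "\<exists>C. \<forall>f\<in>A2 X. (cmod (f i j))^2 \<le> C * Re (A2_inner X f f)" for i :: "('a, 'n) chart" and j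
    by (rule A2_eval_bounded)
qed (rule A2_complete)

sublocale function_hilbert_space "A2 X :: ('a, 'n) form set" "A2_inner X"
  by (rule A2_function_hilbert_space)

definition bk :: "('a, 'n) chart => 'a => ('a, 'n) chart => 'a => complex" where
  "bk c x d y = (\<Sum>\<^sub>\<infinity>\<phi>\<in>(SOME B. orthonormal_basis X B). \<phi> c x * cnj (\<phi> d y))"

lemma manifold_bergman_kernel_bk: "manifold_bergman_kernel X c x d y = \<i> ^ (CARD('n)^2) * bk c x d y"
  by (simp add: manifold_bergman_kernel_def bk_def)

lemma onb_some: "onb (SOME B. orthonormal_basis X B)"
proof -
  have "orthonormal_basis X B \<longleftrightarrow> onb B" for B
    unfolding orthonormal_basis_def onb_def orthonormal_def by blast
  then show ?thesis using onb_exists by (metis someI_ex)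
qed

lemma bk_mem: "(\<lambda>c x. bk c x d y) \<in> A2 X"
  unfolding bk_def by (rule reproducing_kernel(1)[OF onb_some])

lemma bk_reproduces: "\<phi> \<in> A2 X ==> A2_inner X \<phi> (\<lambda>c x. bk c x d y) = \<phi> d y"
  unfolding bk_def by (rule reproducing_kernel(2)[OF onb_some])

lemma bk_cnj: "bk c x d y = cnj (bk d y c x)"
  unfolding bk_def by (subst infsum_cnj[symmetric]) (simp add: mult.commute)

text \<open>The factor \<open>a\<close> comes out conjugated because the inner product is antilinear
  on the right.\<close>

lemma bk_unique:
  assumes "k \<in> A2 X" "\<And>\<phi>. \<phi> \<in> A2 X ==> A2_inner X \<phi> k = a * \<phi> d y"
  shows "k = (\<lambda>c x. cnj a * bk c x d y)"
proof (rule kernel_unique[OF assms(1) A2_scale[OF bk_mem]])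
  fix \<phi> :: "('a, 'n) form" assume \<phi>: "\<phi> \<in> A2 X"
  show "A2_inner X \<phi> k = A2_inner X \<phi> (\<lambda>c x. cnj a * bk c x d y)"
    using assms(2)[OF \<phi>] bk_reproduces[OF \<phi>, of d y] ip_scale_right[OF bk_mem[of d y] \<phi>, of "cnj a"] by simp
qed

end

section \<open>Removing an analytic subset does not change the Bergman kernel\<close>

text \<open>If \<open>f z\<close> and \<open>g z\<close> differ, the functions differ on a
  neighbourhood of \<open>z\<close>, which therefore misses \<open>S\<close> and falls under the
  last assumption. Boundary points of \<open>S\<close> are covered by this as well.\<close>

lemma continuous_eq_off_boundary:
  fixes f g :: "'m::topological_space => 'b::t2_space"
  assumes D: "open D" and f: "continuous_on D f" and g: "continuous_on D g" and z: "z \<in> D"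
    and S: "\<And>w. w \<in> D ==> w \<in> S ==> f w = g w"
    and T: "\<And>U w. open U ==> U \<subseteq> D ==> U \<inter> S = {} ==> w \<in> U ==> f w = g w"
  shows "f z = g z"
proof (rule ccontr)
  assume ne: "f z ~= g z"
  obtain U V where UV: "open U" "open V" "f z \<in> U" "g z \<in> V" "U \<inter> V = {}" using separation_t2 ne by metis
  define W where "W = (f -` U \<inter> D) \<inter> (g -` V \<inter> D)"
  have "open W" unfolding W_def
    using f g UV D by (auto simp: continuous_on_open_vimage[OF D])
  moreover have "W \<inter> S = {}"
  proof (rule ccontr)
    assume "W \<inter> S ~= {}"
    then obtain w where "w \<in> W" "w \<in> S" by blast
    then show False using S[of w] UV by (auto simp: W_def)
  qed
  moreover have "W \<subseteq> D" "z \<in> W" using UV z by (auto simp: W_def)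
  ultimately show False using T[of W z] ne by blast
qed

lemma pint_cong:
  assumes "\<And>z. z \<in> snd c ` A ==> u c (chart_inv c z) = \<eta> c (chart_inv c z)"
  shows "pint c A u = pint c A \<eta>"
  unfolding pint_def using assms by (intro nn_integral_cong) (auto simp: indicator_def)

text \<open>In use \<open>X\<close> is the regular part of \<open>M\<close>, \<open>N\<close> is
  \<open>M - V\<close> and \<open>G\<close> its underlying set. \<open>thin\<close> says that the
  complement of \<open>G\<close> is locally the common zero set of holomorphic functions; it may
  have interior points.\<close>

locale form_restriction = X: form_space X dim + N: form_space N dim
  for X N :: "'a complex_space" and dim :: "'n::finite itself" +
  fixes G :: "'a set"
  assumes G: "openin (ctop X) G"
    and charts_N: "(charts N :: ('a, 'n) chart set) = {c\<in>charts X. fst c \<subseteq> G}"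
    and thin: "\<And>x. x \<in> topspace (ctop X) ==>
      \<exists>W F. openin (ctop X) W \<and> x \<in> W \<and> F \<subseteq> hol X W \<and> W - G = {y\<in>W. \<forall>g\<in>F. g y = 0}"
begin

text \<open>The interior of the complement of \<open>G\<close>. Forms on \<open>N\<close> are
  extended by 0 there.\<close>

definition hole :: "'a set" where "hole = \<Union>{W. openin (ctop X) W \<and> W \<inter> G = {}}"

definition rc :: "('a, 'n) chart => ('a, 'n) chart" where "rc c = (fst c \<inter> G, snd c)"

lemma hole_openin: "openin (ctop X) hole"
  unfolding hole_def by (rule openin_Union) blast

lemma hole_disjoint: "x \<in> hole ==> x \<notin> G"
  unfolding hole_def by blast

lemma charts_NX: "c \<in> charts N ==> c \<in> charts X" and charts_N_sub: "c \<in> charts N ==> fst c \<subseteq> G"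
  for c :: "('a, 'n) chart"
  by (simp_all add: charts_N)

lemma rc_eq: "c \<in> charts N ==> rc c = c"
  using charts_N_sub[of c] by (simp add: rc_def Int_absorb2 prod_eq_iff)

context
  fixes c :: "('a, 'n) chart" assumes c: "c \<in> charts X"
begin

lemma open_Int_G: "openin (ctop X) (fst c \<inter> G)" by (rule openin_Int[OF chart_openin[OF c] G])

lemma rc_mem: "rc c \<in> charts N" and rc_inv: "z \<in> snd c ` (fst c \<inter> G) ==> chart_inv (rc c) z = chart_inv c z"
  using chart_restrict[OF c open_Int_G] by (auto simp: charts_N rc_def)

lemma open_range_G: "open (snd c ` (fst c \<inter> G))"
  by (rule chart_open_image[OF c open_Int_G]) blast

lemma hole_range:
  assumes U: "open U" "U \<subseteq> snd c ` fst c" "U \<inter> snd c ` (fst c \<inter> G) = {}" and z: "z \<in> U"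
  shows "chart_inv c z \<in> hole"
proof -
  have "openin (ctop X) (fst c \<inter> snd c -` U)" by (rule chart_vimage[OF c U(1)])
  moreover have "(fst c \<inter> snd c -` U) \<inter> G = {}" using U(3) by blast
  moreover have "chart_inv c z \<in> fst c \<inter> snd c -` U"
    using chart_inv_mem[OF c] chart_inv_right[OF c] U(2) z by (auto simp: subset_iff)
  ultimately show ?thesis unfolding hole_def by blast
qed

text \<open>If \<open>G\<close> meets the ball, some defining function is nonzero at a point of
  \<open>G\<close> there, and within the ball the complement of \<open>G\<close> lies in the zero
  set of this single function.\<close>

lemma local_dichotomy:
  assumes p: "p \<in> snd c ` fst c"
  shows "\<exists>R>0. ball p R \<subseteq> snd c ` fst c \<and>
    (ball p R \<inter> snd c ` (fst c \<inter> G) = {} \<or>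
     (\<exists>g q. holo_on g (ball p R) \<and> q \<in> ball p R \<and> g q ~= 0 \<and> {z\<in>ball p R. g z ~= 0} \<subseteq> snd c ` (fst c \<inter> G)))"
proof -
  define x where "x = chart_inv c p"
  have x: "x \<in> fst c" "snd c x = p" using chart_inv_mem[OF c p] chart_inv_right[OF c p] by (auto simp: x_def)
  obtain W F where W: "openin (ctop X) W" "x \<in> W" "F \<subseteq> hol X W" "W - G = {y\<in>W. \<forall>g\<in>F. g y = 0}"
    using thin[of x] x(1) chart_subset_topspace[OF c] by blast
  have cW: "openin (ctop X) (fst c \<inter> W)" by (rule openin_Int[OF chart_openin[OF c] W(1)])
  have "open (snd c ` (fst c \<inter> W))" by (rule chart_open_image[OF c cW]) blast
  moreover have "p \<in> snd c ` (fst c \<inter> W)" using x W(2) by blast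
  ultimately obtain R where R: "R > 0" "ball p R \<subseteq> snd c ` (fst c \<inter> W)" using openE by blast
  have inW: "chart_inv c z \<in> W" "chart_inv c z \<in> fst c" "snd c (chart_inv c z) = z" if z: "z \<in> ball p R" for z
  proof -
    obtain y where "y \<in> fst c" "y \<in> W" "z = snd c y" using R(2) z by blast
    then show "chart_inv c z \<in> W" "chart_inv c z \<in> fst c" "snd c (chart_inv c z) = z"
      using chart_inv_left[OF c] by auto
  qed
  show ?thesis
  proof (cases "ball p R \<inter> snd c ` (fst c \<inter> G) = {}")
    case True
    then show ?thesis using R by (intro exI[of _ R]) auto
  next
    case False
    then obtain y where y: "y \<in> fst c" "y \<in> G" "snd c y \<in> ball p R" by blast
    have "y \<in> W" using inW(1)[OF y(3)] chart_inv_left[OF c y(1)] by simp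
    then obtain g where g: "g \<in> F" "g y ~= 0" using W(4) y(2) by blast
    have "g \<in> hol X W" using g(1) W(3) by blast
    then have "g \<in> hol X (fst c \<inter> W)"
      by (rule sheaf_restrict[OF X.sheaf W(1) cW, rotated]) blast
    then have h: "holo_on (\<lambda>z. g (chart_inv c z)) (ball p R)"
      using holo_on_subset[OF _ R(2)] chart_hol[OF c cW, of g] by simp
    have "{z\<in>ball p R. g (chart_inv c z) ~= 0} \<subseteq> snd c ` (fst c \<inter> G)"
    proof
      fix z assume z: "z \<in> {z\<in>ball p R. g (chart_inv c z) ~= 0}"
      then have "chart_inv c z \<in> G" using inW(1)[of z] W(4) g(1) by blast
      then show "z \<in> snd c ` (fst c \<inter> G)" using inW(2,3)[of z] z by (metis (no_types, lifting) IntI imageI mem_Collect_eq)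
    qed
    moreover have "g (chart_inv c (snd c y)) ~= 0" using g(2) chart_inv_left[OF c y(1)] by simp
    ultimately show ?thesis using R h y(3) by (intro exI[of _ R]) auto
  qed
qed

text \<open>Near a boundary point the complement of \<open>G\<close> lies in a thin set, which is
  null; Lindelof's theorem leaves countably many such neighbourhoods.\<close>

lemma boundary_null: "snd c ` (fst c - G - hole) \<in> null_sets lborel"
proof -
  let ?S = "snd c ` (fst c - G - hole)"
  have Seq: "?S = snd c ` fst c - snd c ` (fst c \<inter> G) - snd c ` (fst c \<inter> hole)"
    using chart_inj[OF c] by (auto simp: inj_on_def)
  have "open (snd c ` (fst c \<inter> hole))"
    by (rule chart_open_image[OF c openin_Int[OF chart_openin[OF c] hole_openin]]) blast
  then have Sb: "?S \<in> sets borel" unfolding Seq using chart_open_range[OF c] open_range_G by auto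
  define \<B> where "\<B> = {B. open B \<and> ?S \<inter> B \<in> null_sets lborel}"
  have cov: "?S \<subseteq> \<Union>\<B>"
  proof
    fix p assume p: "p \<in> ?S"
    then have "p \<in> snd c ` fst c" by blast
    then obtain R where R: "R > 0" "ball p R \<subseteq> snd c ` fst c"
      and dich: "ball p R \<inter> snd c ` (fst c \<inter> G) = {} \<or>
       (\<exists>g q. holo_on g (ball p R) \<and> q \<in> ball p R \<and> g q ~= 0 \<and> {z\<in>ball p R. g z ~= 0} \<subseteq> snd c ` (fst c \<inter> G))"
      using local_dichotomy by blast
    from dich show "p \<in> \<Union>\<B>"
    proof
      assume "ball p R \<inter> snd c ` (fst c \<inter> G) = {}"
      then have "chart_inv c p \<in> hole" by (rule hole_range[OF open_ball R(2)]) (use R(1) in simp)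
      then have False using p chart_inv_left[OF c] by auto
      then show ?thesis ..
    next
      assume "\<exists>g q. holo_on g (ball p R) \<and> q \<in> ball p R \<and> g q ~= 0 \<and> {z\<in>ball p R. g z ~= 0} \<subseteq> snd c ` (fst c \<inter> G)"
      then obtain g q where g: "holo_on g (ball p R)" "q \<in> ball p R" "g q ~= 0"
        and sub: "{z\<in>ball p R. g z ~= 0} \<subseteq> snd c ` (fst c \<inter> G)" by blast
      obtain t where t: "t > 0" "t \<le> R" "emeasure lborel {z \<in> ball p t. g z = 0} = 0"
        using thin_set_null[OF g(1) R(1) g(2,3)] by metis
      have bs: "ball p t \<subseteq> ball p R" using t(2) by auto
      have "{z \<in> ball p t. g z = 0} \<in> null_sets lborel"
        using t(3) holo_zero_set_borel(1)[OF holo_on_subset[OF g(1) bs]] by auto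
      moreover have "?S \<inter> ball p t \<in> sets lborel" using Sb by (simp add: sets.Int)
      moreover have "?S \<inter> ball p t \<subseteq> {z \<in> ball p t. g z = 0}" using sub bs unfolding Seq by blast
      ultimately have "?S \<inter> ball p t \<in> null_sets lborel" by (rule null_sets_subset)
      then have "ball p t \<in> \<B>" unfolding \<B>_def by simp
      then show ?thesis using t(1) by (meson UnionI centre_in_ball)
    qed
  qed
  obtain \<B>' where B': "\<B>' \<subseteq> \<B>" "countable \<B>'" "\<Union>\<B>' = \<Union>\<B>"
    using Lindelof[of \<B>] by (auto simp: \<B>_def)
  have "(\<Union>B\<in>\<B>'. ?S \<inter> B) \<in> null_sets lborel"
    by (rule null_sets_UN'[OF B'(2)]) (use B'(1) in \<open>auto simp: \<B>_def\<close>)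
  moreover have "(\<Union>B\<in>\<B>'. ?S \<inter> B) = ?S" using cov B'(3) by blast
  ultimately show ?thesis by simp
qed

end

lemma forms_eqI:
  fixes \<alpha> \<beta> :: "('a, 'n) form"
  assumes \<alpha>: "holomorphic_form X \<alpha>" and \<beta>: "holomorphic_form X \<beta>"
    and 1: "\<And>c x. c \<in> charts N ==> x \<in> fst c ==> \<alpha> c x = \<beta> c x"
    and 2: "\<And>c x. c \<in> charts X ==> x \<in> fst c ==> x \<in> hole ==> \<alpha> c x = \<beta> c x"
  shows "\<alpha> = \<beta>"
proof (intro ext)
  fix c :: "('a, 'n) chart" and x
  show "\<alpha> c x = \<beta> c x"
  proof (cases "c \<in> charts X \<and> x \<in> fst c")
    case False
    then show ?thesis using form_zero[OF \<alpha>] form_zero[OF \<beta>] by metis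
  next
    case True
    then have c: "c \<in> charts X" and x: "x \<in> fst c" by auto
    have "\<alpha> c (chart_inv c (snd c x)) = \<beta> c (chart_inv c (snd c x))"
    proof (rule continuous_eq_off_boundary[OF chart_open_range[OF c] holo_on_continuous[OF form_holo[OF \<alpha> c]]
          holo_on_continuous[OF form_holo[OF \<beta> c]], where S = "snd c ` (fst c \<inter> G)"])
      show "snd c x \<in> snd c ` fst c" using x by blast
      fix w assume "w \<in> snd c ` (fst c \<inter> G)"
      then obtain y where y: "y \<in> fst c" "y \<in> G" "w = snd c y" by blast
      have "\<alpha> c y = \<alpha> (rc c) y" "\<beta> c y = \<beta> (rc c) y"
        by (rule form_restrict[OF \<alpha> c charts_NX[OF rc_mem[OF c]]] form_restrict[OF \<beta> c charts_NX[OF rc_mem[OF c]]];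
            use y in \<open>simp add: rc_def\<close>)+
      moreover have "\<alpha> (rc c) y = \<beta> (rc c) y" by (rule 1[OF rc_mem[OF c]]) (use y in \<open>simp add: rc_def\<close>)
      ultimately show "\<alpha> c (chart_inv c w) = \<beta> c (chart_inv c w)" using chart_inv_left[OF c y(1)] y(3) by simp
    next
      fix U w assume U: "open U" "U \<subseteq> snd c ` fst c" "U \<inter> snd c ` (fst c \<inter> G) = {}" "w \<in> U"
      show "\<alpha> c (chart_inv c w) = \<beta> c (chart_inv c w)"
        by (rule 2[OF c]) (use hole_range[OF c U] chart_inv_mem[OF c] U in auto)
    qed
    then show ?thesis using chart_inv_left[OF c x] by simp
  qed
qed

text \<open>Local extensions are not glued: the limit along \<open>G\<close> names the value of any
  continuous extension, so that independence of choices is automatic.\<close>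

definition extend :: "('a, 'n) form => ('a, 'n) form" where
  "extend u c x = (if c \<in> charts X \<and> x \<in> fst c \<and> x \<notin> hole
     then Lim (at (snd c x) within snd c ` (fst c \<inter> G)) (\<lambda>z. u (rc c) (chart_inv (rc c) z)) else 0)"

text \<open>By the dichotomy a small ball either lies in the hole, where the extension is 0, or
  meets the complement of \<open>G\<close> in a thin set, across which \<open>L2_extension\<close>
  provides \<open>F\<close>. The points with \<open>g \<noteq> 0\<close> are dense, which makes
  \<open>F\<close> agree with the form on all of \<open>G\<close> in that ball and identifies
  \<open>F\<close> as the limit that defines \<open>extend\<close>.\<close>

lemma extend_local:
  assumes u: "u \<in> A2 N" and c: "c \<in> charts X" and p: "p \<in> snd c ` fst c"
  shows "\<exists>t>0. \<exists>F. ball p t \<subseteq> snd c ` fst c \<and> holo_on F (ball p t) \<and> (\<forall>z\<in>ball p t. extend u c (chart_inv c z) = F z)"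
proof -
  define h where "h = (\<lambda>z. u (rc c) (chart_inv (rc c) z))"
  have uf: "holomorphic_form N u" by (rule N.A2_form[OF u])
  have snd_rc: "snd (rc c) = snd c" and fst_rc: "fst (rc c) = fst c \<inter> G" by (simp_all add: rc_def)
  have hol: "holo_on h (snd c ` (fst c \<inter> G))"
    using form_holo[OF uf rc_mem[OF c]] unfolding h_def snd_rc fst_rc .
  obtain R where R: "R > 0" "ball p R \<subseteq> snd c ` fst c"
    and dich: "ball p R \<inter> snd c ` (fst c \<inter> G) = {} \<or>
     (\<exists>g q. holo_on g (ball p R) \<and> q \<in> ball p R \<and> g q ~= 0 \<and> {z\<in>ball p R. g z ~= 0} \<subseteq> snd c ` (fst c \<inter> G))"
    using local_dichotomy[OF c p] by blast
  from dich show ?thesis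
  proof
    assume e: "ball p R \<inter> snd c ` (fst c \<inter> G) = {}"
    have "extend u c (chart_inv c z) = 0" if "z \<in> ball p R" for z
      using hole_range[OF c open_ball R(2) e that] by (simp add: extend_def)
    then show ?thesis using R holo_on_const[of 0] by (intro exI[of _ R] conjI exI[of _ "\<lambda>z. 0"]) auto
  next
    assume "\<exists>g q. holo_on g (ball p R) \<and> q \<in> ball p R \<and> g q ~= 0 \<and> {z\<in>ball p R. g z ~= 0} \<subseteq> snd c ` (fst c \<inter> G)"
    then obtain g q where g: "holo_on g (ball p R)" "q \<in> ball p R" "g q ~= 0"
      and sub: "{z\<in>ball p R. g z ~= 0} \<subseteq> snd c ` (fst c \<inter> G)" by blast
    let ?A = "{z\<in>ball p R. g z ~= 0}"
    define A where "A = (fst c \<inter> G) \<inter> snd c -` ?A"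
    have A: "snd (rc c) ` A = ?A" "A \<subseteq> fst (rc c)" using sub by (auto simp: A_def snd_rc fst_rc)
    have "(\<integral>\<^sup>+z\<in>?A. ennreal ((cmod (h z))^2) \<partial>lborel) = pint (rc c) A u"
      unfolding pint_def A(1) h_def ..
    also have "... \<le> N.sqnorm u" unfolding N.sqnorm_def
      by (rule pint_le_fint[OF uf N.P_family rc_mem[OF c] A(2)])
         (use A holo_zero_set_borel(2)[OF g(1)] rc_mem[OF c] N.P_Union in auto)
    also have "... < \<infinity>" using u by (simp add: N.A2_iff)
    finally have fin: "(\<integral>\<^sup>+z\<in>?A. ennreal ((cmod (h z))^2) \<partial>lborel) < \<infinity>" .
    obtain t1 F where t1: "t1 > 0" "t1 \<le> R" and F: "holo_on F (ball p t1)"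
      and Fh: "\<And>z. z \<in> ball p t1 ==> g z ~= 0 ==> F z = h z"
      using L2_extension[OF g(1) R(1) g(2,3) holo_on_subset[OF hol sub] fin] by metis
    obtain t2 where t2: "t2 > 0" "t2 \<le> R" "emeasure lborel {z \<in> ball p t2. g z = 0} = 0"
      using thin_set_null[OF g(1) R(1) g(2,3)] by metis
    define t where "t = min t1 t2"
    have t: "t > 0" "ball p t \<subseteq> ball p t1" "ball p t \<subseteq> ball p t2" "ball p t \<subseteq> ball p R"
      using t1 t2 by (auto simp: t_def)
    have dense: "\<exists>y\<in>U. g y ~= 0" if U: "open U" "U \<subseteq> ball p t" "U ~= {}" for U
    proof (rule ccontr)
      assume "\<not> (\<exists>y\<in>U. g y ~= 0)"
      then have "U \<subseteq> {z \<in> ball p t2. g z = 0}" using U(2) t(3) by blast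
      then have "emeasure lborel U \<le> emeasure lborel {z \<in> ball p t2. g z = 0}"
        by (rule emeasure_mono) (use holo_zero_set_borel(1)[OF holo_on_subset[OF g(1) subset_ball[OF t2(2)]]] in simp)
      then have "emeasure lborel U = 0" using t2(3) by simp
      then show False using open_null_empty[OF U(1)] U(3) by blast
    qed
    have cont: "isCont F z" if "z \<in> ball p t" for z
      using holo_on_continuous[OF F] t(2) that by (meson continuous_on_eq_continuous_at open_ball subsetD)
    have Fh': "F z = h z" if z: "z \<in> ball p t" "z \<in> snd c ` (fst c \<inter> G)" for z
    proof (rule continuous_eq_off_boundary[where D = "ball p t \<inter> snd c ` (fst c \<inter> G)" and S = "{z. g z ~= 0}"])
      show "open (ball p t \<inter> snd c ` (fst c \<inter> G))" using open_range_G[OF c] by blast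
      show "continuous_on (ball p t \<inter> snd c ` (fst c \<inter> G)) F"
        using continuous_on_subset[OF holo_on_continuous[OF F]] t(2) by blast
      show "continuous_on (ball p t \<inter> snd c ` (fst c \<inter> G)) h"
        using continuous_on_subset[OF holo_on_continuous[OF hol]] by blast
      show "z \<in> ball p t \<inter> snd c ` (fst c \<inter> G)" using z by blast
      show "F w = h w" if "w \<in> ball p t \<inter> snd c ` (fst c \<inter> G)" "w \<in> {z. g z ~= 0}" for w
        using Fh[of w] that t(2) by blast
      show "F w = h w" if "open U" "U \<subseteq> ball p t \<inter> snd c ` (fst c \<inter> G)" "U \<inter> {z. g z ~= 0} = {}" "w \<in> U" for U w
        using dense[of U] that by blast
    qed
    have "extend u c (chart_inv c z) = F z" if z: "z \<in> ball p t" for z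
    proof -
      have zr: "z \<in> snd c ` fst c" using z t(4) R(2) by blast
      have x: "chart_inv c z \<in> fst c" "snd c (chart_inv c z) = z" using chart_inv_mem[OF c zr] chart_inv_right[OF c zr] by auto
      have nh: "chart_inv c z \<notin> hole"
      proof
        assume hz: "chart_inv c z \<in> hole"
        have ho: "openin (ctop X) (fst c \<inter> hole)" by (rule openin_Int[OF chart_openin[OF c] hole_openin])
        have "open (snd c ` (fst c \<inter> hole))" by (rule chart_open_image[OF c ho]) blast
        moreover have "z \<in> snd c ` (fst c \<inter> hole)" using x hz by force
        ultimately have "open (ball p t \<inter> snd c ` (fst c \<inter> hole))" "ball p t \<inter> snd c ` (fst c \<inter> hole) ~= {}"
          using z by auto
        then obtain y where y: "y \<in> ball p t \<inter> snd c ` (fst c \<inter> hole)" "g y ~= 0"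
          using dense[OF _ Int_lower1] by blast
        then have "y \<in> snd c ` (fst c \<inter> G)" using sub t(4) by blast
        with y(1) chart_inj[OF c] show False using hole_disjoint by (auto simp: inj_on_def)
      qed
      have nt: "at z within snd c ` (fst c \<inter> G) ~= bot"
      proof -
        have "z islimpt snd c ` (fst c \<inter> G)"
        proof (rule islimptI)
          fix T assume T: "z \<in> T" "open T"
          have "open (T \<inter> ball p t - {z})" using T by (intro open_Diff open_Int) auto
          moreover have "T \<inter> ball p t - {z} ~= {}"
          proof
            assume "T \<inter> ball p t - {z} = {}"
            then have "T \<inter> ball p t = {z}" using T z by blast
            then have "open {z}" using T by (metis open_Int open_ball)
            then show False using not_open_singleton by blast
          qed
          ultimately obtain y where "y \<in> T \<inter> ball p t - {z}" "g y ~= 0"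
            using dense[of "T \<inter> ball p t - {z}"] by blast
          then show "\<exists>y\<in>snd c ` (fst c \<inter> G). y \<in> T \<and> y ~= z" using sub t(4) by blast
        qed
        then show ?thesis by (simp add: trivial_limit_within)
      qed
      have "(F \<longlongrightarrow> F z) (at z within snd c ` (fst c \<inter> G))"
        using cont[OF z] by (simp add: continuous_at tendsto_within_subset[of _ _ _ UNIV])
      moreover have "eventually (\<lambda>w. F w = h w) (at z within snd c ` (fst c \<inter> G))"
        unfolding eventually_at_topological using Fh' z by (intro exI[of _ "ball p t"]) auto
      ultimately have "(h \<longlongrightarrow> F z) (at z within snd c ` (fst c \<inter> G))"
        by (rule Lim_transform_eventually)
      then have "Lim (at z within snd c ` (fst c \<inter> G)) h = F z" by (rule tendsto_Lim[OF nt])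
      then show ?thesis using c x nh by (simp add: extend_def h_def)
    qed
    then show ?thesis using t(1) subset_trans[OF t(4) R(2)] holo_on_subset[OF F t(2)] by blast
  qed
qed

context
  fixes u :: "('a, 'n) form" assumes u: "u \<in> A2 N"
begin

lemma extend_holo: "c \<in> charts X ==> holo_on (\<lambda>z. extend u c (chart_inv c z)) (snd c ` fst c)"
proof (rule holo_on_local)
  fix p assume c: "c \<in> charts X" and p: "p \<in> snd c ` fst c"
  obtain t F where "t > 0" "holo_on F (ball p t)" "\<forall>z\<in>ball p t. extend u c (chart_inv c z) = F z"
    using extend_local[OF u c p] by blast
  then show "\<exists>E. p \<in> E \<and> holo_on (\<lambda>z. extend u c (chart_inv c z)) E"
    using holo_on_cong[of "ball p t" F "\<lambda>z. extend u c (chart_inv c z)"] by (intro exI[of _ "ball p t"]) auto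
qed

lemma extend_rc:
  assumes c: "c \<in> charts X" and x: "x \<in> fst c" "x \<in> G"
  shows "extend u c x = u (rc c) x"
proof -
  let ?S = "snd c ` (fst c \<inter> G)"
  have xS: "snd c x \<in> ?S" using x by blast
  have "continuous_on ?S (\<lambda>z. u (rc c) (chart_inv (rc c) z))"
    using holo_on_continuous[OF form_holo[OF N.A2_form[OF u] rc_mem[OF c]]] by (simp add: rc_def)
  then have "((\<lambda>z. u (rc c) (chart_inv (rc c) z)) \<longlongrightarrow> u (rc c) (chart_inv (rc c) (snd c x))) (at (snd c x) within ?S)"
    using xS by (auto simp: continuous_on_def)
  moreover have "at (snd c x) within ?S ~= bot"
    unfolding at_within_open[OF xS open_range_G[OF c]] by (rule at_neq_bot)
  ultimately have "Lim (at (snd c x) within ?S) (\<lambda>z. u (rc c) (chart_inv (rc c) z)) = u (rc c) (chart_inv (rc c) (snd c x))"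
    by (intro tendsto_Lim)
  moreover have "chart_inv (rc c) (snd c x) = x" using rc_inv[OF c xS] chart_inv_left[OF c x(1)] by simp
  ultimately show ?thesis using c x hole_disjoint[of x] by (auto simp: extend_def)
qed

lemma extend_N: "c \<in> charts N ==> x \<in> fst c ==> extend u c x = u c x"
  using extend_rc[of c x] rc_eq charts_NX charts_N_sub by (metis subsetD)

lemma extend_hole: "x \<in> hole ==> extend u c x = 0"
  by (simp add: extend_def)

text \<open>The transformation law holds on \<open>G\<close> and, with both sides zero, on the hole;
  continuity takes it to the boundary between them.\<close>

lemma extend_form: "holomorphic_form X (extend u)"
  unfolding holomorphic_form_def
proof (intro conjI ballI allI impI)
  fix c :: "('a, 'n) chart" and x assume "\<not> (c \<in> charts X \<and> x \<in> fst c)"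
  then show "extend u c x = 0" by (auto simp: extend_def)
next
  fix c :: "('a, 'n) chart" assume c: "c \<in> charts X"
  then show "holo_on (\<lambda>z. extend u c (chart_inv c z)) (snd c ` fst c)" by (rule extend_holo)
  fix d :: "('a, 'n) chart" and x assume d: "d \<in> charts X" and x: "x \<in> fst c \<inter> fst d"
  let ?D = "snd c ` (fst c \<inter> fst d)" and ?T = "\<lambda>z. snd d (chart_inv c z)"
  have o: "openin (ctop X) (fst c \<inter> fst d)" by (rule openin_Int[OF chart_openin[OF c] chart_openin[OF d]])
  have D: "open ?D" by (rule chart_open_image[OF c o]) blast
  have T: "holo_map ?T ?D" by (rule chart_transition[OF c d])
  have inv: "chart_inv c z \<in> fst c" "chart_inv c z \<in> fst d" "snd c (chart_inv c z) = z" if "z \<in> ?D" for z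
    using that chart_inv_left[OF c] by auto
  have "holo_on (\<lambda>z. extend u d (chart_inv d (?T z)) * jac ?T z) ?D"
    by (intro holo_on_mult holo_on_compose[OF T extend_holo[OF d]] holo_on_jac[OF D T]) (use inv in auto)
  then have "holo_on (\<lambda>z. extend u d (chart_inv c z) * jac ?T z) ?D"
    by (rule holo_on_cong[OF D, rotated]) (use inv chart_inv_left[OF d] in auto)
  then have c2: "continuous_on ?D (\<lambda>z. extend u d (chart_inv c z) * jac ?T z)" by (rule holo_on_continuous)
  have "extend u c (chart_inv c (snd c x)) = extend u d (chart_inv c (snd c x)) * jac ?T (snd c x)"
  proof (rule continuous_eq_off_boundary[OF D continuous_on_subset[OF holo_on_continuous[OF extend_holo[OF c]]] c2,
        where S = "snd c ` (fst c \<inter> G)"])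
    show "?D \<subseteq> snd c ` fst c" "snd c x \<in> ?D" using x by auto
    fix w assume w: "w \<in> ?D"
    define y where "y = chart_inv c w"
    have y: "y \<in> fst c" "y \<in> fst d" "snd c y = w" using inv[OF w] by (auto simp: y_def)
    {
      assume "w \<in> snd c ` (fst c \<inter> G)"
      then have yO: "y \<in> G" unfolding y_def using chart_inv_left[OF c] by auto
      have "u (rc c) y = u (rc d) y * jac (\<lambda>z. snd (rc d) (chart_inv (rc c) z)) (snd (rc c) y)"
        by (rule form_transform[OF N.A2_form[OF u] rc_mem[OF c] rc_mem[OF d]]) (use y yO in \<open>simp_all add: rc_def\<close>)
      moreover have "jac (\<lambda>z. snd (rc d) (chart_inv (rc c) z)) w = jac ?T w"
        by (rule jac_cong[OF open_range_G[OF c]]) (use y yO rc_inv[OF c] in \<open>auto simp: rc_def[of d]\<close>)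
      ultimately have "extend u c y = extend u d y * jac ?T w"
        using extend_rc[OF c y(1) yO] extend_rc[OF d y(2) yO] y(3) by (simp add: rc_def[of c])
      then show "extend u c (chart_inv c w) = extend u d (chart_inv c w) * jac ?T w" by (simp add: y_def)
    }
  next
    fix U w assume U: "open U" "U \<subseteq> ?D" "U \<inter> snd c ` (fst c \<inter> G) = {}" "w \<in> U"
    have "U \<subseteq> snd c ` fst c" using U(2) by blast
    from extend_hole[OF hole_range[OF c U(1) this U(3,4)]]
    show "extend u c (chart_inv c w) = extend u d (chart_inv c w) * jac ?T w" by simp
  qed
  then show "extend u c x = extend u d x * jac ?T (snd c x)" using chart_inv_left[OF c] x by simp
qed

end

lemma chart_family_N:
  fixes P :: "nat => ('a, 'n) chart \<times> 'a set"
  assumes "chart_family N P" shows "chart_family X P"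
  using assms unfolding chart_family_def by (simp add: charts_N)

lemma fint_N_X:
  fixes v :: "('a, 'n) form"
  assumes "holomorphic_form X v"
  shows "fint N.P v = fint (\<lambda>k. (fst (X.P k), snd (X.P k) \<inter> G)) v"
proof (rule fint_family_independent[OF assms chart_family_N[OF N.P_family] chart_family_Int[OF X.P_family cborel_open[OF G]]])
  have "\<Union>(fst ` (charts N :: ('a, 'n) chart set)) = \<Union>(fst ` (charts X :: ('a, 'n) chart set)) \<inter> G"
  proof
    show "\<Union>(fst ` (charts X :: ('a, 'n) chart set)) \<inter> G \<subseteq> \<Union>(fst ` (charts N :: ('a, 'n) chart set))"
    proof
      fix x assume "x \<in> \<Union>(fst ` (charts X :: ('a, 'n) chart set)) \<inter> G"
      then obtain c :: "('a, 'n) chart" where "c \<in> charts X" "x \<in> fst c" "x \<in> G" by blast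
      then have "rc c \<in> charts N" "x \<in> fst (rc c)" using rc_mem by (auto simp: rc_def)
      then show "x \<in> \<Union>(fst ` (charts N :: ('a, 'n) chart set))" by blast
    qed
  qed (auto simp: charts_N)
  then show "(\<Union>k. snd (N.P k)) = (\<Union>k. snd (fst (X.P k), snd (X.P k) \<inter> G))"
    using N.P_Union X.P_Union by simp
qed

lemma pint_diff_G:
  fixes c :: "('a, 'n) chart"
  assumes \<alpha>: "holomorphic_form X \<alpha>" and h: "\<And>c x. x \<in> hole ==> \<alpha> c x = 0" and c: "c \<in> charts X"
    and A: "A \<subseteq> fst c" "snd c ` A \<in> sets borel"
  shows "pint c A \<alpha> = pint c (A \<inter> G) \<alpha>"
  unfolding pint_def
proof (rule nn_integral_cong_AE, rule AE_I'[OF boundary_null[OF c]], rule subsetI, rule ccontr)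
  fix z assume z: "z \<in> {z\<in>space lborel. \<not> ennreal ((cmod (\<alpha> c (chart_inv c z)))^2) * indicator (snd c ` A) z
      = ennreal ((cmod (\<alpha> c (chart_inv c z)))^2) * indicator (snd c ` (A \<inter> G)) z}"
    and nz: "z \<notin> snd c ` (fst c - G - hole)"
  have zA: "z \<in> snd c ` A" "z \<notin> snd c ` (A \<inter> G)" "\<alpha> c (chart_inv c z) ~= 0"
    using z by (cases "z \<in> snd c ` A"; cases "z \<in> snd c ` (A \<inter> G)"; auto)+
  then obtain y where y: "y \<in> A" "z = snd c y" "y \<notin> G" by blast
  moreover have "y \<in> fst c" using y(1) A by blast
  ultimately have "\<alpha> c y ~= 0" using zA(3) chart_inv_left[OF c] by simp
  then have "y \<notin> hole" using h[of y c] by blast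
  then show False using nz y A by blast
qed

lemma sqnorm_extend:
  assumes u: "u \<in> A2 N" shows "X.sqnorm (extend u) = N.sqnorm u"
proof -
  have "X.sqnorm (extend u) = fint (\<lambda>k. (fst (X.P k), snd (X.P k) \<inter> G)) (extend u)"
    unfolding X.sqnorm_def fint_def
    by (intro suminf_cong) (simp add: pint_diff_G[OF extend_form[OF u] extend_hole[OF u] X.Pd(1,2,3)])
  also have "... = fint N.P (extend u)" by (rule fint_N_X[OF extend_form[OF u], symmetric])
  also have "... = N.sqnorm u" unfolding N.sqnorm_def fint_def
  proof (intro suminf_cong pint_cong)
    fix k z assume "z \<in> snd (fst (N.P k)) ` snd (N.P k)"
    then have "chart_inv (fst (N.P k)) z \<in> fst (fst (N.P k))" using N.Pd(2)[of k] chart_inv_mem[OF N.Pd(1)] by blast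
    then show "extend u (fst (N.P k)) (chart_inv (fst (N.P k)) z) = u (fst (N.P k)) (chart_inv (fst (N.P k)) z)"
      by (rule extend_N[OF u N.Pd(1)])
  qed
  finally show ?thesis .
qed

lemma extend_A2: "u \<in> A2 N ==> extend u \<in> A2 X"
  using extend_form sqnorm_extend by (simp add: X.A2_iff N.A2_iff)

lemma extend_eqI:
  assumes "u \<in> A2 N" "holomorphic_form X \<alpha>" "\<And>c x. c \<in> charts N ==> x \<in> fst c ==> \<alpha> c x = u c x"
    "\<And>c x. x \<in> hole ==> \<alpha> c x = 0"
  shows "extend u = \<alpha>"
  by (rule forms_eqI[OF extend_form[OF assms(1)] assms(2)])
     (use assms(3,4) extend_N[OF assms(1)] extend_hole[OF assms(1)] in simp_all)

lemma A2_inner_extend: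
  assumes u: "u \<in> A2 N" and \<eta>: "\<eta> \<in> A2 N"
  shows "A2_inner X (extend u) (extend \<eta>) = A2_inner N u \<eta>"
proof -
  have "A2_inner X (extend u) (extend \<eta>) = of_real 1 * A2_inner N u \<eta>"
  proof (rule polarization_transfer[OF N.A2_function_hilbert_space X.A2_function_hilbert_space extend_A2 _ _ _ u \<eta>])
    fix f g :: "('a, 'n) form" assume f: "f \<in> A2 N" and g: "g \<in> A2 N"
    show "extend (\<lambda>i j. f i j + g i j) = (\<lambda>i j. extend f i j + extend g i j)"
      by (rule extend_eqI[OF N.A2_add[OF f g] holomorphic_form_add[OF extend_form[OF f] extend_form[OF g]]])
         (simp_all add: extend_N[OF f] extend_N[OF g] extend_hole[OF f] extend_hole[OF g])
  next
    fix f :: "('a, 'n) form" and a assume f: "f \<in> A2 N"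
    show "extend (\<lambda>i j. a * f i j) = (\<lambda>i j. a * extend f i j)"
      by (rule extend_eqI[OF N.A2_scale[OF f] holomorphic_form_scale[OF extend_form[OF f]]])
         (simp_all add: extend_N[OF f] extend_hole[OF f])
  next
    fix f :: "('a, 'n) form" assume f: "f \<in> A2 N"
    show "Re (A2_inner X (extend f) (extend f)) = 1 * Re (A2_inner N f f)"
      using X.Re_A2_inner_self[OF extend_A2[OF f]] N.Re_A2_inner_self[OF f] sqnorm_extend[OF f] by simp
  qed
  then show ?thesis by simp
qed

definition restr :: "('a, 'n) form => ('a, 'n) form" where
  "restr v c x = (if c \<in> charts N then v c x else 0)"

lemma restr_A2:
  assumes v: "v \<in> A2 X" shows "restr v \<in> A2 N"
proof -
  have vf: "holomorphic_form X v" by (rule X.A2_form[OF v])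
  have form: "holomorphic_form N (restr v)"
    unfolding holomorphic_form_def
  proof (intro conjI ballI allI impI)
    fix c :: "('a, 'n) chart" and x assume "\<not> (c \<in> charts N \<and> x \<in> fst c)"
    then show "restr v c x = 0" using form_zero[OF vf, of c x] by (auto simp: restr_def)
  next
    fix c :: "('a, 'n) chart" assume c: "c \<in> charts N"
    show "holo_on (\<lambda>z. restr v c (chart_inv c z)) (snd c ` fst c)"
      using form_holo[OF vf charts_NX[OF c]] c by (simp add: restr_def)
    fix d :: "('a, 'n) chart" and x assume d: "d \<in> charts N" and x: "x \<in> fst c \<inter> fst d"
    show "restr v c x = restr v d x * jac (\<lambda>z. snd d (chart_inv c z)) (snd c x)"
      using form_transform[OF vf charts_NX[OF c] charts_NX[OF d]] x c d by (simp add: restr_def)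
  qed
  have "N.sqnorm (restr v) = fint N.P v"
    unfolding N.sqnorm_def fint_def by (intro suminf_cong pint_cong) (simp add: restr_def N.Pd(1))
  also have "... = fint (\<lambda>k. (fst (X.P k), snd (X.P k) \<inter> G)) v" by (rule fint_N_X[OF vf])
  also have "... \<le> X.sqnorm v"
    unfolding X.sqnorm_def fint_def by (intro suminf_le) (auto intro: pint_mono)
  finally show ?thesis using form v unfolding X.A2_iff N.A2_iff by (metis le_less_trans)
qed

text \<open>Up to the null boundary one form lives on the hole and the other on \<open>G\<close>, so
  the product of their coefficients vanishes almost everywhere.\<close>

lemma A2_inner_disjoint:
  fixes \<alpha> \<beta> :: "('a, 'n) form"
  assumes \<alpha>: "\<alpha> \<in> A2 X" and \<beta>: "\<beta> \<in> A2 X"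
    and 1: "\<And>c x. c \<in> charts N ==> x \<in> fst c ==> \<alpha> c x = 0" and 2: "\<And>c x. x \<in> hole ==> \<beta> c x = 0"
  shows "A2_inner X \<alpha> \<beta> = 0"
proof -
  have z: "X.pr \<alpha> \<beta> k = 0" for k
  proof -
    have "AE z in lborel. X.loc \<alpha> k z * cnj (X.loc \<beta> k z) = 0"
    proof (rule AE_I'[OF boundary_null[OF X.Pd(1)[of k]]], rule subsetI, rule ccontr)
      fix z assume z: "z \<in> {z\<in>space lborel. \<not> X.loc \<alpha> k z * cnj (X.loc \<beta> k z) = 0}"
        and nz: "z \<notin> snd (fst (X.P k)) ` (fst (fst (X.P k)) - G - hole)"
      define c where "c = fst (X.P k)"
      have c: "c \<in> charts X" using X.Pd(1) by (simp add: c_def)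
      have "z \<in> snd c ` snd (X.P k)" and nz': "\<alpha> c (chart_inv c z) ~= 0" "\<beta> c (chart_inv c z) ~= 0"
        using z by (auto simp: X.loc_def c_def indicator_def split: if_splits)
      then obtain y where y: "y \<in> fst c" "z = snd c y" using X.Pd(2)[of k] by (auto simp: c_def)
      have n0: "\<alpha> c y ~= 0" "\<beta> c y ~= 0" using nz' y chart_inv_left[OF c] by auto
      have "y \<notin> hole" using 2[of y c] n0(2) by blast
      then have "y \<in> G" using nz y unfolding c_def[symmetric] by blast
      then have "\<alpha> (rc c) y = 0" using 1[OF rc_mem[OF c]] y(1) by (simp add: rc_def)
      moreover have "\<alpha> c y = \<alpha> (rc c) y"
        by (rule form_restrict[OF X.A2_form[OF \<alpha>] c charts_NX[OF rc_mem[OF c]]])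
           (use y \<open>y \<in> G\<close> in \<open>simp_all add: rc_def\<close>)
      ultimately show False using n0 by simp
    qed
    then show ?thesis unfolding X.pr_def by (rule integral_eq_zero_AE)
  qed
  have "X.pr \<alpha> \<beta> = (\<lambda>k. 0)" using z by blast
  then show ?thesis unfolding X.A2_inner_pr[OF \<alpha> \<beta>] by simp
qed

text \<open>The extension of the kernel of \<open>N\<close> reproduces on \<open>X\<close>: a form
  on \<open>X\<close> differs from the extension of its restriction by one that vanishes on
  \<open>G\<close> and is thus orthogonal to the extended kernel, and \<open>extend\<close> is
  isometric. Uniqueness of the reproducing kernel concludes.\<close>

theorem bk_restriction:
  fixes c d :: "('a, 'n) chart"
  assumes c: "c \<in> charts N" and x: "x \<in> fst c" and d: "d \<in> charts N"
  shows "X.bk c x d y = N.bk c x d y"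
proof -
  define k where "k = (\<lambda>c x. N.bk c x d y)"
  have k: "k \<in> A2 N" unfolding k_def by (rule N.bk_mem)
  have "extend k = (\<lambda>c x. cnj 1 * X.bk c x d y)"
  proof (rule X.bk_unique[OF extend_A2[OF k]])
    fix v :: "('a, 'n) form" assume v: "v \<in> A2 X"
    have r: "restr v \<in> A2 N" by (rule restr_A2[OF v])
    have e: "extend (restr v) \<in> A2 X" by (rule extend_A2[OF r])
    have "A2_inner X (fdiff v (extend (restr v))) (extend k) = 0"
      by (rule A2_inner_disjoint[OF X.A2_fdiff[OF v e] extend_A2[OF k] _ extend_hole[OF k]])
         (simp add: fdiff_def extend_N[OF r] restr_def)
    then have "A2_inner X v (extend k) = A2_inner X (extend (restr v)) (extend k)"
      using X.ip_diff[OF v e extend_A2[OF k]] by simp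
    also have "... = A2_inner N (restr v) k" by (rule A2_inner_extend[OF r k])
    also have "... = restr v d y" unfolding k_def by (rule N.bk_reproduces[OF r])
    finally show "A2_inner X v (extend k) = 1 * v d y" using d by (simp add: restr_def)
  qed
  then have "extend k c x = X.bk c x d y" by simp
  then show ?thesis using extend_N[OF k c x] by (simp add: k_def)
qed

end

section \<open>Analytic subvarieties and regular points\<close>

lemma tendsto_product_coordinate:
  "((\<lambda>w::nat => complex. w i) \<longlongrightarrow> z i) (at z within S)"
proof -
  have "continuous_on UNIV (\<lambda>w::nat => complex. w i)" by simp
  then have "((\<lambda>w::nat => complex. w i) \<longlongrightarrow> z i) (at z)" by (simp add: continuous_on_def)
  then show ?thesis by (rule tendsto_within_subset) simp
qed

lemma CN_eqI: "w \<in> CN N ==> z \<in> CN N ==> (\<And>i. i < N ==> w i = z i) ==> w = z"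
  unfolding CN_def by (rule PiE_ext) auto

text \<open>The quotient times its denominator recovers the remainder, and within
  \<open>CN N\<close> the denominator vanishes only at \<open>z\<close>.\<close>

lemma holo_CN_tendsto:
  assumes h: "holo_CN N h D" and z: "z \<in> D" "z \<in> CN N"
  shows "(h \<longlongrightarrow> h z) (at z within CN N)"
proof -
  obtain a where q: "((\<lambda>w. (h w - h z - (\<Sum>i<N. a i * (w i - z i))) / of_real (\<Sum>i<N. norm (w i - z i))) \<longlongrightarrow> 0) (at z within CN N)"
    using h z unfolding holo_CN_def by blast
  let ?s = "\<lambda>w. \<Sum>i<N. norm (w i - z i)" and ?l = "\<lambda>w. \<Sum>i<N. a i * (w i - z i)"
  have s: "(?s \<longlongrightarrow> (\<Sum>i<N. norm (z i - z i))) (at z within CN N)"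
    by (intro tendsto_intros tendsto_product_coordinate)
  have l: "(?l \<longlongrightarrow> (\<Sum>i<N. a i * (z i - z i))) (at z within CN N)"
    by (intro tendsto_intros tendsto_product_coordinate)
  have "((\<lambda>w. (h w - h z - ?l w) / of_real (?s w) * of_real (?s w) + ?l w + h z)
      \<longlongrightarrow> 0 * of_real (\<Sum>i<N. norm (z i - z i)) + (\<Sum>i<N. a i * (z i - z i)) + h z) (at z within CN N)"
    by (intro tendsto_add tendsto_mult tendsto_of_real q s l tendsto_const)
  moreover have "eventually (\<lambda>w. (h w - h z - ?l w) / of_real (?s w) * of_real (?s w) + ?l w + h z = h w) (at z within CN N)"
    unfolding eventually_at_filter
  proof (rule always_eventually, intro allI impI)
    fix w assume w: "w ~= z" "w \<in> CN N"
    have "?s w ~= 0"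
    proof
      assume "?s w = 0"
      then have "\<forall>i<N. norm (w i - z i) = 0" by (subst (asm) sum_nonneg_eq_0_iff) auto
      then show False using CN_eqI[OF w(2) z(2)] w(1) by auto
    qed
    then have "complex_of_real (?s w) ~= 0" by (simp only: of_real_eq_0_iff not_False_eq_True)
    then show "(h w - h z - ?l w) / of_real (?s w) * of_real (?s w) + ?l w + h z = h w"
      by (simp only: nonzero_divide_eq_eq times_divide_eq_left) (simp add: divide_simps)
  qed
  ultimately show ?thesis using Lim_transform_eventually by fastforce
qed

text \<open>Continuity is not part of the definition of a section. In a local model a section is
  locally the restriction of a holomorphic function of the ambient space, and continuity of the
  latter is transported back.\<close>

lemma hol_nonzero_near:
  assumes M: "reduced_complex_space M" and W: "openin (ctop M) W" and x: "x \<in> W" and g: "g \<in> hol M W" "g x ~= 0"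
  shows "\<exists>W'. openin (ctop M) W' \<and> x \<in> W' \<and> W' \<subseteq> W \<and> (\<forall>y\<in>W'. g y ~= 0)"
proof -
  have sh: "function_sheaf M" using M by (simp add: reduced_complex_space_def)
  have xt: "x \<in> topspace (ctop M)" using openin_subset[OF W] x by blast
  have "\<forall>x\<in>topspace (ctop M). \<exists>N D F U \<kappa>. openin (top_of_set (CN N)) D \<and> finite F \<and> (\<forall>h\<in>F. holo_CN N h D) \<and> x \<in> U \<and>
       local_iso M U \<kappa> {z\<in>D. \<forall>h\<in>F. h z = 0} (model_sheaf N)"
    using M by (simp add: reduced_complex_space_def)
  from bspec[OF this xt] obtain N D U \<kappa> and F :: "((nat => complex) => complex) set" where D: "openin (top_of_set (CN N)) D" and xU: "x \<in> U"
    and iso: "local_iso M U \<kappa> {z\<in>D. \<forall>h\<in>F. h z = 0} (model_sheaf N)"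
    by blast
  let ?A = "{z\<in>D. \<forall>h\<in>F. h z = 0}"
  have U: "openin (ctop M) U" and hm: "homeomorphic_map (subtopology (ctop M) U) (top_of_set ?A) \<kappa>"
    and hol: "\<And>W g. openin (ctop M) W ==> W \<subseteq> U ==> g \<in> hol M W \<longleftrightarrow> (\<lambda>z. g (inv_into U \<kappa> z)) \<in> model_sheaf N (\<kappa> ` W)"
    using iso unfolding local_iso_def by blast+
  have tU: "topspace (subtopology (ctop M) U) = U" using openin_subset[OF U] by auto
  have inj: "inj_on \<kappa> U" using homeomorphic_imp_injective_map[OF hm] tU by simp
  have cont: "continuous_map (subtopology (ctop M) U) (top_of_set ?A) \<kappa>" by (rule homeomorphic_imp_continuous_map[OF hm])
  have ACN: "?A \<subseteq> CN N" using openin_subset[OF D] by auto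
  have inA: "\<kappa> y \<in> ?A" if "y \<in> U" for y
    using continuous_map_funspace[OF cont] that tU by (auto simp: Pi_iff)
  have oWU: "openin (ctop M) (W \<inter> U)" by (rule openin_Int[OF W U])
  have "g \<in> hol M (W \<inter> U)" by (rule sheaf_restrict[OF sh W oWU _ g(1)]) blast
  then have ms: "(\<lambda>z. g (inv_into U \<kappa> z)) \<in> model_sheaf N (\<kappa> ` (W \<inter> U))" using hol[OF oWU] by blast
  have "\<kappa> x \<in> \<kappa> ` (W \<inter> U)" using x xU by blast
  then obtain D' h' where D': "openin (top_of_set (CN N)) D'" "\<kappa> x \<in> D'" and h': "holo_CN N h' D'"
    and eq: "\<forall>w\<in>D' \<inter> \<kappa> ` (W \<inter> U). g (inv_into U \<kappa> w) = h' w"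
    using ms unfolding model_sheaf_def by blast
  have eqy: "h' (\<kappa> y) = g y" if "y \<in> W" "y \<in> U" "\<kappa> y \<in> D'" for y
    using eq[rule_format, of "\<kappa> y"] that inv_into_f_f[OF inj that(2)] by simp
  have "(h' \<longlongrightarrow> h' (\<kappa> x)) (at (\<kappa> x) within CN N)"
    by (rule holo_CN_tendsto[OF h' D'(2)]) (use inA[OF xU] ACN in blast)
  then have "eventually (\<lambda>w. h' w ~= 0) (at (\<kappa> x) within CN N)"
    by (rule tendsto_imp_eventually_ne) (use eqy[OF x xU D'(2)] g(2) in simp)
  then obtain S where S: "open S" "\<kappa> x \<in> S" "\<forall>w\<in>S. w ~= \<kappa> x \<longrightarrow> w \<in> CN N \<longrightarrow> h' w ~= 0"
    unfolding eventually_at_topological by blast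
  obtain T where T: "open T" "D' = CN N \<inter> T" using D'(1) by (auto simp: openin_open)
  have "openin (top_of_set ?A) (?A \<inter> (S \<inter> T))" by (intro openin_open_Int open_Int S(1) T(1))
  then have "openin (subtopology (ctop M) U) {y \<in> topspace (subtopology (ctop M) U). \<kappa> y \<in> ?A \<inter> (S \<inter> T)}"
    by (rule openin_continuous_map_preimage[OF cont])
  then have "openin (ctop M) {y \<in> U. \<kappa> y \<in> ?A \<inter> (S \<inter> T)}"
    unfolding tU openin_open_subtopology[OF U] by blast
  then have o: "openin (ctop M) (W \<inter> {y \<in> U. \<kappa> y \<in> ?A \<inter> (S \<inter> T)})" by (rule openin_Int[OF W])
  show ?thesis
  proof (intro exI conjI ballI)
    show "x \<in> W \<inter> {y \<in> U. \<kappa> y \<in> ?A \<inter> (S \<inter> T)}" using x xU inA[OF xU] S(2) T(2) D'(2) by blast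
    fix y assume y: "y \<in> W \<inter> {y \<in> U. \<kappa> y \<in> ?A \<inter> (S \<inter> T)}"
    then have yD: "\<kappa> y \<in> D'" "y \<in> U" "y \<in> W" "\<kappa> y \<in> S" using T(2) ACN by blast+
    have "h' (\<kappa> y) ~= 0"
    proof (cases "\<kappa> y = \<kappa> x")
      case True
      then show ?thesis using eqy[OF x xU D'(2)] g(2) by simp
    next
      case False
      then show ?thesis using S(3) yD T(2) by blast
    qed
    then show "g y ~= 0" using eqy[OF yD(3,2,1)] by simp
  qed (use o in auto)
qed

lemma subvariety_complement_open:
  assumes M: "reduced_complex_space M" and V: "analytic_subvariety M V"
  shows "openin (ctop M) (topspace (ctop M) - V)"
proof (subst openin_subopen, rule ballI)
  fix x assume x: "x \<in> topspace (ctop M) - V"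
  then have "\<exists>W F. openin (ctop M) W \<and> x \<in> W \<and> finite F \<and> F \<subseteq> hol M W \<and> V \<inter> W = {y\<in>W. \<forall>g\<in>F. g y = 0}"
    using V unfolding analytic_subvariety_def by blast
  then obtain W F where W: "openin (ctop M) W" "x \<in> W" "F \<subseteq> hol M W" "V \<inter> W = {y\<in>W. \<forall>g\<in>F. g y = 0}" by blast
  then obtain g where g: "g \<in> F" "g x ~= 0" using x by blast
  obtain W' where W': "openin (ctop M) W'" "x \<in> W'" "W' \<subseteq> W" "\<forall>y\<in>W'. g y ~= 0"
    using hol_nonzero_near[where g = g, OF M W(1,2) _ g(2)] g(1) W(3) by blast
  have "W' \<inter> V = {}" using W' W(4) g(1) by blast
  then show "\<exists>T. openin (ctop M) T \<and> x \<in> T \<and> T \<subseteq> topspace (ctop M) - V"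
    using W'(1,2) openin_subset[OF W'(1)] by blast
qed

section \<open>Open subspaces and regular points\<close>

context
  fixes X :: "'a complex_space" and V :: "'a set"
  assumes o: "openin (ctop X) (topspace (ctop X) - V)"
begin

lemma openin_without: "openin (ctop (without X V)) W \<longleftrightarrow> openin (ctop X) W \<and> W \<subseteq> topspace (ctop X) - V"
  unfolding without_def using openin_open_subtopology[OF o] by simp

lemma topspace_without: "topspace (ctop (without X V)) = topspace (ctop X) - V"
  unfolding without_def by auto

lemma local_iso_without:
  "local_iso (without X V) U \<kappa> A \<O> \<longleftrightarrow> U \<subseteq> topspace (ctop X) - V \<and> local_iso X U \<kappa> A \<O>"
proof (cases "U \<subseteq> topspace (ctop X) - V")
  case True
  then have "subtopology (ctop (without X V)) U = subtopology (ctop X) U"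
    unfolding without_def by (simp add: subtopology_subtopology Int_absorb1)
  moreover have "hol (without X V) = hol X" by (simp add: without_def)
  moreover have "openin (ctop (without X V)) W \<and> W \<subseteq> U \<longleftrightarrow> openin (ctop X) W \<and> W \<subseteq> U" for W
    using True by (auto simp: openin_without)
  ultimately show ?thesis using True by (simp add: local_iso_def openin_without)
next
  case False
  then show ?thesis by (auto simp: local_iso_def openin_without)
qed

lemma charts_without: "(charts (without X V) :: ('a, 'n::finite) chart set) = {c\<in>charts X. fst c \<subseteq> topspace (ctop X) - V}"
  unfolding charts_def by (auto simp: local_iso_without)

lemma function_sheaf_without:
  assumes sh: "function_sheaf X" shows "function_sheaf (without X V)"
proof -
  have h: "hol (without X V) = hol X" by (simp add: without_def)
  show ?thesis
    unfolding function_sheaf_def openin_without h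
  proof (intro conjI allI impI; elim conjE)
    fix W g h assume "openin (ctop X) W" "g \<in> hol X W" "\<forall>x\<in>W. h x = g x"
    then show "h \<in> hol X W" using sheaf_cong[OF sh] by blast
  next
    fix W W' g assume "openin (ctop X) W" "openin (ctop X) W'" "W' \<subseteq> W" "g \<in> hol X W"
    then show "g \<in> hol X W'" by (rule sheaf_restrict[OF sh])
  next
    fix W g assume W: "openin (ctop X) W"
      and "\<forall>x\<in>W. \<exists>W'. (openin (ctop X) W' \<and> W' \<subseteq> topspace (ctop X) - V) \<and> x \<in> W' \<and> W' \<subseteq> W \<and> g \<in> hol X W'"
    then show "g \<in> hol X W" by (intro sheaf_glue[OF sh W]) meson
  qed
qed

end

lemma singular_complement_open: "openin (ctop X) (topspace (ctop X) - singular_points X)"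
proof (subst openin_subopen, rule ballI)
  fix x assume "x \<in> topspace (ctop X) - singular_points X"
  then obtain k D U \<kappa> where *: "openin (top_of_set (CN k)) D" "x \<in> U" "local_iso X U \<kappa> D (\<lambda>W. {h. holo_CN k h W})"
    unfolding singular_points_def by blast
  have o: "openin (ctop X) U" using *(3) by (simp add: local_iso_def)
  moreover have "U \<subseteq> topspace (ctop X) - singular_points X"
    using openin_subset[OF o] *(1,3) unfolding singular_points_def by blast
  ultimately show "\<exists>T. openin (ctop X) T \<and> x \<in> T \<and> T \<subseteq> topspace (ctop X) - singular_points X" using *(2) by blast
qed

text \<open>The sum of the moduli lies between the Euclidean norm and \<open>CARD('n)\<close> times
  it, so the quotient in \<open>holo_CN\<close> and the Frechet quotient tend to 0 together.\<close>

lemma linear_frechet_l1: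
  fixes h :: "complex^'n => complex" and b :: "'n => complex"
  defines "L \<equiv> \<lambda>v. \<Sum>j\<in>UNIV. b j * v $ j"
  shows "(h has_derivative L) (at z) \<longleftrightarrow>
    ((\<lambda>w. (h w - h z - L (w - z)) / of_real (\<Sum>j\<in>UNIV. norm (w $ j - z $ j))) \<longlongrightarrow> 0) (at z)"
    (is "_ \<longleftrightarrow> (?Q \<longlongrightarrow> 0) _")
proof -
  let ?s = "\<lambda>w. \<Sum>j\<in>UNIV. norm (w $ j - z $ j)"
  let ?R = "\<lambda>w. (1 / norm (w - z)) *\<^sub>R (h w - (h z + L (w - z)))"
  have bl: "bounded_linear L"
    unfolding L_def
    by (intro bounded_linear_sum bounded_linear_compose[OF bounded_linear_mult_right bounded_linear_vec_nth])
  have le1: "norm (w - z) \<le> ?s w" for w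
    using L2_set_le_sum[of UNIV "\<lambda>j. norm ((w - z) $ j)"] by (simp add: norm_vec_def)
  have le2: "?s w \<le> CARD('n) * norm (w - z)" for w
    using sum_bounded_above[of UNIV "\<lambda>j. norm ((w - z) $ j)" "norm (w - z)"] Finite_Cartesian_Product.norm_nth_le[of "w - z"] by simp
  have num: "h w - (h z + L (w - z)) = h w - h z - L (w - z)" for w by simp
  have c1: "norm (?Q w) \<le> norm (?R w) * 1" if w: "w ~= z" for w
  proof -
    have "norm (w - z) > 0" using w by simp
    moreover have "?s w \<ge> norm (w - z)" by (rule le1)
    ultimately show ?thesis
      unfolding num norm_divide norm_scaleR norm_of_real
      by (simp add: frac_le abs_of_pos sum_nonneg)
  qed
  have c2: "norm (?R w) \<le> norm (?Q w) * CARD('n)" if w: "w ~= z" for w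
  proof -
    have p: "norm (w - z) > 0" using w by simp
    then have p': "?s w > 0" using le1[of w] by linarith
    have "norm (h w - h z - L (w - z)) * ?s w \<le> norm (h w - h z - L (w - z)) * (CARD('n) * norm (w - z))"
      by (rule mult_left_mono[OF le2]) simp
    then have "norm (h w - h z - L (w - z)) / norm (w - z) \<le> norm (h w - h z - L (w - z)) / ?s w * CARD('n)"
      using p p' by (simp add: field_simps)
    then show ?thesis unfolding num norm_divide norm_scaleR norm_of_real using p p' by simp
  qed
  have "(?R \<longlongrightarrow> 0) (at z) \<longleftrightarrow> (?Q \<longlongrightarrow> 0) (at z)"
  proof
    assume "(?R \<longlongrightarrow> 0) (at z)"
    then show "(?Q \<longlongrightarrow> 0) (at z)"
      by (rule tendsto_0_le[where K = 1]) (use c1 in \<open>auto simp: eventually_at_filter\<close>)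
  next
    assume "(?Q \<longlongrightarrow> 0) (at z)"
    then show "(?R \<longlongrightarrow> 0) (at z)"
      by (rule tendsto_0_le[where K = "CARD('n)"]) (use c2 in \<open>auto simp: eventually_at_filter\<close>)
  qed
  then show ?thesis using bl by (simp add: has_derivative_within)
qed

locale coordinate_enumeration =
  fixes e :: "nat => 'n::finite" and e' :: "'n => nat"
  assumes e': "e' j < CARD('n)" "e (e' j) = j" and e: "i < CARD('n) ==> e' (e i) = i"
begin

text \<open>The remaining coordinates are \<open>undefined\<close> because \<open>CN N\<close>
  consists of extensional functions.\<close>

definition flat :: "complex^'n => nat => complex" where
  "flat z = (\<lambda>i. if i < CARD('n) then z $ e i else undefined)"

definition unflat :: "(nat => complex) => complex^'n" where "unflat w = vec_lambda (\<lambda>j. w (e' j))"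

lemma flat_CN: "flat z \<in> CN CARD('n)"
  by (simp add: flat_def CN_def PiE_iff extensional_def)

lemma unflat_flat: "unflat (flat z) = z"
  by (simp add: vec_eq_iff unflat_def flat_def e')

lemma flat_unflat: "w \<in> CN CARD('n) ==> flat (unflat w) = w"
  by (rule CN_eqI[OF flat_CN]) (auto simp: unflat_def flat_def e)

lemma continuous_flat: "continuous_on S flat"
proof (rule continuous_on_coordinatewise_then_product)
  show "continuous_on S (\<lambda>z. flat z i)" for i
    unfolding flat_def by (cases "i < CARD('n)") (auto intro!: continuous_intros)
qed

lemma continuous_unflat: "continuous_on S unflat"
proof -
  have "continuous_on UNIV unflat"
    unfolding unflat_def by (intro continuous_on_vec_lambda) simp
  then show ?thesis by (rule continuous_on_subset) simp
qed

lemma sum_enumeration: "(\<Sum>i<CARD('n). F i) = (\<Sum>j\<in>UNIV. F (e' j))"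
  by (rule sum.reindex_bij_witness[of _ e' e]) (auto simp: e' e)

lemma homeomorphic_flat: "homeomorphic_map (top_of_set S) (top_of_set (flat ` S)) flat"
proof -
  have "homeomorphic_maps (top_of_set S) (top_of_set (flat ` S)) flat unflat"
    unfolding homeomorphic_maps_def
    by (auto simp: unflat_flat intro!: continuous_flat continuous_unflat)
  then show ?thesis by (rule homeomorphic_maps_imp_map)
qed

lemma openin_flat:
  assumes "open S" shows "openin (top_of_set (CN CARD('n))) (flat ` S)"
proof -
  have "open (unflat -` S)" using assms continuous_unflat[of UNIV] by (rule open_vimage)
  moreover have "flat ` S = CN CARD('n) \<inter> unflat -` S"
    using flat_CN unflat_flat flat_unflat by (auto simp: image_iff) metis
  ultimately show ?thesis by (simp add: openin_open_Int)
qed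

lemma tendsto_flat_iff:
  fixes Q :: "(nat => complex) => complex"
  shows "(Q \<longlongrightarrow> l) (at (flat z) within CN CARD('n)) \<longleftrightarrow> ((\<lambda>v. Q (flat v)) \<longlongrightarrow> l) (at z)"
proof
  assume Q: "(Q \<longlongrightarrow> l) (at (flat z) within CN CARD('n))"
  have "filterlim flat (at (flat z) within CN CARD('n)) (at z)"
    unfolding filterlim_at
  proof
    show "eventually (\<lambda>v. flat v \<in> CN CARD('n) \<and> flat v ~= flat z) (at z)"
      unfolding eventually_at_filter using flat_CN unflat_flat by (intro always_eventually) metis
    show "(flat \<longlongrightarrow> flat z) (at z)" using continuous_flat[of UNIV] by (simp add: continuous_on_def)
  qed
  from filterlim_compose[OF Q this] show "((\<lambda>v. Q (flat v)) \<longlongrightarrow> l) (at z)" .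
next
  assume Q: "((\<lambda>v. Q (flat v)) \<longlongrightarrow> l) (at z)"
  have "filterlim unflat (at z) (at (flat z) within CN CARD('n))"
    unfolding filterlim_at
  proof
    show "eventually (\<lambda>w. unflat w \<in> UNIV \<and> unflat w ~= z) (at (flat z) within CN CARD('n))"
      unfolding eventually_at_filter using flat_unflat by (intro always_eventually) auto
    have "(unflat \<longlongrightarrow> unflat (flat z)) (at (flat z))" using continuous_unflat[of UNIV] by (simp add: continuous_on_def)
    then show "(unflat \<longlongrightarrow> z) (at (flat z) within CN CARD('n))"
      using tendsto_within_subset[of _ _ _ UNIV] by (simp add: unflat_flat)
  qed
  from filterlim_compose[OF Q this] have "((\<lambda>w. Q (flat (unflat w))) \<longlongrightarrow> l) (at (flat z) within CN CARD('n))" .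
  moreover have "eventually (\<lambda>w. Q (flat (unflat w)) = Q w) (at (flat z) within CN CARD('n))"
    unfolding eventually_at_filter using flat_unflat by (intro always_eventually) auto
  ultimately show "(Q \<longlongrightarrow> l) (at (flat z) within CN CARD('n))" by (rule Lim_transform_eventually)
qed

lemma holo_CN_flat: "holo_CN CARD('n) h (flat ` S) \<longleftrightarrow> holo_on (\<lambda>z. h (flat z)) S"
proof -
  have "(\<exists>a :: nat => complex.
      ((\<lambda>w. (h w - h (flat z) - (\<Sum>i<CARD('n). a i * (w i - flat z i))) / of_real (\<Sum>i<CARD('n). norm (w i - flat z i)))
        \<longlongrightarrow> 0) (at (flat z) within CN CARD('n)))
    \<longleftrightarrow> (\<exists>L. ((\<lambda>z. h (flat z)) has_derivative L) (at z) \<and> (\<forall>c v. L (c *s v) = c * L v))" (is "?L \<longleftrightarrow> ?R") for z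
  proof -
    have key: "((\<lambda>w. (h w - h (flat z) - (\<Sum>i<CARD('n). a i * (w i - flat z i))) / of_real (\<Sum>i<CARD('n). norm (w i - flat z i)))
        \<longlongrightarrow> 0) (at (flat z) within CN CARD('n))
      \<longleftrightarrow> ((\<lambda>z. h (flat z)) has_derivative (\<lambda>v. \<Sum>j\<in>UNIV. a (e' j) * v $ j)) (at z)" for a
      unfolding tendsto_flat_iff linear_frechet_l1
      by (simp add: sum_enumeration flat_def e' cong: if_cong)
    show ?thesis
    proof
      assume ?L
      then obtain a where "((\<lambda>z. h (flat z)) has_derivative (\<lambda>v. \<Sum>j\<in>UNIV. a (e' j) * v $ j)) (at z)"
        using key by blast
      then show ?R by (intro exI[of _ "\<lambda>v. \<Sum>j\<in>UNIV. a (e' j) * v $ j"]) (auto simp: sum_distrib_left ac_simps)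
    next
      assume ?R
      then obtain L where L: "((\<lambda>z. h (flat z)) has_derivative L) (at z)" "\<And>c v. L (c *s v) = c * L v" by blast
      have lin: "linear L" using has_derivative_linear[OF L(1)] .
      have "L v = (\<Sum>j\<in>UNIV. L (axis (e (e' j)) 1) * v $ j)" for v
      proof -
        have "L v = L (\<Sum>j\<in>UNIV. v $ j *s axis j 1)" by (simp add: basis_expansion)
        also have "... = (\<Sum>j\<in>UNIV. v $ j * L (axis j 1))" by (simp add: linear_sum[OF lin] L(2))
        finally show ?thesis by (simp add: e' mult.commute)
      qed
      then have "L = (\<lambda>v. \<Sum>j\<in>UNIV. L (axis (e (e' j)) 1) * v $ j)" by blast
      then have "((\<lambda>z. h (flat z)) has_derivative (\<lambda>v. \<Sum>j\<in>UNIV. L (axis (e (e' j)) 1) * v $ j)) (at z)"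
        using L(1) by simp
      then show ?L unfolding key[symmetric, of "\<lambda>i. L (axis (e i) 1)"] by (rule exI[of _ "\<lambda>i. L (axis (e i) 1)"])
    qed
  qed
  then show ?thesis unfolding holo_CN_def holo_on_def by (simp add: ball_simps)
qed

end

text \<open>A chart followed by \<open>flat\<close> is a local model on an open subset of
  \<open>CN CARD('n)\<close>. Hence \<open>M - V\<close>, being covered by charts, lies in the
  regular part of \<open>M\<close>.\<close>

lemma chart_nonsingular:
  fixes c :: "('a, 'n::finite) chart"
  assumes c: "c \<in> charts X" and x: "x \<in> fst c"
  shows "x \<notin> singular_points X"
proof -
  obtain e0 where e0: "bij_betw e0 {0..<CARD('n)} (UNIV :: 'n set)" using ex_bij_betw_nat_finite[OF finite] by blast
  define e1 where "e1 = inv_into {0..<CARD('n)} e0"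
  interpret coordinate_enumeration e0 e1
  proof
    fix j :: 'n
    have j: "j \<in> e0 ` {0..<CARD('n)}" using e0 by (simp add: bij_betw_def)
    show "e1 j < CARD('n)" using inv_into_into[OF j] by (simp add: e1_def)
    show "e0 (e1 j) = j" unfolding e1_def by (rule f_inv_into_f[OF j])
  next
    fix i assume "i < CARD('n)"
    then show "e1 (e0 i) = i" unfolding e1_def using e0 by (intro inv_into_f_f) (auto simp: bij_betw_def)
  qed
  have inj: "inj_on (snd c) (fst c)" by (rule chart_inj[OF c])
  have injf: "inj_on flat S" for S by (metis inj_on_def unflat_flat)
  have "local_iso X (fst c) (flat \<circ> snd c) (flat ` snd c ` fst c) (\<lambda>W. {h. holo_CN CARD('n) h W})"
    unfolding local_iso_def
  proof (intro conjI allI impI)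
    show "openin (ctop X) (fst c)" by (rule chart_openin[OF c])
    have "homeomorphic_map (subtopology (ctop X) (fst c)) (top_of_set (snd c ` fst c)) (snd c)"
      using c by (auto simp: charts_def local_iso_def)
    then show "homeomorphic_map (subtopology (ctop X) (fst c)) (top_of_set (flat ` snd c ` fst c)) (flat \<circ> snd c)"
      by (rule homeomorphic_map_compose[OF _ homeomorphic_flat])
    fix W g assume W: "openin (ctop X) W \<and> W \<subseteq> fst c"
    have oW: "open (snd c ` W)" by (rule chart_open_image[OF c]) (use W in auto)
    have "inv_into (fst c) (flat \<circ> snd c) (flat z) = chart_inv c z" if z: "z \<in> snd c ` W" for z
    proof -
      obtain y where y: "y \<in> fst c" "z = snd c y" using z W by blast
      have "inv_into (fst c) (flat \<circ> snd c) ((flat \<circ> snd c) y) = y"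
        by (rule inv_into_f_f[OF comp_inj_on[OF inj injf] y(1)])
      then show ?thesis using chart_inv_left[OF c y(1)] y(2) by simp
    qed
    then have "holo_on (\<lambda>z. g (inv_into (fst c) (flat \<circ> snd c) (flat z))) (snd c ` W) \<longleftrightarrow> holo_on (\<lambda>z. g (chart_inv c z)) (snd c ` W)"
      using holo_on_cong[OF oW, of "\<lambda>z. g (inv_into (fst c) (flat \<circ> snd c) (flat z))" "\<lambda>z. g (chart_inv c z)"]
        holo_on_cong[OF oW, of "\<lambda>z. g (chart_inv c z)" "\<lambda>z. g (inv_into (fst c) (flat \<circ> snd c) (flat z))"] by auto
    then show "g \<in> hol X W \<longleftrightarrow>
        (\<lambda>z. g (inv_into (fst c) (flat \<circ> snd c) z)) \<in> {h. holo_CN CARD('n) h ((flat \<circ> snd c) ` W)}"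
      using chart_hol[OF c, of W g] W unfolding image_comp[symmetric] mem_Collect_eq holo_CN_flat by blast
  qed
  then show ?thesis using openin_flat[OF chart_open_range[OF c]] x unfolding singular_points_def by blast
qed

lemma form_restriction_regular_part:
  assumes M: "reduced_complex_space M" and V: "analytic_subvariety M V"
    and N: "complex_manifold TYPE('n::finite) (without M V)"
  shows "form_restriction TYPE('n) (regular_part M) (without M V) (topspace (ctop M) - V)"
proof -
  note oV = subvariety_complement_open[OF M V]
  note oS = singular_complement_open[of M]
  have sh: "function_sheaf M" and sc: "second_countable (ctop M)" using M by (auto simp: reduced_complex_space_def)
  have sub: "topspace (ctop M) - V \<subseteq> topspace (ctop M) - singular_points M"
  proof
    fix x assume x: "x \<in> topspace (ctop M) - V"
    then obtain c :: "('a, 'n) chart" where c: "c \<in> charts (without M V)" "x \<in> fst c"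
      using N topspace_without[OF oV] unfolding complex_manifold_def by blast
    then have "c \<in> charts M" using charts_without[OF oV] by blast
    then show "x \<in> topspace (ctop M) - singular_points M" using chart_nonsingular[OF _ c(2)] x by blast
  qed
  show ?thesis
  proof
    show "second_countable (ctop (regular_part M))"
      unfolding regular_part_def without_def using sc by (simp add: second_countable_subtopology)
    show "function_sheaf (regular_part M)" unfolding regular_part_def by (rule function_sheaf_without[OF oS sh])
    show "second_countable (ctop (without M V))" "function_sheaf (without M V)"
      using N by (auto simp: complex_manifold_def)
    show "openin (ctop (regular_part M)) (topspace (ctop M) - V)"
      unfolding regular_part_def openin_without[OF oS] using oV sub by blast
    show "(charts (without M V) :: ('a, 'n) chart set) = {c \<in> charts (regular_part M). fst c \<subseteq> topspace (ctop M) - V}"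
      unfolding regular_part_def charts_without[OF oS] charts_without[OF oV] using sub by blast
    fix x assume "x \<in> topspace (ctop (regular_part M))"
    then have x: "x \<in> topspace (ctop M)" "x \<notin> singular_points M" unfolding regular_part_def topspace_without[OF oS] by auto
    have "\<exists>W F. openin (ctop M) W \<and> x \<in> W \<and> finite F \<and> F \<subseteq> hol M W \<and> V \<inter> W = {y\<in>W. \<forall>g\<in>F. g y = 0}"
      using V x(1) unfolding analytic_subvariety_def by blast
    then obtain W F where W: "openin (ctop M) W" "x \<in> W" "F \<subseteq> hol M W" "V \<inter> W = {y\<in>W. \<forall>g\<in>F. g y = 0}" by blast
    define W' where "W' = W \<inter> (topspace (ctop M) - singular_points M)"
    have oW': "openin (ctop M) W'" unfolding W'_def by (rule openin_Int[OF W(1) oS])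
    have "F \<subseteq> hol M W'" using sheaf_restrict[OF sh W(1) oW'] W(3) by (auto simp: W'_def)
    then have "F \<subseteq> hol (regular_part M) W'" by (simp add: regular_part_def without_def)
    moreover have "openin (ctop (regular_part M)) W'"
      unfolding regular_part_def openin_without[OF oS] using oW' by (auto simp: W'_def)
    moreover have "W' - (topspace (ctop M) - V) = {y\<in>W'. \<forall>g\<in>F. g y = 0}"
      using W(4) by (auto simp: W'_def)
    moreover have "x \<in> W'" using W(2) x by (simp add: W'_def)
    ultimately show "\<exists>W F. openin (ctop (regular_part M)) W \<and> x \<in> W \<and> F \<subseteq> hol (regular_part M) W \<and>
        W - (topspace (ctop M) - V) = {y\<in>W. \<forall>g\<in>F. g y = 0}" by blast
  qed
qed

section \<open>Pull-back of forms\<close>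

definition cjac :: "('a => 'b) => ('b, 'n::finite) chart => ('a, 'n) chart => 'a => complex" where
  "cjac f d c x = jac (\<lambda>z. snd d (f (chart_inv c z))) (snd c x)"

lemma holomorphic_map_id: "holomorphic_map X X (\<lambda>x. x)" if "function_sheaf X"
  unfolding holomorphic_map_def
proof (intro conjI allI impI)
  show "continuous_map (ctop X) (ctop X) (\<lambda>x. x)" by simp
  fix W and g :: "'a => complex" assume W: "openin (ctop X) W \<and> g \<in> hol X W"
  then have "{x \<in> topspace (ctop X). x \<in> W} = W" using openin_subset[of "ctop X" W] by blast
  then show "g \<circ> (\<lambda>x. x) \<in> hol X {x \<in> topspace (ctop X). x \<in> W}" using W by (simp add: o_def)
qed

lemma cjac_cong:
  assumes c: "c \<in> charts X" and O: "openin (ctop X) U" "x \<in> U" "x \<in> fst c"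
    and eq: "\<And>y. y \<in> fst c ==> y \<in> U ==> snd d (f y) = snd d' (g y)"
  shows "cjac f d c x = cjac g d' c x"
  unfolding cjac_def
proof (rule jac_cong)
  show "open (snd c ` (fst c \<inter> U))" by (rule chart_open_image[OF c openin_Int[OF chart_openin[OF c] O(1)]]) blast
  show "snd c x \<in> snd c ` (fst c \<inter> U)" using O by blast
  fix z assume "z \<in> snd c ` (fst c \<inter> U)"
  then obtain y where "y \<in> fst c" "y \<in> U" "z = snd c y" by blast
  then show "snd d (f (chart_inv c z)) = snd d' (g (chart_inv c z))" using eq chart_inv_left[OF c] by simp
qed

context
  fixes X :: "'a complex_space" and Y :: "'b complex_space" and f :: "'a => 'b"
  assumes sheafX: "function_sheaf X" and f: "holomorphic_map X Y f"
begin

lemma preimage_openin: "openin (ctop Y) W ==> openin (ctop X) {x \<in> topspace (ctop X). f x \<in> W}"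
  by (rule openin_continuous_map_preimage) (use f in \<open>auto simp: holomorphic_map_def\<close>)

lemma chart_preimage_openin:
  assumes c: "c \<in> charts X" and W: "openin (ctop Y) W"
  shows "openin (ctop X) (fst c \<inter> f -` W)"
proof -
  have "fst c \<inter> f -` W = fst c \<inter> {x \<in> topspace (ctop X). f x \<in> W}" using chart_subset_topspace[OF c] by blast
  then show ?thesis using openin_Int[OF chart_openin[OF c] preimage_openin[OF W]] by simp
qed

text \<open>Coordinates of \<open>d\<close> are sections on the target, a holomorphic map pulls them
  back to sections, and the chart \<open>c\<close> reads these as holomorphic functions.\<close>

lemma holo_map_in_charts:
  fixes c :: "('a, 'n::finite) chart" and d :: "('b, 'n) chart"
  assumes c: "c \<in> charts X" and d: "d \<in> charts Y"
  shows "holo_map (\<lambda>z. snd d (f (chart_inv c z))) (snd c ` (fst c \<inter> f -` fst d))"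
  unfolding holo_map_def
proof
  fix i
  have o: "openin (ctop X) (fst c \<inter> f -` fst d)" by (rule chart_preimage_openin[OF c chart_openin[OF d]])
  have "holo_on (\<lambda>z. snd d (chart_inv d z) $ i) (snd d ` fst d)"
    by (rule holo_on_cong[OF chart_open_range[OF d] _ holo_on_coord[of i]]) (simp add: chart_inv_right[OF d])
  then have "(\<lambda>y. snd d y $ i) \<in> hol Y (fst d)" using chart_hol[OF d chart_openin[OF d] order_refl] by simp
  then have "(\<lambda>y. snd d y $ i) \<circ> f \<in> hol X {x \<in> topspace (ctop X). f x \<in> fst d}"
    using f chart_openin[OF d] unfolding holomorphic_map_def by blast
  then have "(\<lambda>y. snd d y $ i) \<circ> f \<in> hol X (fst c \<inter> f -` fst d)"
    by (rule sheaf_restrict[OF sheafX preimage_openin[OF chart_openin[OF d]] o, rotated])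
       (use chart_subset_topspace[OF c] in blast)
  then show "holo_on (\<lambda>z. snd d (f (chart_inv c z)) $ i) (snd c ` (fst c \<inter> f -` fst d))"
    using chart_hol[OF c o] by simp
qed

end

text \<open>With the identity in place of one of the maps, this is the rule for changing charts in
  the source or in the target.\<close>

lemma cjac_chain:
  fixes X :: "'a complex_space" and Y :: "'b complex_space" and Z :: "'c complex_space" and c :: "('a, 'n::finite) chart" and d :: "('b, 'n) chart" and e :: "('c, 'n) chart"
  assumes sheafX: "function_sheaf X" and f: "holomorphic_map X Y f"
    and sheafY: "function_sheaf Y" and g: "holomorphic_map Y Z g"
    and c: "c \<in> charts X" "x \<in> fst c" and d: "d \<in> charts Y" "f x \<in> fst d" and e: "e \<in> charts Z" "g (f x) \<in> fst e"
  shows "cjac (\<lambda>x. g (f x)) e c x = cjac g e d (f x) * cjac f d c x"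
proof -
  let ?F = "\<lambda>z. snd d (f (chart_inv c z))" and ?G = "\<lambda>w. snd e (g (chart_inv d w))"
  have inv: "chart_inv c (snd c x) = x" by (rule chart_inv_left[OF c])
  have "cjac (\<lambda>x. g (f x)) e c x = jac (\<lambda>z. ?G (?F z)) (snd c x)"
    unfolding cjac_def
  proof (rule jac_cong)
    show "open (snd c ` (fst c \<inter> f -` fst d))"
      by (rule chart_open_image[OF c(1) chart_preimage_openin[OF sheafX f c(1) chart_openin[OF d(1)]]]) blast
    show "snd c x \<in> snd c ` (fst c \<inter> f -` fst d)" using c d by blast
    fix z assume "z \<in> snd c ` (fst c \<inter> f -` fst d)"
    then obtain y where "y \<in> fst c" "f y \<in> fst d" "z = snd c y" by blast
    then show "snd e (g (f (chart_inv c z))) = ?G (?F z)"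
      using chart_inv_left[OF c(1)] chart_inv_left[OF d(1)] by simp
  qed
  also have "... = jac ?G (?F (snd c x)) * jac ?F (snd c x)"
  proof (rule jac_compose)
    show "\<exists>M. chol ?F M (snd c x)"
      using holo_map_in_charts[OF sheafX f c(1) d(1)] c d unfolding holo_map_iff by blast
    have "holo_map ?G (snd d ` (fst d \<inter> g -` fst e))" by (rule holo_map_in_charts[OF sheafY g d(1) e(1)])
    then show "\<exists>L. chol ?G L (?F (snd c x))"
      using d e unfolding holo_map_iff inv by blast
  qed
  finally show ?thesis by (simp add: cjac_def inv)
qed

text \<open>\<open>chart_at\<close> fixes one chart at each point of the target;
  \<open>pull_eq\<close> shows that any other gives the same value.\<close>

definition pull :: "'a complex_space => 'b complex_space => ('a => 'b) => ('b, 'n::finite) form => ('a, 'n) form" where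
  "pull X Y f \<psi> c x = (if c \<in> charts X \<and> x \<in> fst c
     then \<psi> (chart_at Y (f x)) (f x) * cjac f (chart_at Y (f x)) c x else 0)"

lemma chart_at:
  fixes d :: "('b, 'n::finite) chart"
  assumes "d \<in> charts Y" "y \<in> fst d"
  shows "(chart_at Y y :: ('b, 'n) chart) \<in> charts Y" "y \<in> fst (chart_at Y y :: ('b, 'n) chart)"
  using someI[of "\<lambda>c :: ('b, 'n) chart. c \<in> charts Y \<and> y \<in> fst c" d] assms by (auto simp: chart_at_def)

context
  fixes X :: "'a complex_space" and Y :: "'b complex_space" and f :: "'a => 'b" and \<psi> :: "('b, 'n::finite) form"
  assumes sheafX: "function_sheaf X" and sheafY: "function_sheaf Y" and f: "holomorphic_map X Y f"
    and covY: "\<And>y. y \<in> topspace (ctop Y) ==> \<exists>d\<in>charts Y :: ('b, 'n) chart set. y \<in> fst d"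
    and \<psi>: "holomorphic_form Y \<psi>"
begin

lemma pull_eq:
  assumes c: "c \<in> charts X" "x \<in> fst c" and d: "d \<in> charts Y" "f x \<in> fst d"
  shows "pull X Y f \<psi> c x = \<psi> d (f x) * cjac f d c x"
proof -
  let ?d = "chart_at Y (f x) :: ('b, 'n) chart"
  have d': "?d \<in> charts Y" "f x \<in> fst ?d" using chart_at[OF d] by auto
  have "cjac (\<lambda>x. f x) ?d c x = cjac (\<lambda>y. y) ?d d (f x) * cjac f d c x"
    by (rule cjac_chain[OF sheafX f sheafY holomorphic_map_id[OF sheafY] c d d'])
  moreover have "\<psi> d (f x) = \<psi> ?d (f x) * cjac (\<lambda>y. y) ?d d (f x)"
    using form_transform[OF \<psi> d(1) d'(1) d(2) d'(2)] by (simp add: cjac_def)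
  ultimately show ?thesis using c by (simp add: pull_def)
qed

lemma map_chart_exists: "x \<in> fst c ==> c \<in> charts X ==> \<exists>d\<in>charts Y :: ('b, 'n) chart set. f x \<in> fst d"
  for c :: "('a, 'n) chart"
  using covY f chart_subset_topspace[of c X] unfolding holomorphic_map_def continuous_map_def Pi_iff by blast

lemma pull_form: "holomorphic_form X (pull X Y f \<psi>)"
  unfolding holomorphic_form_def
proof (intro conjI ballI allI impI)
  fix c :: "('a, 'n) chart" and x assume "\<not> (c \<in> charts X \<and> x \<in> fst c)"
  then show "pull X Y f \<psi> c x = 0" unfolding pull_def by (rule if_not_P)
next
  fix c :: "('a, 'n) chart" assume c: "c \<in> charts X"
  show "holo_on (\<lambda>z. pull X Y f \<psi> c (chart_inv c z)) (snd c ` fst c)"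
  proof (rule holo_on_local)
    fix z assume "z \<in> snd c ` fst c"
    then obtain x where x: "x \<in> fst c" "z = snd c x" by blast
    obtain d :: "('b, 'n) chart" where d: "d \<in> charts Y" "f x \<in> fst d" using map_chart_exists[OF x(1) c] by blast
    let ?E = "snd c ` (fst c \<inter> f -` fst d)" and ?T = "\<lambda>z. snd d (f (chart_inv c z))"
    have E: "open ?E" by (rule chart_open_image[OF c chart_preimage_openin[OF sheafX f c chart_openin[OF d(1)]]]) blast
    have T: "holo_map ?T ?E" by (rule holo_map_in_charts[OF sheafX f c d(1)])
    have inv: "chart_inv c w \<in> fst c" "f (chart_inv c w) \<in> fst d" "snd c (chart_inv c w) = w" if "w \<in> ?E" for w
      using that chart_inv_left[OF c] by auto
    have "holo_on (\<lambda>w. \<psi> d (chart_inv d (?T w)) * jac ?T w) ?E"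
      by (intro holo_on_mult holo_on_compose[OF T form_holo[OF \<psi> d(1)]] holo_on_jac[OF E T]) (use inv in auto)
    then have "holo_on (\<lambda>w. pull X Y f \<psi> c (chart_inv c w)) ?E"
      by (rule holo_on_cong[OF E, rotated])
         (simp add: pull_eq[OF c _ d(1)] inv chart_inv_left[OF d(1)] cjac_def)
    moreover have "z \<in> ?E" using x d(2) by blast
    ultimately show "\<exists>E. z \<in> E \<and> holo_on (\<lambda>w. pull X Y f \<psi> c (chart_inv c w)) E"
      by (intro exI[of _ ?E] conjI)
  qed
  fix c' :: "('a, 'n) chart" and x assume c': "c' \<in> charts X" and "x \<in> fst c \<inter> fst c'"
  then have x: "x \<in> fst c" "x \<in> fst c'" by auto
  obtain d :: "('b, 'n) chart" where d: "d \<in> charts Y" "f x \<in> fst d" using map_chart_exists[OF x(1) c] by blast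
  have "cjac (\<lambda>x. f x) d c x = cjac f d c' x * cjac (\<lambda>y. y) c' c x"
    by (rule cjac_chain[OF sheafX holomorphic_map_id[OF sheafX] sheafX f c x(1) c' x(2) d])
  then show "pull X Y f \<psi> c x = pull X Y f \<psi> c' x * jac (\<lambda>z. snd c' (chart_inv c z)) (snd c x)"
    unfolding pull_eq[OF c x(1) d] pull_eq[OF c' x(2) d] by (simp add: cjac_def)
qed

end

section \<open>Finite coverings of complex manifolds\<close>

locale manifold_covering = X: form_space X dim + Y: form_space Y dim
  for X :: "'a complex_space" and Y :: "'b complex_space" and dim :: "'n::finite itself" +
  fixes f :: "'a => 'b" and m :: nat
  assumes covX: "\<And>x. x \<in> topspace (ctop X) ==> \<exists>c\<in>charts X :: ('a, 'n) chart set. x \<in> fst c"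
    and covY: "\<And>y. y \<in> topspace (ctop Y) ==> \<exists>d\<in>charts Y :: ('b, 'n) chart set. y \<in> fst d"
    and f: "holomorphic_map X Y f"
    and covering: "finite_covering m (ctop X) (ctop Y) f"
begin

text \<open>The image is not prescribed, unlike for the sheets of an evenly covered set, so that
  open subsets of sheets are sheets.\<close>

definition sheet :: "'a set => bool" where
  "sheet U \<longleftrightarrow> openin (ctop X) U \<and> inj_on f U \<and> (\<forall>W. openin (ctop X) W \<and> W \<subseteq> U \<longrightarrow> openin (ctop Y) (f ` W))"

lemma sheet_subset: "sheet U ==> openin (ctop X) W ==> W \<subseteq> U ==> sheet W"
  unfolding sheet_def by (meson inj_on_subset order_trans)

lemma f_mem: "x \<in> topspace (ctop X) ==> f x \<in> topspace (ctop Y)"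
  using f unfolding holomorphic_map_def continuous_map_def by blast

definition evenly :: "'b set => 'a set set => bool" where
  "evenly W \<U> \<longleftrightarrow> openin (ctop Y) W \<and> finite \<U> \<and> card \<U> = m \<and> disjoint \<U> \<and>
     \<Union>\<U> = {x\<in>topspace (ctop X). f x \<in> W} \<and> (\<forall>U\<in>\<U>. sheet U \<and> f ` U = W)"

lemma evenly_exists:
  assumes y: "y \<in> topspace (ctop Y)" shows "\<exists>W \<U>. y \<in> W \<and> evenly W \<U>"
proof -
  obtain W \<U> where W: "openin (ctop Y) W" "y \<in> W" "finite \<U>" "card \<U> = m" "disjoint \<U>"
    "\<Union>\<U> = {x\<in>topspace (ctop X). f x \<in> W}"
    and h: "\<And>U. U \<in> \<U> ==> openin (ctop X) U \<and> homeomorphic_map (subtopology (ctop X) U) (subtopology (ctop Y) W) f"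
    using covering y unfolding finite_covering_def by meson
  have "sheet U \<and> f ` U = W" if U: "U \<in> \<U>" for U
  proof -
    have o: "openin (ctop X) U" and hm: "homeomorphic_map (subtopology (ctop X) U) (subtopology (ctop Y) W) f"
      using h[OF U] by auto
    have tU: "topspace (subtopology (ctop X) U) = U" using openin_subset[OF o] by auto
    have tW: "topspace (subtopology (ctop Y) W) = W" using openin_subset[OF W(1)] by auto
    have "openin (ctop Y) (f ` V)" if V: "openin (ctop X) V \<and> V \<subseteq> U" for V
    proof -
      have "openin (subtopology (ctop X) U) V" using V by (simp add: openin_open_subtopology[OF o])
      then have "openin (subtopology (ctop Y) W) (f ` V)"
        using homeomorphic_imp_open_map[OF hm] unfolding open_map_def by blast
      then show ?thesis by (simp add: openin_open_subtopology[OF W(1)])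
    qed
    moreover have "inj_on f U" using homeomorphic_imp_injective_map[OF hm] unfolding tU .
    moreover have "f ` U = W" using homeomorphic_imp_surjective_map[OF hm] unfolding tU tW .
    ultimately show ?thesis using o by (simp add: sheet_def)
  qed
  then show ?thesis using W unfolding evenly_def by blast
qed

text \<open>\<open>W'\<close> is nonempty so that the cut sheets stay distinct and their number is
  still \<open>m\<close>.\<close>

lemma evenly_restrict:
  assumes e: "evenly W \<U>" and W': "openin (ctop Y) W'" "W' \<subseteq> W" "W' ~= {}"
  shows "evenly W' ((\<lambda>U. U \<inter> f -` W') ` \<U>)"
proof -
  have U: "sheet U" "f ` U = W" if "U \<in> \<U>" for U using e that by (auto simp: evenly_def)
  have img: "f ` (U \<inter> f -` W') = W'" if "U \<in> \<U>" for U using U(2)[OF that] W'(2) by blast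
  have disj: "U \<inter> V = {}" if "U \<in> \<U>" "V \<in> \<U>" "U ~= V" for U V
    using e that unfolding evenly_def disjoint_def by blast
  have inj: "inj_on (\<lambda>U. U \<inter> f -` W') \<U>"
  proof (rule inj_onI, rule ccontr)
    fix U V assume UV: "U \<in> \<U>" "V \<in> \<U>" "U \<inter> f -` W' = V \<inter> f -` W'" "U ~= V"
    then have "U \<inter> f -` W' = {}" using disj[OF UV(1,2,4)] by blast
    then show False using img[OF UV(1)] W'(3) by simp
  qed
  have "sheet (U \<inter> f -` W')" if "U \<in> \<U>" for U
  proof (rule sheet_subset[OF U(1)[OF that]])
    have "openin (ctop X) U" using U(1)[OF that] by (simp add: sheet_def)
    moreover from this have "U \<inter> f -` W' = U \<inter> {x \<in> topspace (ctop X). f x \<in> W'}"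
      using openin_subset by fastforce
    ultimately show "openin (ctop X) (U \<inter> f -` W')" using openin_Int preimage_openin[OF X.sheaf f W'(1)] by metis
  qed blast
  moreover have "\<Union>((\<lambda>U. U \<inter> f -` W') ` \<U>) = {x\<in>topspace (ctop X). f x \<in> W'}"
  proof -
    have "\<Union>((\<lambda>U. U \<inter> f -` W') ` \<U>) = \<Union>\<U> \<inter> f -` W'" by blast
    also have "... = {x\<in>topspace (ctop X). f x \<in> W'}" using e W'(2) unfolding evenly_def by blast
    finally show ?thesis .
  qed
  moreover have "disjoint ((\<lambda>U. U \<inter> f -` W') ` \<U>)"
    unfolding disjoint_def using disj by blast
  ultimately show ?thesis
    using e W'(1) img unfolding evenly_def by (simp add: card_image[OF inj])
qed

definition good :: "('b, 'n) chart set" where "good = {d \<in> charts Y. \<exists>\<U>. evenly (fst d) \<U>}"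

lemma good_near:
  fixes d :: "('b, 'n) chart"
  assumes d: "d \<in> charts Y" "y \<in> fst d"
  shows "\<exists>W. y \<in> W \<and> W \<subseteq> fst d \<and> (W, snd d) \<in> good"
proof -
  have "y \<in> topspace (ctop Y)" using chart_subset_topspace[OF d(1)] d(2) by blast
  then obtain W \<U> where W: "y \<in> W" "evenly W \<U>" using evenly_exists by blast
  have o: "openin (ctop Y) (fst d \<inter> W)"
    by (rule openin_Int[OF chart_openin[OF d(1)]]) (use W(2) in \<open>simp add: evenly_def\<close>)
  have "evenly (fst d \<inter> W) ((\<lambda>U. U \<inter> f -` (fst d \<inter> W)) ` \<U>)"
    by (rule evenly_restrict[OF W(2) o]) (use W(1) d(2) in auto)
  moreover have "(fst d \<inter> W, snd d) \<in> charts Y" by (rule chart_restrict(1)[OF d(1) o]) blast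
  ultimately have "(fst d \<inter> W, snd d) \<in> good" unfolding good_def by auto
  then show ?thesis using W(1) d(2) by (intro exI[of _ "fst d \<inter> W"]) auto
qed

text \<open>The local biholomorphy of \<open>f\<close>: on a sheet the coordinates of the target
  serve as coordinates of the source. The transition from a chart \<open>c\<close> of
  \<open>X\<close> is holomorphic because \<open>f\<close> is, the one back by
  \<open>holo_inverse\<close>; the sheaf of \<open>X\<close> is then compared locally in the charts
  \<open>c\<close> and glued.\<close>

lemma pulled_chart:
  fixes d :: "('b, 'n) chart"
  assumes d: "d \<in> charts Y" and U: "sheet U" "f ` U \<subseteq> fst d"
  shows "(U, snd d \<circ> f) \<in> charts X"
    and "x \<in> U ==> chart_inv (U, snd d \<circ> f) (snd d (f x)) = x"
    and "z \<in> snd d ` f ` U ==> chart_inv (U, snd d \<circ> f) z \<in> U"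
    and "z \<in> snd d ` f ` U ==> f (chart_inv (U, snd d \<circ> f) z) = chart_inv d z"
proof -
  let ?e = "(U, snd d \<circ> f) :: ('a, 'n) chart"
  have oU: "openin (ctop X) U" and injf: "inj_on f U" using U(1) by (auto simp: sheet_def)
  have open_im: "openin (ctop Y) (f ` W)" if "openin (ctop X) W" "W \<subseteq> U" for W using U(1) that by (simp add: sheet_def)
  have injd: "inj_on (snd d) (f ` U)" using chart_inj[OF d] U(2) by (rule inj_on_subset)
  have inj: "inj_on (snd d \<circ> f) U" by (rule comp_inj_on[OF injf injd])
  have left: "chart_inv ?e (snd d (f x)) = x" if "x \<in> U" for x
    using inv_into_f_f[OF inj that] by (simp add: chart_inv_def)
  then show "x \<in> U ==> chart_inv ?e (snd d (f x)) = x" by blast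
  show "z \<in> snd d ` f ` U ==> chart_inv ?e z \<in> U" using left by auto
  show "z \<in> snd d ` f ` U ==> f (chart_inv ?e z) = chart_inv d z"
    using left chart_inv_left[OF d] U(2) by auto
  have op: "open (snd d ` f ` W)" if "openin (ctop X) W" "W \<subseteq> U" for W
    by (rule chart_open_image[OF d open_im[OF that]]) (use that U(2) in blast)
  have trans: "holo_map (\<lambda>z. snd d (f (chart_inv c z))) (snd c ` W)" "holo_map (\<lambda>z. snd c (chart_inv ?e z)) (snd d ` f ` W)"
    if c: "c \<in> charts X" and W: "openin (ctop X) W" "W \<subseteq> fst c" "W \<subseteq> U" for c :: "('a, 'n) chart" and W
  proof -
    show T: "holo_map (\<lambda>z. snd d (f (chart_inv c z))) (snd c ` W)"
      by (rule holo_map_subset[OF holo_map_in_charts[OF X.sheaf f c d]]) (use W U(2) in blast)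
    show "holo_map (\<lambda>z. snd c (chart_inv ?e z)) (snd d ` f ` W)"
    proof (rule holo_inverse[OF chart_open_image[OF c W(1,2)] op[OF W(1,3)] T])
      have "snd d (f (chart_inv c (snd c x))) = snd d (f x)" if "x \<in> W" for x using chart_inv_left[OF c] that W(2) by (simp add: subset_iff)
      then show "(\<lambda>z. snd d (f (chart_inv c z))) ` snd c ` W = snd d ` f ` W"
        by (simp add: image_image cong: image_cong)
      show "snd c (chart_inv ?e (snd d (f (chart_inv c z)))) = z" if z: "z \<in> snd c ` W" for z
      proof -
        obtain x where "x \<in> W" "z = snd c x" using z by blast
        then show ?thesis using chart_inv_left[OF c, of x] left[of x] W(2,3) by (simp add: subset_iff)
      qed
      \<comment> \<open>Continuity of the inverse is openness of \<open>f\<close> on the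
        sheet.\<close>
      show "continuous_on (snd d ` f ` W) (\<lambda>z. snd c (chart_inv ?e z))"
        unfolding continuous_on_open_vimage[OF op[OF W(1,3)]]
      proof (intro allI impI)
        fix Q :: "(complex^'n) set" assume Q: "open Q"
        have eq: "(\<lambda>z. snd c (chart_inv ?e z)) -` Q \<inter> snd d ` f ` W = snd d ` f ` (W \<inter> (fst c \<inter> snd c -` Q))"
          using left W(2,3) by (auto simp: subset_iff)
        show "open ((\<lambda>z. snd c (chart_inv ?e z)) -` Q \<inter> snd d ` f ` W)"
          unfolding eq by (rule op) (use openin_Int[OF W(1) chart_vimage[OF c Q]] W(3) in auto)
      qed
    qed
  qed
  show "?e \<in> charts X"
    unfolding mem_charts_iff fst_conv snd_conv
  proof (intro conjI allI impI)
    show "openin (ctop X) U" by (rule oU)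
    show "open ((snd d \<circ> f) ` U)" using op[OF oU order_refl] by (simp add: image_comp)
    show "inj_on (snd d \<circ> f) U" by (rule inj)
    fix Q :: "(complex^'n) set" assume Q: "open Q"
    have "U \<inter> (snd d \<circ> f) -` Q = U \<inter> {x \<in> topspace (ctop X). f x \<in> fst d \<inter> snd d -` Q}"
      using U(2) openin_subset[OF oU] by auto
    then show "openin (ctop X) (U \<inter> (snd d \<circ> f) -` Q)"
      using openin_Int[OF oU preimage_openin[OF X.sheaf f chart_vimage[OF d Q]]] by simp
  next
    fix W assume "openin (ctop X) W \<and> W \<subseteq> U"
    then show "open ((snd d \<circ> f) ` W)" using op[of W] by (simp add: image_comp)
  next
    fix W g assume "openin (ctop X) W \<and> W \<subseteq> U"
    then have W: "openin (ctop X) W" "W \<subseteq> U" by auto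
    have key: "g \<in> hol X W' \<longleftrightarrow> holo_on (\<lambda>z. g (chart_inv ?e z)) (snd d ` f ` W')"
      if c: "c \<in> charts X" and W': "openin (ctop X) W'" "W' \<subseteq> fst c" "W' \<subseteq> U" for c :: "('a, 'n) chart" and W'
    proof -
      note T = trans(1)[OF c W'] and S = trans(2)[OF c W']
      have i: "chart_inv c (snd c x) = x" "chart_inv ?e (snd d (f x)) = x" if "x \<in> W'" for x
        using that chart_inv_left[OF c] left W' by (auto simp: subset_iff)
      have "holo_on (\<lambda>z. g (chart_inv ?e z)) (snd d ` f ` W')" if h: "holo_on (\<lambda>z. g (chart_inv c z)) (snd c ` W')"
      proof (rule holo_on_cong[OF op[OF W'(1,3)]])
        show "holo_on (\<lambda>z. g (chart_inv c (snd c (chart_inv ?e z)))) (snd d ` f ` W')"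
          by (rule holo_on_compose[OF S h]) (use i in auto)
      qed (use i in auto)
      moreover have "holo_on (\<lambda>z. g (chart_inv c z)) (snd c ` W')" if h: "holo_on (\<lambda>z. g (chart_inv ?e z)) (snd d ` f ` W')"
      proof (rule holo_on_cong[OF chart_open_image[OF c W'(1,2)]])
        show "holo_on (\<lambda>z. g (chart_inv ?e (snd d (f (chart_inv c z))))) (snd c ` W')"
          by (rule holo_on_compose[OF T h]) (use i in auto)
      qed (use i in auto)
      ultimately show ?thesis using chart_hol[OF c W'(1,2)] by blast
    qed
    have chart: "\<exists>c :: ('a, 'n) chart. c \<in> charts X \<and> x \<in> fst c" if "x \<in> W" for x
      using covX[of x] openin_subset[OF W(1)] that by blast
    show "g \<in> hol X W \<longleftrightarrow> holo_on (\<lambda>z. g (chart_inv ?e z)) ((snd d \<circ> f) ` W)"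
      unfolding image_comp[symmetric]
    proof
      assume g: "g \<in> hol X W"
      show "holo_on (\<lambda>z. g (chart_inv ?e z)) (snd d ` f ` W)"
      proof (rule holo_on_local)
        fix z assume "z \<in> snd d ` f ` W"
        then obtain x where x: "x \<in> W" "z = snd d (f x)" by blast
        obtain c :: "('a, 'n) chart" where c: "c \<in> charts X" "x \<in> fst c" using chart[OF x(1)] by blast
        have o: "openin (ctop X) (W \<inter> fst c)" by (rule openin_Int[OF W(1) chart_openin[OF c(1)]])
        have "g \<in> hol X (W \<inter> fst c)" by (rule sheaf_restrict[OF X.sheaf W(1) o _ g]) blast
        then have "holo_on (\<lambda>z. g (chart_inv ?e z)) (snd d ` f ` (W \<inter> fst c))" using key[OF c(1) o] W(2) by blast
        moreover have "z \<in> snd d ` f ` (W \<inter> fst c)" using x c(2) by blast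
        ultimately show "\<exists>E. z \<in> E \<and> holo_on (\<lambda>z. g (chart_inv ?e z)) E" by (intro exI conjI)
      qed
    next
      assume h: "holo_on (\<lambda>z. g (chart_inv ?e z)) (snd d ` f ` W)"
      show "g \<in> hol X W"
      proof (rule sheaf_glue[OF X.sheaf W(1)])
        fix x assume x: "x \<in> W"
        obtain c :: "('a, 'n) chart" where c: "c \<in> charts X" "x \<in> fst c" using chart[OF x] by blast
        have o: "openin (ctop X) (W \<inter> fst c)" by (rule openin_Int[OF W(1) chart_openin[OF c(1)]])
        have "holo_on (\<lambda>z. g (chart_inv ?e z)) (snd d ` f ` (W \<inter> fst c))" by (rule holo_on_subset[OF h]) blast
        then have "g \<in> hol X (W \<inter> fst c)" using key[OF c(1) o] W(2) by blast
        then show "\<exists>W'. openin (ctop X) W' \<and> x \<in> W' \<and> W' \<subseteq> W \<and> g \<in> hol X W'"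
          using o x c(2) by (intro exI[of _ "W \<inter> fst c"]) auto
      qed
    qed
  qed
qed

end

context manifold_covering
begin

text \<open>In a pulled back chart \<open>f\<close> is the identity in coordinates, with Jacobian
  1.\<close>

lemma pull_pulled:
  fixes d :: "('b, 'n) chart"
  assumes \<psi>: "holomorphic_form Y \<psi>" and d: "d \<in> charts Y" and U: "sheet U" "f ` U \<subseteq> fst d" and x: "x \<in> U"
  shows "pull X Y f \<psi> (U, snd d \<circ> f) x = \<psi> d (f x)"
proof -
  let ?e = "(U, snd d \<circ> f) :: ('a, 'n) chart"
  note e = pulled_chart[OF d U]
  have fx: "f x \<in> fst d" using U(2) x by blast
  have "cjac f d ?e x = 1"
    unfolding cjac_def
  proof (rule jac_eq_1_of_id)
    show "open (snd d ` f ` U)" using chart_open_range[OF e(1)] by (simp add: image_comp)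
    show "snd ?e x \<in> snd d ` f ` U" using x by simp
    fix w assume "w \<in> snd d ` f ` U"
    then obtain y where "y \<in> U" "w = snd d (f y)" by blast
    then show "snd d (f (chart_inv ?e w)) = w" using e(2) by simp
  qed
  then show ?thesis
    using pull_eq[OF X.sheaf Y.sheaf f covY \<psi> e(1) _ d fx] x by simp
qed

lemma charts_Union_X: "\<Union>(fst ` (charts X :: ('a, 'n) chart set)) = topspace (ctop X)"
  using covX chart_subset_topspace by blast

lemma charts_Union_Y: "\<Union>(fst ` (charts Y :: ('b, 'n) chart set)) = topspace (ctop Y)"
  using covY chart_subset_topspace by blast

lemma good_charts: "good \<subseteq> charts Y" and good_Union: "\<Union>(fst ` good) = \<Union>(fst ` (charts Y :: ('b, 'n) chart set))"
proof -
  show g: "good \<subseteq> charts Y" by (auto simp: good_def)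
  have "y \<in> \<Union>(fst ` good)" if d: "d \<in> charts Y" "y \<in> fst d" for d :: "('b, 'n) chart" and y
  proof -
    obtain W where "y \<in> W" "(W, snd d) \<in> good" using good_near[OF d] by blast
    then show ?thesis by force
  qed
  then show "\<Union>(fst ` good) = \<Union>(fst ` (charts Y :: ('b, 'n) chart set))" using g by blast
qed

text \<open>The enumeration by \<open>i < m\<close> labels the sheets over one piece. A piece may be
  empty with a chart that is not known to be evenly covered; then empty sheets do.\<close>

lemma sheets_over:
  fixes q :: "('b, 'n) chart \<times> 'b set"
  assumes q: "fst q \<in> good \<or> snd q = {}" "snd q \<subseteq> fst (fst q)"
  shows "\<exists>u. (\<forall>i<m. sheet (u i) \<and> f ` u i \<subseteq> fst (fst q) \<and> f ` (u i \<inter> f -` snd q) = snd q) \<and>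
    (\<forall>i<m. \<forall>j<m. i ~= j \<longrightarrow> u i \<inter> u j = {}) \<and>
    (\<Union>i<m. u i \<inter> f -` snd q) = {x\<in>topspace (ctop X). f x \<in> snd q}"
proof (cases "fst q \<in> good")
  case False
  then show ?thesis using q by (intro exI[of _ "\<lambda>i. {}"]) (auto simp: sheet_def)
next
  case True
  then obtain \<U> where U: "evenly (fst (fst q)) \<U>" by (auto simp: good_def)
  then have fin: "finite \<U>" "card \<U> = m" and disj: "\<And>A B. A \<in> \<U> ==> B \<in> \<U> ==> A ~= B ==> A \<inter> B = {}"
    and un: "\<Union>\<U> = {x\<in>topspace (ctop X). f x \<in> fst (fst q)}" and sh: "\<And>A. A \<in> \<U> ==> sheet A \<and> f ` A = fst (fst q)"
    by (simp_all add: evenly_def disjoint_def)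
  obtain u where u: "bij_betw u {0..<m} \<U>" using ex_bij_betw_nat_finite[OF fin(1)] fin(2) by blast
  have mem: "u i \<in> \<U>" if "i < m" for i using u that by (auto simp: bij_betw_def)
  have ne: "u i ~= u j" if "i < m" "j < m" "i ~= j" for i j using u that by (auto simp: bij_betw_def inj_on_def)
  have Un: "(\<Union>i<m. u i) = \<Union>\<U>" using u by (auto simp: bij_betw_def atLeast0LessThan)
  show ?thesis
  proof (intro exI[of _ u] conjI allI impI)
    fix i assume i: "i < m"
    show "sheet (u i)" "f ` u i \<subseteq> fst (fst q)" using sh[OF mem[OF i]] by auto
    have "f ` (u i \<inter> f -` snd q) = f ` u i \<inter> snd q" by blast
    then show "f ` (u i \<inter> f -` snd q) = snd q" using sh[OF mem[OF i]] q(2) by (simp add: Int_absorb1)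
    fix j assume j: "j < m" "i ~= j"
    show "u i \<inter> u j = {}" by (rule disj[OF mem[OF i] mem[OF j(1)] ne[OF i j]])
  next
    have "(\<Union>i<m. u i \<inter> f -` snd q) = (\<Union>i<m. u i) \<inter> f -` snd q" by auto
    also have "... = {x\<in>topspace (ctop X). f x \<in> fst (fst q)} \<inter> f -` snd q" unfolding Un un ..
    also have "... = {x\<in>topspace (ctop X). f x \<in> snd q}" using q(2) by (auto simp del: fst_conv)
    finally show "(\<Union>i<m. u i \<inter> f -` snd q) = {x\<in>topspace (ctop X). f x \<in> snd q}" .
  qed
qed

text \<open>Cut \<open>Y\<close> into pieces inside evenly covered charts. Each piece has
  \<open>m\<close> lifts, the pulled back form has the same coefficients on each lift in its pulled
  back chart, and all lifts together partition \<open>X\<close>.\<close>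

lemma sqnorm_pull:
  fixes \<psi> :: "('b, 'n) form"
  assumes \<psi>: "holomorphic_form Y \<psi>"
  shows "X.sqnorm (pull X Y f \<psi>) = of_nat m * Y.sqnorm \<psi>"
proof -
  let ?\<phi> = "pull X Y f \<psi>"
  obtain Q where Q: "chart_partition Y Q" and Qg: "\<And>k. fst (Q k) \<in> good \<or> snd (Q k) = {}"
    using chart_partition_subordinate[OF Y.second_countable Y.sheaf good_charts good_Union] by metis
  have fam: "chart_family Y Q" and Qun: "(\<Union>k. snd (Q k)) = topspace (ctop Y)"
    using Q charts_Union_Y by (auto simp: chart_partition_iff)
  note Qd = chart_familyD[OF fam]
  define H where "H k u \<longleftrightarrow> (\<forall>i<m. sheet (u i) \<and> f ` u i \<subseteq> fst (fst (Q k)) \<and> f ` (u i \<inter> f -` snd (Q k)) = snd (Q k)) \<and>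
    (\<forall>i<m. \<forall>j<m. i ~= j \<longrightarrow> u i \<inter> u j = {}) \<and>
    (\<Union>i<m. u i \<inter> f -` snd (Q k)) = {x\<in>topspace (ctop X). f x \<in> snd (Q k)}" for k u
  have "\<exists>u. H k u" for k unfolding H_def by (rule sheets_over[OF Qg Qd(2)])
  then obtain u where u: "\<And>k. H k (u k)" by metis
  have u1: "sheet (u k i)" "f ` u k i \<subseteq> fst (fst (Q k))" "f ` (u k i \<inter> f -` snd (Q k)) = snd (Q k)" if "i < m" for k i
    using u[of k] that by (auto simp: H_def)
  have u2: "u k i \<inter> u k j = {}" if "i < m" "j < m" "i ~= j" for k i j using u[of k] that by (simp add: H_def)
  have u3: "(\<Union>i<m. u k i \<inter> f -` snd (Q k)) = {x\<in>topspace (ctop X). f x \<in> snd (Q k)}" for k using u[of k] by (simp add: H_def)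
  \<comment> \<open>Lifts are indexed by piece and sheet and padded with the empty chart for
    \<open>i \<ge> m\<close>; \<open>prod_decode\<close> later makes this a sequence.\<close>
  define R :: "nat \<times> nat => ('a, 'n) chart \<times> 'a set" where
    "R = (\<lambda>(k, i). if i < m then ((u k i, snd (fst (Q k)) \<circ> f), u k i \<inter> f -` snd (Q k)) else (({}, undefined), {}))"
  have R: "fst (R (k, i)) \<in> charts X" "snd (R (k, i)) \<subseteq> fst (fst (R (k, i)))" "snd (fst (R (k, i))) ` snd (R (k, i)) \<in> sets borel"
    "pint (fst (R (k, i))) (snd (R (k, i))) ?\<phi> = (if i < m then pint (fst (Q k)) (snd (Q k)) \<psi> else 0)" for k i
  proof -
    show "fst (R (k, i)) \<in> charts X"
      using pulled_chart(1)[OF Qd(1) u1(1,2), of i k] by (simp add: R_def empty_chart[OF X.sheaf])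
    show "snd (R (k, i)) \<subseteq> fst (fst (R (k, i)))" by (simp add: R_def)
    have img: "(snd (fst (Q k)) \<circ> f) ` (u k i \<inter> f -` snd (Q k)) = snd (fst (Q k)) ` snd (Q k)" if "i < m"
      unfolding image_comp[symmetric] u1(3)[OF that, of k] ..
    then show "snd (fst (R (k, i))) ` snd (R (k, i)) \<in> sets borel" using Qd(3)[of k] by (simp add: R_def)
    show "pint (fst (R (k, i))) (snd (R (k, i))) ?\<phi> = (if i < m then pint (fst (Q k)) (snd (Q k)) \<psi> else 0)"
    proof (cases "i < m")
      case True
      let ?e = "(u k i, snd (fst (Q k)) \<circ> f) :: ('a, 'n) chart"
      have "?\<phi> ?e (chart_inv ?e z) = \<psi> (fst (Q k)) (chart_inv (fst (Q k)) z)" if z: "z \<in> snd (fst (Q k)) ` snd (Q k)" for z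
      proof -
        have "z \<in> snd (fst (Q k)) ` f ` (u k i \<inter> f -` snd (Q k))" using z unfolding u1(3)[OF True] .
        then obtain x where x: "x \<in> u k i" "z = snd (fst (Q k)) (f x)" by blast
        have fx: "f x \<in> fst (fst (Q k))" using u1(2)[OF True] x(1) by blast
        show ?thesis
          unfolding x(2) pulled_chart(2)[OF Qd(1) u1(1,2)[OF True] x(1)] chart_inv_left[OF Qd(1) fx]
          by (rule pull_pulled[OF \<psi> Qd(1) u1(1,2)[OF True] x(1)])
      qed
      then have "pint ?e (u k i \<inter> f -` snd (Q k)) ?\<phi> = pint (fst (Q k)) (snd (Q k)) \<psi>"
        unfolding pint_def snd_conv img[OF True] by (intro nn_integral_cong) (simp add: indicator_def)
      then show ?thesis using True by (simp add: R_def)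
    qed (simp add: R_def)
  qed
  have famR: "chart_family X (\<lambda>l. R (prod_decode l))"
    unfolding chart_family_def
  proof (intro conjI allI)
    show "fst (R (prod_decode l)) \<in> charts X" "snd (R (prod_decode l)) \<subseteq> fst (fst (R (prod_decode l)))"
      "snd (fst (R (prod_decode l))) ` snd (R (prod_decode l)) \<in> sets borel" for l
      using R(1-3)[of "fst (prod_decode l)" "snd (prod_decode l)"] by simp_all
    show "disjoint_family (\<lambda>l. snd (R (prod_decode l)))"
      unfolding disjoint_family_on_def
    proof (intro ballI impI)
      fix l l' :: nat assume "l ~= l'"
      obtain k i where ki: "prod_decode l = (k, i)" by (cases "prod_decode l")
      obtain k' i' where ki': "prod_decode l' = (k', i')" by (cases "prod_decode l'")
      have ne: "(k, i) ~= (k', i')" using \<open>l ~= l'\<close> ki ki' by (metis prod_decode_inverse)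
      show "snd (R (prod_decode l)) \<inter> snd (R (prod_decode l')) = {}"
      proof (cases "k = k'")
        case True
        then show ?thesis using ne u2[of i i' k] unfolding ki ki' by (auto simp: R_def)
      next
        case False
        then have "snd (Q k) \<inter> snd (Q k') = {}" using Qd(4) unfolding disjoint_family_on_def by blast
        then show ?thesis unfolding ki ki' by (auto simp: R_def)
      qed
    qed
  qed
  have unR: "(\<Union>l. snd (R (prod_decode l))) = topspace (ctop X)"
  proof
    show "(\<Union>l. snd (R (prod_decode l))) \<subseteq> topspace (ctop X)"
      using chart_familyD(1,2)[OF famR] chart_subset_topspace by blast
    show "topspace (ctop X) \<subseteq> (\<Union>l. snd (R (prod_decode l)))"
    proof
      fix x assume x: "x \<in> topspace (ctop X)"
      then obtain k where "f x \<in> snd (Q k)" using f_mem Qun by blast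
      then obtain i where "i < m" "x \<in> u k i" "f x \<in> snd (Q k)" using u3[of k] x by blast
      then have "x \<in> snd (R (prod_decode (prod_encode (k, i))))" by (simp add: R_def)
      then show "x \<in> (\<Union>l. snd (R (prod_decode l)))" by blast
    qed
  qed
  have "X.sqnorm ?\<phi> = fint (\<lambda>l. R (prod_decode l)) ?\<phi>"
    unfolding X.sqnorm_def
    by (rule fint_family_independent[OF pull_form[OF X.sheaf Y.sheaf f covY \<psi>] X.P_family famR])
       (simp_all add: X.P_Union charts_Union_X unR)
  also have "... = (\<Sum>k. of_nat m * pint (fst (Q k)) (snd (Q k)) \<psi>)"
    unfolding fint_def
  proof (rule suminf_ennreal_2dimen[of _ "\<lambda>r. pint (fst (R r)) (snd (R r)) ?\<phi>"])
    fix k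
    have "(\<Sum>i. pint (fst (R (k, i))) (snd (R (k, i))) ?\<phi>) = (\<Sum>i<m. pint (fst (R (k, i))) (snd (R (k, i))) ?\<phi>)"
      by (rule suminf_finite) (auto simp: R(4))
    then show "of_nat m * pint (fst (Q k)) (snd (Q k)) \<psi> = (\<Sum>i. pint (fst (R (k, i))) (snd (R (k, i))) ?\<phi>)"
      by (simp add: R(4))
  qed
  also have "... = of_nat m * fint Q \<psi>" unfolding fint_def by simp
  also have "fint Q \<psi> = Y.sqnorm \<psi>"
    unfolding Y.sqnorm_def
    by (rule fint_family_independent[OF \<psi> fam Y.P_family]) (simp add: Y.P_Union charts_Union_Y Qun)
  finally show ?thesis .
qed

lemma m_pos: "m > 0"
  using covering by (simp add: finite_covering_def)

text \<open>The factor \<open>m\<close> is positive and finite, so norms on \<open>X\<close> decide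
  square integrability on \<open>Y\<close>. In this way a push-forward is seen to be square
  integrable from its pull-back, a finite sum over the deck group.\<close>

lemma pull_A2_iff:
  fixes \<psi> :: "('b, 'n) form"
  assumes "holomorphic_form Y \<psi>" shows "pull X Y f \<psi> \<in> A2 X \<longleftrightarrow> \<psi> \<in> A2 Y"
proof -
  have "of_nat m * Y.sqnorm \<psi> < \<infinity> \<longleftrightarrow> Y.sqnorm \<psi> < \<infinity>"
    using m_pos of_nat_less_top[of m] by (auto simp: ennreal_mult_less_top)
  then show ?thesis
    using assms pull_form[OF X.sheaf Y.sheaf f covY assms] by (simp add: X.A2_iff Y.A2_iff sqnorm_pull)
qed

lemma pull_A2: "\<psi> \<in> A2 Y ==> pull X Y f \<psi> \<in> A2 X" for \<psi> :: "('b, 'n) form"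
  using pull_A2_iff Y.A2_form by blast

lemma A2_inner_pull:
  fixes \<psi> \<eta> :: "('b, 'n) form"
  assumes \<psi>: "\<psi> \<in> A2 Y" and \<eta>: "\<eta> \<in> A2 Y"
  shows "A2_inner X (pull X Y f \<psi>) (pull X Y f \<eta>) = of_nat m * A2_inner Y \<psi> \<eta>"
proof -
  have "A2_inner X (pull X Y f \<psi>) (pull X Y f \<eta>) = of_real (real m) * A2_inner Y \<psi> \<eta>"
  proof (rule polarization_transfer[OF Y.A2_function_hilbert_space X.A2_function_hilbert_space pull_A2 _ _ _ \<psi> \<eta>])
    fix \<phi> \<xi> :: "('b, 'n) form" and a
    show "pull X Y f (\<lambda>i j. \<phi> i j + \<xi> i j) = (\<lambda>i j. pull X Y f \<phi> i j + pull X Y f \<xi> i j)"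
      by (intro ext) (simp add: pull_def distrib_right)
    show "pull X Y f (\<lambda>i j. a * \<phi> i j) = (\<lambda>i j. a * pull X Y f \<phi> i j)"
      by (intro ext) (simp add: pull_def)
    assume \<phi>: "\<phi> \<in> A2 Y"
    have "enn2real (of_nat m * Y.sqnorm \<phi>) = real m * enn2real (Y.sqnorm \<phi>)"
      by (simp add: enn2real_mult)
    then show "Re (A2_inner X (pull X Y f \<phi>) (pull X Y f \<phi>)) = real m * Re (A2_inner Y \<phi> \<phi>)"
      unfolding X.Re_A2_inner_self[OF pull_A2[OF \<phi>]] Y.Re_A2_inner_self[OF \<phi>] sqnorm_pull[OF Y.A2_form[OF \<phi>]] by simp
  qed
  then show ?thesis by simp
qed

section \<open>Push-forward of forms\<close>

abbreviation fibre :: "'b => 'a set" where "fibre y \<equiv> {x\<in>topspace (ctop X). f x = y}"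

lemma fibre_bij:
  assumes e: "evenly W \<U>" and y: "y \<in> W"
  shows "bij_betw (\<lambda>U. inv_into U f y) \<U> (fibre y)"
proof -
  have sh: "sheet A" "f ` A = W" if "A \<in> \<U>" for A using e that by (auto simp: evenly_def)
  have inv: "inv_into A f y \<in> A" "f (inv_into A f y) = y" if "A \<in> \<U>" for A
    using sh(2)[OF that] y by (auto intro: inv_into_into f_inv_into_f)
  have un: "\<Union>\<U> = {x\<in>topspace (ctop X). f x \<in> W}" using e by (simp add: evenly_def)
  have "inj_on (\<lambda>U. inv_into U f y) \<U>"
  proof (rule inj_onI, rule ccontr)
    fix A B assume AB: "A \<in> \<U>" "B \<in> \<U>" "inv_into A f y = inv_into B f y" "A ~= B"
    then have "A \<inter> B = {}" using e unfolding evenly_def disjoint_def by blast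
    then show False using inv(1)[OF AB(1)] inv(1)[OF AB(2)] AB(3) by auto
  qed
  moreover have "(\<lambda>U. inv_into U f y) ` \<U> = fibre y"
  proof
    show "(\<lambda>U. inv_into U f y) ` \<U> \<subseteq> fibre y" using inv un by blast
    show "fibre y \<subseteq> (\<lambda>U. inv_into U f y) ` \<U>"
    proof
      fix x assume x: "x \<in> fibre y"
      then obtain A where A: "A \<in> \<U>" "x \<in> A" using un y by blast
      have "inv_into A f y = x" using inv_into_f_f[of f A x] sh(1)[OF A(1)] A(2) x by (auto simp: sheet_def)
      then show "x \<in> (\<lambda>U. inv_into U f y) ` \<U>" using A(1) by blast
    qed
  qed
  ultimately show ?thesis by (simp add: bij_betw_def)
qed

lemma card_fibre:
  assumes "y \<in> topspace (ctop Y)" shows "card (fibre y) = m"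
proof -
  obtain W \<U> where "y \<in> W" "evenly W \<U>" using evenly_exists[OF assms] by blast
  then show ?thesis using bij_betw_same_card[OF fibre_bij, of W \<U> y] by (simp add: evenly_def)
qed

definition sheet_at :: "'b set => 'a => 'a set" where
  "sheet_at W x = (SOME U. sheet U \<and> x \<in> U \<and> f ` U \<subseteq> W)"

lemma sheet_at:
  assumes x: "x \<in> topspace (ctop X)" and W: "openin (ctop Y) W" "f x \<in> W"
  shows "sheet (sheet_at W x)" "x \<in> sheet_at W x" "f ` sheet_at W x \<subseteq> W"
proof -
  obtain W' \<U> where W': "f x \<in> W'" "evenly W' \<U>" using evenly_exists[OF f_mem[OF x]] by blast
  then obtain U where U: "U \<in> \<U>" "x \<in> U" using x by (auto simp: evenly_def)
  then have sh: "sheet U" using W'(2) by (simp add: evenly_def)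
  have "U \<inter> f -` W = U \<inter> {x \<in> topspace (ctop X). f x \<in> W}"
    using sh openin_subset[of "ctop X" U] by (auto simp: sheet_def)
  moreover have "openin (ctop X) (U \<inter> {x \<in> topspace (ctop X). f x \<in> W})"
    using sh by (intro openin_Int preimage_openin[OF X.sheaf f W(1)]) (simp add: sheet_def)
  ultimately have "sheet (U \<inter> f -` W)" using sheet_subset[OF sh] by (metis Int_lower1)
  then have "\<exists>U. sheet U \<and> x \<in> U \<and> f ` U \<subseteq> W" using U(2) W(2) by (intro exI[of _ "U \<inter> f -` W"]) auto
  from someI_ex[OF this] show "sheet (sheet_at W x)" "x \<in> sheet_at W x" "f ` sheet_at W x \<subseteq> W"
    unfolding sheet_at_def by auto
qed

text \<open>Coefficients are read in the pulled back chart, in which \<open>f\<close> is the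
  identity, so no Jacobian appears. By \<open>push_term\<close> the chosen sheet does not
  matter.\<close>

definition push :: "('a, 'n) form => ('b, 'n) form" where
  "push \<phi> d y = (if d \<in> charts Y \<and> y \<in> fst d then \<Sum>x\<in>fibre y. \<phi> (sheet_at (fst d) x, snd d \<circ> f) x else 0)"

context
  fixes \<phi> :: "('a, 'n) form" assumes \<phi>: "holomorphic_form X \<phi>"
begin

lemma push_term:
  fixes d :: "('b, 'n) chart"
  assumes d: "d \<in> charts Y" and U: "sheet U" "f ` U \<subseteq> fst d" and x: "x \<in> U"
  shows "\<phi> (sheet_at (fst d) x, snd d \<circ> f) x = \<phi> (U, snd d \<circ> f) x"
proof -
  have xt: "x \<in> topspace (ctop X)" using U(1) x openin_subset by (auto simp: sheet_def)
  have fx: "f x \<in> fst d" using U(2) x by blast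
  note s = sheet_at[OF xt chart_openin[OF d] fx]
  show ?thesis
    by (rule form_restrict[OF \<phi> pulled_chart(1)[OF d s(1,3)] pulled_chart(1)[OF d U]]) (use s(2) x in auto)
qed

text \<open>Over an evenly covered set the sum over the fibre is a sum over the sheets, and each
  summand is the coefficient of \<open>\<phi>\<close> in one chart.\<close>

lemma push_form: "holomorphic_form Y (push \<phi>)"
  unfolding holomorphic_form_def
proof (intro conjI ballI allI impI)
  fix d :: "('b, 'n) chart" and y assume "\<not> (d \<in> charts Y \<and> y \<in> fst d)"
  then show "push \<phi> d y = 0" unfolding push_def by (rule if_not_P)
next
  fix d :: "('b, 'n) chart" assume d: "d \<in> charts Y"
  show "holo_on (\<lambda>z. push \<phi> d (chart_inv d z)) (snd d ` fst d)"
  proof (rule holo_on_local)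
    fix z assume "z \<in> snd d ` fst d"
    then obtain y where y: "y \<in> fst d" "z = snd d y" by blast
    obtain W where W: "y \<in> W" "W \<subseteq> fst d" "(W, snd d) \<in> good" using good_near[OF d y(1)] by blast
    then obtain \<U> where ev: "evenly W \<U>" by (auto simp: good_def)
    then have oW: "openin (ctop Y) W" by (simp add: evenly_def)
    have sh: "sheet A" "f ` A = W" if "A \<in> \<U>" for A using ev that by (auto simp: evenly_def)
    have sub: "f ` A \<subseteq> fst d" if "A \<in> \<U>" for A using sh(2)[OF that] W(2) by simp
    have oE: "open (snd d ` W)" by (rule chart_open_image[OF d oW W(2)])
    have eq: "(\<Sum>A\<in>\<U>. \<phi> (A, snd d \<circ> f) (chart_inv (A, snd d \<circ> f) w)) = push \<phi> d (chart_inv d w)"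
      if w: "w \<in> snd d ` W" for w
    proof -
      obtain y' where y': "y' \<in> W" "w = snd d y'" using w by blast
      have ci: "chart_inv d w = y'" using chart_inv_left[OF d] y' W(2) by auto
      have t: "\<phi> (sheet_at (fst d) (inv_into A f y'), snd d \<circ> f) (inv_into A f y')
          = \<phi> (A, snd d \<circ> f) (chart_inv (A, snd d \<circ> f) w)" if A: "A \<in> \<U>" for A
      proof -
        have "y' \<in> f ` A" using sh(2)[OF A] y'(1) by simp
        then have i: "inv_into A f y' \<in> A" "f (inv_into A f y') = y'" by (auto intro: inv_into_into f_inv_into_f)
        have "chart_inv (A, snd d \<circ> f) w = inv_into A f y'"
          using pulled_chart(2)[OF d sh(1)[OF A] sub[OF A] i(1)] i(2) y'(2) by simp
        then show ?thesis using push_term[OF d sh(1)[OF A] sub[OF A] i(1)] by simp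
      qed
      have "push \<phi> d y' = (\<Sum>x\<in>fibre y'. \<phi> (sheet_at (fst d) x, snd d \<circ> f) x)"
        unfolding push_def using d y'(1) W(2) by auto
      also have "... = (\<Sum>A\<in>\<U>. \<phi> (sheet_at (fst d) (inv_into A f y'), snd d \<circ> f) (inv_into A f y'))"
        by (rule sum.reindex_bij_betw[OF fibre_bij[OF ev y'(1)], symmetric])
      also have "... = (\<Sum>A\<in>\<U>. \<phi> (A, snd d \<circ> f) (chart_inv (A, snd d \<circ> f) w))"
        by (rule sum.cong[OF refl t])
      finally show ?thesis using ci by simp
    qed
    have "holo_on (\<lambda>w. \<Sum>A\<in>\<U>. \<phi> (A, snd d \<circ> f) (chart_inv (A, snd d \<circ> f) w)) (snd d ` W)"
    proof (rule holo_on_sum)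
      fix A assume A: "A \<in> \<U>"
      have "snd d ` W = snd (A, snd d \<circ> f) ` fst (A, snd d \<circ> f)" unfolding fst_conv snd_conv image_comp[symmetric] sh(2)[OF A] ..
      then show "holo_on (\<lambda>w. \<phi> (A, snd d \<circ> f) (chart_inv (A, snd d \<circ> f) w)) (snd d ` W)"
        using form_holo[OF \<phi> pulled_chart(1)[OF d sh(1)[OF A] sub[OF A]]] by simp
    qed
    then have "holo_on (\<lambda>z. push \<phi> d (chart_inv d z)) (snd d ` W)"
      by (rule holo_on_cong[OF oE, rotated]) (simp add: eq)
    moreover have "z \<in> snd d ` W" using W(1) y(2) by blast
    ultimately show "\<exists>E. z \<in> E \<and> holo_on (\<lambda>z. push \<phi> d (chart_inv d z)) E" by (intro exI conjI)
  qed
  fix d' :: "('b, 'n) chart" and y assume d': "d' \<in> charts Y" and "y \<in> fst d \<inter> fst d'"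
  then have y: "y \<in> fst d" "y \<in> fst d'" by auto
  have o: "openin (ctop Y) (fst d \<inter> fst d')" by (rule openin_Int[OF chart_openin[OF d] chart_openin[OF d']])
  let ?j = "jac (\<lambda>z. snd d' (chart_inv d z)) (snd d y)"
  have t: "\<phi> (sheet_at (fst d) x, snd d \<circ> f) x = \<phi> (sheet_at (fst d') x, snd d' \<circ> f) x * ?j" if "x \<in> fibre y" for x
  proof -
    have x: "x \<in> topspace (ctop X)" "f x = y" using that by auto
    obtain U where U: "sheet U" "x \<in> U" "f ` U \<subseteq> fst d \<inter> fst d'" using sheet_at[OF x(1) o] x(2) y by blast
    have Ud: "f ` U \<subseteq> fst d" "f ` U \<subseteq> fst d'" using U(3) by auto
    note e = pulled_chart[OF d U(1) Ud(1)] and e' = pulled_chart[OF d' U(1) Ud(2)]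
    have "\<phi> (U, snd d \<circ> f) x = \<phi> (U, snd d' \<circ> f) x * jac (\<lambda>z. (snd d' \<circ> f) (chart_inv (U, snd d \<circ> f) z)) ((snd d \<circ> f) x)"
      using form_transform[OF \<phi> e(1) e'(1), of x] U(2) by simp
    moreover have "jac (\<lambda>z. (snd d' \<circ> f) (chart_inv (U, snd d \<circ> f) z)) ((snd d \<circ> f) x) = ?j"
      unfolding o_def x(2)
    proof (rule jac_cong)
      show "open (snd d ` f ` U)" using chart_open_range[OF e(1)] by (simp add: image_comp)
      show "snd d y \<in> snd d ` f ` U" using U(2) x(2) by blast
      show "snd d' (f (chart_inv (U, \<lambda>x. snd d (f x)) z)) = snd d' (chart_inv d z)" if "z \<in> snd d ` f ` U" for z
        using e(4)[OF that] by (simp add: o_def)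
    qed
    ultimately show ?thesis using push_term[OF d U(1) Ud(1) U(2)] push_term[OF d' U(1) Ud(2) U(2)] by simp
  qed
  have "push \<phi> d y = (\<Sum>x\<in>fibre y. \<phi> (sheet_at (fst d) x, snd d \<circ> f) x)" unfolding push_def using d y by simp
  also have "... = (\<Sum>x\<in>fibre y. \<phi> (sheet_at (fst d') x, snd d' \<circ> f) x * ?j)" by (rule sum.cong[OF refl t])
  also have "... = push \<phi> d' y * ?j" unfolding push_def using d' y by (simp add: sum_distrib_right)
  finally show "push \<phi> d y = push \<phi> d' y * ?j" .
qed

end

section \<open>Deck transformations\<close>

abbreviation deck :: "('a => 'a) set" where "deck \<equiv> deck_group (ctop X) f"

context
  fixes \<gamma> assumes \<gamma>: "\<gamma> \<in> deck"
begin

lemma deck_homeo: "homeomorphic_map (ctop X) (ctop X) \<gamma>" and deck_f: "x \<in> topspace (ctop X) ==> f (\<gamma> x) = f x"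
  and deck_ext: "\<gamma> \<in> extensional (topspace (ctop X))"
  using \<gamma> by (auto simp: deck_group_def)

lemma deck_continuous: "continuous_map (ctop X) (ctop X) \<gamma>"
  by (rule homeomorphic_imp_continuous_map[OF deck_homeo])

lemma deck_mem: "x \<in> topspace (ctop X) ==> \<gamma> x \<in> topspace (ctop X)"
  using deck_continuous unfolding continuous_map_def by blast

lemma deck_open: "openin (ctop X) W ==> openin (ctop X) (\<gamma> ` W)"
  using homeomorphic_imp_open_map[OF deck_homeo] by (simp add: open_map_def)

text \<open>A deck transformation is given as a homeomorphism only. As
  \<open>f (\<gamma> x) = f x\<close>, it is the identity in the coordinates of pulled back charts
  around \<open>x\<close> and \<open>\<gamma> x\<close>.\<close>

lemma deck_holomorphic: "holomorphic_map X X \<gamma>"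
  unfolding holomorphic_map_def
proof (intro conjI allI impI)
  show "continuous_map (ctop X) (ctop X) \<gamma>" by (rule deck_continuous)
  fix W g assume "openin (ctop X) W \<and> g \<in> hol X W"
  then have W: "openin (ctop X) W" and g: "g \<in> hol X W" by auto
  have pre: "openin (ctop X) {x \<in> topspace (ctop X). \<gamma> x \<in> W'}" if "openin (ctop X) W'" for W'
    by (rule openin_continuous_map_preimage[OF deck_continuous that])
  show "g \<circ> \<gamma> \<in> hol X {x \<in> topspace (ctop X). \<gamma> x \<in> W}"
  proof (rule sheaf_glue[OF X.sheaf pre[OF W]])
    fix x assume "x \<in> {x \<in> topspace (ctop X). \<gamma> x \<in> W}"
    then have x: "x \<in> topspace (ctop X)" "\<gamma> x \<in> W" by auto
    obtain d :: "('b, 'n) chart" where d: "d \<in> charts Y" "f x \<in> fst d" using covY[OF f_mem[OF x(1)]] by blast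
    obtain U where U: "sheet U" "x \<in> U" "f ` U \<subseteq> fst d" using sheet_at[OF x(1) chart_openin[OF d(1)] d(2)] by blast
    obtain U' where U': "sheet U'" "\<gamma> x \<in> U'" "f ` U' \<subseteq> fst d"
      using sheet_at[OF deck_mem[OF x(1)] chart_openin[OF d(1)]] d(2) deck_f[OF x(1)] by auto
    have oU: "openin (ctop X) U" "openin (ctop X) U'" using U(1) U'(1) by (auto simp: sheet_def)
    define S where "S = U \<inter> {x \<in> topspace (ctop X). \<gamma> x \<in> U' \<inter> W}"
    have oS: "openin (ctop X) S" unfolding S_def by (rule openin_Int[OF oU(1) pre[OF openin_Int[OF oU(2) W]]])
    have S: "S \<subseteq> U" "\<gamma> ` S \<subseteq> U'" "\<gamma> ` S \<subseteq> W" "S \<subseteq> topspace (ctop X)" by (auto simp: S_def)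
    note e = pulled_chart[OF d(1) U(1,3)] and e' = pulled_chart[OF d(1) U'(1,3)]
    have "g \<in> hol X (\<gamma> ` S)" by (rule sheaf_restrict[OF X.sheaf W deck_open[OF oS] S(3) g])
    then have h: "holo_on (\<lambda>z. g (chart_inv (U', snd d \<circ> f) z)) ((snd d \<circ> f) ` \<gamma> ` S)"
      using chart_hol[OF e'(1) deck_open[OF oS]] S(2) by simp
    have img: "(snd d \<circ> f) ` \<gamma> ` S = (snd d \<circ> f) ` S"
    proof -
      have "(snd d \<circ> f) (\<gamma> y) = (snd d \<circ> f) y" if "y \<in> S" for y using deck_f[of y] that S(4) by auto
      then show ?thesis by (simp add: image_image cong: image_cong)
    qed
    have "holo_on (\<lambda>z. (g \<circ> \<gamma>) (chart_inv (U, snd d \<circ> f) z)) ((snd d \<circ> f) ` S)"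
    proof (rule holo_on_cong)
      show "open ((snd d \<circ> f) ` S)" using chart_open_image[OF e(1) oS] S(1) by simp
      show "holo_on (\<lambda>z. g (chart_inv (U', snd d \<circ> f) z)) ((snd d \<circ> f) ` S)" using h by (simp only: img)
      fix z assume "z \<in> (snd d \<circ> f) ` S"
      then obtain y where y: "y \<in> S" "z = snd d (f y)" by auto
      have "chart_inv (U, snd d \<circ> f) z = y" using e(2)[of y] y S(1) by auto
      moreover have "chart_inv (U', snd d \<circ> f) z = \<gamma> y"
      proof -
        have "\<gamma> y \<in> U'" "f (\<gamma> y) = f y" using y(1) S(2,4) deck_f[of y] by auto
        then show ?thesis using e'(2)[of "\<gamma> y"] y(2) by simp
      qed
      ultimately show "g (chart_inv (U', snd d \<circ> f) z) = (g \<circ> \<gamma>) (chart_inv (U, snd d \<circ> f) z)" by simp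
    qed
    then have "g \<circ> \<gamma> \<in> hol X S" using chart_hol[OF e(1) oS] S(1) by simp
    then show "\<exists>W'. openin (ctop X) W' \<and> x \<in> W' \<and> W' \<subseteq> {x \<in> topspace (ctop X). \<gamma> x \<in> W} \<and> g \<circ> \<gamma> \<in> hol X W'"
      using oS U(2) U'(2) x by (intro exI[of _ S]) (auto simp: S_def)
  qed
qed

text \<open>As a covering with one sheet, \<open>\<gamma>\<close> inherits the results on
  pull-backs; with \<open>m = 1\<close> they say that pull-back by \<open>\<gamma>\<close> preserves
  the inner product of \<open>A2 X\<close>.\<close>

lemma deck_covering: "manifold_covering TYPE('n) X X \<gamma> 1"
proof
  show "finite_covering 1 (ctop X) (ctop X) \<gamma>"
    unfolding finite_covering_def
  proof (intro conjI ballI)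
    fix y assume "y \<in> topspace (ctop X)"
    then show "\<exists>W \<U>. openin (ctop X) W \<and> y \<in> W \<and> finite \<U> \<and> card \<U> = 1 \<and> disjoint \<U> \<and>
       \<Union>\<U> = {x\<in>topspace (ctop X). \<gamma> x \<in> W} \<and>
       (\<forall>U\<in>\<U>. openin (ctop X) U \<and> homeomorphic_map (subtopology (ctop X) U) (subtopology (ctop X) W) \<gamma>)"
      using deck_homeo deck_mem
      by (intro exI[of _ "topspace (ctop X)"] exI[of _ "{topspace (ctop X)}"]) auto
  qed (simp_all add: deck_continuous)
qed (rule covX deck_holomorphic; assumption)+

lemma pull_push_term:
  fixes c :: "('a, 'n) chart" and d :: "('b, 'n) chart"
  assumes \<phi>: "holomorphic_form X \<phi>" and c: "c \<in> charts X" "x \<in> fst c" and d: "d \<in> charts Y" "f x \<in> fst d"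
  shows "pull X X \<gamma> \<phi> c x = \<phi> (sheet_at (fst d) (\<gamma> x), snd d \<circ> f) (\<gamma> x) * cjac f d c x"
proof -
  have x: "x \<in> topspace (ctop X)" using chart_subset_topspace[OF c(1)] c(2) by blast
  have fx: "f (\<gamma> x) \<in> fst d" using deck_f[OF x] d(2) by simp
  note s = sheet_at[OF deck_mem[OF x] chart_openin[OF d(1)] fx]
  \<comment> \<open>The coordinates at \<open>\<gamma> x\<close> are those of \<open>d\<close> after
    \<open>f\<close>, and \<open>f \<circ> \<gamma> = f\<close>.\<close>
  have "cjac \<gamma> (sheet_at (fst d) (\<gamma> x), snd d \<circ> f) c x = cjac f d c x"
    by (rule cjac_cong[OF c(1) openin_topspace x c(2)]) (simp add: deck_f)
  then show ?thesis
    using pull_eq[OF X.sheaf X.sheaf deck_holomorphic covX \<phi> c pulled_chart(1)[OF d(1) s(1,3)]] s(2) by simp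
qed

lemma pull_pull_deck:
  fixes \<psi> :: "('b, 'n) form"
  assumes \<psi>: "holomorphic_form Y \<psi>"
  shows "pull X X \<gamma> (pull X Y f \<psi>) = pull X Y f \<psi>"
proof (intro ext)
  fix c :: "('a, 'n) chart" and x
  show "pull X X \<gamma> (pull X Y f \<psi>) c x = pull X Y f \<psi> c x"
  proof (cases "c \<in> charts X \<and> x \<in> fst c")
    case False
    then show ?thesis unfolding pull_def by (simp only: if_False)
  next
    case True
    then have c: "c \<in> charts X" "x \<in> fst c" by auto
    have x: "x \<in> topspace (ctop X)" using chart_subset_topspace[OF c(1)] c(2) by blast
    obtain d :: "('b, 'n) chart" where d: "d \<in> charts Y" "f x \<in> fst d" using covY[OF f_mem[OF x]] by blast
    have fx: "f (\<gamma> x) \<in> fst d" using deck_f[OF x] d(2) by simp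
    note s = sheet_at[OF deck_mem[OF x] chart_openin[OF d(1)] fx]
    have "pull X X \<gamma> (pull X Y f \<psi>) c x
        = pull X Y f \<psi> (sheet_at (fst d) (\<gamma> x), snd d \<circ> f) (\<gamma> x) * cjac f d c x"
      by (rule pull_push_term[OF pull_form[OF X.sheaf Y.sheaf f covY \<psi>] c d])
    also have "pull X Y f \<psi> (sheet_at (fst d) (\<gamma> x), snd d \<circ> f) (\<gamma> x) = \<psi> d (f (\<gamma> x))"
      by (rule pull_pulled[OF \<psi> d(1) s(1,3,2)])
    also have "\<psi> d (f (\<gamma> x)) * cjac f d c x = pull X Y f \<psi> c x"
      unfolding deck_f[OF x] by (rule pull_eq[OF X.sheaf Y.sheaf f covY \<psi> c d, symmetric])
    finally show ?thesis .
  qed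
qed

end

end

context manifold_covering
begin

text \<open>The set where the two transformations agree is open because \<open>f\<close> is
  injective on sheets, and its complement is open because different sheets over an evenly covered
  set are disjoint.\<close>

lemma deck_eqI:
  assumes conn: "connected_space (ctop X)" and \<gamma>: "\<gamma> \<in> deck" and \<gamma>': "\<gamma>' \<in> deck"
    and x: "x \<in> topspace (ctop X)" "\<gamma> x = \<gamma>' x"
  shows "\<gamma> = \<gamma>'"
proof -
  let ?E = "{y \<in> topspace (ctop X). \<gamma> y = \<gamma>' y}"
  have pre: "openin (ctop X) ({y \<in> topspace (ctop X). \<gamma> y \<in> U} \<inter> {y \<in> topspace (ctop X). \<gamma>' y \<in> U'})"
    if "sheet U" "sheet U'" for U U'
    using that unfolding sheet_def
    by (intro openin_Int openin_continuous_map_preimage[OF deck_continuous[OF \<gamma>]]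
        openin_continuous_map_preimage[OF deck_continuous[OF \<gamma>']]) auto
  have eq: "\<gamma> y = \<gamma>' y" if "sheet U" "y \<in> topspace (ctop X)" "\<gamma> y \<in> U" "\<gamma>' y \<in> U" for U y
  proof -
    have "f (\<gamma> y) = f (\<gamma>' y)" using deck_f[OF \<gamma> that(2)] deck_f[OF \<gamma>' that(2)] by simp
    then show ?thesis using that(1,3,4) by (auto simp: sheet_def inj_on_def)
  qed
  have "openin (ctop X) ?E"
  proof (subst openin_subopen, rule ballI)
    fix y assume y: "y \<in> ?E"
    then have yt: "y \<in> topspace (ctop X)" by simp
    have "f (\<gamma> y) \<in> topspace (ctop Y)" using f_mem[OF deck_mem[OF \<gamma> yt]] .
    note s = sheet_at[OF deck_mem[OF \<gamma> yt] openin_topspace this]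
    let ?U = "sheet_at (topspace (ctop Y)) (\<gamma> y)"
    let ?T = "{y \<in> topspace (ctop X). \<gamma> y \<in> ?U} \<inter> {y \<in> topspace (ctop X). \<gamma>' y \<in> ?U}"
    have "?T \<subseteq> ?E" using eq[OF s(1)] by blast
    moreover have "y \<in> ?T" using y s(2) by auto
    ultimately show "\<exists>T. openin (ctop X) T \<and> y \<in> T \<and> T \<subseteq> ?E" using pre[OF s(1) s(1)] by (intro exI conjI)
  qed
  moreover have "openin (ctop X) (topspace (ctop X) - ?E)"
  proof (subst openin_subopen, rule ballI)
    fix y assume y: "y \<in> topspace (ctop X) - ?E"
    then have yt: "y \<in> topspace (ctop X)" and ne: "\<gamma> y ~= \<gamma>' y" by auto
    obtain W \<U> where W: "f y \<in> W" "evenly W \<U>" using evenly_exists[OF f_mem[OF yt]] by blast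
    then have un: "\<Union>\<U> = {x\<in>topspace (ctop X). f x \<in> W}" and sh: "\<And>A. A \<in> \<U> ==> sheet A" by (auto simp: evenly_def)
    have "\<gamma> y \<in> \<Union>\<U>" "\<gamma>' y \<in> \<Union>\<U>"
      unfolding un using W(1) deck_f[OF \<gamma> yt] deck_f[OF \<gamma>' yt] deck_mem[OF \<gamma> yt] deck_mem[OF \<gamma>' yt] by auto
    then obtain U U' where U: "U \<in> \<U>" "\<gamma> y \<in> U" "U' \<in> \<U>" "\<gamma>' y \<in> U'" by blast
    have "U ~= U'" using eq[OF sh[OF U(1)] yt U(2)] U(4) ne by blast
    then have disj: "U \<inter> U' = {}" using W(2) U(1,3) unfolding evenly_def disjoint_def by blast
    let ?T = "{y \<in> topspace (ctop X). \<gamma> y \<in> U} \<inter> {y \<in> topspace (ctop X). \<gamma>' y \<in> U'}"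
    have "?T \<subseteq> topspace (ctop X) - ?E" using disj by auto
    moreover have "y \<in> ?T" using yt U by auto
    ultimately show "\<exists>T. openin (ctop X) T \<and> y \<in> T \<and> T \<subseteq> topspace (ctop X) - ?E"
      using pre[OF sh[OF U(1)] sh[OF U(3)]] by (intro exI conjI)
  qed
  ultimately have "?E = {} \<or> ?E = topspace (ctop X)"
    using conn unfolding connected_space_clopen_in closedin_def by blast
  then have "?E = topspace (ctop X)" using x by blast
  then have e: "\<gamma> y = \<gamma>' y" if "y \<in> topspace (ctop X)" for y using that by blast
  show ?thesis by (rule extensionalityI[OF deck_ext[OF \<gamma>] deck_ext[OF \<gamma>'] e])
qed

text \<open>Evaluation at \<open>x\<close> maps \<open>m\<close> deck transformations into a fibre
  of \<open>m\<close> points. On a connected space it is injective, in the other case onto; equal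
  cardinalities give the rest.\<close>

lemma deck_fibre_bij:
  assumes card: "card deck = m"
    and trans: "connected_space (ctop X) \<or>
      (\<forall>x\<in>topspace (ctop X). \<forall>y\<in>topspace (ctop X). f x = f y \<longrightarrow> (\<exists>\<gamma>\<in>deck. \<gamma> x = y))"
    and x: "x \<in> topspace (ctop X)"
  shows "bij_betw (\<lambda>\<gamma>. \<gamma> x) deck (fibre (f x))"
proof -
  have cf: "card (fibre (f x)) = m" by (rule card_fibre[OF f_mem[OF x]])
  have fin: "finite deck" "finite (fibre (f x))" using card cf m_pos by (auto intro: card_ge_0_finite)
  have sub: "(\<lambda>\<gamma>. \<gamma> x) ` deck \<subseteq> fibre (f x)" using deck_mem[OF _ x] deck_f[OF _ x] by auto
  from trans show ?thesis
  proof
    assume "connected_space (ctop X)"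
    then have inj: "inj_on (\<lambda>\<gamma>. \<gamma> x) deck" using deck_eqI x by (intro inj_onI)
    then have "(\<lambda>\<gamma>. \<gamma> x) ` deck = fibre (f x)" using card_image[OF inj] card cf by (intro card_subset_eq[OF fin(2) sub]) simp
    then show ?thesis using inj by (simp add: bij_betw_def)
  next
    assume t: "\<forall>x\<in>topspace (ctop X). \<forall>y\<in>topspace (ctop X). f x = f y \<longrightarrow> (\<exists>\<gamma>\<in>deck. \<gamma> x = y)"
    have "fibre (f x) \<subseteq> (\<lambda>\<gamma>. \<gamma> x) ` deck"
    proof
      fix y assume "y \<in> fibre (f x)"
      then have "y \<in> topspace (ctop X)" "f x = f y" by auto
      then obtain \<gamma> where "\<gamma> \<in> deck" "\<gamma> x = y" using t x by blast
      then show "y \<in> (\<lambda>\<gamma>. \<gamma> x) ` deck" by blast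
    qed
    then have im: "(\<lambda>\<gamma>. \<gamma> x) ` deck = fibre (f x)" using sub by blast
    then have "inj_on (\<lambda>\<gamma>. \<gamma> x) deck" using card cf by (intro eq_card_imp_inj_on[OF fin(1)]) simp
    then show ?thesis using im by (simp add: bij_betw_def)
  qed
qed

lemma pull_push:
  assumes \<phi>: "holomorphic_form X \<phi>" and bij: "\<And>x. x \<in> topspace (ctop X) ==> bij_betw (\<lambda>\<gamma>. \<gamma> x) deck (fibre (f x))"
  shows "pull X Y f (push \<phi>) = (\<lambda>c x. \<Sum>\<gamma>\<in>deck. pull X X \<gamma> \<phi> c x)"
proof (intro ext)
  fix c :: "('a, 'n) chart" and x
  show "pull X Y f (push \<phi>) c x = (\<Sum>\<gamma>\<in>deck. pull X X \<gamma> \<phi> c x)"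
  proof (cases "c \<in> charts X \<and> x \<in> fst c")
    case False
    then show ?thesis unfolding pull_def by (simp only: if_False sum.neutral_const)
  next
    case True
    then have c: "c \<in> charts X" "x \<in> fst c" by auto
    have x: "x \<in> topspace (ctop X)" using chart_subset_topspace[OF c(1)] c(2) by blast
    obtain d :: "('b, 'n) chart" where d: "d \<in> charts Y" "f x \<in> fst d" using covY[OF f_mem[OF x]] by blast
    have "pull X Y f (push \<phi>) c x = push \<phi> d (f x) * cjac f d c x"
      by (rule pull_eq[OF X.sheaf Y.sheaf f covY push_form[OF \<phi>] c d])
    also have "push \<phi> d (f x) = (\<Sum>x\<in>fibre (f x). \<phi> (sheet_at (fst d) x, snd d \<circ> f) x)"
      unfolding push_def using d by simp
    also have "... = (\<Sum>\<gamma>\<in>deck. \<phi> (sheet_at (fst d) (\<gamma> x), snd d \<circ> f) (\<gamma> x))"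
      by (rule sum.reindex_bij_betw[OF bij[OF x], symmetric])
    also have "... * cjac f d c x = (\<Sum>\<gamma>\<in>deck. pull X X \<gamma> \<phi> c x)"
      unfolding sum_distrib_right by (rule sum.cong[OF refl pull_push_term[OF _ \<phi> c d, symmetric]])
    finally show ?thesis .
  qed
qed

lemma A2_sum:
  fixes h :: "'s => ('a, 'n) form"
  assumes "finite S" "\<And>s. s \<in> S ==> h s \<in> A2 X"
  shows "(\<lambda>c x. \<Sum>s\<in>S. h s c x) \<in> A2 X"
    and "u \<in> A2 X ==> A2_inner X u (\<lambda>c x. \<Sum>s\<in>S. h s c x) = (\<Sum>s\<in>S. A2_inner X u (h s))"
proof -
  have "(\<lambda>c x. \<Sum>s\<in>S. h s c x) \<in> A2 X \<and>
      (u \<in> A2 X \<longrightarrow> A2_inner X u (\<lambda>c x. \<Sum>s\<in>S. h s c x) = (\<Sum>s\<in>S. A2_inner X u (h s)))"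
    using assms
  proof (induction S rule: finite_induct)
    case empty
    show ?case using X.A2_0 X.ip_scale_right[OF X.A2_0, of u 0] by simp
  next
    case (insert a S)
    then have h: "h a \<in> A2 X" and IH: "(\<lambda>c x. \<Sum>s\<in>S. h s c x) \<in> A2 X"
      "u \<in> A2 X ==> A2_inner X u (\<lambda>c x. \<Sum>s\<in>S. h s c x) = (\<Sum>s\<in>S. A2_inner X u (h s))" by auto
    show ?case using insert(1,2) X.A2_add[OF h IH(1)] X.ip_add_right[OF h IH(1), of u] IH(2) by simp
  qed
  then show "(\<lambda>c x. \<Sum>s\<in>S. h s c x) \<in> A2 X"
    and "u \<in> A2 X ==> A2_inner X u (\<lambda>c x. \<Sum>s\<in>S. h s c x) = (\<Sum>s\<in>S. A2_inner X u (h s))" by auto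
qed

theorem bk_transformation:
  fixes c d :: "('a, 'n) chart" and a b :: "('b, 'n) chart"
  assumes bij: "\<And>x. x \<in> topspace (ctop X) ==> bij_betw (\<lambda>\<gamma>. \<gamma> x) deck (fibre (f x))"
    and fin: "finite deck"
    and c: "c \<in> charts X" "z \<in> fst c" and d: "d \<in> charts X" "w \<in> fst d"
    and a: "a \<in> charts Y" "f z \<in> fst a" and b: "b \<in> charts Y" "f w \<in> fst b"
  shows "(\<Sum>\<gamma>\<in>deck. pull X X \<gamma> (\<lambda>c x. X.bk c x d w) c z)
    = Y.bk a (f z) b (f w) * cjac f a c z * cnj (cjac f b d w)"
proof -
  define k where "k = (\<lambda>c x. X.bk c x d w)"
  have k: "k \<in> A2 X" unfolding k_def by (rule X.bk_mem)
  have kf: "holomorphic_form X k" by (rule X.A2_form[OF k])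
  let ?J = "cjac f b d w"
  have dA: "pull X X \<gamma> \<phi> \<in> A2 X" if "\<gamma> \<in> deck" "\<phi> \<in> A2 X" for \<gamma> and \<phi> :: "('a, 'n) form"
    by (rule manifold_covering.pull_A2[OF deck_covering[OF that(1)] that(2)])
  have pp: "pull X Y f (push k) = (\<lambda>c x. \<Sum>\<gamma>\<in>deck. pull X X \<gamma> k c x)" by (rule pull_push[OF kf bij])
  have "pull X Y f (push k) \<in> A2 X" unfolding pp by (rule A2_sum(1)[OF fin dA[OF _ k]])
  then have g: "push k \<in> A2 Y" using pull_A2_iff[OF push_form[OF kf]] by simp
  have "A2_inner Y \<psi> (push k) = ?J * \<psi> b (f w)" if \<psi>: "\<psi> \<in> A2 Y" for \<psi> :: "('b, 'n) form"
  proof -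
    have p: "pull X Y f \<psi> \<in> A2 X" by (rule pull_A2[OF \<psi>])
    have t: "A2_inner X (pull X Y f \<psi>) (pull X X \<gamma> k) = pull X Y f \<psi> d w" if \<gamma>: "\<gamma> \<in> deck" for \<gamma>
    proof -
      have "A2_inner X (pull X Y f \<psi>) (pull X X \<gamma> k) = A2_inner X (pull X X \<gamma> (pull X Y f \<psi>)) (pull X X \<gamma> k)"
        by (simp only: pull_pull_deck[OF \<gamma> Y.A2_form[OF \<psi>]])
      also have "... = A2_inner X (pull X Y f \<psi>) k"
        using manifold_covering.A2_inner_pull[OF deck_covering[OF \<gamma>] p k] by simp
      also have "... = pull X Y f \<psi> d w" unfolding k_def by (rule X.bk_reproduces[OF p])
      finally show ?thesis .
    qed
    obtain x where "x \<in> topspace (ctop X)" using chart_subset_topspace[OF d(1)] d(2) by blast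
    then have cd: "card deck = m" using bij_betw_same_card[OF bij] card_fibre[OF f_mem] by simp
    have "of_nat m * A2_inner Y \<psi> (push k) = A2_inner X (pull X Y f \<psi>) (pull X Y f (push k))"
      by (rule A2_inner_pull[OF \<psi> g, symmetric])
    also have "... = (\<Sum>\<gamma>\<in>deck. A2_inner X (pull X Y f \<psi>) (pull X X \<gamma> k))"
      unfolding pp by (rule A2_sum(2)[OF fin dA[OF _ k] p])
    also have "... = of_nat m * pull X Y f \<psi> d w" using t cd by simp
    finally have "A2_inner Y \<psi> (push k) = pull X Y f \<psi> d w" using m_pos by simp
    then show ?thesis using pull_eq[OF X.sheaf Y.sheaf f covY Y.A2_form[OF \<psi>] d b] by (simp add: mult.commute)
  qed
  then have gk: "push k = (\<lambda>c x. cnj ?J * Y.bk c x b (f w))" by (rule Y.bk_unique[OF g])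
  have "(\<Sum>\<gamma>\<in>deck. pull X X \<gamma> k c z) = pull X Y f (push k) c z" by (simp add: pp)
  also have "... = push k a (f z) * cjac f a c z" by (rule pull_eq[OF X.sheaf Y.sheaf f covY push_form[OF kf] c a])
  also have "... = Y.bk a (f z) b (f w) * cjac f a c z * cnj ?J" by (simp add: gk)
  finally show ?thesis by (simp add: k_def)
qed

end

text \<open>The transformation law of forms applies to the first argument; Hermitian symmetry
  carries it to the second.\<close>

lemma (in form_space) bk_change_chart:
  fixes b d :: "('a, 'n) chart"
  assumes b: "b \<in> charts X" "w \<in> fst b" and d: "d \<in> charts X" "w \<in> fst d"
  shows "bk d w a x = bk b w a x * cjac id b d w" and "bk a x d w = bk a x b w * cnj (cjac id b d w)"
proof -
  have "bk d w a x = bk b w a x * cjac id b d w" for a x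
    using form_transform[OF A2_form[OF bk_mem] d(1) b(1) d(2) b(2), of a x] by (simp add: cjac_def)
  then show "bk d w a x = bk b w a x * cjac id b d w" "bk a x d w = bk a x b w * cnj (cjac id b d w)"
    using bk_cnj[of a x d w] bk_cnj[of a x b w] by simp_all
qed

context form_restriction
begin

lemma bk_rc:
  fixes a b :: "('a, 'n) chart"
  assumes a: "a \<in> charts X" "x \<in> fst a" "x \<in> G" and b: "b \<in> charts X" "y \<in> fst b" "y \<in> G"
  shows "X.bk a x b y = N.bk (rc a) x (rc b) y"
proof -
  have r: "X.bk a x c y = X.bk (rc a) x c y" if a: "a \<in> charts X" "x \<in> fst a" "x \<in> G" for a c :: "('a, 'n) chart" and x y
    by (rule form_restrict[OF X.A2_form[OF X.bk_mem] a(1) charts_NX[OF rc_mem[OF a(1)]]]) (use a in \<open>simp_all add: rc_def\<close>)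
  have "X.bk a x b y = X.bk (rc a) x b y" by (rule r[OF a])
  also have "... = cnj (X.bk (rc b) y (rc a) x)" using X.bk_cnj r[OF b] by metis
  also have "... = X.bk (rc a) x (rc b) y" by (rule X.bk_cnj[symmetric])
  also have "... = N.bk (rc a) x (rc b) y"
    by (rule bk_restriction[OF rc_mem[OF a(1)] _ rc_mem[OF b(1)]]) (use a in \<open>simp add: rc_def\<close>)
  finally show ?thesis .
qed

lemma chart_at_rc:
  fixes c :: "('a, 'n) chart"
  assumes c: "c \<in> charts N" "x \<in> fst c"
  shows "(chart_at X x :: ('a, 'n) chart) \<in> charts X" "x \<in> fst (chart_at X x :: ('a, 'n) chart)" "x \<in> G"
    "rc (chart_at X x) \<in> charts N" "x \<in> fst (rc (chart_at X x))"
proof -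
  show *: "(chart_at X x :: ('a, 'n) chart) \<in> charts X" "x \<in> fst (chart_at X x :: ('a, 'n) chart)" "x \<in> G"
    using chart_at[OF charts_NX[OF c(1)] c(2)] charts_N_sub[OF c(1)] c(2) by auto
  show "rc (chart_at X x) \<in> charts N" by (rule rc_mem[OF *(1)])
  show "x \<in> fst (rc (chart_at X x))" using * by (simp add: rc_def)
qed

text \<open>\<open>chart_at\<close> picks charts of \<open>X\<close> that may leave
  \<open>G\<close>. Cutting them down to \<open>G\<close> changes neither the kernel nor the
  Jacobians and brings in the kernel of \<open>N\<close>.\<close>

lemma pullback_kernel_N:
  fixes a b :: "('a, 'n) chart" and c :: "('b, 'n) chart" and d :: "('c, 'n) chart"
  assumes a: "a \<in> charts N" "\<gamma> z \<in> fst a" and b: "b \<in> charts N" "\<tau> w \<in> fst b"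
  obtains a' b' where "a' \<in> charts N" "\<gamma> z \<in> fst a'" "b' \<in> charts N" "\<tau> w \<in> fst b'"
    "pullback_kernel X \<gamma> \<tau> (manifold_bergman_kernel X) c z d w
      = \<i> ^ (CARD('n)^2) * (N.bk a' (\<gamma> z) b' (\<tau> w) * cjac \<gamma> a' c z * cnj (cjac \<tau> b' d w))"
proof -
  note A = chart_at_rc[OF a] and B = chart_at_rc[OF b]
  have s: "cjac \<gamma> (rc e) c z = cjac \<gamma> e c z" "cjac \<tau> (rc e) d w = cjac \<tau> e d w" for e
    by (simp_all add: cjac_def rc_def)
  have "pullback_kernel X \<gamma> \<tau> (manifold_bergman_kernel X) c z d w
      = \<i> ^ (CARD('n)^2) * (N.bk (rc (chart_at X (\<gamma> z))) (\<gamma> z) (rc (chart_at X (\<tau> w))) (\<tau> w)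
        * cjac \<gamma> (rc (chart_at X (\<gamma> z))) c z * cnj (cjac \<tau> (rc (chart_at X (\<tau> w))) d w))"
    unfolding pullback_kernel_def Let_def X.manifold_bergman_kernel_bk bk_rc[OF A(1-3) B(1-3)] s
    by (simp add: cjac_def)
  then show ?thesis by (rule that[OF A(4,5) B(4,5)])
qed

end

theorem theorem1p6:
  fixes M1 :: "'a complex_space" and M2 :: "'b complex_space"
    and V1 :: "'a set" and V2 :: "'b set"
    and f :: "'a \<Rightarrow> 'b" and m :: nat and \<Gamma> :: "('a \<Rightarrow> 'a) set"
  assumes "reduced_complex_space M1" and "reduced_complex_space M2"
    and "analytic_subvariety M1 V1" and "V1 \<noteq> topspace (ctop M1)"
    and "analytic_subvariety M2 V2" and "V2 \<noteq> topspace (ctop M2)"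
    and "complex_manifold TYPE('n::finite) (without M1 V1)"
    and "complex_manifold TYPE('n) (without M2 V2)"
    and "holomorphic_map (without M1 V1) (without M2 V2) f"
    and "finite_covering m (ctop (without M1 V1)) (ctop (without M2 V2)) f"
    and "\<Gamma> = deck_group (ctop (without M1 V1)) f" and "card \<Gamma> = m"
    and "connected_space (ctop (without M1 V1)) \<or>
         (\<forall>x\<in>topspace (ctop (without M1 V1)). \<forall>y\<in>topspace (ctop (without M1 V1)).
            f x = f y \<longrightarrow> (\<exists>\<gamma>\<in>\<Gamma>. \<gamma> x = y))"
  shows "\<forall>c\<in>charts (without M1 V1) :: ('a, 'n) chart set. \<forall>d\<in>charts (without M1 V1).
    \<forall>z\<in>fst c. \<forall>w\<in>fst d.
      (\<Sum>\<gamma>\<in>\<Gamma>. pullback_kernel (regular_part M1) \<gamma> id (bergman_kernel M1) c z d w)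
        = (\<Sum>\<gamma>\<in>\<Gamma>. pullback_kernel (regular_part M1) id \<gamma> (bergman_kernel M1) c z d w) \<and>
      (\<Sum>\<gamma>\<in>\<Gamma>. pullback_kernel (regular_part M1) id \<gamma> (bergman_kernel M1) c z d w)
        = pullback_kernel (regular_part M2) f f (bergman_kernel M2) c z d w"
proof -
  interpret R1: form_restriction "regular_part M1" "without M1 V1" "TYPE('n)" "topspace (ctop M1) - V1"
    by (rule form_restriction_regular_part[OF assms(1,3,7)])
  interpret R2: form_restriction "regular_part M2" "without M2 V2" "TYPE('n)" "topspace (ctop M2) - V2"
    by (rule form_restriction_regular_part[OF assms(2,5,8)])
  interpret C: manifold_covering "without M1 V1" "without M2 V2" "TYPE('n)" f m
  proof
    show "\<And>x. x \<in> topspace (ctop (without M1 V1)) \<Longrightarrow> \<exists>c\<in>charts (without M1 V1) :: ('a, 'n) chart set. x \<in> fst c"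
      and "\<And>y. y \<in> topspace (ctop (without M2 V2)) \<Longrightarrow> \<exists>d\<in>charts (without M2 V2) :: ('b, 'n) chart set. y \<in> fst d"
      using assms(7,8) by (simp_all add: complex_manifold_def)
  qed (fact assms(9) assms(10))+
  have bij: "bij_betw (\<lambda>\<gamma>. \<gamma> x) \<Gamma> (C.fibre (f x))" if "x \<in> topspace (ctop (without M1 V1))" for x
    unfolding assms(11) by (rule C.deck_fibre_bij[OF _ _ that]) (use assms(11-13) in simp_all)
  have fin: "finite \<Gamma>" using assms(12) C.m_pos by (auto intro: card_ge_0_finite)
  let ?I = "\<i> ^ (CARD('n)^2) :: complex"
  show ?thesis
  proof (intro ballI)
    fix c d :: "('a, 'n) chart" and z w
    assume cd: "c \<in> charts (without M1 V1)" "d \<in> charts (without M1 V1)" and "z \<in> fst c" "w \<in> fst d"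
    then have c: "c \<in> charts (without M1 V1)" "z \<in> fst c" and d: "d \<in> charts (without M1 V1)" "w \<in> fst d" by auto
    have cov1: "\<exists>a :: ('a, 'n) chart. a \<in> charts (without M1 V1) \<and> \<gamma> x \<in> fst a"
      if e: "e \<in> charts (without M1 V1)" "x \<in> fst e" and \<gamma>: "\<gamma> \<in> \<Gamma>" for \<gamma> x and e :: "('a, 'n) chart"
      using C.covX[OF C.deck_mem[OF \<gamma>[unfolded assms(11)]]] chart_subset_topspace[OF e(1)] e(2) by blast
    have cov2: "\<exists>a :: ('b, 'n) chart. a \<in> charts (without M2 V2) \<and> f x \<in> fst a"
      if e: "e \<in> charts (without M1 V1)" "x \<in> fst e" for x and e :: "('a, 'n) chart"
      using C.covY[OF C.f_mem] chart_subset_topspace[OF e(1)] e(2) by blast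
    have pe: "pull (without M1 V1) (without M1 V1) \<gamma> (\<lambda>c x. R1.N.bk c x d w) c z
        = R1.N.bk a (\<gamma> z) d w * cjac \<gamma> a c z"
      if "\<gamma> \<in> \<Gamma>" "c \<in> charts (without M1 V1)" "z \<in> fst c" "a \<in> charts (without M1 V1)" "\<gamma> z \<in> fst a"
      for \<gamma> z w and a c d :: "('a, 'n) chart"
      by (rule pull_eq[OF R1.N.sheaf R1.N.sheaf C.deck_holomorphic C.covX R1.N.A2_form[OF R1.N.bk_mem]])
         (use that assms(11) in auto)
    \<comment> \<open>The Jacobian of \<open>id\<close> is the change of chart from \<open>d\<close>
      to \<open>b'\<close> in the second argument; what remains is the pull-back of the kernel form
      in the first argument.\<close>
    have 1: "pullback_kernel (regular_part M1) \<gamma> id (bergman_kernel M1) c z d w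
        = ?I * pull (without M1 V1) (without M1 V1) \<gamma> (\<lambda>c x. R1.N.bk c x d w) c z" if \<gamma>: "\<gamma> \<in> \<Gamma>" for \<gamma>
    proof -
      obtain a :: "('a, 'n) chart" where a: "a \<in> charts (without M1 V1)" "\<gamma> z \<in> fst a" using cov1[OF c \<gamma>] by blast
      have dw: "id w \<in> fst d" using d by simp
      obtain a' b' :: "('a, 'n) chart" where ab: "a' \<in> charts (without M1 V1)" "\<gamma> z \<in> fst a'"
        "b' \<in> charts (without M1 V1)" "id w \<in> fst b'"
        and eq: "pullback_kernel (regular_part M1) \<gamma> id (manifold_bergman_kernel (regular_part M1)) c z d w
          = ?I * (R1.N.bk a' (\<gamma> z) b' (id w) * cjac \<gamma> a' c z * cnj (cjac id b' d w))"
        by (rule R1.pullback_kernel_N[of a \<gamma> z d id w c d, OF a d(1) dw])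
      have "R1.N.bk a' (\<gamma> z) d w = R1.N.bk a' (\<gamma> z) b' w * cnj (cjac id b' d w)"
        by (rule R1.N.bk_change_chart(2)[OF ab(3) _ d]) (use ab(4) in simp)
      then show ?thesis unfolding bergman_kernel_def eq pe[OF \<gamma> c ab(1,2)] by simp
    qed
    \<comment> \<open>Hermitian symmetry turns a pull-back in the second argument into the conjugate
      of one in the first, with \<open>z\<close> and \<open>w\<close> exchanged.\<close>
    have 2: "pullback_kernel (regular_part M1) id \<gamma> (bergman_kernel M1) c z d w
        = ?I * cnj (pull (without M1 V1) (without M1 V1) \<gamma> (\<lambda>e x. R1.N.bk e x c z) d w)" if \<gamma>: "\<gamma> \<in> \<Gamma>" for \<gamma>
    proof -
      obtain a :: "('a, 'n) chart" where a: "a \<in> charts (without M1 V1)" "\<gamma> w \<in> fst a" using cov1[OF d \<gamma>] by blast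
      have cz: "id z \<in> fst c" using c by simp
      obtain a' b' :: "('a, 'n) chart" where ab: "a' \<in> charts (without M1 V1)" "id z \<in> fst a'"
        "b' \<in> charts (without M1 V1)" "\<gamma> w \<in> fst b'"
        and eq: "pullback_kernel (regular_part M1) id \<gamma> (manifold_bergman_kernel (regular_part M1)) c z d w
          = ?I * (R1.N.bk a' (id z) b' (\<gamma> w) * cjac id a' c z * cnj (cjac \<gamma> b' d w))"
        by (rule R1.pullback_kernel_N[of c id z a \<gamma> w c d, OF c(1) cz a])
      have "R1.N.bk c z b' (\<gamma> w) = R1.N.bk a' z b' (\<gamma> w) * cjac id a' c z"
        by (rule R1.N.bk_change_chart(1)[OF ab(1) _ c]) (use ab(2) in simp)
      then have "R1.N.bk a' (id z) b' (\<gamma> w) * cjac id a' c z = cnj (R1.N.bk b' (\<gamma> w) c z)"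
        using R1.N.bk_cnj[of c z b' "\<gamma> w"] by simp
      then show ?thesis unfolding bergman_kernel_def eq pe[OF \<gamma> d ab(3,4)] by simp
    qed
    obtain a0 b0 :: "('b, 'n) chart" where a0: "a0 \<in> charts (without M2 V2)" "f z \<in> fst a0"
      and b0: "b0 \<in> charts (without M2 V2)" "f w \<in> fst b0" using cov2[OF c] cov2[OF d] by blast
    obtain a b :: "('b, 'n) chart" where a: "a \<in> charts (without M2 V2)" "f z \<in> fst a"
      and b: "b \<in> charts (without M2 V2)" "f w \<in> fst b"
      and 3: "pullback_kernel (regular_part M2) f f (manifold_bergman_kernel (regular_part M2)) c z d w
          = ?I * (R2.N.bk a (f z) b (f w) * cjac f a c z * cnj (cjac f b d w))"
      by (rule R2.pullback_kernel_N[of a0 f z b0 f w c d, OF a0 b0])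
    have T: "(\<Sum>\<gamma>\<in>\<Gamma>. pull (without M1 V1) (without M1 V1) \<gamma> (\<lambda>c x. R1.N.bk c x d w) c z)
        = R2.N.bk a (f z) b (f w) * cjac f a c z * cnj (cjac f b d w)"
      if "c \<in> charts (without M1 V1)" "z \<in> fst c" "d \<in> charts (without M1 V1)" "w \<in> fst d"
        "a \<in> charts (without M2 V2)" "f z \<in> fst a" "b \<in> charts (without M2 V2)" "f w \<in> fst b"
      for c d :: "('a, 'n) chart" and a b :: "('b, 'n) chart" and z w
      unfolding assms(11) by (rule C.bk_transformation[OF bij[unfolded assms(11)] fin[unfolded assms(11)]]) (assumption | rule that)+
    have "(\<Sum>\<gamma>\<in>\<Gamma>. pullback_kernel (regular_part M1) \<gamma> id (bergman_kernel M1) c z d w)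
        = ?I * (\<Sum>\<gamma>\<in>\<Gamma>. pull (without M1 V1) (without M1 V1) \<gamma> (\<lambda>c x. R1.N.bk c x d w) c z)"
      unfolding sum_distrib_left by (rule sum.cong[OF refl 1])
    also have "\<dots> = pullback_kernel (regular_part M2) f f (bergman_kernel M2) c z d w"
      unfolding T[OF c d a b] bergman_kernel_def 3 ..
    finally have s1: "(\<Sum>\<gamma>\<in>\<Gamma>. pullback_kernel (regular_part M1) \<gamma> id (bergman_kernel M1) c z d w)
        = pullback_kernel (regular_part M2) f f (bergman_kernel M2) c z d w" .
    have "(\<Sum>\<gamma>\<in>\<Gamma>. pullback_kernel (regular_part M1) id \<gamma> (bergman_kernel M1) c z d w)
        = ?I * cnj (\<Sum>\<gamma>\<in>\<Gamma>. pull (without M1 V1) (without M1 V1) \<gamma> (\<lambda>e x. R1.N.bk e x c z) d w)"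
      unfolding sum_distrib_left cnj_sum by (rule sum.cong[OF refl 2])
    \<comment> \<open>Conjugating the formula with \<open>z\<close> and \<open>w\<close> exchanged
      gives the same right-hand side as before, since the kernel of the target is Hermitian.\<close>
    also have "\<dots> = ?I * (R2.N.bk a (f z) b (f w) * cjac f a c z * cnj (cjac f b d w))"
      unfolding T[OF d c b a] using R2.N.bk_cnj[of a "f z" b "f w"] by simp
    also have "\<dots> = pullback_kernel (regular_part M2) f f (bergman_kernel M2) c z d w"
      unfolding bergman_kernel_def 3 ..
    finally show "(\<Sum>\<gamma>\<in>\<Gamma>. pullback_kernel (regular_part M1) \<gamma> id (bergman_kernel M1) c z d w)
        = (\<Sum>\<gamma>\<in>\<Gamma>. pullback_kernel (regular_part M1) id \<gamma> (bergman_kernel M1) c z d w) \<and>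
      (\<Sum>\<gamma>\<in>\<Gamma>. pullback_kernel (regular_part M1) id \<gamma> (bergman_kernel M1) c z d w)
        = pullback_kernel (regular_part M2) f f (bergman_kernel M2) c z d w" using s1 by simp
  qed
qed

end
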